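(* Let $(X,\mathcal{A},\mu)$ be a $\sigma$-finite Lebesgue space with $\mu$ continuous (non-atomic) and infinite, let $T$ be an automorphism of $(X,\mathcal{A},\mu)$, and let $(X^{*},\mathcal{A}^{*},\mu^{*},T_{*})$ be the Poisson suspension over $(X,\mathcal{A},\mu,T)$. Then: 1. $T$ is of type $\mathbf{II}_{\infty}$ on its conservative part if and only if $T_{*}$ is ergodic (and then $T_*$ is weakly mixing). 2. For a sequence $n_k\uparrow\infty$, $T$ is rigid for the sequence $n_{k}$ if and only if $T_{*}$ is rigid for the sequence $n_{k}$. 3. $T$ is rigidity free if and only if $T_{*}$ is mildly mixing. 4. $T$ is of zero type if and only if $T_{*}$ is mixing (and then $T_*$ is mixing of any order). 5. If $T$ is remotely infinite, then $T_{*}$ is $\mathrm{K}$. 6. If $T$ is dissipative, then $T_{*}$ is Bernoulli.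
   Context: Poisson suspension: $X^{*}$ is the space of measures on $(X,\mathcal{A})$; $\mathcal{A}^{*}$ is the $\sigma$-algebra generated by the maps $N(A):\nu\mapsto\nu(A)$, $A\in\mathcal{A}$; $\mu^{*}$ is the Poisson measure, i.e. the probability measure (carried by measures giving values in $\mathbb{N}$ to the sets of a fixed countable partition of $X$ into sets of finite $\mu$-measure) such that for every finite family of disjoint sets $A_1,\dots,A_k$ of finite $\mu$-measure the $N(A_i)$ are independent Poisson random variables of parameter $\mu(A_i)$; $\mathcal{A}^{*}$ is completed with respect to $\mu^{*}$. An automorphism is an invertible measure preserving transformation, and $T_{*}(\nu)=\nu\circ T^{-1}$. Definitions for $T$ (all modulo $\mu$-null sets). A wandering set is a set $W$ with $T^{n}W\cap T^{m}W=\emptyset$ for $n\neq m$. - $T$ is dissipative if there is a wandering set $W$ with $X=\bigcup_{n\in\mathbb{Z}}T^{n}W$. - $T$ is conservative if there is no wandering set (of positive measure). The conservative part of $T$ is the conservative part in the Hopf decomposition of $X$. - $T$ is of type $\mathbf{II}_{\infty}$ if it is conservative and there is no $T$-invariant probability measure $\tilde\mu\ll\mu$. "Of type $\mathbf{II}_\infty$ on its conservative part" means that the restriction of $T$ to its conservative part has this property (vacuous if that part is null). - $T$ is remotely infinite if there is a $\sigma$-finite sub-$\sigma$-field $\mathcal{G}\subset\mathcal{A}$ such that $T^{-1}\mathcal{G}\subseteq\mathcal{G}$, $\bigvee_{n\in\mathbb{Z}}T^{-n}\mathcal{G}=\mathcal{A}$, and $\bigcap_{n\in\mathbb{Z}}T^{-n}\mathcal{G}$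 contains no set of finite positive $\mu$-measure. - $T$ is of zero type if $\lim_{n\to\infty}\mu(A\cap T^{n}A)=0$ for every $A$ of finite measure. - $T$ is rigid for the sequence $n_k\uparrow\infty$ if $\lim_{k\to\infty}\mu(A\bigtriangleup T^{n_k}A)=0$ for every $A$ of finite measure. The same definition is used for $T_*$ with $\mu^*$. - $T$ is rigidity free if for every sequence $n_k\uparrow\infty$ and every set $A$ of finite positive measure, $\liminf_{k\to\infty}\mu(A\bigtriangleup T^{n_k}A)>0$. $T_*$ is mildly mixing if there are no non-constant $f\in L^2(\mu^* )$ and $n_k\uparrow\infty$ with $f\circ T_*^{n_k}\to f$ in $L^2(\mu^* )$. *)

theory Defs
  imports "HOL-Probability.Probability"
begin

definition iso_mod0 :: "'a measure \<Rightarrow> 'b measure \<Rightarrow> ('a \<Rightarrow> 'b) \<Rightarrow> bool" where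
  "iso_mod0 M N \<phi> \<longleftrightarrow>
    (\<exists>M0\<in>sets M. \<exists>N0\<in>sets N.
      space M - M0 \<in> null_sets M \<and> space N - N0 \<in> null_sets N \<and>
      bij_betw \<phi> M0 N0 \<and>
      (\<forall>B. B \<subseteq> N0 \<longrightarrow> (B \<in> sets N \<longleftrightarrow> \<phi> -` B \<inter> M0 \<in> sets M)) \<and>
      (\<forall>B\<in>sets N. B \<subseteq> N0 \<longrightarrow> emeasure M (\<phi> -` B \<inter> M0) = emeasure N B))"

text \<open>A \<open>\<sigma>\<close>-finite Lebesgue space is a complete measure space that is isomorphic, up to null
  sets, to the completion of a \<open>\<sigma>\<close>-finite Borel measure on the line (which may have atoms).\<close>

definition lebesgue_space :: "'a measure \<Rightarrow> bool" where
  "lebesgue_space M \<longleftrightarrow> sigma_finite_measure M \<and> complete_measure M \<and>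
    (\<exists>N :: real measure. sets N = sets borel \<and> sigma_finite_measure N \<and>
      (\<exists>\<phi>. iso_mod0 M (completion N) \<phi>))"

definition non_atomic :: "'a measure \<Rightarrow> bool" where
  "non_atomic M \<longleftrightarrow>
    \<not> (\<exists>A\<in>sets M. emeasure M A > 0 \<and>
        (\<forall>B\<in>sets M. B \<subseteq> A \<longrightarrow> emeasure M B = 0 \<or> emeasure M (A - B) = 0))"

text \<open>An automorphism defined only modulo null sets of a complete space agrees almost everywhere
  with one that is bijective everywhere.\<close>

definition automorphism :: "'a measure \<Rightarrow> ('a \<Rightarrow> 'a) \<Rightarrow> bool" where
  "automorphism M T \<longleftrightarrow> bij_betw T (space M) (space M) \<and>
    T \<in> measurable M M \<and> the_inv_into (space M) T \<in> measurable M M \<and> distr M M T = M"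

definition int_iterate :: "'a measure \<Rightarrow> ('a \<Rightarrow> 'a) \<Rightarrow> int \<Rightarrow> 'a \<Rightarrow> 'a" where
  "int_iterate M T n =
    (if 0 \<le> n then T ^^ nat n else the_inv_into (space M) T ^^ nat (- n))"

definition tends_up_to_infinity :: "(nat \<Rightarrow> nat) \<Rightarrow> bool" where
  "tends_up_to_infinity n \<longleftrightarrow> incseq n \<and> filterlim n at_top sequentially"

definition wandering :: "'a measure \<Rightarrow> ('a \<Rightarrow> 'a) \<Rightarrow> 'a set \<Rightarrow> bool" where
  "wandering M T W \<longleftrightarrow> W \<in> sets M \<and>
    (\<forall>n m :: int. n \<noteq> m \<longrightarrow>
      int_iterate M T n ` W \<inter> int_iterate M T m ` W \<in> null_sets M)"

definition dissipative :: "'a measure \<Rightarrow> ('a \<Rightarrow> 'a) \<Rightarrow> bool" where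
  "dissipative M T \<longleftrightarrow>
    (\<exists>W. wandering M T W \<and> space M - (\<Union>n. int_iterate M T n ` W) \<in> null_sets M)"

definition conservative :: "'a measure \<Rightarrow> ('a \<Rightarrow> 'a) \<Rightarrow> bool" where
  "conservative M T \<longleftrightarrow> \<not> (\<exists>W. wandering M T W \<and> emeasure M W > 0)"

definition type_II_infinity :: "'a measure \<Rightarrow> ('a \<Rightarrow> 'a) \<Rightarrow> bool" where
  "type_II_infinity M T \<longleftrightarrow> conservative M T \<and>
    \<not> (\<exists>Q. prob_space Q \<and> sets Q = sets M \<and> absolutely_continuous M Q \<and> distr Q M T = Q)"

text \<open>\<open>C\<close> is the conservative part of the Hopf decomposition of \<open>M\<close>. It is unique modulo null
  sets, and we only use representatives with \<open>T C = C\<close> exactly, on which \<open>T\<close> can be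
  restricted; such representatives exist.\<close>

definition conservative_part :: "'a measure \<Rightarrow> ('a \<Rightarrow> 'a) \<Rightarrow> 'a set \<Rightarrow> bool" where
  "conservative_part M T C \<longleftrightarrow> C \<in> sets M \<and> T ` C = C \<and>
    conservative (restrict_space M C) T \<and>
    dissipative (restrict_space M (space M - C)) T"

definition type_II_infinity_on_conservative_part :: "'a measure \<Rightarrow> ('a \<Rightarrow> 'a) \<Rightarrow> bool" where
  "type_II_infinity_on_conservative_part M T \<longleftrightarrow>
    (\<exists>C. conservative_part M T C \<and> type_II_infinity (restrict_space M C) T)"

definition preimage_sets :: "'a measure \<Rightarrow> ('a \<Rightarrow> 'a) \<Rightarrow> 'a measure \<Rightarrow> int \<Rightarrow> 'a set set" where
  "preimage_sets M T G n = (\<lambda>A. int_iterate M T n -` A \<inter> space M) ` sets G"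

text \<open>Sub-\<open>\<sigma>\<close>-fields are considered modulo null sets. They are represented by those that contain
  all null sets, for which inclusions and equalities modulo null sets hold exactly.\<close>

definition exhaustive_subalgebra :: "'a measure \<Rightarrow> ('a \<Rightarrow> 'a) \<Rightarrow> 'a measure \<Rightarrow> bool" where
  "exhaustive_subalgebra M T G \<longleftrightarrow> subalgebra M G \<and> null_sets M \<subseteq> sets G \<and>
    preimage_sets M T G 1 \<subseteq> sets G \<and>
    sigma_sets (space M) (\<Union>n. preimage_sets M T G n) = sets M"

definition remotely_infinite :: "'a measure \<Rightarrow> ('a \<Rightarrow> 'a) \<Rightarrow> bool" where
  "remotely_infinite M T \<longleftrightarrow>
    (\<exists>G. exhaustive_subalgebra M T G \<and> sigma_finite_subalgebra M G \<and>
      \<not> (\<exists>A \<in> (\<Inter>n. preimage_sets M T G n). 0 < emeasure M A \<and> emeasure M A < \<infinity>))"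

definition zero_type :: "'a measure \<Rightarrow> ('a \<Rightarrow> 'a) \<Rightarrow> bool" where
  "zero_type M T \<longleftrightarrow>
    (\<forall>A\<in>fmeasurable M. (\<lambda>n. measure M (A \<inter> (T ^^ n) ` A)) \<longlonglongrightarrow> 0)"

definition rigid_along :: "'a measure \<Rightarrow> ('a \<Rightarrow> 'a) \<Rightarrow> (nat \<Rightarrow> nat) \<Rightarrow> bool" where
  "rigid_along M T n \<longleftrightarrow>
    (\<forall>A\<in>fmeasurable M. (\<lambda>k. measure M (sym_diff A ((T ^^ n k) ` A))) \<longlonglongrightarrow> 0)"

definition rigidity_free :: "'a measure \<Rightarrow> ('a \<Rightarrow> 'a) \<Rightarrow> bool" where
  "rigidity_free M T \<longleftrightarrow>
    (\<forall>n. tends_up_to_infinity n \<longrightarrow>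
      (\<forall>A\<in>fmeasurable M. emeasure M A > 0 \<longrightarrow>
        liminf (\<lambda>k. emeasure M (sym_diff A ((T ^^ n k) ` A))) > 0))"

definition ergodic :: "'a measure \<Rightarrow> ('a \<Rightarrow> 'a) \<Rightarrow> bool" where
  "ergodic M T \<longleftrightarrow>
    (\<forall>A\<in>sets M. sym_diff A (T -` A \<inter> space M) \<in> null_sets M \<longrightarrow>
      A \<in> null_sets M \<or> space M - A \<in> null_sets M)"

definition weakly_mixing :: "'a measure \<Rightarrow> ('a \<Rightarrow> 'a) \<Rightarrow> bool" where
  "weakly_mixing M T \<longleftrightarrow>
    (\<forall>A\<in>sets M. \<forall>B\<in>sets M.
      (\<lambda>n. (\<Sum>k<n. \<bar>measure M (A \<inter> ((T ^^ k) -` B \<inter> space M)) - measure M A * measure M B\<bar>)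
        / real n) \<longlonglongrightarrow> 0)"

definition mildly_mixing :: "'a measure \<Rightarrow> ('a \<Rightarrow> 'a) \<Rightarrow> bool" where
  "mildly_mixing M T \<longleftrightarrow>
    \<not> (\<exists>(f :: 'a \<Rightarrow> complex) n.
        f \<in> borel_measurable M \<and> integrable M (\<lambda>x. (cmod (f x))\<^sup>2) \<and>
        \<not> (\<exists>c. AE x in M. f x = c) \<and> tends_up_to_infinity n \<and>
        (\<lambda>k. \<integral>x. (cmod (f ((T ^^ n k) x) - f x))\<^sup>2 \<partial>M) \<longlonglongrightarrow> 0)"

definition mixing :: "'a measure \<Rightarrow> ('a \<Rightarrow> 'a) \<Rightarrow> bool" where
  "mixing M T \<longleftrightarrow>
    (\<forall>A\<in>sets M. \<forall>B\<in>sets M.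
      (\<lambda>n. measure M (A \<inter> ((T ^^ n) -` B \<inter> space M))) \<longlonglongrightarrow> measure M A * measure M B)"

text \<open>\<open>\<mu> (T\<^sup>-\<^sup>n\<^sup>0 A\<^sub>0 \<inter> \<dots> \<inter> T\<^sup>-\<^sup>n\<^sup>r A\<^sub>r) \<rightarrow> \<mu> A\<^sub>0 \<cdots> \<mu> A\<^sub>r\<close> as all gaps \<open>n\<^sub>i\<^sub>+\<^sub>1 - n\<^sub>i\<close> tend to infinity.\<close>

definition mixing_of_all_orders :: "'a measure \<Rightarrow> ('a \<Rightarrow> 'a) \<Rightarrow> bool" where
  "mixing_of_all_orders M T \<longleftrightarrow>
    (\<forall>(r::nat) A. (\<forall>i\<le>r. A i \<in> sets M) \<longrightarrow>
      (\<forall>e>0. \<exists>N. \<forall>n :: nat \<Rightarrow> nat. (\<forall>i<r. n i + N \<le> n (Suc i)) \<longrightarrow>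
        \<bar>measure M (\<Inter>i\<le>r. (T ^^ n i) -` A i \<inter> space M) - (\<Prod>i\<le>r. measure M (A i))\<bar> < e))"

definition K_automorphism :: "'a measure \<Rightarrow> ('a \<Rightarrow> 'a) \<Rightarrow> bool" where
  "K_automorphism M T \<longleftrightarrow>
    (\<exists>G. exhaustive_subalgebra M T G \<and>
      (\<forall>A \<in> (\<Inter>n. preimage_sets M T G n). measure M A = 0 \<or> measure M A = 1))"

text \<open>Isomorphism with the two-sided shift on \<open>B\<^sup>\<int>\<close>. Up to isomorphism, every Lebesgue probability
  space is the completion of some Borel probability \<open>B\<close> on the line.\<close>

definition bernoulli :: "'a measure \<Rightarrow> ('a \<Rightarrow> 'a) \<Rightarrow> bool" where
  "bernoulli M T \<longleftrightarrow>
    (\<exists>(B :: real measure) (\<phi> :: 'a \<Rightarrow> int \<Rightarrow> real). prob_space B \<and> sets B = sets borel \<and>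
      iso_mod0 M (completion (\<Pi>\<^sub>M i\<in>UNIV. B)) \<phi> \<and>
      (AE x in M. \<phi> (T x) = (\<lambda>i. \<phi> x (i + 1))))"

definition measures_algebra :: "'a measure \<Rightarrow> 'a measure measure" where
  "measures_algebra M =
    (SUP A\<in>sets M. vimage_algebra {\<nu>. sets \<nu> = sets M} (\<lambda>\<nu>. emeasure \<nu> A) borel)"

text \<open>The library specifies \<^const>\<open>poisson_pmf\<close> only for positive rates.\<close>

definition poisson_law :: "real \<Rightarrow> nat pmf" where
  "poisson_law r = (if r = 0 then return_pmf 0 else poisson_pmf r)"

definition poisson_measure :: "'a measure \<Rightarrow> 'a measure measure \<Rightarrow> bool" where
  "poisson_measure M P \<longleftrightarrow> prob_space P \<and> sets P = sets (measures_algebra M) \<and>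
    (\<exists>X :: nat \<Rightarrow> 'a set. range X \<subseteq> fmeasurable M \<and> disjoint_family X \<and> (\<Union>i. X i) = space M \<and>
      (AE \<nu> in P. \<forall>i. emeasure \<nu> (X i) \<in> \<nat>)) \<and>
    (\<forall>(k::nat) A. (\<forall>i<k. A i \<in> fmeasurable M) \<longrightarrow> disjoint_family_on A {..<k} \<longrightarrow>
      prob_space.indep_vars P (\<lambda>_. borel) (\<lambda>i \<nu>. emeasure \<nu> (A i)) {..<k} \<and>
      (\<forall>i<k. distr P borel (\<lambda>\<nu>. emeasure \<nu> (A i)) =
        distr (measure_pmf (poisson_law (measure M (A i)))) borel of_nat))"

text \<open>\<open>S\<close> is the completed space \<open>(X\<^sup>*, \<A>\<^sup>*, \<mu>\<^sup>*)\<close> over \<open>M = (X, \<A>, \<mu>)\<close>; the Poisson measure is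
  uniquely determined by its defining property.\<close>

definition poisson_suspension :: "'a measure \<Rightarrow> 'a measure measure \<Rightarrow> bool" where
  "poisson_suspension M S \<longleftrightarrow> (\<exists>P. poisson_measure M P \<and> S = completion P)"

definition suspension_map :: "'a measure \<Rightarrow> ('a \<Rightarrow> 'a) \<Rightarrow> 'a measure \<Rightarrow> 'a measure" where
  "suspension_map M T \<nu> = distr \<nu> M T"

end

theory Submission
 imports Defs
begin

text \<open>Events that depend on the points in \<open>A\<close> and on the points in \<open>B\<close> are independent up to \<open>2 \<mu>(A \<inter> B)\<close>, and
 every event is approximated by events that depend on the points in a set of finite measure. So (weak) mixing of the
 suspension is the (Cesaro) convergence of \<open>\<mu>(A \<inter> T\<^sup>-\<^sup>nA)\<close> to \<open>0\<close>, which the mean ergodic theorem gives if there is no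
 invariant set of finite positive measure; conversely the void events \<open>{N A = 0}\<close> see invariant and rigid sets.
 If an event \<open>E\<close> is rigid, a set \<open>B\<close> that maximises \<open>\<parallel>E[1\<^sub>E | points in B]\<parallel>\<^sup>2 - c \<mu>(B)\<close> is rigid along a subsequence.
 For the K property, conditioning on the void event of \<open>A\<close> perturbs the configuration seen by a field \<open>\<G>\<close> by an amount
 controlled by \<open>\<parallel>E[1\<^sub>A | \<G>]\<parallel>\<^sup>2\<close>, and this norm tends to \<open>0\<close> along \<open>T\<^sup>-\<^sup>n\<G>\<close>; since \<open>\<mu>\<close> has no atoms, void events generate.
 In the dissipative case the configurations on the translates of the wandering set are independent and equally
 distributed, and each is coded by one real number, from which the quantiles recover the points.\<close>

text \<open>A configuration is any measure on the sets of \<open>M\<close>, not a sum of point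
  masses, and a count is a natural number only almost surely, for each fixed set of finite measure.
  So there is no list of the points of a configuration to start from: the estimates speak of counts
  and of their joint laws. \<open>fincyl\<close>, the events given by finitely many counts of sets
  of finite measure, is the algebra on which these laws can be computed; approximation carries
  results to \<open>P\<close>, null sets carry them to the completion. Points are recovered only for
  the Bernoulli property, almost surely, from countably many counts over rational half-lines. The
  hypothesis on the conservative part speaks of invariant probabilities; level sets of their
  densities lead to invariant sets of finite positive measure, and the dissipative part has none. A
  rigid event may depend on points in all of X. The cost \<open>c \<mu>(B)\<close> confines
  near-maximisers to bounded measure, and commuting projections make the functional supermodular,
  which lets maximisers be united to a largest one.\<close>

lemmas sub_space = sets.sets_into_space
 and bint_cong = Bochner_Integration.integral_cong
 and bint_nonneg = Bochner_Integration.integral_nonneg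
 and bint_bound = Bochner_Integration.integrable_bound
 and bint_diff = Bochner_Integration.integral_diff

section \<open>Approximation and square-integrable limits\<close>

definition approximable :: "'a measure \<Rightarrow> 'a set set \<Rightarrow> 'a set set" where "approximable M V = {E \<in> sets M. \<forall>e>0. \<exists>D\<in>V. measure M (sym_diff E D) < e}"

text \<open>Countable unions are the only issue: continuity from below replaces the union by a
  finite one up to \<open>e/2\<close>, and the other \<open>e/2\<close> is shared by the finitely
  many members. So an algebra \<open>V\<close> is enough to reach the whole generated field.\<close>

lemma sigma_algebra_approximable:
 assumes "finite_measure M" and V: "algebra (space M) V" "V \<subseteq> sets M"
 shows "sigma_algebra (space M) (approximable M V)"
proof -
 interpret finite_measure M by fact
 interpret V: algebra "space M" V by fact
 have Vs: "D \<in> V \<Longrightarrow> D \<in> sets M" for D using V(2) by auto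
 show ?thesis unfolding sigma_algebra_iff2 proof (intro conjI ballI allI impI)
  show "approximable M V \<subseteq> Pow (space M)" by (auto simp: approximable_def dest: sub_space)
  show "{} \<in> approximable M V" unfolding approximable_def by (auto intro!: bexI[of _ "{}"])
 next
  fix E assume E: "E \<in> approximable M V"
  then have Es: "E \<in> sets M" by (simp add: approximable_def)
  show "space M - E \<in> approximable M V" unfolding approximable_def proof (safe)
   show "space M - E \<in> sets M" using Es by auto
   fix e :: real assume "e > 0"
   then obtain D where D: "D \<in> V" "measure M (sym_diff E D) < e" using E by (auto simp: approximable_def)
   have "sym_diff (space M - E) (space M - D) = sym_diff E D" using sub_space[OF Es] sub_space[OF Vs[OF D(1)]] by auto
   then show "\<exists>D\<in>V. measure M (sym_diff (space M - E) D) < e" using D V.compl_sets by (intro bexI[of _ "space M - D"]) auto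
  qed
 next
  fix E :: "nat \<Rightarrow> 'a set" assume E: "range E \<subseteq> approximable M V"
  then have Es: "E i \<in> sets M" for i by (auto simp: approximable_def)
  have ap: "\<exists>D\<in>V. measure M (sym_diff (E i) D) < e" if "e > 0" for e i using E that unfolding approximable_def by blast
  show "\<Union> (range E) \<in> approximable M V" unfolding approximable_def proof (safe)
   show "\<Union> (range E) \<in> sets M" using Es by auto
   fix e :: real assume e: "e > 0"
   let ?U = "\<Union> (range E)"
   define B where "B n = (\<Union>i<n. E i)" for n
   have Bs: "B n \<in> sets M" for n using Es by (auto simp: B_def)
   have "(\<lambda>n. measure M (B n)) \<longlonglongrightarrow> measure M (\<Union>n. B n)" using Bs by (intro finite_Lim_measure_incseq) (auto simp: B_def incseq_def, fastforce)
   moreover have "(\<Union>n. B n) = ?U" by (auto simp: B_def)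
   ultimately have "(\<lambda>n. measure M (B n)) \<longlonglongrightarrow> measure M ?U" by simp
   then have "eventually (\<lambda>n. dist (measure M (B n)) (measure M ?U) < e/2) sequentially" using e by (intro tendstoD) auto
   then obtain n where n: "dist (measure M (B n)) (measure M ?U) < e/2" by (auto simp: eventually_sequentially)
   have "measure M (?U - B n) = measure M ?U - measure M (B n)" using Bs Es by (intro finite_measure_Diff) (auto simp: B_def)
   then have n': "measure M (?U - B n) < e/2" using n e unfolding dist_real_def by arith
   \<comment> \<open>\<open>n\<close> may be \<open>0\<close>; the denominator with
     \<open>real n + 1\<close> keeps each share defined and the sum of \<open>n\<close> shares at
     most \<open>e/2\<close>.\<close>
   have "\<forall>i. \<exists>D\<in>V. measure M (sym_diff (E i) D) < e / (2 * (real n + 1))" using ap e by (intro allI ap) auto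
   then obtain D where D: "\<And>i. D i \<in> V" "\<And>i. measure M (sym_diff (E i) (D i)) < e / (2 * (real n + 1))" by metis
   have DU: "(\<Union>i<n. D i) \<in> V" using D by (intro V.finite_UN) auto
   have "measure M (sym_diff ?U (\<Union>i<n. D i)) \<le> measure M ((?U - B n) \<union> (\<Union>i<n. sym_diff (E i) (D i)))"
    using Bs Es Vs D by (intro finite_measure_mono) (auto simp: B_def intro!: sets.Un sets.Diff sets.finite_UN)
   also have "\<dots> \<le> measure M (?U - B n) + measure M (\<Union>i<n. sym_diff (E i) (D i))"
    using Bs Es Vs D by (intro measure_Un_le) (auto intro!: sets.Un sets.Diff sets.finite_UN)
   also have "measure M (\<Union>i<n. sym_diff (E i) (D i)) \<le> (\<Sum>i<n. measure M (sym_diff (E i) (D i)))"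
    using Es Vs D by (intro finite_measure_subadditive_finite) (auto intro!: sets.Un sets.Diff)
   also have "\<dots> \<le> (\<Sum>i<n. e / (2 * (real n + 1)))" using D by (intro sum_mono less_imp_le) auto
   also have "\<dots> \<le> e/2" using e by (simp add: field_simps)
   finally have "measure M (sym_diff ?U (\<Union>i<n. D i)) < e" using n' by simp
   then show "\<exists>D\<in>V. measure M (sym_diff ?U D) < e" using DU by auto
  qed
 qed
qed

lemma approximable_superset: "V \<subseteq> sets M \<Longrightarrow> V \<subseteq> approximable M V" unfolding approximable_def by (force intro: exI)

lemma approximable_sigma_sets:
 assumes "finite_measure M" "algebra (space M) V" "V \<subseteq> sets M" "G \<subseteq> approximable M V"
 shows "sigma_sets (space M) G \<subseteq> approximable M V" using sigma_algebra.sigma_sets_subset[OF sigma_algebra_approximable[OF assms(1-3)] assms(4)] .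

text \<open>Square norms are kept in \<open>ennreal\<close>, so that no integrability has to be
  carried along and Fatou applies at once.\<close>

abbreviation (input) nsq :: "'a measure \<Rightarrow> ('a \<Rightarrow> real) \<Rightarrow> ennreal" where "nsq M f \<equiv> \<integral>\<^sup>+x. ennreal ((f x)\<^sup>2) \<partial>M"

text \<open>Completeness of L2, with the almost everywhere convergent subsequence as part of the
  conclusion: a pointwise limit shows directly for which subfields the limit function is
  measurable.\<close>

lemma L2_Cauchy_limit:
 fixes f :: "nat \<Rightarrow> 'a \<Rightarrow> real"
 assumes [measurable]: "\<And>n. f n \<in> borel_measurable M" and Cauchy: "\<And>e. e > 0 \<Longrightarrow> \<exists>N. \<forall>m\<ge>N. \<forall>n\<ge>N. (nsq M (\<lambda>x. f m x - f n x)) < ennreal e"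
 obtains r where "strict_mono r" "AE x in M. (\<lambda>i. f (r i) x) \<longlonglongrightarrow> lim (\<lambda>i. f (r i) x)" "(\<lambda>n. nsq M (\<lambda>x. f n x - lim (\<lambda>i. f (r i) x))) \<longlonglongrightarrow> 0"
proof -
 have "\<exists>N. \<forall>i. (\<forall>m\<ge>N i. \<forall>n\<ge>N i. (nsq M (\<lambda>x. f m x - f n x)) < ennreal ((1/16)^i))" by (intro choice allI Cauchy) auto
 then obtain N where N: "\<And>i m n. m \<ge> N i \<Longrightarrow> n \<ge> N i \<Longrightarrow> (nsq M (\<lambda>x. f m x - f n x)) < ennreal ((1/16)^i)" by metis
 define r where "r i = (\<Sum>j\<le>i. N j) + i" for i
 have rN: "r i \<ge> N i" for i by (auto simp: r_def intro!: trans_le_add1 member_le_sum)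
 have mr: "strict_mono r" by (rule strict_monoI_Suc) (simp add: r_def)
 have mono_r: "r i \<le> r j" if "i \<le> j" for i j using mr that by (simp add: strict_mono_less_eq)
 have rb: "(nsq M (\<lambda>x. f m x - f n x)) < ennreal ((1/16)^i)" if "m \<ge> r i" "n \<ge> r i" for i m n using N rN that by (meson le_trans)
 \<comment> \<open>The square norms are below \<open>16^-i\<close>, so they remain summable with the
   weights \<open>4^i\<close>; a pointwise bound \<open>C\<close> on \<open>4^i * (d i x)^2\<close>
   then gives \<open>\<bar>d i x\<bar> \<le> sqrt C * 2^-i\<close>, hence summable differences at
   almost every point.\<close>
 define d where "d i x = f (r (Suc i)) x - f (r i) x" for i x
 have [measurable]: "d i \<in> borel_measurable M" for i unfolding d_def by measurable
 have "(\<integral>\<^sup>+x. (\<Sum>i. ennreal (4^i * (d i x)\<^sup>2)) \<partial>M) = (\<Sum>i. \<integral>\<^sup>+x. ennreal (4^i * (d i x)\<^sup>2) \<partial>M)" by (intro nn_integral_suminf) measurable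
 also have "\<dots> \<le> (\<Sum>i. ennreal ((1/4)^i))" proof (intro suminf_le allI)
  fix i
  have "(\<integral>\<^sup>+x. ennreal (4^i * (d i x)\<^sup>2) \<partial>M) = ennreal (4^i) * (nsq M (\<lambda>x. d i x))"
   by (subst nn_integral_cmult[symmetric]) (auto simp: ennreal_mult)
  also have "\<dots> \<le> ennreal (4^i) * ennreal ((1/16)^i)" unfolding d_def by (intro mult_left_mono less_imp_le[OF rb[OF mono_r mono_r]]) auto
  also have "\<dots> = ennreal ((1/4)^i)" by (subst ennreal_mult[symmetric]) (auto simp: power_mult_distrib[symmetric])
  finally show "(\<integral>\<^sup>+x. ennreal (4^i * (d i x)\<^sup>2) \<partial>M) \<le> ennreal ((1/4)^i)" .
 qed auto
 also have "\<dots> < \<infinity>" by (subst suminf_ennreal2) (auto simp: summable_geometric)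
 finally have "AE x in M. (\<Sum>i. ennreal (4^i * (d i x)\<^sup>2)) \<noteq> \<infinity>" by (intro nn_integral_PInf_AE) auto
 then have conv: "AE x in M. (\<lambda>i. f (r i) x) \<longlonglongrightarrow> lim (\<lambda>i. f (r i) x)" proof eventually_elim
  fix x assume fin: "(\<Sum>i. ennreal (4^i * (d i x)\<^sup>2)) \<noteq> \<infinity>"
  then have sm: "summable (\<lambda>i. 4^i * (d i x)\<^sup>2)" by (intro summable_suminf_not_top) auto
  then obtain C where C: "\<And>i. 4^i * (d i x)\<^sup>2 \<le> C" using summable_imp_Bseq[OF sm] by (auto simp: Bseq_def)
  have "\<bar>d i x\<bar> \<le> sqrt C * (1/2)^i" for i proof -
   have "(2^i * \<bar>d i x\<bar>)\<^sup>2 \<le> C" using C[of i] by (simp add: power_mult_distrib power_mult[symmetric] mult.commute[of i 2]) (simp add: power_mult)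
   then have "2^i * \<bar>d i x\<bar> \<le> sqrt C" by (rule real_le_rsqrt)
   then show ?thesis by (simp add: field_simps power_divide)
  qed
  then have "summable (\<lambda>i. d i x)" by (intro summable_comparison_test[where g="\<lambda>i. sqrt C * (1/2)^i" and f = "\<lambda>i. d i x"])
    (auto intro!: summable_mult summable_geometric)
  then have "convergent (\<lambda>n. \<Sum>i<n. d i x)" by (simp add: summable_iff_convergent)
  then have "convergent (\<lambda>n. f (r 0) x + (\<Sum>i<n. d i x))" by (intro convergent_add convergent_const)
  moreover have "f (r 0) x + (\<Sum>i<n. d i x) = f (r n) x" for n by (induction n) (auto simp: d_def)
  ultimately show "(\<lambda>i. f (r i) x) \<longlonglongrightarrow> lim (\<lambda>i. f (r i) x)" by (simp add: convergent_LIMSEQ_iff)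
 qed
 define g where "g x = lim (\<lambda>i. f (r i) x)" for x
 \<comment> \<open>Fatou along the subsequence: \<open>f n - g\<close> is the pointwise limit of
   \<open>f n - f (r j)\<close>, whose square norms stay below the Cauchy bound.\<close>
 have bound: "(nsq M (\<lambda>x. f n x - g x)) \<le> ennreal ((1/16)^i)" if "n \<ge> r i" for n i proof -
  have "(nsq M (\<lambda>x. f n x - g x)) = (\<integral>\<^sup>+x. liminf (\<lambda>j. ennreal ((f n x - f (r j) x)\<^sup>2)) \<partial>M)" proof (intro nn_integral_cong_AE)
   show "AE x in M. ennreal ((f n x - g x)\<^sup>2) = liminf (\<lambda>j. ennreal ((f n x - f (r j) x)\<^sup>2))" using conv proof eventually_elim
    fix x assume "(\<lambda>i. f (r i) x) \<longlonglongrightarrow> lim (\<lambda>i. f (r i) x)"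
    then have "(\<lambda>j. ennreal ((f n x - f (r j) x)\<^sup>2)) \<longlonglongrightarrow> ennreal ((f n x - g x)\<^sup>2)" unfolding g_def by (intro tendsto_ennrealI tendsto_intros)
    then show "ennreal ((f n x - g x)\<^sup>2) = liminf (\<lambda>j. ennreal ((f n x - f (r j) x)\<^sup>2))" by (intro lim_imp_Liminf[symmetric]) auto
   qed
  qed
  also have "\<dots> \<le> liminf (\<lambda>j. nsq M (\<lambda>x. f n x - f (r j) x))" by (intro nn_integral_liminf) measurable
  also have "\<dots> \<le> ennreal ((1/16)^i)" proof (rule Liminf_le)
   show "eventually (\<lambda>j. (nsq M (\<lambda>x. f n x - f (r j) x)) \<le> ennreal ((1/16)^i)) sequentially"
    using eventually_ge_at_top[of i] by eventually_elim (rule less_imp_le[OF rb[OF that mono_r]])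
  qed simp
  finally show ?thesis .
 qed
 have "(\<lambda>n. nsq M (\<lambda>x. f n x - g x)) \<longlonglongrightarrow> 0" proof (rule order_tendstoI)
  fix a :: ennreal assume "0 < a"
  then obtain e where e: "e > 0" "ennreal e \<le> a" proof (cases a)
   case (real r)
   then show thesis using that[of r] \<open>0 < a\<close> by auto
  next
   case top
   then show thesis using that[of 1] by auto
  qed
  obtain i where i: "(1/16::real)^i < e" using real_arch_pow_inv[OF e(1), of "1/16"] by auto
  show "eventually (\<lambda>n. (nsq M (\<lambda>x. f n x - g x)) < a) sequentially" using eventually_ge_at_top[of "r i"] proof eventually_elim
   fix n assume "r i \<le> n"
   then show "(nsq M (\<lambda>x. f n x - g x)) < a" using bound[of i n] i e by (meson ennreal_lessI le_less_trans less_le_trans)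
  qed
 qed auto
 then show ?thesis using that[OF mr conv] by (simp add: g_def)
qed

text \<open>The limit \<open>h\<close> is square integrable, so by Chebyshev its level sets have
  finite measure and \<open>level\<close> applies: \<open>h = 0\<close> almost everywhere. The
  hypothesis is put on level sets because these inherit invariance, or tail measurability, from
  \<open>h\<close>.\<close>

lemma L2_vanish:
 fixes g :: "nat \<Rightarrow> 'a \<Rightarrow> real"
 assumes [measurable]: "\<And>n. g n \<in> borel_measurable M" "h \<in> borel_measurable M" and lim: "(\<lambda>n. nsq M (\<lambda>x. g n x - h x)) \<longlonglongrightarrow> 0"
  and fin: "\<And>n. (nsq M (\<lambda>x. g n x)) < \<infinity>"
  and level: "\<And>c. c > 0 \<Longrightarrow> emeasure M {x\<in>space M. c < (h x)\<^sup>2} < \<infinity> \<Longrightarrow> emeasure M {x\<in>space M. c < (h x)\<^sup>2} = 0"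
 shows "(\<lambda>n. nsq M (\<lambda>x. g n x)) \<longlonglongrightarrow> 0"
proof -
 obtain n where n: "(nsq M (\<lambda>x. g n x - h x)) < 1" using order_tendstoD(2)[OF lim, of 1] by (auto simp: eventually_sequentially)
 have "(nsq M (\<lambda>x. h x)) \<le> (\<integral>\<^sup>+x. 2 * ennreal ((g n x - h x)\<^sup>2) + 2 * ennreal ((g n x)\<^sup>2) \<partial>M)" proof (rule nn_integral_mono)
  fix x
  have "(h x)\<^sup>2 \<le> 2 * (g n x - h x)\<^sup>2 + 2 * (g n x)\<^sup>2" using zero_le_power2[of "2 * g n x - h x"] by (simp add: power2_eq_square algebra_simps)
  then show "ennreal ((h x)\<^sup>2) \<le> 2 * ennreal ((g n x - h x)\<^sup>2) + 2 * ennreal ((g n x)\<^sup>2)" using ennreal_leI by (fastforce simp: ennreal_mult)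
 qed
 also have "\<dots> = 2 * (nsq M (\<lambda>x. g n x - h x)) + 2 * (nsq M (\<lambda>x. g n x))" by (simp add: nn_integral_add nn_integral_cmult)
 also have "\<dots> < \<infinity>" using less_trans[OF n ennreal_one_less_top] fin[of n] by (simp add: ennreal_mult_less_top)
 finally have h2: "(nsq M (\<lambda>x. h x)) < \<infinity>" .
 have "AE x in M. (h x)\<^sup>2 \<le> c" if c: "c > 0" for c proof -
  let ?B = "{x\<in>space M. c < (h x)\<^sup>2}"
  have "ennreal c * emeasure M ?B = (\<integral>\<^sup>+x. ennreal c * indicator ?B x \<partial>M)" by (subst nn_integral_cmult_indicator) auto
  also have "\<dots> \<le> (nsq M (\<lambda>x. h x))" by (intro nn_integral_mono) (auto simp: indicator_def intro!: ennreal_leI)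
  finally have "ennreal c * emeasure M ?B < \<infinity>" using h2 by simp
  then have "emeasure M ?B < \<infinity>" using c by (auto simp: ennreal_mult_less_top)
  from level[OF c this] show ?thesis by (intro AE_I[of _ _ ?B]) auto
 qed
 then have "AE x in M. \<forall>k. (h x)\<^sup>2 \<le> 1 / Suc k" by (subst AE_all_countable) simp
 then have h0: "AE x in M. h x = 0" proof eventually_elim
  fix x assume "\<forall>k. (h x)\<^sup>2 \<le> 1 / Suc k"
  then have "(h x)\<^sup>2 \<le> 0" by (intro LIMSEQ_le_const[OF LIMSEQ_inverse_real_of_nat]) (auto simp: divide_inverse)
  then show "h x = 0" by simp
 qed
 have "(nsq M (\<lambda>x. g n x - h x)) = (nsq M (\<lambda>x. g n x))" for n
  using h0 by (intro nn_integral_cong_AE) (auto elim!: eventually_mono)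
 then show ?thesis using lim by simp
qed

section \<open>Mean ergodic theorem\<close>

locale aut =
 fixes M :: "'a measure" and T :: "'a \<Rightarrow> 'a"
 assumes aut: "automorphism M T"
begin

abbreviation Z :: "int \<Rightarrow> 'a \<Rightarrow> 'a" where "Z \<equiv> int_iterate M T"

text \<open>Preimages commute with all set operations and compose by adding exponents; the images in
  the dynamical notions are turned into preimages by \<open>pre_image\<close>.\<close>

definition pre :: "int \<Rightarrow> 'a set \<Rightarrow> 'a set" where "pre n A = Z n -` A \<inter> space M"

lemma bij_T: "bij_betw T (space M) (space M)" and meas_T [measurable]: "T \<in> measurable M M"
 and meas_Ti [measurable]: "the_inv_into (space M) T \<in> measurable M M" and distr_T: "distr M M T = M" using aut by (auto simp: automorphism_def)

lemma T_in: "x \<in> space M \<Longrightarrow> T x \<in> space M" using bij_T by (auto simp: bij_betw_def)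

lemma Ti_in: "x \<in> space M \<Longrightarrow> the_inv_into (space M) T x \<in> space M" using meas_Ti by (auto simp: measurable_def)

lemma T_Ti: "x \<in> space M \<Longrightarrow> T (the_inv_into (space M) T x) = x" using bij_T by (auto simp: bij_betw_def intro: f_the_inv_into_f)

lemma Ti_T: "x \<in> space M \<Longrightarrow> the_inv_into (space M) T (T x) = x" using bij_T by (auto simp: bij_betw_def intro: the_inv_into_f_f)

lemma distr_Ti: "distr M M (the_inv_into (space M) T) = M"
proof -
 have "distr M M (the_inv_into (space M) T) = distr (distr M M T) M (the_inv_into (space M) T)" by (simp add: distr_T)
 also have "\<dots> = distr M M (the_inv_into (space M) T \<circ> T)" by (rule distr_distr) simp_all
 also have "\<dots> = distr M M (\<lambda>x. x)" by (rule distr_cong) (auto simp: Ti_T)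
 finally show ?thesis by simp
qed

lemma funpow_measurable: "f \<in> measurable M M \<Longrightarrow> f ^^ n \<in> measurable M M" by (induction n) (auto intro: measurable_comp)

lemma funpow_distr: "f \<in> measurable M M \<Longrightarrow> distr M M f = M \<Longrightarrow> distr M M (f ^^ n) = M"
proof (induction n)
 case (Suc n)
 have "distr M M (f ^^ Suc n) = distr M M (f \<circ> (f ^^ n))" by simp
 also have "\<dots> = distr (distr M M (f ^^ n)) M f" using Suc.prems by (intro distr_distr[symmetric]) (simp_all add: funpow_measurable)
 also have "\<dots> = M" using Suc by metis
 finally show ?case .
qed (simp add: id_def)

lemma Z_meas [measurable]: "Z n \<in> measurable M M" unfolding int_iterate_def by (auto intro: funpow_measurable)

lemma Z_distr: "distr M M (Z n) = M" unfolding int_iterate_def by (auto intro!: funpow_distr distr_T distr_Ti)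

lemma Z_in: "x \<in> space M \<Longrightarrow> Z n x \<in> space M" using Z_meas[of n] by (auto simp: measurable_def)

lemma Z_0 [simp]: "Z 0 x = x" by (simp add: int_iterate_def)

lemma Z_of_nat: "Z (int n) = T ^^ n" by (simp add: int_iterate_def)

lemma Z_1: "Z 1 = T" using Z_of_nat[of 1] by simp

lemma Z_Suc: assumes x: "x \<in> space M" shows "Z (n + 1) x = T (Z n x)"
proof (cases "n \<ge> 0")
 case True
 then have "nat (n + 1) = Suc (nat n)" by auto
 with True show ?thesis by (simp add: int_iterate_def)
next
 case False
 define k where "k = nat (- n - 1)"
 have k: "n = - int (Suc k)" using False by (simp add: k_def)
 have "(the_inv_into (space M) T ^^ k) x \<in> space M" using x by (induction k) (auto intro: Ti_in)
 then have "T (Z n x) = (the_inv_into (space M) T ^^ k) x" unfolding k by (simp add: int_iterate_def T_Ti nat_add_distrib)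
 also have "\<dots> = Z (n + 1) x" unfolding k by (simp add: int_iterate_def)
 finally show ?thesis ..
qed

lemma Z_add: assumes x: "x \<in> space M" shows "Z (m + n) x = Z m (Z n x)"
proof (induction m rule: int_induct[where k=0])
 case base then show ?case by simp
next
 case (step1 m)
 have "Z (m + 1 + n) x = Z ((m + n) + 1) x" by (simp add: algebra_simps)
 also have "\<dots> = Z (m + 1) (Z n x)" using step1 x by (simp only: Z_Suc Z_in)
 finally show ?case .
next
 case (step2 m)
 have "T (Z (m - 1 + n) x) = Z (m - 1 + n + 1) x" using x by (simp only: Z_Suc)
 also have "\<dots> = Z m (Z n x)" using step2 by (simp add: algebra_simps)
 also have "\<dots> = T (Z (m - 1) (Z n x))" using Z_Suc[of "Z n x" "m - 1"] x Z_in by simp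
 finally show ?case using bij_T Z_in x unfolding bij_betw_def by (meson inj_on_def)
qed

lemma Z_inv: "x \<in> space M \<Longrightarrow> Z (- n) (Z n x) = x" "x \<in> space M \<Longrightarrow> Z n (Z (- n) x) = x" using Z_add[of x "-n" n] Z_add[of x n "-n"] by auto

lemma pre_sets [measurable, intro]: "A \<in> sets M \<Longrightarrow> pre n A \<in> sets M" unfolding pre_def by measurable

lemma pre_subset: "pre n A \<subseteq> space M" by (auto simp: pre_def)

lemma pre_iff: "x \<in> pre n A \<longleftrightarrow> x \<in> space M \<and> Z n x \<in> A" by (auto simp: pre_def)

lemma pre_emeasure: "A \<in> sets M \<Longrightarrow> emeasure M (pre n A) = emeasure M A"
 unfolding pre_def by (subst emeasure_distr[symmetric, of "Z n" M M]) (simp_all add: Z_distr)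

lemma pre_measure: "A \<in> sets M \<Longrightarrow> measure M (pre n A) = measure M A" by (simp add: measure_def pre_emeasure)

lemma pre_fmeasurable: "A \<in> fmeasurable M \<Longrightarrow> pre n A \<in> fmeasurable M" by (auto simp: fmeasurable_def pre_emeasure)

lemma pre_null: "A \<in> null_sets M \<Longrightarrow> pre n A \<in> null_sets M" by (auto simp: null_sets_def pre_emeasure)

lemma pre_pre: "pre m (pre n A) = pre (m + n) A" by (auto simp: pre_def Z_in Z_add[symmetric] add.commute)

lemma pre_0: "A \<subseteq> space M \<Longrightarrow> pre 0 A = A" by (auto simp: pre_def)

lemma pre_Diff: "pre n (A - B) = pre n A - pre n B" and pre_Un: "pre n (A \<union> B) = pre n A \<union> pre n B" and pre_Int: "pre n (A \<inter> B) = pre n A \<inter> pre n B"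
 and pre_UN: "pre n (\<Union>i\<in>I. F i) = (\<Union>i\<in>I. pre n (F i))" by (auto simp: pre_def)

lemma pre_mono: "A \<subseteq> B \<Longrightarrow> pre n A \<subseteq> pre n B" by (auto simp: pre_def)

lemma pre_space: "pre n (space M) = space M" by (auto simp: pre_def Z_in)

lemma pre_emeasure2: "A \<in> sets M \<Longrightarrow> B \<in> sets M \<Longrightarrow> emeasure M (pre m A \<inter> pre n B) = emeasure M (A \<inter> pre (n - m) B)"
 using pre_emeasure[of "A \<inter> pre (n - m) B" m] by (simp add: pre_Int pre_pre pre_sets)

lemma pre_measure2: "A \<in> sets M \<Longrightarrow> B \<in> sets M \<Longrightarrow> measure M (pre m A \<inter> pre n B) = measure M (A \<inter> pre (n - m) B)" by (simp add: measure_def pre_emeasure2)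

lemma pre_sym_diff: "A \<in> sets M \<Longrightarrow> B \<in> sets M \<Longrightarrow>
  emeasure M (sym_diff (pre m A) (pre n B)) = emeasure M (sym_diff A (pre (n - m) B))"
 using pre_emeasure[of "sym_diff A (pre (n - m) B)" m] pre_sets by (simp add: pre_Diff pre_Un pre_pre sets.Un sets.Diff)

lemma pre_image: "A \<subseteq> space M \<Longrightarrow> Z n ` A = pre (- n) A" by (auto simp: pre_def Z_inv Z_in subset_eq image_iff) (metis Z_inv(2))

lemma funpow_image: "A \<subseteq> space M \<Longrightarrow> (T ^^ n) ` A = pre (- int n) A" using pre_image[of A "int n"] by (simp add: Z_of_nat)

text \<open>Moving both sets by the same power of \<open>T\<close> trades an image of
  \<open>A\<close> for a preimage at the same distance from \<open>A\<close>.\<close>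

lemma emeasure_sym_diff_image:
 assumes "A \<in> sets M" shows "emeasure M (sym_diff A ((T ^^ n) ` A)) = emeasure M (sym_diff A (pre (int n) A))"
 using pre_sym_diff[OF assms assms, of "- int n" 0] assms by (simp add: funpow_image sub_space pre_0 Un_commute)

lemma measure_sym_diff_image:
 assumes "A \<in> sets M" shows "measure M (sym_diff A ((T ^^ n) ` A)) = measure M (sym_diff A (pre (int n) A))"
 using emeasure_sym_diff_image[OF assms] by (simp add: measure_def)

lemma measure_Int_image:
 assumes "A \<in> sets M" shows "measure M (A \<inter> (T ^^ n) ` A) = measure M (A \<inter> pre (int n) A)" using pre_measure2[OF assms assms, of "- int n" 0] assms
 by (simp add: funpow_image sub_space pre_0 Int_commute)

lemma AE_Z: assumes "AE x in M. P x" shows "AE x in M. P (Z n x)"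
proof -
 have "AE x in distr M M (Z n). P x" unfolding Z_distr by (rule assms)
 then show ?thesis by (rule AE_distrD[OF Z_meas])
qed

end

section \<open>Convex hull of an orbit and Cesaro means of correlations\<close>

context aut
begin

text \<open>Convex combinations of \<open>indicator B\<close> composed with powers of
  \<open>T\<close>, restricted to what the minimisation uses: midpoints serve the parallelogram
  identity, shifts the invariance of the minimiser.\<close>

inductive orbit_hull :: "'a set \<Rightarrow> ('a \<Rightarrow> real) \<Rightarrow> bool" for B where
 base: "orbit_hull B (indicator B)"
| shift: "orbit_hull B g \<Longrightarrow> orbit_hull B (\<lambda>x. g (T x))"
| mid: "orbit_hull B g \<Longrightarrow> orbit_hull B h \<Longrightarrow> orbit_hull B (\<lambda>x. (g x + h x) / 2)"

lemma hull_integrable: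
 assumes B: "B \<in> fmeasurable M" and "orbit_hull B g"
 shows "0 \<le> g x" "g x \<le> 1" "integrable M g" "integrable M (\<lambda>x. (g x)\<^sup>2)"
proof -
 have *: "(\<forall>x. 0 \<le> g x \<and> g x \<le> 1) \<and> integrable M g" using \<open>orbit_hull B g\<close> proof induction
  case base
  have "integrable M (indicator B :: 'a \<Rightarrow> real)" using B by (simp add: fmeasurable_def)
  then show ?case by simp
 next
  case (shift g)
  then have "integrable (distr M M T) g" by (simp add: distr_T)
  then show ?case using shift.IH by (auto intro: integrable_distr[OF meas_T])
 next
  case (mid g h)
  then have "g x + h x \<le> 2" for x by (metis add_mono one_add_one)
  then show ?case using mid by simp
 qed
 then show g: "0 \<le> g x" "g x \<le> 1" "integrable M g" for x by auto
 show "integrable M (\<lambda>x. (g x)\<^sup>2)"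
  by (rule bint_bound[OF g(3)]) (use * in \<open>auto simp: power2_eq_square abs_mult mult_left_le\<close>)
qed

text \<open>Every hull element has the same Cesaro correlations with \<open>B\<close> as
  \<open>indicator B\<close>: a shift moves the averaging window by one, which changes the mean by
  two bounded boundary terms over \<open>n\<close>, and midpoints pass through by linearity.\<close>

lemma hull_average:
 assumes B: "B \<in> fmeasurable M" and "orbit_hull B g"
 shows "(\<lambda>n. (\<Sum>k<n. (\<integral>x. g (Z (int k) x) * indicator B x \<partial>M) - measure M (B \<inter> pre (int k) B)) / real n) \<longlonglongrightarrow> 0" using \<open>orbit_hull B g\<close>
proof induction
 case base
 have "(\<integral>x. indicator B (Z (int k) x) * indicator B x \<partial>M) = measure M (B \<inter> pre (int k) B)" for k proof -
  have "(\<integral>x. indicator B (Z (int k) x) * indicator B x \<partial>M) = (\<integral>x. indicator (B \<inter> pre (int k) B) x \<partial>M :: real)"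
   by (intro bint_cong) (auto simp: indicator_def pre_iff)
  also have "\<dots> = measure M (B \<inter> pre (int k) B)" using B sub_space by (simp add: Int_absorb2 le_infI1)
  finally show ?thesis .
 qed
 then show ?case by simp
next
 case (shift g)
 note g = hull_integrable[OF B shift.hyps]
 let ?c = "\<lambda>k. \<integral>x. g (Z (int k) x) * indicator B x \<partial>M"
 have c: "\<bar>?c k\<bar> \<le> measure M B" for k proof -
  have i: "integrable M (indicator B :: 'a \<Rightarrow> real)" using B by (simp add: fmeasurable_def)
  have "?c k \<le> (\<integral>x. indicator B x \<partial>M)" using g by (intro integral_mono_AE' i AE_I2) (auto intro!: mult_left_le_one_le)
  moreover have "0 \<le> ?c k" using g by (intro bint_nonneg) auto
  ultimately show ?thesis using B by auto
 qed
 have s: "(\<integral>x. g (T (Z (int k) x)) * indicator B x \<partial>M) = ?c (Suc k)" for k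
  by (intro bint_cong) (auto simp: Z_Suc[symmetric] add.commute)
 have "(\<Sum>k<n. (\<integral>x. g (T (Z (int k) x)) * indicator B x \<partial>M) - measure M (B \<inter> pre (int k) B)) / real n
  = (\<Sum>k<n. ?c k - measure M (B \<inter> pre (int k) B)) / real n + (?c n - ?c 0) / real n" for n
  unfolding s add_divide_distrib[symmetric] sum_lessThan_telescope[of ?c, symmetric] sum.distrib[symmetric] by simp
 moreover have "(\<lambda>n. (?c n - ?c 0) / real n) \<longlonglongrightarrow> 0" proof (rule Lim_null_comparison[OF always_eventually[OF allI] lim_const_over_n])
  show "norm ((?c n - ?c 0) / real n) \<le> 2 * measure M B / real n" for n using c[of n] c[of 0] by (auto intro!: divide_right_mono simp: abs_divide)
 qed
 ultimately show ?case using tendsto_add[OF shift.IH] by simp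
next
 case (mid g h)
 have "(\<integral>x. (g (Z (int k) x) + h (Z (int k) x)) / 2 * indicator B x \<partial>M)
  = ((\<integral>x. g (Z (int k) x) * indicator B x \<partial>M) + (\<integral>x. h (Z (int k) x) * indicator B x \<partial>M)) / 2" for k
 proof -
  have i: "integrable M (\<lambda>x. f (Z (int k) x) * indicator B x)" if "orbit_hull B f" for f proof (rule integrable_real_mult_indicator)
   have "integrable (distr M M (Z (int k))) f" using hull_integrable(3)[OF B that] by (simp add: Z_distr)
   then show "integrable M (\<lambda>x. f (Z (int k) x))" by (rule integrable_distr[OF Z_meas])
  qed (use B in auto)
  show ?thesis using i[OF mid.hyps(1)] i[OF mid.hyps(2)]
   by (subst Bochner_Integration.integral_add[symmetric]) (auto simp: distrib_right add_divide_distrib)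
 qed
 then have eq: "(\<Sum>k<n. (\<integral>x. (g (Z (int k) x) + h (Z (int k) x)) / 2 * indicator B x \<partial>M) - measure M (B \<inter> pre (int k) B)) / real n
  = ((\<Sum>k<n. (\<integral>x. g (Z (int k) x) * indicator B x \<partial>M) - measure M (B \<inter> pre (int k) B)) / real n
   + (\<Sum>k<n. (\<integral>x. h (Z (int k) x) * indicator B x \<partial>M) - measure M (B \<inter> pre (int k) B)) / real n) / 2" for n
  by (simp add: sum_subtractf sum.distrib sum_divide_distrib[symmetric] add_divide_distrib diff_divide_distrib)
 from tendsto_divide[OF tendsto_add[OF mid.IH] tendsto_const[of "2::real"] zero_neq_numeral[symmetric]]
 show ?case unfolding eq by (simp only: add_0_right div_0)
qed

text \<open>The element of minimal norm in the closed convex hull of the orbit of \<open>B\<close> is invariant, hence zero.\<close>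

lemma hull_small:
 assumes no_inv: "\<And>A. A \<in> fmeasurable M \<Longrightarrow> sym_diff A (pre 1 A) \<in> null_sets M \<Longrightarrow> A \<in> null_sets M" and B: "B \<in> fmeasurable M" and e: "e > 0"
 shows "\<exists>g. orbit_hull B g \<and> (\<integral>x. (g x)\<^sup>2 \<partial>M) < e"
proof -
 note hi = hull_integrable[OF B]
 define q where "q g = (\<integral>x. (g x)\<^sup>2 \<partial>M)" for g :: "'a \<Rightarrow> real"
 define d where "d = Inf (q ` Collect (orbit_hull B))"
 have q0: "0 \<le> q g" for g unfolding q_def by (rule bint_nonneg) simp
 have bb: "bdd_below (q ` Collect (orbit_hull B))" by (rule bdd_belowI[of _ 0]) (auto simp: q0)
 have dq: "d \<le> q g" if "orbit_hull B g" for g unfolding d_def using that by (intro cInf_lower bb) auto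
 have ne: "q ` Collect (orbit_hull B) \<noteq> {}" using orbit_hull.base by blast
 have "\<exists>g. orbit_hull B g \<and> q g < d + 1 / real (Suc i)" for i using cInf_lessD[OF ne, of "d + 1 / real (Suc i)"] by (auto simp: d_def)
 then obtain g where g: "\<And>i. orbit_hull B (g i)" "\<And>i. q (g i) < d + 1 / real (Suc i)" by metis
 have m [measurable]: "g i \<in> borel_measurable M" for i using hi(3)[OF g(1)] by auto
 \<comment> \<open>Parallelogram identity: the midpoint of \<open>f\<close> and \<open>h\<close>
   lies in the hull, so its square norm is at least the infimum \<open>d\<close>.\<close>
 have par: "(nsq M (\<lambda>x. f x - h x)) \<le> ennreal (2 * (q f - d) + 2 * (q h - d))" if fh: "orbit_hull B f" "orbit_hull B h" for f h proof -
  have mid: "integrable M (\<lambda>x. ((f x + h x) / 2)\<^sup>2)" by (rule hi(4)[OF orbit_hull.mid[OF fh]])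
  have eq: "(f x - h x)\<^sup>2 = 2 * (f x)\<^sup>2 + 2 * (h x)\<^sup>2 - 4 * ((f x + h x) / 2)\<^sup>2" for x
   by (simp add: power2_eq_square algebra_simps add_divide_distrib)
  have "(\<integral>x. (f x - h x)\<^sup>2 \<partial>M) = 2 * q f + 2 * q h - 4 * q (\<lambda>x. (f x + h x) / 2)"
   unfolding eq q_def using hi(4)[OF fh(1)] hi(4)[OF fh(2)] mid by simp
  moreover have "integrable M (\<lambda>x. (f x - h x)\<^sup>2)" unfolding eq using hi(4)[OF fh(1)] hi(4)[OF fh(2)] mid by simp
  ultimately show ?thesis using dq[OF orbit_hull.mid[OF fh]] by (subst nn_integral_eq_integral) (auto intro!: ennreal_leI)
 qed
 have Cauchy: "\<exists>N. \<forall>m\<ge>N. \<forall>n\<ge>N. (nsq M (\<lambda>x. g m x - g n x)) < ennreal e" if e: "e > 0" for e proof -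
  obtain N where N: "1 / real (Suc N) < e / 4" using nat_approx_posE[of "e / 4"] e by auto
  have *: "a \<le> c \<Longrightarrow> b \<le> c \<Longrightarrow> x < d + a \<Longrightarrow> y < d + b \<Longrightarrow> c < e / 4 \<Longrightarrow> 2 * (x - d) + 2 * (y - d) < e" for a b c x y :: real by argo
  have "2 * (q (g m) - d) + 2 * (q (g n) - d) < e" if "m \<ge> N" "n \<ge> N" for m n proof -
   have "1 / real (Suc m) \<le> 1 / real (Suc N)" "1 / real (Suc n) \<le> 1 / real (Suc N)" using that by (auto intro!: divide_left_mono)
   then show ?thesis using * g(2)[of m] g(2)[of n] N by blast
  qed
  then show ?thesis using par[OF g(1) g(1)] e by (meson ennreal_lessI order_le_less_trans)
 qed
 obtain r where r: "(\<lambda>n. nsq M (\<lambda>x. g n x - lim (\<lambda>i. g (r i) x))) \<longlonglongrightarrow> 0"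
  by (rule L2_Cauchy_limit[of g M, OF m Cauchy]) (assumption, rule that)
 define h where "h x = lim (\<lambda>i. g (r i) x)" for x
 have [measurable]: "h \<in> borel_measurable M" unfolding h_def by measurable
 have lim: "(\<lambda>n. nsq M (\<lambda>x. g n x - h x)) \<longlonglongrightarrow> 0" using r by (simp add: h_def)
 have hT: "AE x in M. h (T x) = h x" proof -
  have "(nsq M (\<lambda>x. h (T x) - h x)) \<le> 3 * (nsq M (\<lambda>x. g n x - h x)) + 3 * ennreal (4 * (1 / Suc n)) + 3 * (nsq M (\<lambda>x. g n x - h x))" for n proof -
   let ?a = "\<lambda>x. ennreal ((g n x - h x)\<^sup>2)"
   have "(nsq M (\<lambda>x. h (T x) - h x)) \<le> (\<integral>\<^sup>+x. 3 * ?a (T x) + 3 * ennreal ((g n (T x) - g n x)\<^sup>2) + 3 * ?a x \<partial>M)" proof (rule nn_integral_mono)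
    fix x
    have *: "(w - z)\<^sup>2 \<le> 3 * (u - w)\<^sup>2 + 3 * (u - v)\<^sup>2 + 3 * (v - z)\<^sup>2" for u v w z :: real
     using zero_le_power2[of "(u - w) + (u - v)"] zero_le_power2[of "(u - w) + (v - z)"] zero_le_power2[of "(u - v) - (v - z)"]
     by (simp add: power2_eq_square algebra_simps)
    show "ennreal ((h (T x) - h x)\<^sup>2) \<le> 3 * ?a (T x) + 3 * ennreal ((g n (T x) - g n x)\<^sup>2) + 3 * ?a x"
     using ennreal_leI[OF *[of "h (T x)" "h x" "g n (T x)" "g n x"]] by (simp add: ennreal_mult)
   qed
   also have "\<dots> = 3 * (\<integral>\<^sup>+x. ?a (T x) \<partial>M) + 3 * (nsq M (\<lambda>x. g n (T x) - g n x)) + 3 * (\<integral>\<^sup>+x. ?a x \<partial>M)"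
    by (simp add: nn_integral_add nn_integral_cmult)
   also have "(\<integral>\<^sup>+x. ?a (T x) \<partial>M) = (\<integral>\<^sup>+x. ?a x \<partial>M)" using nn_integral_distr[OF meas_T, of ?a] by (simp add: distr_T)
   finally have 1: "(nsq M (\<lambda>x. h (T x) - h x))
    \<le> 3 * (\<integral>\<^sup>+x. ?a x \<partial>M) + 3 * (nsq M (\<lambda>x. g n (T x) - g n x)) + 3 * (\<integral>\<^sup>+x. ?a x \<partial>M)" .
   \<comment> \<open>\<open>T\<close> preserves the norm, so the shift of \<open>g n\<close> is as
     nearly minimal as \<open>g n\<close>; \<open>par\<close> then makes the two close, whence the
     limit \<open>h\<close> is invariant.\<close>
   have "q (\<lambda>x. g n (T x)) = q (g n)" unfolding q_def using integral_distr[OF meas_T, of "\<lambda>x. (g n x)\<^sup>2"] by (simp add: distr_T)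
   then have "2 * (q (\<lambda>x. g n (T x)) - d) + 2 * (q (g n) - d) \<le> 4 * (1 / Suc n)" using g(2)[of n] by simp
   from order_trans[OF par[OF orbit_hull.shift[OF g(1)] g(1)] ennreal_leI[OF this]]
   have 2: "(nsq M (\<lambda>x. g n (T x) - g n x)) \<le> ennreal (4 * (1 / Suc n))" .
   show ?thesis by (rule order_trans[OF 1]) (intro add_mono mult_left_mono 2; simp)
  qed
  moreover have "(\<lambda>n. 3 * (nsq M (\<lambda>x. g n x - h x)) + 3 * ennreal (4 * (1 / Suc n)) + 3 * (nsq M (\<lambda>x. g n x - h x)))
   \<longlonglongrightarrow> 3 * 0 + 3 * ennreal (4 * 0) + 3 * 0" using LIMSEQ_inverse_real_of_nat
   by (intro tendsto_add ennreal_tendsto_cmult lim tendsto_ennrealI tendsto_mult tendsto_const) (simp_all add: divide_inverse)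
  ultimately have "(nsq M (\<lambda>x. h (T x) - h x)) \<le> 3 * 0 + 3 * ennreal (4 * 0) + 3 * 0" by (intro LIMSEQ_le_const) auto
  then have "(nsq M (\<lambda>x. h (T x) - h x)) = 0" by simp
  then have "AE x in M. ennreal ((h (T x) - h x)\<^sup>2) = 0" by (subst (asm) nn_integral_0_iff_AE) measurable
  then show ?thesis by eventually_elim (simp add: ennreal_eq_0_iff)
 qed
 have fin: "(nsq M (\<lambda>x. g n x)) = ennreal (q (g n))" for n unfolding q_def by (rule nn_integral_eq_integral[OF hi(4)[OF g(1)]]) simp
 have "(\<lambda>n. nsq M (\<lambda>x. g n x)) \<longlonglongrightarrow> 0" proof (rule L2_vanish[OF m _ lim])
  fix c :: real
  let ?A = "{x\<in>space M. c < (h x)\<^sup>2}"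
  assume "emeasure M ?A < \<infinity>"
  then have A: "?A \<in> fmeasurable M" by (auto simp: fmeasurable_def)
  then have "?A \<in> sets M" "pre 1 ?A \<in> sets M" by (auto intro: pre_sets)
  moreover have "AE x in M. x \<notin> sym_diff ?A (pre 1 ?A)" using hT AE_space by eventually_elim (auto simp: pre_iff Z_1 T_in)
  ultimately have "sym_diff ?A (pre 1 ?A) \<in> null_sets M" by (subst AE_iff_null_sets) auto
  then show "emeasure M ?A = 0" using no_inv[OF A] by auto
 qed (simp_all add: fin)
 then have "eventually (\<lambda>n. ennreal (q (g n)) < ennreal e) sequentially" unfolding fin by (rule order_tendstoD(2)) (use e in simp)
 then obtain n where "q (g n) < e" using q0 by (auto simp: eventually_sequentially ennreal_less_iff)
 then show ?thesis using g(1) by (auto simp: q_def)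
qed

text \<open>By \<open>hull_average\<close> the indicator may be replaced by a hull element of small
  norm, whose correlations with \<open>B\<close> are small uniformly in the time.\<close>

lemma cesaro_zero:
 assumes no_inv: "\<And>A. A \<in> fmeasurable M \<Longrightarrow> sym_diff A (pre 1 A) \<in> null_sets M \<Longrightarrow> A \<in> null_sets M" and B: "B \<in> fmeasurable M"
 shows "(\<lambda>n. (\<Sum>k<n. measure M (B \<inter> pre (int k) B)) / real n) \<longlonglongrightarrow> 0"
proof (rule LIMSEQ_I)
 fix e :: real assume e: "0 < e"
 \<comment> \<open>The weight in \<open>y \<le> y^2 / (2 * s) + s / 2\<close>: with the square norm
   of \<open>g\<close> below \<open>e * s / 2\<close> and
   \<open>s * measure M B \<le> e / 2\<close>, the two terms contribute at most \<open>e / 4\<close>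
   each.\<close>
 define s where "s = e / (2 * (measure M B + 1))"
 have b: "0 \<le> measure M B" by simp
 have s: "s > 0" using e b by (auto simp: s_def intro!: divide_pos_pos add_nonneg_pos)
 have sb: "s * measure M B \<le> e / 2" proof -
  have "s * measure M B \<le> s * (measure M B + 1)" using s by simp
  also have "\<dots> = e / 2" using add_nonneg_pos[OF b zero_less_one] unfolding s_def by (simp add: divide_eq_eq)
  finally show ?thesis .
 qed
 have "0 < e * s / 2" using e s by simp
 from hull_small[OF no_inv B this] obtain g where g: "orbit_hull B g" "(\<integral>x. (g x)\<^sup>2 \<partial>M) < e * s / 2" by blast
 note gi = hull_integrable[OF B g(1)]
 have c: "(\<integral>x. g (Z k x) * indicator B x \<partial>M) \<le> e / 2" for k proof -
  have d: "integrable (distr M M (Z k)) (\<lambda>x. (g x)\<^sup>2)" using gi(4) by (simp add: Z_distr)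
  have i: "integrable M (\<lambda>x. (g (Z k x))\<^sup>2)" by (rule integrable_distr[OF Z_meas d])
  have gm: "g \<in> borel_measurable M" using gi(3) by auto
  have iB: "integrable M (indicator B :: 'a \<Rightarrow> real)" using B by (simp add: fmeasurable_def)
  have "(\<integral>x. g (Z k x) * indicator B x \<partial>M) \<le> (\<integral>x. (g (Z k x))\<^sup>2 / (2 * s) + s / 2 * indicator B x \<partial>M)" proof (rule integral_mono_AE', goal_cases)
   case 1 then show ?case using i iB by simp
  next
   case 2
   have "y \<le> y\<^sup>2 / (2 * s) + s / 2" for y using zero_le_power2[of "y - s"] s by (simp add: field_simps power2_eq_square)
   then show ?case using s by (intro AE_I2) (simp add: indicator_def)
  next
   case 3 then show ?case using s by (intro AE_I2) simp
  qed
  also have "\<dots> = (\<integral>x. (g (Z k x))\<^sup>2 \<partial>M) / (2 * s) + s / 2 * measure M B" using i iB B by (subst Bochner_Integration.integral_add) auto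
  also have "(\<integral>x. (g (Z k x))\<^sup>2 \<partial>M) = (\<integral>x. (g x)\<^sup>2 \<partial>M)" using integral_distr[OF Z_meas[of k], of "\<lambda>x. (g x)\<^sup>2"] gm by (simp add: Z_distr)
  also have "(\<integral>x. (g x)\<^sup>2 \<partial>M) / (2 * s) \<le> e / 4" using g(2) s by (simp add: field_simps)
  finally show ?thesis using sb by simp
 qed
 from LIMSEQ_D[OF hull_average[OF B g(1)], of "e / 2"] e obtain N where
  N: "\<And>n. n \<ge> N \<Longrightarrow> \<bar>(\<Sum>k<n. (\<integral>x. g (Z (int k) x) * indicator B x \<partial>M) - measure M (B \<inter> pre (int k) B)) / real n\<bar> < e / 2" by auto
 show "\<exists>N. \<forall>n\<ge>N. norm ((\<Sum>k<n. measure M (B \<inter> pre (int k) B)) / real n - 0) < e" proof (intro exI allI impI)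
  fix n assume "n \<ge> N"
  have "(\<Sum>k<n. \<integral>x. g (Z (int k) x) * indicator B x \<partial>M) \<le> (\<Sum>k<n. e / 2)" by (intro sum_mono c)
  then have "(\<Sum>k<n. \<integral>x. g (Z (int k) x) * indicator B x \<partial>M) / real n \<le> e / 2" using e by (cases "n = 0") (simp_all add: field_simps)
  moreover have "0 \<le> (\<Sum>k<n. measure M (B \<inter> pre (int k) B)) / real n" by (simp add: sum_nonneg)
  ultimately show "norm ((\<Sum>k<n. measure M (B \<inter> pre (int k) B)) / real n - 0) < e"
   using N[OF \<open>n \<ge> N\<close>] unfolding sum_subtractf diff_divide_distrib real_norm_def by linarith
 qed
qed

end

text \<open>The form in which the hypothesis on the conservative part enters the ergodic arguments;
  \<open>type_II_infinity_iff\<close> identifies the two.\<close>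

definition (in aut) no_finite_invariant :: bool where "no_finite_invariant \<longleftrightarrow> (\<forall>A\<in>fmeasurable M. sym_diff A (pre 1 A) \<in> null_sets M \<longrightarrow> A \<in> null_sets M)"

section \<open>Poisson measures\<close>

abbreviation config :: "'a measure \<Rightarrow> 'a measure set" where "config M \<equiv> {w. sets w = sets M}"

definition cyl_gen :: "'a measure \<Rightarrow> 'a set set \<Rightarrow> 'a measure set set" where
 "cyl_gen M AA = {(\<lambda>w. emeasure w A) -` U \<inter> config M | A U. A \<in> AA \<and> U \<in> sets borel}"

text \<open>The events that depend on the counts of the members of \<open>AA\<close>. The field is a
  plain family of sets over \<open>config M\<close>, so that the fields for different
  \<open>AA\<close> are compared by inclusion.\<close>

definition cyl :: "'a measure \<Rightarrow> 'a set set \<Rightarrow> 'a measure set set" where "cyl M AA = sigma_sets (config M) (cyl_gen M AA)"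

abbreviation cylm :: "'a measure \<Rightarrow> 'a set set \<Rightarrow> 'a measure measure" where "cylm M AA \<equiv> sigma (config M) (cyl M AA)"

abbreviation (input) cnt :: "'a set \<Rightarrow> 'a measure \<Rightarrow> ennreal" where "cnt A \<equiv> \<lambda>w. emeasure w A"

lemma cyl_gen_Pow: "cyl_gen M AA \<subseteq> Pow (config M)" by (auto simp: cyl_gen_def)

lemma sigma_algebra_cyl: "sigma_algebra (config M) (cyl M AA)" unfolding cyl_def by (rule sigma_algebra_sigma_sets[OF cyl_gen_Pow])

lemma cyl_Pow: "cyl M AA \<subseteq> Pow (config M)" unfolding cyl_def using sigma_sets_into_sp[OF cyl_gen_Pow] by blast

lemma sets_cylm: "sets (cylm M AA) = cyl M AA" using sigma_algebra.sets_measure_of_eq[OF sigma_algebra_cyl] by (simp add: sets_measure_of_conv cyl_Pow)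

lemma space_cylm: "space (cylm M AA) = config M" by (simp add: space_measure_of_conv)

lemma cyl_basic: "A \<in> AA \<Longrightarrow> U \<in> sets borel \<Longrightarrow> {w. sets w = sets M \<and> emeasure w A \<in> U} \<in> cyl M AA"
 unfolding cyl_def by (rule sigma_sets.Basic) (force simp: cyl_gen_def)

lemma emeasure_cylm: assumes "A \<in> AA" shows "(cnt A) \<in> borel_measurable (cylm M AA)"
proof (rule measurableI)
 fix U :: "ennreal set" assume "U \<in> sets borel"
 moreover have "(cnt A) -` U \<inter> space (cylm M AA) = {w. sets w = sets M \<and> emeasure w A \<in> U}" by (auto simp: space_cylm)
 ultimately show "(cnt A) -` U \<inter> space (cylm M AA) \<in> sets (cylm M AA)" unfolding sets_cylm using cyl_basic[OF assms] by simp
qed simp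

lemma cyl_leI:
 assumes "sigma_algebra (config M) S" and "space N = config M" "sets N = S" and "\<And>A. A \<in> AA \<Longrightarrow> (cnt A) \<in> borel_measurable N"
 shows "cyl M AA \<subseteq> S" unfolding cyl_def
proof (rule sigma_algebra.sigma_sets_subset[OF assms(1)], rule)
 fix E assume "E \<in> cyl_gen M AA"
 then obtain A U where "A \<in> AA" "U \<in> sets borel" "E = (cnt A) -` U \<inter> config M" by (auto simp: cyl_gen_def)
 then show "E \<in> S" using measurable_sets[OF assms(4)] assms(2,3) by auto
qed

lemma cyl_le_cyl:
 assumes "\<And>A. A \<in> AA \<Longrightarrow> (cnt A) \<in> borel_measurable (cylm M BB)"
 shows "cyl M AA \<subseteq> cyl M BB" by (rule cyl_leI[OF sigma_algebra_cyl space_cylm sets_cylm assms])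

lemma cyl_mono: "AA \<subseteq> BB \<Longrightarrow> cyl M AA \<subseteq> cyl M BB" by (rule cyl_le_cyl) (auto intro: emeasure_cylm)

lemma measurable_sum_disjoint:
 assumes "A = (\<Union>i. B i)" "disjoint_family B" "\<And>i::nat. B i \<in> sets M"
  and N: "space N = config M" "\<And>i. (cnt (B i)) \<in> borel_measurable N"
 shows "(cnt A) \<in> borel_measurable N"
proof (subst measurable_cong)
 fix w assume "w \<in> space N"
 then show "emeasure w A = (\<Sum>i. emeasure w (B i))" using assms by (simp add: suminf_emeasure image_subset_iff)
qed (use N in measurable)

lemma space_measures_algebra: "space (measures_algebra M) = config M"
 unfolding measures_algebra_def by (subst space_Sup_eq_UN) (auto intro: sets.empty_sets)

lemma UN_Collect_image: "(\<Union>A\<in>S. {h A U | U. U \<in> B}) = {h A U | A U. A \<in> S \<and> U \<in> B}" by auto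

lemma sets_measures_algebra: "sets (measures_algebra M) = cyl M (sets M)"
proof -
 have *: "(\<Union>x\<in>(\<lambda>A. vimage_algebra (config M) (cnt A) borel) ` sets M. sets x) = cyl_gen M (sets M)" proof -
  have v: "sets (vimage_algebra (config M) f borel) = {f -` U \<inter> config M | U. U \<in> sets borel}" for f :: "'a measure \<Rightarrow> ennreal"
   by (rule sets_vimage_algebra2) simp
  have "(\<Union>x\<in>(\<lambda>A. vimage_algebra (config M) (cnt A) borel) ` sets M. sets x)
    = (\<Union>A\<in>sets M. {(cnt A) -` U \<inter> config M | U. U \<in> sets borel})" by (simp only: image_image v)
  also have "\<dots> = cyl_gen M (sets M)" unfolding cyl_gen_def by (rule UN_Collect_image[where h = "\<lambda>A U. (cnt A) -` U \<inter> config M"])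
  finally show ?thesis .
 qed
 show ?thesis unfolding measures_algebra_def cyl_def *[symmetric] by (rule sets_Sup_eq) auto
qed

text \<open>Requiring \<open>S\<close> to be nonempty leaves out the complement of the union, so
  every atom lies in a member of \<open>AA\<close> and inherits finite measure from it.\<close>

definition atoms :: "'a set set \<Rightarrow> 'a set set" where "atoms AA = {\<Inter>S - \<Union>(AA - S) | S. S \<subseteq> AA \<and> S \<noteq> {}}"

lemma finite_atoms: "finite AA \<Longrightarrow> finite (atoms AA)"
proof -
 assume "finite AA"
 then have "finite ((\<lambda>S. \<Inter>S - \<Union>(AA - S)) ` Pow AA)" by simp
 then show ?thesis by (rule finite_subset[rotated]) (auto simp: atoms_def)
qed

lemma disjoint_atoms: "disjoint (atoms AA)" unfolding disjoint_def
proof (intro ballI impI)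
 fix C D assume "C \<in> atoms AA" "D \<in> atoms AA" and ne: "C \<noteq> D"
 then obtain S S' where S: "S \<subseteq> AA" "C = \<Inter>S - \<Union>(AA - S)" and S': "S' \<subseteq> AA" "D = \<Inter>S' - \<Union>(AA - S')" unfolding atoms_def by blast
 have "S \<noteq> S'" using ne S S' by auto
 then obtain B where "B \<in> S \<and> B \<notin> S' \<or> B \<in> S' \<and> B \<notin> S" by auto
 then show "C \<inter> D = {}" proof
  assume B: "B \<in> S \<and> B \<notin> S'"
  then have "C \<subseteq> B" "D \<inter> B = {}" using S S' by auto
  then show ?thesis by auto
 next
  assume B: "B \<in> S' \<and> B \<notin> S"
  then have "D \<subseteq> B" "C \<inter> B = {}" using S S' by auto
  then show ?thesis by auto
 qed
qed

lemma atoms_le: "C \<in> atoms AA \<Longrightarrow> \<exists>A\<in>AA. C \<subseteq> A" unfolding atoms_def by auto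

lemma atoms_cover: assumes "A \<in> AA" shows "A = \<Union>{C\<in>atoms AA. C \<subseteq> A}"
proof
 show "A \<subseteq> \<Union>{C\<in>atoms AA. C \<subseteq> A}" proof
  fix x assume x: "x \<in> A"
  let ?S = "{B\<in>AA. x \<in> B}"
  have "\<Inter>?S - \<Union>(AA - ?S) \<in> atoms AA" unfolding atoms_def using assms x by blast
  moreover have "\<Inter>?S - \<Union>(AA - ?S) \<subseteq> A" using assms x by auto
  moreover have "x \<in> \<Inter>?S - \<Union>(AA - ?S)" by auto
  ultimately show "x \<in> \<Union>{C\<in>atoms AA. C \<subseteq> A}" by blast
 qed
qed auto

lemma atoms_sets: "finite AA \<Longrightarrow> AA \<subseteq> sets G \<Longrightarrow> atoms AA \<subseteq> sets G"
proof
 fix C assume A: "finite AA" "AA \<subseteq> sets G" and "C \<in> atoms AA"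
 then obtain S where S: "S \<subseteq> AA" "S \<noteq> {}" "C = \<Inter>S - \<Union>(AA - S)" by (auto simp: atoms_def)
 have "(\<Inter>B\<in>S. B) \<in> sets G" using S A by (intro sets.finite_INT) (auto dest: finite_subset)
 moreover have "\<Union>(AA - S) \<in> sets G" using A by (intro sets.finite_Union) auto
 ultimately show "C \<in> sets G" using S(3) by auto
qed

lemma atoms_fmeasurable: assumes "finite AA" "AA \<subseteq> fmeasurable M" shows "atoms AA \<subseteq> fmeasurable M"
proof
 fix C assume C: "C \<in> atoms AA"
 then obtain A where "A \<in> AA" "C \<subseteq> A" using atoms_le by blast
 moreover have "C \<in> sets M" using atoms_sets[of AA M] assms C by auto
 ultimately show "C \<in> fmeasurable M" using assms by (auto intro: fmeasurableI2)
qed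

lemma emeasure_atoms:
 assumes "finite AA" "AA \<subseteq> sets M" "A \<in> AA" "sets w = sets M"
 shows "emeasure w A = (\<Sum>C\<in>{C\<in>atoms AA. C \<subseteq> A}. emeasure w C)"
proof -
 have "(\<Sum>C\<in>{C\<in>atoms AA. C \<subseteq> A}. emeasure w C) = emeasure w (\<Union>C\<in>{C\<in>atoms AA. C \<subseteq> A}. C)" using atoms_sets[OF assms(1,2)] disjoint_atoms[of AA] assms
  by (intro sum_emeasure) (auto simp: finite_atoms disjoint_family_on_def disjoint_def)
 then show ?thesis using atoms_cover[OF assms(3)] by simp
qed

text \<open>Counts of members are finite sums of counts of atoms. The empty atom is dropped because
  it may belong to the atoms of several families at once, while grouping independent variables asks
  for disjoint index sets.\<close>

lemma cyl_atoms: assumes "finite AA" "AA \<subseteq> sets M" shows "cyl M AA \<subseteq> cyl M (atoms AA - {{}})"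
proof (rule cyl_le_cyl)
 fix A assume A: "A \<in> AA"
 show "(cnt A) \<in> borel_measurable (cylm M (atoms AA - {{}}))" proof (subst measurable_cong)
  fix w assume "w \<in> space (cylm M (atoms AA - {{}}))"
  then have "emeasure w A = (\<Sum>C\<in>{C\<in>atoms AA. C \<subseteq> A}. emeasure w C)" by (intro emeasure_atoms[where M=M] assms A) (simp add: space_cylm)
  also have "\<dots> = (\<Sum>C\<in>{C\<in>atoms AA - {{}}. C \<subseteq> A}. emeasure w C)" using assms(1) by (intro sum.mono_neutral_right) (auto simp: finite_atoms)
  finally show "emeasure w A = (\<Sum>C\<in>{C\<in>atoms AA - {{}}. C \<subseteq> A}. emeasure w C)" .
 qed (auto intro!: borel_measurable_sum emeasure_cylm)
qed

text \<open>The events whose probability the definition of a Poisson measure determines directly.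
  Admitting all finite families makes them an algebra, which is what approximation starts
  from.\<close>

definition fincyl :: "'a measure \<Rightarrow> 'a set set \<Rightarrow> 'a measure set set" where "fincyl M RR = \<Union>{cyl M BB | BB. finite BB \<and> BB \<subseteq> RR \<inter> fmeasurable M}"

lemma fincylE: assumes "E \<in> fincyl M RR" obtains BB where "finite BB" "BB \<subseteq> RR \<inter> fmeasurable M" "E \<in> cyl M BB" using assms unfolding fincyl_def by blast

lemma fincylI: "finite BB \<Longrightarrow> BB \<subseteq> RR \<inter> fmeasurable M \<Longrightarrow> E \<in> cyl M BB \<Longrightarrow> E \<in> fincyl M RR" unfolding fincyl_def by blast

lemma fincyl_common:
 assumes "E \<in> fincyl M RR" "F \<in> fincyl M RR"
 obtains BB where "finite BB" "BB \<subseteq> RR \<inter> fmeasurable M" "E \<in> cyl M BB" "F \<in> cyl M BB"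
proof -
 from assms obtain BB CC where B: "finite BB" "BB \<subseteq> RR \<inter> fmeasurable M" "E \<in> cyl M BB" and C: "finite CC" "CC \<subseteq> RR \<inter> fmeasurable M" "F \<in> cyl M CC"
  by (metis fincylE)
 then show ?thesis using that[of "BB \<union> CC"] cyl_mono[of BB "BB \<union> CC" M] cyl_mono[of CC "BB \<union> CC" M] by blast
qed

lemma algebra_fincyl: "algebra (config M) (fincyl M RR)" unfolding algebra_iff_Un
proof (intro conjI ballI)
 show "fincyl M RR \<subseteq> Pow (config M)" unfolding fincyl_def using cyl_Pow by blast
 show "{} \<in> fincyl M RR" by (rule fincylI[of "{}"]) (auto simp: cyl_def intro: sigma_sets.Empty)
next
 fix E assume "E \<in> fincyl M RR"
 then obtain BB where "finite BB" "BB \<subseteq> RR \<inter> fmeasurable M" "E \<in> cyl M BB" by (rule fincylE)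
 then show "config M - E \<in> fincyl M RR" by (intro fincylI[of BB]) (auto simp: cyl_def intro: sigma_sets.Compl)
next
 fix E F assume "E \<in> fincyl M RR" "F \<in> fincyl M RR"
 then obtain BB where B: "finite BB" "BB \<subseteq> RR \<inter> fmeasurable M" "E \<in> cyl M BB" "F \<in> cyl M BB" by (rule fincyl_common)
 interpret sigma_algebra "config M" "cyl M BB" by (rule sigma_algebra_cyl)
 show "E \<union> F \<in> fincyl M RR" using B by (intro fincylI[of BB]) auto
qed

text \<open>A count is the sum of the counts over a countable partition into sets of finite measure.
  Hypothesis \<open>dec\<close> asks for pieces inside \<open>RR\<close>, so that the statement
  serves for the points in a set and for subfields alike.\<close>

lemma cyl_subset_sigma_fincyl:
 assumes R: "RR \<subseteq> sets M" and dec: "\<And>A. A \<in> RR \<Longrightarrow> \<exists>B::nat \<Rightarrow> 'a set. A = (\<Union>i. B i) \<and> disjoint_family B \<and> range B \<subseteq> RR \<inter> fmeasurable M"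
 shows "cyl M RR \<subseteq> sigma_sets (config M) (fincyl M RR)"
proof -
 let ?N = "sigma (config M) (fincyl M RR)"
 have P: "fincyl M RR \<subseteq> Pow (config M)" using algebra_fincyl[of M RR] unfolding algebra_iff_Un by blast
 have sN: "sets ?N = sigma_sets (config M) (fincyl M RR)" "space ?N = config M"
  using P by (simp_all add: sets_measure_of space_measure_of)
 have fin: "(cnt A) \<in> borel_measurable ?N" if "A \<in> RR \<inter> fmeasurable M" for A proof (rule measurableI)
  fix U :: "ennreal set" assume "U \<in> sets borel"
  then have "{w. sets w = sets M \<and> emeasure w A \<in> U} \<in> fincyl M RR" using that by (intro fincylI[of "{A}"] cyl_basic) auto
  moreover have "(cnt A) -` U \<inter> space ?N = {w. sets w = sets M \<and> emeasure w A \<in> U}" by (auto simp: sN)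
  ultimately show "(cnt A) -` U \<inter> space ?N \<in> sets ?N" unfolding sN by (auto intro: sigma_sets.Basic)
 qed simp
 show ?thesis proof (rule cyl_leI[OF _ sN(2) sN(1)])
  show "sigma_algebra (config M) (sigma_sets (config M) (fincyl M RR))" by (rule sigma_algebra_sigma_sets[OF P])
  fix A assume "A \<in> RR"
  from dec[OF this] obtain B :: "nat \<Rightarrow> 'a set" where B: "A = (\<Union>i. B i)" "disjoint_family B" "range B \<subseteq> RR \<inter> fmeasurable M" by blast
  show "(cnt A) \<in> borel_measurable ?N" using B R by (intro measurable_sum_disjoint[OF B(1,2) _ sN(2)] fin) auto
 qed
qed

text \<open>The definition of a Poisson measure indexes its families by initial segments of the
  natural numbers, whereas finite families of sets are used below with the sets themselves as
  indices.\<close>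

lemma (in prob_space) indep_vars_reindex_bij:
 assumes ind: "indep_vars (\<lambda>_. N) (\<lambda>j. X (h j)) J" and h: "bij_betw h J I"
 shows "indep_vars (\<lambda>_. N) X I"
proof -
 from ind have rv: "\<And>j. j \<in> J \<Longrightarrow> random_variable N (X (h j))" and ind': "indep_sets (\<lambda>j. {X (h j) -` A \<inter> space M |A. A \<in> sets N}) J"
  unfolding indep_vars_def2 by auto
 have I: "I = h ` J" using h by (simp add: bij_betw_def)
 show ?thesis unfolding indep_vars_def2 proof (intro conjI ballI indep_setsI)
  fix i assume "i \<in> I" then show "random_variable N (X i)" using rv I by auto
  then show "{X i -` A \<inter> space M |A. A \<in> sets N} \<subseteq> events" by (auto dest: measurable_sets)
 next
  fix A K assume K: "K \<noteq> {}" "K \<subseteq> I" "finite K" and A: "\<forall>i\<in>K. A i \<in> {X i -` A \<inter> space M |A. A \<in> sets N}"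
  obtain L where L: "L \<subseteq> J" "inj_on h L" "K = h ` L" using K(2) I by (metis subset_image_inj)
  have "finite L" using K L by (simp add: finite_image_iff)
  then have "prob (\<Inter>j\<in>L. A (h j)) = (\<Prod>j\<in>L. prob (A (h j)))" using K L A by (intro indep_setsD[OF ind']) auto
  then show "prob (\<Inter>j\<in>K. A j) = (\<Prod>j\<in>K. prob (A j))" by (simp add: L prod.reindex)
 qed
qed

section \<open>Independence over disjoint sets, and approximation by local events\<close>

locale poisson =
 fixes M :: "'a measure" and P :: "'a measure measure"
 assumes poisson: "poisson_measure M P"
begin

abbreviation (input) void :: "'a set \<Rightarrow> 'a measure set" where "void A \<equiv> {w\<in>space P. emeasure w A = 0}"
abbreviation (input) occ :: "'a set \<Rightarrow> ennreal set \<Rightarrow> 'a measure set" where "occ A U \<equiv> {w\<in>space P. emeasure w A \<in> U}"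

sublocale prob_space P using poisson by (simp add: poisson_measure_def)

lemma sets_P: "sets P = cyl M (sets M)" using poisson by (simp add: poisson_measure_def sets_measures_algebra)

lemma space_P: "space P = config M"
 using poisson sets_eq_imp_space_eq[of P "measures_algebra M"] by (simp add: poisson_measure_def space_measures_algebra)

lemma N_meas [measurable]: "A \<in> sets M \<Longrightarrow> (cnt A) \<in> borel_measurable P"
 by (subst measurable_cong_sets[of P "cylm M (sets M)" borel borel]) (simp_all add: sets_P sets_cylm emeasure_cylm del: sets_measure_of_conv)

lemma N_sets [simp]: "A \<in> sets M \<Longrightarrow> U \<in> sets borel \<Longrightarrow> (occ A U) \<in> events"
 using measurable_sets[OF N_meas, of A U] by (simp add: vimage_def Int_def conj_commute)

lemma N_eq_sets [simp]: "A \<in> sets M \<Longrightarrow> {w\<in>space P. emeasure w A = c} \<in> events" using N_sets[of A "{c}"] by simp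

lemma N_neq_sets [simp]: "A \<in> sets M \<Longrightarrow> {w\<in>space P. emeasure w A \<noteq> c} \<in> events" using N_sets[of A "- {c}"] by simp

lemma cyl_sub: "AA \<subseteq> sets M \<Longrightarrow> cyl M AA \<subseteq> sets P" unfolding sets_P by (rule cyl_mono)

lemma partition: obtains X :: "nat \<Rightarrow> 'a set" where "range X \<subseteq> fmeasurable M" "disjoint_family X" "(\<Union>i. X i) = space M"
proof -
 have "\<exists>X :: nat \<Rightarrow> 'a set. range X \<subseteq> fmeasurable M \<and> disjoint_family X \<and> (\<Union>i. X i) = space M \<and>
   (AE w in P. \<forall>i. emeasure w (X i) \<in> \<nat>)" using poisson[unfolded poisson_measure_def, THEN conjunct2, THEN conjunct2, THEN conjunct1] .
 then show thesis using that by (elim exE conjE) simp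
qed

lemmas poissonD = poisson[unfolded poisson_measure_def, THEN conjunct2, THEN conjunct2, THEN conjunct2, rule_format]

lemma disj_indep:
 assumes "finite I" "\<And>i. i \<in> I \<Longrightarrow> A i \<in> fmeasurable M" "disjoint_family_on A I"
 shows "indep_vars (\<lambda>_. borel) (\<lambda>i w. emeasure w (A i)) I"
proof -
 obtain h where h: "bij_betw h {..<card I} I" using ex_bij_betw_nat_finite[OF assms(1)] by (auto simp: atLeast0LessThan)
 have "\<forall>i<card I. A (h i) \<in> fmeasurable M" using h assms by (auto simp: bij_betw_def)
 moreover have "disjoint_family_on (\<lambda>i. A (h i)) {..<card I}"
  using h assms(3) unfolding disjoint_family_on_def bij_betw_def by (metis imageI inj_onD)
 ultimately have "indep_vars (\<lambda>_. borel) (\<lambda>i w. emeasure w (A (h i))) {..<card I}" using poissonD[THEN conjunct1, of "card I" "\<lambda>i. A (h i)"] by blast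
 then show ?thesis by (rule indep_vars_reindex_bij[OF _ h])
qed

lemma distr_N:
 assumes "A \<in> fmeasurable M"
 shows "distr P borel (cnt A) = distr (measure_pmf (poisson_law (measure M A))) borel of_nat"
proof -
 have "disjoint_family_on (\<lambda>_. A) {..<1::nat}" by (simp add: disjoint_family_on_def)
 then have "\<forall>i<1::nat. distr P borel (cnt A) = distr (measure_pmf (poisson_law (measure M A))) borel of_nat"
  using assms by (intro conjunct2[OF poissonD[of 1 "\<lambda>_::nat. A"]]) auto
 then show ?thesis by simp
qed

lemma prob_N:
 assumes "A \<in> fmeasurable M" and U: "U \<in> sets borel"
 shows "prob (occ A U) = measure (measure_pmf (poisson_law (measure M A))) {n. of_nat n \<in> U}"
proof -
 have "prob (occ A U) = measure (distr P borel (cnt A)) U"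
  using assms by (subst measure_distr) (auto intro!: arg_cong[where f=prob])
 also have "\<dots> = measure (measure_pmf (poisson_law (measure M A))) (of_nat -` U \<inter> space (measure_pmf (poisson_law (measure M A))))"
  unfolding distr_N[OF assms(1)] using U by (subst measure_distr) auto
 finally show ?thesis by (simp add: vimage_def)
qed

lemma AE_N_nat: assumes "A \<in> fmeasurable M" shows "AE w in P. emeasure w A \<in> \<nat>"
proof -
 have nat: "(\<nat> :: ennreal set) \<in> sets borel" using sets.countable[of "range (of_nat :: nat \<Rightarrow> ennreal)" borel] by (simp add: Nats_def)
 have "AE x in distr P borel (cnt A). x \<in> \<nat>" unfolding distr_N[OF assms] by (subst AE_distr_iff) (use nat in auto)
 from AE_distrD[OF N_meas this] assms show ?thesis by auto
qed

lemma AE_N_finite: assumes "A \<in> fmeasurable M" shows "AE w in P. emeasure w A < \<infinity>"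
 using AE_N_nat[OF assms] by eventually_elim (auto simp: Nats_def of_nat_less_top)

lemma poisson_law_0: "r \<ge> 0 \<Longrightarrow> pmf (poisson_law r) 0 = exp (- r)" by (auto simp: poisson_law_def)

lemma prob_N0: assumes "A \<in> fmeasurable M" shows "prob (void A) = exp (- measure M A)"
proof -
 have "prob (occ A ({0})) = measure (measure_pmf (poisson_law (measure M A))) {n. (of_nat n :: ennreal) \<in> {0}}"
  by (rule prob_N[OF assms]) simp
 also have "{n::nat. (of_nat n :: ennreal) \<in> {0}} = {0}" by auto
 finally show ?thesis by (simp add: measure_pmf_single poisson_law_0)
qed

lemma prob_N_pos: assumes "A \<in> fmeasurable M" shows "prob {w\<in>space P. emeasure w A \<noteq> 0} = 1 - exp (- measure M A)"
proof -
 have "prob (space P - (void A)) = 1 - prob (void A)" using assms by (intro prob_compl) auto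
 also have "space P - (void A) = {w\<in>space P. emeasure w A \<noteq> 0}" by auto
 finally show ?thesis using prob_N0[OF assms] by simp
qed

lemma prob_N_pos_le: assumes "A \<in> fmeasurable M" shows "prob {w\<in>space P. emeasure w A \<noteq> 0} \<le> measure M A"
 unfolding prob_N_pos[OF assms] using exp_ge_add_one_self[of "- measure M A"] by linarith

lemma AE_N_null: assumes "A \<in> null_sets M" shows "AE w in P. emeasure w A = 0"
proof -
 have A: "A \<in> fmeasurable M" using assms by (auto simp: fmeasurable_def)
 have "prob {w\<in>space P. emeasure w A \<noteq> 0} = 0" unfolding prob_N_pos[OF A] using measure_eq_0_null_sets[OF assms] by simp
 then have "{w\<in>space P. emeasure w A \<noteq> 0} \<in> null_sets P" using A by (auto simp: null_sets_def emeasure_eq_measure)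
 then show ?thesis by (rule AE_I') auto
qed

text \<open>The pieces come from the partition in the definition of the Poisson measure, which is
  the source of sigma-finiteness in this locale.\<close>

lemma decompose_fmeasurable:
 assumes "A \<in> sets M"
 shows "\<exists>B::nat \<Rightarrow> 'a set. A = (\<Union>i. B i) \<and> disjoint_family B \<and> range B \<subseteq> {B\<in>sets M. B \<subseteq> A} \<inter> fmeasurable M"
proof -
 obtain X :: "nat \<Rightarrow> 'a set" where X: "range X \<subseteq> fmeasurable M" "disjoint_family X" "(\<Union>i. X i) = space M" by (rule partition)
 show ?thesis proof (intro exI[of _ "\<lambda>i. A \<inter> X i"] conjI)
  show "A = (\<Union>i. A \<inter> X i)" using X sub_space[OF assms] by auto
  show "disjoint_family (\<lambda>i. A \<inter> X i)" using X by (auto simp: disjoint_family_on_def)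
  show "range (\<lambda>i. A \<inter> X i) \<subseteq> {B\<in>sets M. B \<subseteq> A} \<inter> fmeasurable M" proof
   fix B assume "B \<in> range (\<lambda>i. A \<inter> X i)"
   then obtain i where i: "B = A \<inter> X i" by blast
   have Xi: "X i \<in> fmeasurable M" using X(1) by blast
   then have B: "B \<in> sets M" using i assms by auto
   then have "B \<in> fmeasurable M" using i by (intro fmeasurableI2[OF Xi]) auto
   then show "B \<in> {B\<in>sets M. B \<subseteq> A} \<inter> fmeasurable M" using i B by auto
  qed
 qed
qed

text \<open>\<open>cyl M (below A)\<close> is the field of what the points in \<open>A\<close> do;
  disjoint sets give independent fields.\<close>

abbreviation below :: "'a set \<Rightarrow> 'a set set" where "below A \<equiv> {B\<in>sets M. B \<subseteq> A}"

lemma fincyl_sub: "RR \<subseteq> sets M \<Longrightarrow> fincyl M RR \<subseteq> sets P" unfolding fincyl_def using cyl_sub by blast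

lemma cyl_below: "cyl M (below A) \<subseteq> sigma_sets (config M) (fincyl M (below A))"
proof (rule cyl_subset_sigma_fincyl)
 fix B assume B: "B \<in> below A"
 then have "B \<in> sets M" by simp
 from decompose_fmeasurable[OF this] obtain C :: "nat \<Rightarrow> 'a set" where
  C: "B = (\<Union>i. C i) \<and> disjoint_family C \<and> range C \<subseteq> below B \<inter> fmeasurable M" by (rule exE)
 have "below B \<subseteq> below A" using B by auto
 then show "\<exists>Ba::nat \<Rightarrow> 'a set. B = (\<Union>i. Ba i) \<and> disjoint_family Ba \<and> range Ba \<subseteq> below A \<inter> fmeasurable M" using C by (intro exI[of _ C]) auto
qed auto

text \<open>For finitely many finite families, the nonempty atoms of all of them together are
  pairwise disjoint, so their counts are independent, and grouping the counts gives independent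
  fields. \<open>fincyl\<close> is intersection-stable and generating, which extends this to all of
  \<open>cyl M (below (A i))\<close>.\<close>

lemma indep_cyl:
 assumes disj: "disjoint_family_on A I"
 shows "indep_sets (\<lambda>i. cyl M (below (A i))) I"
proof -
 have fin: "indep_sets (\<lambda>i. cyl M (BB i)) J"
  if J: "finite J" "J \<subseteq> I" and B: "\<And>i. i \<in> J \<Longrightarrow> finite (BB i) \<and> BB i \<subseteq> below (A i) \<inter> fmeasurable M" for J BB
 proof -
  define CC where "CC i = atoms (BB i) - {{}}" for i
  have sub: "C \<subseteq> A i" if "i \<in> J" "C \<in> CC i" for i C using that B[of i] atoms_le[of C "BB i"] by (fastforce simp: CC_def)
  have CC: "C \<inter> D = {}" if "i \<in> J" "j \<in> J" "C \<in> CC i" "D \<in> CC j" "C \<noteq> D" for i j C D proof (cases "i = j")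
   case True then show ?thesis using that disjoint_atoms[of "BB i"] by (auto simp: CC_def disjoint_def)
  next
   case False then show ?thesis using that sub[of i C] sub[of j D] disjoint_family_onD[OF disj, of i j] J by blast
  qed
  have fm: "C \<in> fmeasurable M" if "i \<in> J" "C \<in> CC i" for i C using B[OF that(1)] atoms_fmeasurable[of "BB i" M] that by (auto simp: CC_def)
  have "indep_vars (\<lambda>_. borel) (\<lambda>C w. emeasure w C) (\<Union>i\<in>J. CC i)" proof (rule disj_indep)
   show "finite (\<Union>i\<in>J. CC i)" using J B by (auto simp: CC_def intro!: finite_atoms)
   show "disjoint_family_on (\<lambda>C. C) (\<Union>i\<in>J. CC i)" using CC by (auto simp: disjoint_family_on_def)
  qed (use fm in auto)
  then have "indep_sets (\<lambda>C. {(cnt C) -` U \<inter> space P |U. U \<in> sets borel}) (\<Union>i\<in>J. CC i)" by (simp add: indep_vars_def2)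
  then have "indep_sets (\<lambda>i. sigma_sets (space P) (\<Union>C\<in>CC i. {(cnt C) -` U \<inter> space P |U. U \<in> sets borel})) J" proof (rule indep_sets_collect_sigma)
   fix i j show "Int_stable {(cnt i) -` U \<inter> space P |U. U \<in> sets borel}"
   proof (rule Int_stableI)
    fix a b assume "a \<in> {(cnt i) -` U \<inter> space P |U. U \<in> sets borel}" "b \<in> {(cnt i) -` U \<inter> space P |U. U \<in> sets borel}"
    then obtain U V where "U \<in> sets borel" "V \<in> sets borel" "a = (cnt i) -` U \<inter> space P" "b = (cnt i) -` V \<inter> space P"
     by auto
    then show "a \<inter> b \<in> {(cnt i) -` U \<inter> space P |U. U \<in> sets borel}" by (auto intro!: exI[of _ "U \<inter> V"])
   qed
  next
   show "disjoint_family_on CC J" proof (unfold disjoint_family_on_def, intro ballI impI equals0I)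
    fix i j C assume ij: "i \<in> J" "j \<in> J" "i \<noteq> j" and C: "C \<in> CC i \<inter> CC j"
    then have "C \<subseteq> A i \<inter> A j" using sub by blast
    also have "\<dots> = {}" using ij J disj by (auto simp: disjoint_family_on_def)
    finally show False using C by (auto simp: CC_def)
   qed
  qed
  also have "(\<lambda>i. sigma_sets (space P) (\<Union>C\<in>CC i. {(cnt C) -` U \<inter> space P |U. U \<in> sets borel})) = (\<lambda>i. cyl M (CC i))"
   unfolding cyl_def cyl_gen_def space_P by (intro ext arg_cong2[where f=sigma_sets]) auto
  finally show ?thesis proof (rule indep_sets_mono_sets)
   fix i assume "i \<in> J"
   then show "cyl M (BB i) \<subseteq> cyl M (CC i)" using B[of i] unfolding CC_def by (intro cyl_atoms) auto
  qed
 qed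
 have "indep_sets (\<lambda>i. fincyl M (below (A i))) I" proof (rule indep_setsI)
  fix i show "fincyl M (below (A i)) \<subseteq> events" by (rule fincyl_sub) auto
 next
  fix E J assume J: "J \<noteq> {}" "J \<subseteq> I" "finite J" and E: "\<forall>j\<in>J. E j \<in> fincyl M (below (A j))"
  have "\<forall>j\<in>J. \<exists>BB. finite BB \<and> BB \<subseteq> below (A j) \<inter> fmeasurable M \<and> E j \<in> cyl M BB" proof
   fix j assume "j \<in> J"
   then have "E j \<in> fincyl M (below (A j))" using E by blast
   then obtain BB where "finite BB" "BB \<subseteq> below (A j) \<inter> fmeasurable M" "E j \<in> cyl M BB" by (rule fincylE)
   then show "\<exists>BB. finite BB \<and> BB \<subseteq> below (A j) \<inter> fmeasurable M \<and> E j \<in> cyl M BB" by blast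
  qed
  from bchoice[OF this] obtain BB where B': "\<forall>j\<in>J. finite (BB j) \<and> BB j \<subseteq> below (A j) \<inter> fmeasurable M \<and> E j \<in> cyl M (BB j)" by blast
  have B: "j \<in> J \<Longrightarrow> finite (BB j) \<and> BB j \<subseteq> below (A j) \<inter> fmeasurable M" "j \<in> J \<Longrightarrow> E j \<in> cyl M (BB j)" for j using B' by blast+
  show "prob (\<Inter>j\<in>J. E j) = (\<Prod>j\<in>J. prob (E j))" using J B by (intro indep_setsD[OF fin[OF J(3,2) B(1)]]) auto
 qed
 then have "indep_sets (\<lambda>i. sigma_sets (space P) (fincyl M (below (A i)))) I" proof (rule indep_sets_sigma)
  fix i show "Int_stable (fincyl M (below (A i)))"
  proof (rule Int_stableI)
   fix E F assume "E \<in> fincyl M (below (A i))" "F \<in> fincyl M (below (A i))"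
   then show "E \<inter> F \<in> fincyl M (below (A i))" using algebra_fincyl[of M "below (A i)"] unfolding algebra_iff_Int by blast
  qed
 qed
 then show ?thesis proof (rule indep_sets_mono_sets)
  fix i
  show "cyl M (below (A i)) \<subseteq> sigma_sets (space P) (fincyl M (below (A i)))" unfolding space_P by (rule cyl_below)
 qed
qed

lemma cyl_below_events: "E \<in> cyl M (below A) \<Longrightarrow> E \<in> events" using cyl_sub[of "below A"] by auto

lemma indep_two:
 assumes "A \<inter> B = {}" "E \<in> cyl M (below A)" "F \<in> cyl M (below B)"
 shows "prob (E \<inter> F) = prob E * prob F"
proof -
 have "indep_sets (\<lambda>i. cyl M (below (case_bool A B i))) UNIV"
  using assms(1) by (intro indep_cyl) (auto simp: disjoint_family_on_def split: bool.splits)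
 then have "prob (\<Inter>i\<in>UNIV. case_bool E F i) = (\<Prod>i\<in>UNIV. prob (case_bool E F i))" by (rule indep_setsD) (use assms in \<open>auto split: bool.splits\<close>)
 then show ?thesis by (simp add: UNIV_bool Int_commute)
qed

text \<open>Without points in \<open>D\<close>, the sets \<open>B\<close> and \<open>B - D\<close>
  have the same count; so \<open>B - D\<close> is substituted for \<open>B\<close> in the
  generators, and induction follows the construction of the field.\<close>

lemma cyl_local:
 assumes D: "D \<in> sets M" and E: "E \<in> cyl M (below A)"
 shows "\<exists>E'\<in>cyl M (below (A - D)). \<forall>w\<in>config M. emeasure w D = 0 \<longrightarrow> (w \<in> E \<longleftrightarrow> w \<in> E')" using E unfolding cyl_def[of M "below A"]
proof (induction rule: sigma_sets.induct)
 case (Basic E)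
 then obtain B U where B: "B \<in> below A" "U \<in> sets borel" "E = (cnt B) -` U \<inter> config M" by (auto simp: cyl_gen_def)
 show ?case proof (intro bexI ballI impI)
  show "{w. sets w = sets M \<and> emeasure w (B - D) \<in> U} \<in> cyl M (below (A - D))" using B D by (intro cyl_basic) auto
  fix w assume w: "w \<in> config M" "emeasure w D = 0"
  then have "emeasure w (B - D) = emeasure w B" using B D by (intro emeasure_Diff_null_set) auto
  then show "w \<in> E \<longleftrightarrow> w \<in> {w. sets w = sets M \<and> emeasure w (B - D) \<in> U}" using w B by auto
 qed
next
 case Empty
 then show ?case by (intro bexI[of _ "{}"]) (auto simp: cyl_def intro: sigma_sets.Empty)
next
 case (Compl E)
 then obtain E' where E': "E' \<in> cyl M (below (A - D))" "\<forall>w\<in>config M. emeasure w D = 0 \<longrightarrow> (w \<in> E \<longleftrightarrow> w \<in> E')" by blast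
 then show ?case by (intro bexI[of _ "config M - E'"]) (auto simp: cyl_def intro: sigma_sets.Compl)
next
 case (Union E)
 then have "\<forall>i. \<exists>E'. E' \<in> cyl M (below (A - D)) \<and> (\<forall>w\<in>config M. emeasure w D = 0 \<longrightarrow> (w \<in> E i \<longleftrightarrow> w \<in> E'))" by blast
 from choice[OF this] obtain E' where E': "\<forall>i. E' i \<in> cyl M (below (A - D)) \<and> (\<forall>w\<in>config M. emeasure w D = 0 \<longrightarrow> (w \<in> E i \<longleftrightarrow> w \<in> E' i))" by blast
 then show ?case by (intro bexI[of _ "\<Union>i. E' i"]) (auto simp: cyl_def intro: sigma_sets.Union)
qed

lemma prob_close:
 assumes "E \<in> events" "F \<in> events" "Z \<in> events" "sym_diff E F \<subseteq> Z"
 shows "\<bar>prob E - prob F\<bar> \<le> prob Z"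
proof -
 have "prob E \<le> prob (F \<union> Z)" "prob F \<le> prob (E \<union> Z)" using assms by (auto intro!: finite_measure_mono)
 moreover have "prob (F \<union> Z) \<le> prob F + prob Z" "prob (E \<union> Z) \<le> prob E + prob Z" using assms by (auto intro!: measure_Un_le)
 ultimately show ?thesis by linarith
qed

text \<open>Unless a point falls in \<open>A \<inter> B\<close>, which has probability at most the
  measure of that set, \<open>E\<close> coincides with an event \<open>E'\<close> that sees only
  \<open>A - B\<close> and is independent of \<open>F\<close>. The price is paid twice, for
  \<open>E \<inter> F\<close> and for \<open>E\<close>.\<close>

lemma quasi_indep:
 assumes A: "A \<in> sets M" and B: "B \<in> sets M" and fin: "A \<inter> B \<in> fmeasurable M" and E: "E \<in> cyl M (below A)" and F: "F \<in> cyl M (below B)"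
 shows "\<bar>prob (E \<inter> F) - prob E * prob F\<bar> \<le> 2 * measure M (A \<inter> B)"
proof -
 let ?Z = "{w\<in>space P. emeasure w (A \<inter> B) \<noteq> 0}"
 obtain E' where E': "E' \<in> cyl M (below (A - A \<inter> B))"
  "\<forall>w\<in>config M. emeasure w (A \<inter> B) = 0 \<longrightarrow> (w \<in> E \<longleftrightarrow> w \<in> E')" using cyl_local[of "A \<inter> B" E A] A B E by auto
 note ev [simp] = cyl_below_events[OF E] cyl_below_events[OF F] cyl_below_events[OF E'(1)]
 have Z [simp]: "?Z \<in> events" using A B by auto
 have 1: "sym_diff E E' \<subseteq> ?Z" using E'(2) ev[THEN sub_space] by (auto simp: space_P)
 have 2: "\<bar>prob E - prob E'\<bar> \<le> prob ?Z" by (intro prob_close 1) auto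
 have 3: "\<bar>prob (E \<inter> F) - prob (E' \<inter> F)\<bar> \<le> prob ?Z" using 1 by (intro prob_close) auto
 have 4: "prob (E' \<inter> F) = prob E' * prob F" by (rule indep_two[OF _ E'(1) F]) auto
 have "\<bar>prob E' * prob F - prob E * prob F\<bar> = \<bar>prob E - prob E'\<bar> * prob F"
  by (simp add: abs_mult[symmetric] left_diff_distrib[symmetric] abs_minus_commute) (metis abs_minus_commute abs_mult abs_of_nonneg measure_nonneg)
 also have "\<dots> \<le> prob ?Z * 1" by (intro mult_mono 2) auto
 finally have "\<bar>prob (E \<inter> F) - prob E * prob F\<bar> \<le> 2 * prob ?Z" using 3 4 by linarith
 then show ?thesis using prob_N_pos_le[OF fin] by linarith
qed

lemma approx_fincyl:
 assumes "E \<in> sets P" "e > 0"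
 shows "\<exists>E'\<in>fincyl M (sets M). prob (sym_diff E E') < e"
proof -
 have "sets P \<subseteq> sigma_sets (config M) (fincyl M (sets M))" unfolding sets_P proof (rule cyl_subset_sigma_fincyl)
  fix A assume "A \<in> sets M"
  from decompose_fmeasurable[OF this]
  show "\<exists>B::nat \<Rightarrow> 'a set. A = (\<Union>i. B i) \<and> disjoint_family B \<and> range B \<subseteq> sets M \<inter> fmeasurable M" by blast
 qed simp
 also have "\<dots> \<subseteq> approximable P (fincyl M (sets M))" using approximable_sigma_sets[of P "fincyl M (sets M)" "fincyl M (sets M)"]
  by (simp add: space_P algebra_fincyl fincyl_sub approximable_superset finite_measure_axioms)
 finally show ?thesis using assms unfolding approximable_def by blast
qed

lemma fincyl_below:
 assumes "E \<in> fincyl M (sets M)" shows "\<exists>Y\<in>fmeasurable M. E \<in> cyl M (below Y)"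
proof -
 obtain BB where B: "finite BB" "BB \<subseteq> sets M \<inter> fmeasurable M" "E \<in> cyl M BB" using assms by (rule fincylE)
 have "\<Union>BB \<in> fmeasurable M" using B(1,2) by (intro fmeasurable.finite_Union) auto
 moreover have "cyl M BB \<subseteq> cyl M (below (\<Union>BB))" using B by (intro cyl_mono) auto
 ultimately show ?thesis using B(3) by blast
qed

end

section \<open>Suspensions\<close>

locale suspension = aut M T + poisson M P for M :: "'a measure" and T :: "'a \<Rightarrow> 'a" and P :: "'a measure measure"
begin

abbreviation t :: "int \<Rightarrow> 'a measure \<Rightarrow> 'a measure" where "t n \<equiv> suspension_map M (Z n)"

lemma Z_meas_conf: "w \<in> config M \<Longrightarrow> Z n \<in> measurable w M" using Z_meas[of n] measurable_cong_sets[of w M M M] by auto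

lemma t_emeasure: assumes "w \<in> config M" "A \<in> sets M" shows "emeasure (t n w) A = emeasure w (pre n A)"
 using assms sets_eq_imp_space_eq[of w M] by (simp add: suspension_map_def emeasure_distr[OF Z_meas_conf] pre_def)

lemma t_conf: "t n w \<in> config M" by (simp add: suspension_map_def)

lemma t_add: assumes "w \<in> config M" shows "t m (t n w) = t (m + n) w"
proof (rule measure_eqI)
 show "sets (t m (t n w)) = sets (t (m + n) w)" by (simp add: suspension_map_def)
 fix A assume "A \<in> sets (t m (t n w))"
 then have A: "A \<in> sets M" by (simp add: suspension_map_def)
 show "emeasure (t m (t n w)) A = emeasure (t (m + n) w) A" using A assms t_conf by (simp add: t_emeasure pre_sets pre_pre add.commute)
qed

lemma t_0: assumes "w \<in> config M" shows "t 0 w = w"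
proof (rule measure_eqI)
 show "sets (t 0 w) = sets w" using assms by (simp add: suspension_map_def)
 fix A assume "A \<in> sets (t 0 w)"
 then have A: "A \<in> sets M" by (simp add: suspension_map_def)
 then show "emeasure (t 0 w) A = emeasure w A" using assms by (simp add: t_emeasure pre_0 sub_space)
qed

lemma t_vimage_cyl:
 assumes "AA \<subseteq> sets M" "E \<in> cyl M AA"
 shows "t n -` E \<inter> config M \<in> cyl M (pre n ` AA)" using assms(2) unfolding cyl_def[of M AA]
proof (induction rule: sigma_sets.induct)
 case (Basic E)
 then obtain A U where A: "A \<in> AA" "U \<in> sets borel" "E = (cnt A) -` U \<inter> config M" by (auto simp: cyl_gen_def)
 have "t n -` E \<inter> config M = {w. sets w = sets M \<and> emeasure w (pre n A) \<in> U}" using A assms(1) t_conf t_emeasure by auto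
 also have "\<dots> \<in> cyl M (pre n ` AA)" using A by (intro cyl_basic) auto
 finally show ?case .
next
 case Empty
 then show ?case by (auto simp: cyl_def intro: sigma_sets.Empty)
next
 case (Compl E)
 have "t n -` (config M - E) \<inter> config M = config M - (t n -` E \<inter> config M)" using t_conf by auto
 then show ?case using Compl by (simp add: cyl_def sigma_sets.Compl)
next
 case (Union E)
 have *: "t n -` (\<Union>i. E i) \<inter> config M = (\<Union>i. t n -` E i \<inter> config M)" by auto
 show ?case unfolding * cyl_def by (rule sigma_sets.Union) (use Union in \<open>simp add: cyl_def\<close>)
qed

lemma t_meas [measurable]: "t n \<in> measurable P P"
proof (rule measurableI)
 fix E assume "E \<in> sets P"
 then have "t n -` E \<inter> config M \<in> cyl M (pre n ` sets M)" unfolding sets_P by (intro t_vimage_cyl) auto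
 also have "\<dots> \<subseteq> sets P" by (rule cyl_sub) (auto intro: pre_sets)
 finally show "t n -` E \<inter> space P \<in> sets P" by (simp add: space_P)
qed (use t_conf in \<open>auto simp: space_P\<close>)

text \<open>An event of this field is a condition on the joint vector of counts, so its probability
  is a matter of the joint law of that vector alone.\<close>

lemma cyl_finite_vimage:
 assumes "CC \<subseteq> sets M"
 shows "cyl M CC \<subseteq> (\<lambda>V. (\<lambda>w. \<lambda>C\<in>CC. emeasure w C) -` V \<inter> config M) ` sets (\<Pi>\<^sub>M C\<in>CC. borel)"
proof -
 let ?X = "\<lambda>w. \<lambda>C\<in>CC. emeasure w C"
 let ?V = "vimage_algebra (config M) ?X (\<Pi>\<^sub>M C\<in>CC. borel)"
 have sV: "sets ?V = (\<lambda>V. ?X -` V \<inter> config M) ` sets (\<Pi>\<^sub>M C\<in>CC. borel)" by (subst sets_vimage_algebra2) (auto simp: space_PiM)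
 show ?thesis unfolding sV[symmetric] proof (rule cyl_leI[OF _ _ refl])
  show "sigma_algebra (config M) (sets ?V)" using sets.sigma_algebra_axioms[of ?V] by simp
  fix C assume C: "C \<in> CC"
  have X: "?X \<in> measurable ?V (\<Pi>\<^sub>M C\<in>CC. borel)" by (rule measurable_vimage_algebra1) (auto simp: space_PiM)
  have "(\<lambda>w. ?X w C) \<in> borel_measurable ?V" using measurable_compose[OF X measurable_component_singleton[OF C]] by simp
  then show "(cnt C) \<in> borel_measurable ?V" using C by simp
 qed simp
qed

text \<open>The joint law of the counts of disjoint sets is a product of Poisson laws, with rates
  that \<open>pre n\<close> does not change. So the two measures agree on \<open>fincyl\<close>,
  which is intersection-stable and generates.\<close>

lemma t_distr: "distr P P (t n) = P"
proof (rule measure_eqI_generator_eq[of "fincyl M (sets M)" "config M" _ _ "\<lambda>_. config M", symmetric])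
 show "Int_stable (fincyl M (sets M))" using algebra_fincyl[of M "sets M"] unfolding algebra_iff_Int Int_stable_def by blast
 show "fincyl M (sets M) \<subseteq> Pow (config M)" using algebra_fincyl[of M "sets M"] unfolding algebra_iff_Un by blast
 show sP: "sets P = sigma_sets (config M) (fincyl M (sets M))" proof
  show "sets P \<subseteq> sigma_sets (config M) (fincyl M (sets M))" unfolding sets_P proof (rule cyl_subset_sigma_fincyl)
   fix A assume "A \<in> sets M"
   from decompose_fmeasurable[OF this]
   show "\<exists>B::nat \<Rightarrow> 'a set. A = (\<Union>i. B i) \<and> disjoint_family B \<and> range B \<subseteq> sets M \<inter> fmeasurable M" by blast
  qed simp
  show "sigma_sets (config M) (fincyl M (sets M)) \<subseteq> sets P" using sets.sigma_sets_subset[OF fincyl_sub[of "sets M"]] by (simp add: space_P)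
 qed
 then show "sets (distr P P (t n)) = sigma_sets (config M) (fincyl M (sets M))" by simp
 have "algebra (config M) (fincyl M (sets M))" by (rule algebra_fincyl)
 then show "range (\<lambda>_. config M) \<subseteq> fincyl M (sets M)" using algebra.top by blast
 show "(\<Union>i::nat. config M) = config M" by simp
 show "emeasure P (config M) \<noteq> \<infinity>" by simp
next
 fix E assume "E \<in> fincyl M (sets M)"
 then obtain BB where B: "finite BB" "BB \<subseteq> sets M \<inter> fmeasurable M" "E \<in> cyl M BB" by (rule fincylE)
 \<comment> \<open>The empty set is added so that the product over \<open>CC\<close> has a nonempty
   index set; the family stays disjoint and of finite measure.\<close>
 define CC where "CC = insert {} (atoms BB)"
 have "cyl M BB \<subseteq> cyl M (atoms BB - {{}})" using B by (intro cyl_atoms) auto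
 also have "\<dots> \<subseteq> cyl M CC" unfolding CC_def by (rule cyl_mono) auto
 finally have EC: "E \<in> cyl M CC" using B by auto
 have C: "finite CC" "CC \<subseteq> fmeasurable M" "disjoint CC" "CC \<noteq> {}" using B finite_atoms[of BB] atoms_fmeasurable[of BB M] disjoint_atoms[of BB]
  by (auto simp: CC_def disjoint_def)
 then have Cs: "CC \<subseteq> sets M" by auto
 let ?X = "\<lambda>w. \<lambda>C\<in>CC. emeasure w C" and ?Y = "\<lambda>w. \<lambda>C\<in>CC. emeasure w (pre n C)"
 obtain V where V: "V \<in> sets (\<Pi>\<^sub>M C\<in>CC. borel)" "E = ?X -` V \<inter> config M" using cyl_finite_vimage[OF Cs] EC by blast
 have iX: "indep_vars (\<lambda>_. borel) (\<lambda>C w. emeasure w C) CC" using C by (intro disj_indep) (auto simp: disjoint_family_on_def disjoint_def)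
 have iY: "indep_vars (\<lambda>_. borel) (\<lambda>C w. emeasure w (pre n C)) CC"
  using C pre_fmeasurable by (intro disj_indep) (auto simp: disjoint_family_on_def disjoint_def pre_def)
 have mX: "\<And>C. C \<in> CC \<Longrightarrow> (cnt C) \<in> borel_measurable P" using Cs by auto
 have mY: "\<And>C. C \<in> CC \<Longrightarrow> (cnt (pre n C)) \<in> borel_measurable P" using Cs by auto
 have "(\<Pi>\<^sub>M C\<in>CC. distr P borel (cnt C)) = (\<Pi>\<^sub>M C\<in>CC. distr P borel (cnt (pre n C)))" proof (rule PiM_cong)
  fix C assume "C \<in> CC"
  then have "C \<in> fmeasurable M" using C by auto
  then show "distr P borel (cnt C) = distr P borel (cnt (pre n C))"
   by (subst (1 2) distr_N) (auto simp: pre_fmeasurable pre_measure)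
 qed simp
 then have eq: "distr P (\<Pi>\<^sub>M C\<in>CC. borel) ?X = distr P (\<Pi>\<^sub>M C\<in>CC. borel) ?Y"
  using indep_vars_iff_distr_eq_PiM'[THEN iffD1, OF C(4) mX iX] indep_vars_iff_distr_eq_PiM'[THEN iffD1, OF C(4) mY iY] by metis
 have mX': "?X \<in> measurable P (\<Pi>\<^sub>M C\<in>CC. borel)" and mY': "?Y \<in> measurable P (\<Pi>\<^sub>M C\<in>CC. borel)" using mX mY by (auto intro: measurable_restrict)
 have "t n -` E \<inter> space P = ?Y -` V \<inter> space P" proof -
  have "?X (t n w) = ?Y w" if "w \<in> config M" for w using Cs that by (intro restrict_ext) (auto simp: t_emeasure)
  then show ?thesis using t_conf unfolding V(2) space_P by auto
 qed
 moreover have "E \<in> sets P" using EC cyl_sub[OF Cs] by auto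
 ultimately have "emeasure (distr P P (t n)) E = emeasure (distr P (\<Pi>\<^sub>M C\<in>CC. borel) ?Y) V" using V mY' by (simp add: emeasure_distr)
 also have "\<dots> = emeasure P E" unfolding eq[symmetric] using V mX' by (simp add: emeasure_distr space_P)
 finally show "emeasure P E = emeasure (distr P P (t n)) E" ..
qed

lemma t_inverse: assumes "w \<in> config M" shows "t (- n) (t n w) = w" "t n (t (- n) w) = w" using t_add[OF assms] t_0[OF assms] by auto

lemma bij_t: "bij_betw (t n) (config M) (config M)" by (rule bij_betw_byWitness[where f'="t (- n)"]) (use t_inverse t_conf in auto)

lemma the_inv_t: assumes "w \<in> config M" shows "the_inv_into (config M) (t n) w = t (- n) w"
 using bij_t[of n] t_inverse[OF assms] t_conf by (intro the_inv_into_f_eq) (auto simp: bij_betw_def)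

lemma aut_P: "automorphism P (t n)" unfolding automorphism_def
proof (intro conjI)
 show "bij_betw (t n) (space P) (space P)" unfolding space_P by (rule bij_t)
 show "the_inv_into (space P) (t n) \<in> measurable P P"
  using measurable_cong[of P "the_inv_into (space P) (t n)" "t (- n)" P] the_inv_t t_meas by (simp add: space_P)
qed (simp_all add: t_distr)

end

section \<open>The suspension and its completion as automorphisms\<close>

lemma completion_measurable:
 assumes f: "f \<in> measurable P P" and d: "distr P P f = P"
 shows "f \<in> measurable (completion P) (completion P)" "distr (completion P) (completion P) f = completion P"
proof -
 have d': "distr (completion P) P f = P" using d by (simp add: distr_completion[OF f])
 have f': "f \<in> measurable (completion P) P" by (rule measurable_completion[OF f])
 show "f \<in> measurable (completion P) (completion P)" by (rule completion.measurable_completion2[OF f']) (simp add: d')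
 show "distr (completion P) (completion P) f = completion P" using completion.completion_distr_eq[OF f'] by (simp add: d')
qed

lemma automorphism_completion:
 assumes "automorphism P f" shows "automorphism (completion P) f"
proof -
 interpret aut P f by standard fact
 show ?thesis unfolding automorphism_def using bij_T completion_measurable[OF meas_T distr_T] completion_measurable[OF meas_Ti distr_Ti] by simp
qed

lemma sets_sym_diff [simp]: "A \<in> sets M \<Longrightarrow> B \<in> sets M \<Longrightarrow> sym_diff A B \<in> sets M" by auto

lemma fmeasurable_sym_diff [simp]: "A \<in> fmeasurable M \<Longrightarrow> B \<in> fmeasurable M \<Longrightarrow> sym_diff A B \<in> fmeasurable M"
 by (intro fmeasurable.Un fmeasurable_Diff) auto

lemma abs_chain:
 fixes x :: real
 shows "\<bar>y - q\<bar> \<le> d * 1 \<Longrightarrow> \<bar>x - y\<bar> \<le> m \<Longrightarrow> m \<le> s \<Longrightarrow> d \<le> s' \<Longrightarrow> \<bar>x - q\<bar> \<le> s + s'" by linarith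

lemma atMost_1: "{..1::nat} = {0, 1}" by auto

context suspension
begin

abbreviation T' :: "'a measure \<Rightarrow> 'a measure" where "T' \<equiv> suspension_map M T"
abbreviation S :: "'a measure measure" where "S \<equiv> completion P"

end

sublocale suspension \<subseteq> SP: aut P "suspension_map M T" by standard (use aut_P[of 1] in \<open>simp add: Z_1\<close>)

sublocale suspension \<subseteq> SS: aut "completion P" "suspension_map M T" by standard (rule automorphism_completion[OF SP.aut])

sublocale suspension \<subseteq> S: prob_space "completion P" by standard (simp add: emeasure_space_1)

context suspension
begin

lemma iterate_eq: assumes "w \<in> config M" shows "int_iterate P T' n w = t n w"
proof (induction n rule: int_induct[where k=0])
 case base then show ?case by (simp only: SP.Z_0 t_0[OF assms])
next
 case (step1 n)
 have "int_iterate P T' (n + 1) w = t 1 (int_iterate P T' n w)" using SP.Z_Suc[of w n] assms by (simp add: space_P Z_1)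
 then show ?case using step1 t_add[OF assms, of 1 n] by (simp add: add.commute)
next
 case (step2 n)
 have "t 1 (int_iterate P T' (n - 1) w) = int_iterate P T' n w" using SP.Z_Suc[of w "n - 1"] assms by (simp add: space_P Z_1)
 also have "\<dots> = t 1 (t (n - 1) w)" using step2 t_add[OF assms, of 1 "n - 1"] by simp
 finally show ?case using bij_t[of 1] SP.Z_in[of w "n - 1"] assms t_conf unfolding bij_betw_def space_P by (meson inj_on_def)
qed

lemma spre: "SP.pre n E = t n -` E \<inter> config M" unfolding SP.pre_def space_P using iterate_eq by auto

lemma int_iterate_completion: "int_iterate (completion P) T' = int_iterate P T'" by (intro ext) (simp add: int_iterate_def)

text \<open>The iterates know only the underlying space, so one notation \<open>SP.pre\<close>
  serves for the Poisson measure and for its completion; \<open>SS\<close> supplies the facts about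
  sets that become measurable by completion.\<close>

lemma sspre: "SS.pre n E = SP.pre n E" unfolding SS.pre_def SP.pre_def by (simp add: int_iterate_completion)

lemma spre_cyl: "AA \<subseteq> sets M \<Longrightarrow> E \<in> cyl M AA \<Longrightarrow> SP.pre n E \<in> cyl M (pre n ` AA)" unfolding spre by (rule t_vimage_cyl)

lemma spre_below: assumes "E \<in> cyl M (below Y)" shows "SP.pre n E \<in> cyl M (below (pre n Y))"
proof -
 have "SP.pre n E \<in> cyl M (pre n ` below Y)" by (rule spre_cyl[OF _ assms]) auto
 also have "\<dots> \<subseteq> cyl M (below (pre n Y))" using pre_mono pre_sets by (intro cyl_mono) blast
 finally show ?thesis .
qed

lemma spre_N: "A \<in> sets M \<Longrightarrow> SP.pre n (occ A U) = (occ (pre n A) U)"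
 unfolding spre space_P using t_conf t_emeasure by auto

lemma spre_N0: "A \<in> sets M \<Longrightarrow> SP.pre n (void A) = (void (pre n A))" using spre_N[of A n "{0}"] by simp

lemma S_approx_P:
 assumes "E \<in> sets S" obtains E0 where "E0 \<in> sets P" "sym_diff E E0 \<in> null_sets S"
proof -
 from assms obtain A N N' where A: "E = A \<union> N" "N \<subseteq> N'" "N' \<in> null_sets P" "A \<in> sets P" by (rule sets_completionE)
 have "sym_diff E A \<in> null_sets S" by (rule null_sets_completion_subset[of _ N']) (use A in \<open>auto intro: null_sets_completionI\<close>)
 then show ?thesis using that A by blast
qed

lemma S_approx_fincyl:
 assumes E: "E \<in> sets S" and e: "e > 0"
 shows "\<exists>E'\<in>fincyl M (sets M). measure S (sym_diff E E') < e"
proof -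
 obtain E0 where E0: "E0 \<in> sets P" "sym_diff E E0 \<in> null_sets S" using S_approx_P[OF E] .
 obtain E' where E': "E' \<in> fincyl M (sets M)" "prob (sym_diff E0 E') < e" using approx_fincyl[OF E0(1) e] by blast
 have E's: "E' \<in> sets P" using E'(1) fincyl_sub[of "sets M"] by auto
 have "measure S (sym_diff E E') \<le> measure S (sym_diff E E0 \<union> sym_diff E0 E')"
  using E E0 E's by (intro S.finite_measure_mono) (auto intro!: sets.Un sets.Diff)
 also have "\<dots> \<le> measure S (sym_diff E E0) + measure S (sym_diff E0 E')" using E E0 E's by (intro measure_Un_le) (auto intro!: sets.Un sets.Diff)
 also have "measure S (sym_diff E E0) = 0" using E0(2) by (rule measure_eq_0_null_sets)
 also have "measure S (sym_diff E0 E') = prob (sym_diff E0 E')" using E0 E's by (intro measure_completion) auto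
 finally have "measure S (sym_diff E E') < e" using E'(2) by linarith
 then show ?thesis using E'(1) by blast
qed

lemma S_approx_below:
 assumes E: "E \<in> sets S" and e: "e > 0"
 shows "\<exists>Y\<in>fmeasurable M. \<exists>E'\<in>cyl M (below Y). measure S (sym_diff E E') < e" using S_approx_fincyl[OF assms] fincyl_below by blast

lemma S_close:
 assumes "E \<in> sets S" "F \<in> sets S" "D \<in> sets S" "sym_diff E F \<subseteq> D"
 shows "\<bar>measure S E - measure S F\<bar> \<le> measure S D"
proof -
 have "measure S E \<le> measure S (F \<union> D)" "measure S F \<le> measure S (E \<union> D)" using assms by (auto intro!: S.finite_measure_mono)
 moreover have "measure S (F \<union> D) \<le> measure S F + measure S D" "measure S (E \<union> D) \<le> measure S E + measure S D"
  using assms by (auto intro!: measure_Un_le)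
 ultimately show ?thesis by linarith
qed

lemma spre_sets [simp]: "E \<in> sets S \<Longrightarrow> SP.pre n E \<in> sets S" using SS.pre_sets[of E n] by (simp add: sspre)

lemma spre_measure: "E \<in> sets S \<Longrightarrow> measure S (SP.pre n E) = measure S E" using SS.pre_measure[of E n] by (simp add: sspre)

section \<open>Correlation estimates, mixing and zero type\<close>

lemma below_events: "E \<in> cyl M (below Y) \<Longrightarrow> E \<in> sets S" using cyl_below_events by auto

text \<open>The events are added one at a time: those already treated live on the union of the
  earlier translates of \<open>Y\<close>, the next one on a further translate, and
  \<open>quasi_indep\<close> charges twice the overlap, which is at most the sum of the pairwise
  overlaps.\<close>

lemma multi_indep:
 fixes r :: nat and n :: "nat \<Rightarrow> int"
 assumes Y: "Y \<in> fmeasurable M" and E: "\<And>i. i \<le> r \<Longrightarrow> E i \<in> cyl M (below Y)"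
 shows "\<bar>prob (\<Inter>i\<le>r. SP.pre (n i) (E i)) - (\<Prod>i\<le>r. prob (E i))\<bar>
  \<le> (\<Sum>j\<le>r. \<Sum>i<j. 2 * measure M (Y \<inter> pre (n j - n i) Y))" using E
proof (induction r)
 case 0
 have "E 0 \<in> events" using 0 by (intro cyl_below_events) auto
 then show ?case by (simp add: SP.pre_measure)
next
 case (Suc r)
 let ?A = "\<Inter>i\<le>r. SP.pre (n i) (E i)" and ?B = "SP.pre (n (Suc r)) (E (Suc r))"
 let ?U = "\<Union>i\<le>r. pre (n i) Y" and ?V = "pre (n (Suc r)) Y"
 have Ys: "Y \<in> sets M" using Y by auto
 have Us: "?U \<in> sets M" using Ys by (auto intro!: pre_sets)
 have A: "?A \<in> cyl M (below ?U)" proof -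
  interpret sigma_algebra "config M" "cyl M (below ?U)" by (rule sigma_algebra_cyl)
  have *: "SP.pre (n i) (E i) \<in> cyl M (below ?U)" if "i \<le> r" for i proof -
   have "SP.pre (n i) (E i) \<in> cyl M (below (pre (n i) Y))" using Suc.prems that by (intro spre_below) auto
   also have "\<dots> \<subseteq> cyl M (below ?U)" using that by (intro cyl_mono) auto
   finally show ?thesis .
  qed
  show ?thesis by (rule finite_INT[OF finite_atMost _ *]) (simp_all only: atMost_iff, blast)
 qed
 have B: "?B \<in> cyl M (below ?V)" using Suc.prems by (intro spre_below) auto
 have fm: "?U \<inter> ?V \<in> fmeasurable M" by (rule fmeasurableI2[OF pre_fmeasurable[OF Y] Int_lower2 sets.Int[OF Us pre_sets[OF Ys]]])
 have 1: "\<bar>prob (?A \<inter> ?B) - prob ?A * prob ?B\<bar> \<le> 2 * measure M (?U \<inter> ?V)" by (rule quasi_indep[OF Us pre_sets[OF Ys] fm A B])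
 have "measure M (?U \<inter> ?V) = measure M (\<Union>i\<le>r. pre (n i) Y \<inter> ?V)" by (intro arg_cong[where f="measure M"]) auto
 also have "\<dots> \<le> (\<Sum>i\<le>r. measure M (pre (n i) Y \<inter> ?V))" using Ys pre_sets by (intro measure_UNION_le) auto
 also have "\<dots> = (\<Sum>i\<le>r. measure M (Y \<inter> pre (n (Suc r) - n i) Y))" using Ys by (intro sum.cong refl pre_measure2) auto
 finally have 2: "2 * measure M (?U \<inter> ?V) \<le> (\<Sum>i<Suc r. 2 * measure M (Y \<inter> pre (n (Suc r) - n i) Y))"
  by (simp add: sum_distrib_left[symmetric] lessThan_Suc_atMost)
 have Es: "E (Suc r) \<in> events" using Suc.prems by (intro cyl_below_events) auto
 have pB: "prob ?B = prob (E (Suc r))" using Es by (rule SP.pre_measure)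
 have 3: "\<bar>prob ?A - (\<Prod>i\<le>r. prob (E i))\<bar> \<le> (\<Sum>j\<le>r. \<Sum>i<j. 2 * measure M (Y \<inter> pre (n j - n i) Y))" using Suc by auto
 have "\<bar>prob ?A * prob (E (Suc r)) - (\<Prod>i\<le>r. prob (E i)) * prob (E (Suc r))\<bar> = \<bar>prob ?A - (\<Prod>i\<le>r. prob (E i))\<bar> * prob (E (Suc r))"
  by (simp add: left_diff_distrib[symmetric] abs_mult)
 also have "\<dots> \<le> \<bar>prob ?A - (\<Prod>i\<le>r. prob (E i))\<bar> * 1" by (intro mult_left_mono) auto
 finally have 4: "\<bar>prob (?A \<inter> ?B) - (\<Prod>i\<le>r. prob (E i)) * prob (E (Suc r))\<bar>
   \<le> (\<Sum>i<Suc r. 2 * measure M (Y \<inter> pre (n (Suc r) - n i) Y)) + (\<Sum>j\<le>r. \<Sum>i<j. 2 * measure M (Y \<inter> pre (n j - n i) Y))"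
  using 1[unfolded pB] 2 3 by (rule abs_chain)
 have "(\<Inter>i\<le>Suc r. SP.pre (n i) (E i)) = ?A \<inter> ?B" by (simp add: atMost_Suc Int_commute)
 then show ?case using 4 by (simp add: add.commute)
qed

text \<open>Both events are approximated by events that see one common set \<open>Y\<close>; the
  overlap of \<open>Y\<close> with its translate then controls the correlation for all
  \<open>k\<close> at once.\<close>

lemma pair_estimate:
 assumes E: "E \<in> sets S" and F: "F \<in> sets S" and e: "e > 0"
 shows "\<exists>Y\<in>fmeasurable M. \<forall>k. \<bar>measure S (E \<inter> SP.pre k F) - measure S E * measure S F\<bar> \<le> e + 2 * measure M (Y \<inter> pre k Y)"
proof -
 have e4: "e / 4 > 0" using e by simp
 from S_approx_below[OF E e4] S_approx_below[OF F e4]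
 obtain Y1 Y2 E' F' where Y1: "Y1 \<in> fmeasurable M" "E' \<in> cyl M (below Y1)" "measure S (sym_diff E E') < e / 4"
  and Y2: "Y2 \<in> fmeasurable M" "F' \<in> cyl M (below Y2)" "measure S (sym_diff F F') < e / 4" by blast
 define Y where "Y = Y1 \<union> Y2"
 have Y: "Y \<in> fmeasurable M" using Y1 Y2 by (auto simp: Y_def)
 have E': "E' \<in> cyl M (below Y)" and F': "F' \<in> cyl M (below Y)"
  using Y1(2) Y2(2) cyl_mono[of "below Y1" "below Y" M] cyl_mono[of "below Y2" "below Y" M] by (auto simp: Y_def)
 note sets = E F below_events[OF E'] below_events[OF F']
 show ?thesis proof (intro bexI[of _ Y] allI Y)
  fix k
  have "\<bar>prob (\<Inter>i\<le>1::nat. SP.pre (if i = 0 then 0 else k) (if i = 0 then E' else F')) - (\<Prod>i\<le>1::nat. prob (if i = 0 then E' else F'))\<bar>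
   \<le> (\<Sum>j\<le>1::nat. \<Sum>i<j. 2 * measure M (Y \<inter> pre ((if j = 0 then 0 else k) - (if i = 0 then 0 else k)) Y))" using E' F' Y by (intro multi_indep) auto
  moreover have "SP.pre 0 E' = E'" using cyl_below_events[OF E'] by (simp add: SP.pre_0 sub_space)
  ultimately have 1: "\<bar>prob (E' \<inter> SP.pre k F') - prob E' * prob F'\<bar> \<le> 2 * measure M (Y \<inter> pre k Y)" by (simp add: atMost_1[unfolded One_nat_def])
  have 2: "\<bar>measure S (E \<inter> SP.pre k F) - measure S (E' \<inter> SP.pre k F')\<bar> \<le> measure S (sym_diff E E' \<union> SP.pre k (sym_diff F F'))"
   using sets by (intro S_close) (auto simp: SP.pre_iff)
  have 3: "measure S (sym_diff E E' \<union> SP.pre k (sym_diff F F')) \<le> measure S (sym_diff E E') + measure S (SP.pre k (sym_diff F F'))"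
   using sets by (intro measure_Un_le) auto
  have 4: "measure S (SP.pre k (sym_diff F F')) = measure S (sym_diff F F')" using sets by (intro spre_measure) auto
  have 5: "\<bar>measure S E - measure S E'\<bar> \<le> measure S (sym_diff E E')" "\<bar>measure S F - measure S F'\<bar> \<le> measure S (sym_diff F F')"
   using sets by (auto intro!: S_close)
  have "\<bar>measure S E * measure S F - measure S E' * measure S F'\<bar> \<le> \<bar>measure S E - measure S E'\<bar> + \<bar>measure S F - measure S F'\<bar>" proof -
   have "measure S E * measure S F - measure S E' * measure S F' = (measure S E - measure S E') * measure S F + measure S E' * (measure S F - measure S F')"
    by (simp add: algebra_simps)
   also have "\<bar>\<dots>\<bar> \<le> \<bar>(measure S E - measure S E') * measure S F\<bar> + \<bar>measure S E' * (measure S F - measure S F')\<bar>" by (rule abs_triangle_ineq)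
   also have "\<dots> \<le> \<bar>measure S E - measure S E'\<bar> * 1 + 1 * \<bar>measure S F - measure S F'\<bar>" unfolding abs_mult by (intro add_mono mult_mono) auto
   finally show ?thesis by simp
  qed
  moreover have "measure S (E' \<inter> SP.pre k F') = prob (E' \<inter> SP.pre k F')" "measure S E' * measure S F' = prob E' * prob F'"
   using cyl_below_events[OF E'] cyl_below_events[OF F'] SP.pre_sets by auto
  ultimately show "\<bar>measure S (E \<inter> SP.pre k F) - measure S E * measure S F\<bar> \<le> e + 2 * measure M (Y \<inter> pre k Y)"
   using 1 2 3 4 5 Y1(3) Y2(3) by linarith
 qed
qed

lemma vimage_funpow: "(T' ^^ n) -` E \<inter> space S = SP.pre (int n) E" unfolding SP.pre_def by (simp add: SP.Z_of_nat)

lemma zero_type_iff: "zero_type M T \<longleftrightarrow> (\<forall>A\<in>fmeasurable M. (\<lambda>n. measure M (A \<inter> pre (int n) A)) \<longlonglongrightarrow> 0)"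
 unfolding zero_type_def by (auto simp: measure_Int_image)

lemma zero_type_imp_mixing_all:
 assumes "zero_type M T" shows "mixing_of_all_orders S T'" unfolding mixing_of_all_orders_def vimage_funpow
proof (intro allI impI)
 fix r :: nat and A :: "nat \<Rightarrow> 'a measure set" and e :: real
 assume A: "\<forall>i\<le>r. A i \<in> sets S" and e: "e > 0"
 \<comment> \<open>Each of the \<open>r + 1\<close> approximations is used once for the intersection
   and once for the product; each use is allowed \<open>e / 8\<close> in total.\<close>
 define d where "d = e / (8 * (real r + 1))"
 have d: "d > 0" using e by (simp add: d_def)
 have "\<forall>i\<in>{..r}. \<exists>YE. fst YE \<in> fmeasurable M \<and> snd YE \<in> cyl M (below (fst YE)) \<and> measure S (sym_diff (A i) (snd YE)) < d" proof
  fix i assume "i \<in> {..r}"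
  then obtain Y E where "Y \<in> fmeasurable M" "E \<in> cyl M (below Y)" "measure S (sym_diff (A i) E) < d" using S_approx_below[OF _ d] A by blast
  then show "\<exists>YE. fst YE \<in> fmeasurable M \<and> snd YE \<in> cyl M (below (fst YE)) \<and> measure S (sym_diff (A i) (snd YE)) < d"
   by (intro exI[of _ "(Y, E)"]) simp
 qed
 from bchoice[OF this] obtain YE where YE: "\<forall>i\<in>{..r}. fst (YE i) \<in> fmeasurable M \<and> snd (YE i) \<in> cyl M (below (fst (YE i))) \<and> measure S (sym_diff (A i) (snd (YE i))) < d" by blast
 define Y where "Y = (\<Union>i\<le>r. fst (YE i))"
 define E where "E i = snd (YE i)" for i
 have Y: "Y \<in> fmeasurable M" unfolding Y_def using YE by (intro fmeasurable.finite_UN) auto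
 have E: "E i \<in> cyl M (below Y)" "measure S (sym_diff (A i) (E i)) < d" if "i \<le> r" for i proof -
  have "snd (YE i) \<in> cyl M (below (fst (YE i)))" using YE that by auto
  also have "\<dots> \<subseteq> cyl M (below Y)" using that by (intro cyl_mono) (auto simp: Y_def)
  finally show "E i \<in> cyl M (below Y)" by (simp add: E_def)
  show "measure S (sym_diff (A i) (E i)) < d" using YE that by (auto simp: E_def)
 qed
 \<comment> \<open>There are at most \<open>(r + 1)^2\<close> pairs, each charged
   \<open>2 * h\<close>, so the defect of independence is at most \<open>e / 4\<close>.\<close>
 define h where "h = e / (8 * (real r + 1)^2)"
 have h: "h > 0" using e by (simp add: h_def)
 obtain N where N: "\<And>m. m \<ge> N \<Longrightarrow> measure M (Y \<inter> pre (int m) Y) < h" proof -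
  have "(\<lambda>n. measure M (Y \<inter> pre (int n) Y)) \<longlonglongrightarrow> 0" using assms Y by (simp add: zero_type_iff)
  then have "eventually (\<lambda>n. measure M (Y \<inter> pre (int n) Y) < h) sequentially" using h by (rule order_tendstoD)
  then show thesis using that by (auto simp: eventually_sequentially)
 qed
 show "\<exists>N. \<forall>n. (\<forall>i<r. n i + N \<le> n (Suc i)) \<longrightarrow>
   \<bar>measure S (\<Inter>i\<le>r. SP.pre (int (n i)) (A i)) - (\<Prod>i\<le>r. measure S (A i))\<bar> < e"
 proof (intro exI[of _ N] allI impI)
  fix n :: "nat \<Rightarrow> nat" assume gap: "\<forall>i<r. n i + N \<le> n (Suc i)"
  \<comment> \<open>Large gaps between neighbouring times make all pairwise differences large, so
    zero type bounds every overlap in \<open>multi_indep\<close>.\<close>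
  have gap2: "n i + N \<le> n j" if "i < j" "j \<le> r" for i j using that proof (induction j)
   case (Suc j)
   show ?case proof (cases "i = j")
    case True then show ?thesis using gap Suc.prems by auto
   next
    case False
    then have "n i + N \<le> n j" "n j + N \<le> n (Suc j)" using Suc gap by auto
    then show ?thesis by linarith
   qed
  qed simp
  have small: "measure M (Y \<inter> pre (int (n j) - int (n i)) Y) \<le> h" if "i < j" "j \<le> r" for i j proof -
   have "N \<le> n j - n i" "int (n j - n i) = int (n j) - int (n i)" using gap2[OF that] by auto
   then show ?thesis using N[of "n j - n i"] by simp
  qed
  have "\<bar>prob (\<Inter>i\<le>r. SP.pre (int (n i)) (E i)) - (\<Prod>i\<le>r. prob (E i))\<bar>
   \<le> (\<Sum>j\<le>r. \<Sum>i<j. 2 * measure M (Y \<inter> pre (int (n j) - int (n i)) Y))" using E Y by (intro multi_indep) auto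
  also have "\<dots> \<le> (\<Sum>j\<le>r. \<Sum>i<j. 2 * h)" using small by (intro sum_mono mult_left_mono) auto
  also have "\<dots> \<le> (\<Sum>j\<le>r. (real r + 1) * (2 * h))" using h by (intro sum_mono) (auto intro!: mult_right_mono)
  also have "\<dots> = (real r + 1)\<^sup>2 * (2 * h)" by (simp add: power2_eq_square algebra_simps)
  also have "\<dots> = e / 4" proof -
   have "K * (2 * (e / (8 * K))) = e / 4" if "K \<noteq> 0" for K :: real using that by (simp add: field_simps)
   then show ?thesis unfolding h_def by auto
  qed
  finally have 1: "\<bar>prob (\<Inter>i\<le>r. SP.pre (int (n i)) (E i)) - (\<Prod>i\<le>r. prob (E i))\<bar> \<le> e / 4" .
  have Es: "E i \<in> sets P" if "i \<le> r" for i using E that by (auto intro: cyl_below_events)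
  have As: "A i \<in> sets S" if "i \<le> r" for i using A that by auto
  have As': "sym_diff (A i) (E i) \<in> sets S" if "i \<le> r" for i using As Es that by auto
  let ?Z = "\<Union>i\<le>r. SP.pre (int (n i)) (sym_diff (A i) (E i))"
  have 2: "\<bar>measure S (\<Inter>i\<le>r. SP.pre (int (n i)) (A i)) - measure S (\<Inter>i\<le>r. SP.pre (int (n i)) (E i))\<bar> \<le> measure S ?Z" proof (rule S_close)
   show "(\<Inter>i\<le>r. SP.pre (int (n i)) (A i)) \<in> sets S" "(\<Inter>i\<le>r. SP.pre (int (n i)) (E i)) \<in> sets S" using As Es by (auto intro!: sets.finite_INT)
   show "?Z \<in> sets S" using As' by (intro sets.finite_UN) auto
  qed (auto simp: SP.pre_iff)
  have "measure S ?Z \<le> (\<Sum>i\<le>r. measure S (SP.pre (int (n i)) (sym_diff (A i) (E i))))" using As' by (intro measure_UNION_le) auto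
  also have "\<dots> \<le> (\<Sum>i\<le>r. d)" using As' E(2) by (intro sum_mono) (auto simp: spre_measure intro: less_imp_le)
  also have "\<dots> = e / 8" using e by (simp add: d_def field_simps)
  finally have 3: "measure S ?Z \<le> e / 8" .
  have "norm ((\<Prod>i\<le>r. measure S (A i)) - (\<Prod>i\<le>r. measure S (E i))) \<le> (\<Sum>i\<le>r. norm (measure S (A i) - measure S (E i)))" by (intro norm_prod_diff) auto
  also have "\<dots> \<le> (\<Sum>i\<le>r. d)" proof (intro sum_mono)
   fix i assume "i \<in> {..r}"
   then have "\<bar>measure S (A i) - measure S (E i)\<bar> \<le> measure S (sym_diff (A i) (E i))" using As As' Es by (intro S_close) auto
   then show "norm (measure S (A i) - measure S (E i)) \<le> d" using E(2)[of i] \<open>i \<in> {..r}\<close> by auto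
  qed
  also have "\<dots> = e / 8" using e by (simp add: d_def field_simps)
  finally have 4: "\<bar>(\<Prod>i\<le>r. measure S (A i)) - (\<Prod>i\<le>r. measure S (E i))\<bar> \<le> e / 8" by simp
  have "(\<Prod>i\<le>r. measure S (E i)) = (\<Prod>i\<le>r. prob (E i))" using Es by (intro prod.cong) auto
  moreover have "measure S (\<Inter>i\<le>r. SP.pre (int (n i)) (E i)) = prob (\<Inter>i\<le>r. SP.pre (int (n i)) (E i))"
   using Es SP.pre_sets by (intro measure_completion sets.finite_INT) auto
  ultimately show "\<bar>measure S (\<Inter>i\<le>r. SP.pre (int (n i)) (A i)) - (\<Prod>i\<le>r. measure S (A i))\<bar> < e" using 1 2 3 4 e by linarith
 qed
qed

lemma mixing_all_imp_mixing:
 assumes "mixing_of_all_orders S T'" shows "mixing S T'" unfolding mixing_def vimage_funpow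
proof (intro ballI LIMSEQ_I)
 fix A B and e :: real assume A: "A \<in> sets S" and B: "B \<in> sets S" and e: "0 < e"
 have "\<forall>i\<le>1::nat. (if i = 0 then A else B) \<in> sets S" using A B by simp
 from assms[unfolded mixing_of_all_orders_def vimage_funpow, THEN spec[of _ 1], THEN spec[of _ "\<lambda>i. if i = 0 then A else B"], THEN mp, OF this, THEN spec[of _ e], THEN mp, OF e]
 obtain N where N: "\<forall>n :: nat \<Rightarrow> nat. (\<forall>i<1. n i + N \<le> n (Suc i)) \<longrightarrow>
   \<bar>measure S (\<Inter>i\<le>1. SP.pre (int (n i)) (if i = 0 then A else B)) - (\<Prod>i\<le>1::nat. measure S (if i = 0 then A else B))\<bar> < e" by (rule exE)
 show "\<exists>N. \<forall>n\<ge>N. norm (measure S (A \<inter> SP.pre (int n) B) - measure S A * measure S B) < e" proof (intro exI[of _ N] allI impI)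
  fix n assume n: "n \<ge> N"
  have prem: "\<forall>i<1. (if i = 0 then 0 else n) + N \<le> (if Suc i = 0 then 0 else n)" using n by simp
  have 0: "SP.pre 0 A = A" using sub_space[OF A] by (intro SP.pre_0) simp
  have 1: "(\<Inter>i\<le>(1::nat). SP.pre (int (if i = 0 then 0 else n)) (if i = 0 then A else B)) = A \<inter> SP.pre (int n) B" unfolding atMost_1 using 0 by simp
  have 2: "(\<Prod>i\<le>(1::nat). measure S (if i = 0 then A else B)) = measure S A * measure S B" unfolding atMost_1 by simp
  show "norm (measure S (A \<inter> SP.pre (int n) B) - measure S A * measure S B) < e" using N[THEN spec, THEN mp, OF prem] unfolding 1 2 by simp
 qed
qed

lemma N0_Un: assumes "A \<in> sets M" "B \<in> sets M"
 shows "(void (A \<union> B)) = (void A) \<inter> (void B)"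
proof -
 have "emeasure w (A \<union> B) = 0 \<longleftrightarrow> emeasure w A = 0 \<and> emeasure w B = 0" if "w \<in> space P" for w proof -
  have AB: "A \<in> sets w" "B \<in> sets w" using assms that by (auto simp: space_P)
  have "emeasure w A \<le> emeasure w (A \<union> B)" "emeasure w B \<le> emeasure w (A \<union> B)" using AB by (auto intro!: emeasure_mono)
  moreover have "emeasure w (A \<union> B) \<le> emeasure w A + emeasure w B" using AB by (rule emeasure_subadditive)
  ultimately show ?thesis by auto
 qed
 then show ?thesis by auto
qed

text \<open>The void event of \<open>A\<close> and its translate meet in the void event of the union
  of \<open>A\<close> and \<open>pre n A\<close>. Their correlation is therefore
  \<open>exp (- 2 * a + b)\<close>, with \<open>a\<close> the measure of \<open>A\<close> and
  \<open>b\<close> that of the overlap, and its limit determines the limit of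
  \<open>b\<close>.\<close>

lemma mixing_imp_zero_type:
 assumes "mixing S T'" shows "zero_type M T" unfolding zero_type_iff
proof
 fix A assume A: "A \<in> fmeasurable M"
 then have As: "A \<in> sets M" by auto
 let ?E = "void A" and ?a = "measure M A"
 have Es: "?E \<in> sets S" using As by simp
 have "(\<lambda>n. measure S (?E \<inter> SP.pre (int n) ?E)) \<longlonglongrightarrow> measure S ?E * measure S ?E"
  by (rule bspec[OF bspec[OF assms[unfolded mixing_def vimage_funpow] Es] Es])
 moreover have "measure S ?E = exp (- ?a)" using prob_N0[OF A] As by simp
 moreover have "measure S (?E \<inter> SP.pre (int n) ?E) = exp (- 2 * ?a + measure M (A \<inter> pre (int n) A))" for n proof -
  have "?E \<inter> SP.pre (int n) ?E = (void (A \<union> pre (int n) A))" by (simp only: spre_N0[OF As] N0_Un[OF As pre_sets[OF As]])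
  moreover have "(void (A \<union> pre (int n) A)) \<in> sets P" using As pre_sets[OF As] by (intro N_eq_sets sets.Un)
  ultimately have "measure S (?E \<inter> SP.pre (int n) ?E) = prob (void (A \<union> pre (int n) A))" by (simp only: measure_completion)
  also have "\<dots> = exp (- measure M (A \<union> pre (int n) A))" using A pre_fmeasurable[OF A] by (intro prob_N0) auto
  also have "measure M (A \<union> pre (int n) A) = ?a + measure M (pre (int n) A) - measure M (A \<inter> pre (int n) A)"
   using measure_Un3[OF A pre_fmeasurable[OF A]] by simp
  finally show ?thesis using As by (simp add: pre_measure)
 qed
 ultimately have "(\<lambda>n. exp (- 2 * ?a + measure M (A \<inter> pre (int n) A))) \<longlonglongrightarrow> exp (- 2 * ?a)" by (simp add: exp_add[symmetric])
 then have "(\<lambda>n. ln (exp (- 2 * ?a + measure M (A \<inter> pre (int n) A)))) \<longlonglongrightarrow> ln (exp (- 2 * ?a))" by (rule tendsto_ln) simp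
 then have "(\<lambda>n. - 2 * ?a + measure M (A \<inter> pre (int n) A) - (- 2 * ?a)) \<longlonglongrightarrow> - 2 * ?a - (- 2 * ?a)" by (intro tendsto_diff tendsto_const) simp
 then show "(\<lambda>n. measure M (A \<inter> pre (int n) A)) \<longlonglongrightarrow> 0" by simp
qed

section \<open>Rigidity\<close>

lemma cyl_determined:
 assumes "E \<in> cyl M AA" "w \<in> config M" "w' \<in> config M" "\<And>A. A \<in> AA \<Longrightarrow> emeasure w A = emeasure w' A"
 shows "w \<in> E \<longleftrightarrow> w' \<in> E" using assms(1) unfolding cyl_def
proof (induction rule: sigma_sets.induct)
 case (Basic E) then show ?case using assms by (auto simp: cyl_gen_def)
qed (use assms in auto)

text \<open>\<open>E\<close> is approximated by an event that depends on the counts of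
  \<open>BB\<close>. If none of the sets \<open>sym_diff B (pre k B)\<close> is hit, a configuration
  and its image have the same counts on \<open>BB\<close>, so this event does not distinguish
  them.\<close>

lemma rigid_estimate:
 assumes E: "E \<in> sets S" and e: "e > 0"
 shows "\<exists>BB. finite BB \<and> BB \<subseteq> fmeasurable M \<and> (\<forall>k. measure S (sym_diff E (SP.pre k E)) \<le> e + (\<Sum>B\<in>BB. measure M (sym_diff B (pre k B))))"
proof -
 have "e / 2 > 0" using e by simp
 from S_approx_fincyl[OF E this] obtain E' where E': "E' \<in> fincyl M (sets M)" "measure S (sym_diff E E') < e / 2" by blast
 from E'(1) obtain BB where B: "finite BB" "BB \<subseteq> sets M \<inter> fmeasurable M" "E' \<in> cyl M BB" by (rule fincylE)
 have E's: "E' \<in> sets P" using E'(1) fincyl_sub[of "sets M"] by auto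
 have fm: "sym_diff B (pre k B) \<in> fmeasurable M" if "B \<in> BB" for B k using B that pre_fmeasurable by (intro fmeasurable_sym_diff) auto
 show ?thesis proof (intro exI[of _ BB] conjI allI)
  fix k
  let ?D = "sym_diff E E'"
  have Ds: "?D \<in> sets S" using E E's by auto
  have "sym_diff E' (SP.pre k E') \<subseteq> (\<Union>B\<in>BB. {w\<in>space P. emeasure w (sym_diff B (pre k B)) \<noteq> 0})" proof
   fix w assume w: "w \<in> sym_diff E' (SP.pre k E')"
   then have wc: "w \<in> config M" using sub_space[OF E's] SP.pre_subset[of k E'] by (auto simp: space_P)
   show "w \<in> (\<Union>B\<in>BB. {w\<in>space P. emeasure w (sym_diff B (pre k B)) \<noteq> 0})" proof (rule ccontr)
    assume "\<not> ?thesis"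
    then have 0: "emeasure w (sym_diff B (pre k B)) = 0" if "B \<in> BB" for B using that wc by (auto simp: space_P)
    have "emeasure w B = emeasure (t k w) B" if "B \<in> BB" for B proof -
     have Bs: "B \<in> sets w" "pre k B \<in> sets w" using B that wc pre_sets by auto
     have "sym_diff B (pre k B) \<in> null_sets w" using 0[OF that] Bs by auto
     then have "emeasure w B = emeasure w (pre k B)" using Bs by (intro emeasure_eq_AE) (auto dest!: AE_not_in)
     then show ?thesis using that B wc by (subst t_emeasure) auto
    qed
    then have "w \<in> E' \<longleftrightarrow> t k w \<in> E'" using B wc t_conf by (intro cyl_determined) auto
    then show False using w wc by (auto simp: spre)
   qed
  qed
  then have "prob (sym_diff E' (SP.pre k E')) \<le> prob (\<Union>B\<in>BB. {w\<in>space P. emeasure w (sym_diff B (pre k B)) \<noteq> 0})"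
   using B fm by (intro finite_measure_mono sets.finite_UN) auto
  also have "\<dots> \<le> (\<Sum>B\<in>BB. prob {w\<in>space P. emeasure w (sym_diff B (pre k B)) \<noteq> 0})" using B fm by (intro measure_UNION_le) auto
  also have "\<dots> \<le> (\<Sum>B\<in>BB. measure M (sym_diff B (pre k B)))" using fm by (intro sum_mono prob_N_pos_le)
  finally have 1: "measure S (sym_diff E' (SP.pre k E')) \<le> (\<Sum>B\<in>BB. measure M (sym_diff B (pre k B)))"
   using E's SP.pre_sets[OF E's] by (subst measure_completion) auto
  have "measure S (sym_diff E (SP.pre k E)) \<le> measure S (?D \<union> (SP.pre k ?D \<union> sym_diff E' (SP.pre k E')))" proof (rule S.finite_measure_mono)
   show "?D \<union> (SP.pre k ?D \<union> sym_diff E' (SP.pre k E')) \<in> sets S"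
    using Ds E's SP.pre_sets[OF E's] E by (intro sets.Un[of ?D] sets.Un[of "SP.pre k ?D"] spre_sets sets_sym_diff) auto
  qed (use sub_space[OF E's] sub_space[OF E] in \<open>auto simp: SP.pre_iff\<close>)
  also have "\<dots> \<le> measure S ?D + measure S (SP.pre k ?D \<union> sym_diff E' (SP.pre k E'))" using Ds E's SP.pre_sets[OF E's] by (intro measure_Un_le) auto
  also have "measure S (SP.pre k ?D \<union> sym_diff E' (SP.pre k E')) \<le> measure S (SP.pre k ?D) + measure S (sym_diff E' (SP.pre k E'))"
   using Ds E's SP.pre_sets[OF E's] by (intro measure_Un_le) auto
  finally show "measure S (sym_diff E (SP.pre k E)) \<le> e + (\<Sum>B\<in>BB. measure M (sym_diff B (pre k B)))"
   using 1 E'(2) spre_measure[OF Ds, of k] by linarith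
 qed (use B in auto)
qed

text \<open>If \<open>A\<close> is void and \<open>pre k A - A\<close> is not, exactly one of the
  two void events occurs. These conditions concern disjoint sets and are independent; invariance of
  \<mu> makes the measure of \<open>pre k A - A\<close> half of that of the symmetric difference,
  whence the division by \<open>2\<close>.\<close>

lemma void_rigid_estimate:
 assumes A: "A \<in> fmeasurable M"
 defines "E \<equiv> (void A)"
 shows "exp (- measure M A) * (1 - exp (- measure M (sym_diff A (pre k A)) / 2)) \<le> measure S (sym_diff E (SP.pre k E))"
proof -
 have As: "A \<in> sets M" using A by auto
 have Es: "E \<in> sets P" unfolding E_def using As by simp
 let ?B = "pre k A - A"
 have Bf: "?B \<in> fmeasurable M" using pre_fmeasurable[OF A] As by (intro fmeasurable_Diff) auto
 have m: "measure M (sym_diff A (pre k A)) = 2 * measure M ?B" proof -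
  note f = fmeasurableD2[OF A] fmeasurableD2[OF pre_fmeasurable[OF A]] As pre_sets[OF As]
  have "measure M (sym_diff A (pre k A)) = measure M (A - pre k A) + measure M ?B"
   using f fmeasurableD2[OF Bf] fmeasurableD2[OF fmeasurable_Diff[OF A pre_sets[OF As]]] by (intro measure_Union) auto
  moreover have "measure M (A - pre k A) = measure M A - measure M (A \<inter> pre k A)" using measure_Diff[of M A "A \<inter> pre k A"] f by (simp add: Diff_Int)
  moreover have "measure M ?B = measure M (pre k A) - measure M (A \<inter> pre k A)"
   using measure_Diff[of M "pre k A" "A \<inter> pre k A"] f by (simp add: Diff_Int)
  ultimately show ?thesis using pre_measure[OF As, of k] by simp
 qed
 let ?F = "{w\<in>space P. emeasure w ?B \<noteq> 0}"
 have E1: "E \<in> cyl M (below A)" unfolding E_def space_P using cyl_basic[of A "below A" "{0}" M] As by simp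
 have F1: "?F \<in> cyl M (below ?B)" unfolding space_P using cyl_basic[of ?B "below ?B" "- {0}" M] Bf by auto
 have "prob (E \<inter> ?F) = prob E * prob ?F" by (rule indep_two[OF _ E1 F1]) auto
 also have "\<dots> = exp (- measure M A) * (1 - exp (- measure M ?B))" unfolding E_def prob_N0[OF A] prob_N_pos[OF Bf] ..
 finally have 1: "prob (E \<inter> ?F) = exp (- measure M A) * (1 - exp (- measure M ?B))" .
 have sub: "E \<inter> ?F \<subseteq> sym_diff E (SP.pre k E)" proof
  fix w assume w: "w \<in> E \<inter> ?F"
  then have "emeasure w ?B \<le> emeasure w (pre k A)" using pre_sets[OF As] by (intro emeasure_mono) (auto simp: space_P)
  then show "w \<in> sym_diff E (SP.pre k E)" using w As by (auto simp: E_def spre_N0)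
 qed
 have "prob (E \<inter> ?F) \<le> prob (sym_diff E (SP.pre k E))" using Es SP.pre_sets[OF Es] sub by (intro finite_measure_mono) auto
 also have "\<dots> = measure S (sym_diff E (SP.pre k E))" using Es SP.pre_sets[OF Es] by (subst measure_completion) auto
 finally show ?thesis unfolding 1 m by simp
qed

lemma void_rigid:
 assumes A: "A \<in> fmeasurable M" and lim: "(\<lambda>k. measure S (sym_diff (void A) (SP.pre (n k) (void A)))) \<longlonglongrightarrow> 0"
 shows "(\<lambda>k::nat. measure M (sym_diff A (pre (n k) A))) \<longlonglongrightarrow> 0"
proof -
 let ?d = "\<lambda>k. measure M (sym_diff A (pre (n k) A))"
 have "(\<lambda>k. exp (- measure M A) * (1 - exp (- ?d k / 2))) \<longlonglongrightarrow> 0" proof (rule tendsto_sandwich[OF _ _ tendsto_const lim])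
  show "eventually (\<lambda>k. 0 \<le> exp (- measure M A) * (1 - exp (- ?d k / 2))) sequentially" by simp
  show "eventually (\<lambda>k. exp (- measure M A) * (1 - exp (- ?d k / 2)) \<le>
   measure S (sym_diff (void A) (SP.pre (n k) (void A)))) sequentially"
   by (intro always_eventually allI void_rigid_estimate[OF A])
 qed
 then have "(\<lambda>k. exp (measure M A) * (exp (- measure M A) * (1 - exp (- ?d k / 2)))) \<longlonglongrightarrow> exp (measure M A) * 0" by (intro tendsto_mult tendsto_const)
 then have "(\<lambda>k. 1 - exp (- ?d k / 2)) \<longlonglongrightarrow> 0" by (simp add: mult.assoc[symmetric] exp_add[symmetric])
 then have "(\<lambda>k. 1 - (1 - exp (- ?d k / 2))) \<longlonglongrightarrow> 1 - 0" by (intro tendsto_diff tendsto_const)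
 then have "(\<lambda>k. exp (- ?d k / 2)) \<longlonglongrightarrow> 1" by simp
 then have "(\<lambda>k. ln (exp (- ?d k / 2))) \<longlonglongrightarrow> ln 1" by (rule tendsto_ln) simp
 then have "(\<lambda>k. - 2 * (- ?d k / 2)) \<longlonglongrightarrow> - 2 * 0" by (intro tendsto_mult tendsto_const) simp
 then show ?thesis by simp
qed

lemma rigid_iff_M: "rigid_along M T n \<longleftrightarrow> (\<forall>A\<in>fmeasurable M. (\<lambda>k. measure M (sym_diff A (pre (int (n k)) A))) \<longlonglongrightarrow> 0)"
 unfolding rigid_along_def by (intro ball_cong refl) (subst measure_sym_diff_image, auto)

lemma rigid_iff_S: "rigid_along S T' n \<longleftrightarrow> (\<forall>E\<in>sets S. (\<lambda>k. measure S (sym_diff E (SP.pre (int (n k)) E))) \<longlonglongrightarrow> 0)"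
 unfolding rigid_along_def S.fmeasurable_eq_sets by (intro ball_cong refl) (subst SS.measure_sym_diff_image, auto simp: sspre)

lemma rigid_iff: "rigid_along M T n \<longleftrightarrow> rigid_along S T' n"
proof
 assume R: "rigid_along M T n"
 show "rigid_along S T' n" unfolding rigid_iff_S proof (intro ballI LIMSEQ_I)
  fix E and e :: real assume E: "E \<in> sets S" and e: "0 < e"
  then have "e / 2 > 0" by simp
  from rigid_estimate[OF E this] obtain BB where B: "finite BB" "BB \<subseteq> fmeasurable M"
   "\<And>k. measure S (sym_diff E (SP.pre k E)) \<le> e / 2 + (\<Sum>B\<in>BB. measure M (sym_diff B (pre k B)))" by blast
  have "(\<lambda>k. \<Sum>B\<in>BB. measure M (sym_diff B (pre (int (n k)) B))) \<longlonglongrightarrow> (\<Sum>B\<in>BB. 0)" using R B unfolding rigid_iff_M by (intro tendsto_sum) auto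
  then have "eventually (\<lambda>k. (\<Sum>B\<in>BB. measure M (sym_diff B (pre (int (n k)) B))) < e / 2) sequentially" using e by (intro order_tendstoD) auto
  then obtain K where K: "\<And>k. k \<ge> K \<Longrightarrow> (\<Sum>B\<in>BB. measure M (sym_diff B (pre (int (n k)) B))) < e / 2" by (auto simp: eventually_sequentially)
  show "\<exists>N. \<forall>k\<ge>N. norm (measure S (sym_diff E (SP.pre (int (n k)) E)) - 0) < e" proof (intro exI[of _ K] allI impI)
   fix k assume "k \<ge> K"
   then show "norm (measure S (sym_diff E (SP.pre (int (n k)) E)) - 0) < e" using K[of k] B(3)[of "int (n k)"] by simp
  qed
 qed
next
 assume R: "rigid_along S T' n"
 show "rigid_along M T n" unfolding rigid_iff_M proof
  fix A assume A: "A \<in> fmeasurable M"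
  then have "(void A) \<in> sets S" by auto
  then show "(\<lambda>k. measure M (sym_diff A (pre (int (n k)) A))) \<longlonglongrightarrow> 0" using R unfolding rigid_iff_S by (intro void_rigid[OF A]) auto
 qed
qed

section \<open>Ergodicity and weak mixing\<close>

lemma no_finite_invariant_imp_weakly_mixing:
 assumes no_finite_invariant shows "weakly_mixing S T'" unfolding weakly_mixing_def vimage_funpow
proof (intro ballI LIMSEQ_I)
 fix A B and e :: real assume A: "A \<in> sets S" and B: "B \<in> sets S" and e: "0 < e"
 then have "e / 2 > 0" by simp
 from pair_estimate[OF A B this] obtain Y where Y: "Y \<in> fmeasurable M"
  "\<And>k. \<bar>measure S (A \<inter> SP.pre k B) - measure S A * measure S B\<bar> \<le> e / 2 + 2 * measure M (Y \<inter> pre k Y)" by blast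
 have "(\<lambda>n. (\<Sum>k<n. measure M (Y \<inter> pre (int k) Y)) / real n) \<longlonglongrightarrow> 0" using assms Y(1) unfolding no_finite_invariant_def by (intro cesaro_zero) auto
 then have "eventually (\<lambda>n. (\<Sum>k<n. measure M (Y \<inter> pre (int k) Y)) / real n < e / 4) sequentially" using e by (intro order_tendstoD) auto
 then obtain N where N: "\<And>n. n \<ge> N \<Longrightarrow> (\<Sum>k<n. measure M (Y \<inter> pre (int k) Y)) / real n < e / 4" by (auto simp: eventually_sequentially)
 show "\<exists>N. \<forall>n\<ge>N. norm ((\<Sum>k<n. \<bar>measure S (A \<inter> SP.pre (int k) B) - measure S A * measure S B\<bar>) / real n - 0) < e"
 proof (intro exI[of _ "Suc N"] allI impI)
  fix n assume n: "n \<ge> Suc N"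
  have "(\<Sum>k<n. \<bar>measure S (A \<inter> SP.pre (int k) B) - measure S A * measure S B\<bar>) / real n
   \<le> (\<Sum>k<n. e / 2 + 2 * measure M (Y \<inter> pre (int k) Y)) / real n" by (intro divide_right_mono sum_mono Y(2)) auto
  also have "\<dots> = e / 2 + 2 * ((\<Sum>k<n. measure M (Y \<inter> pre (int k) Y)) / real n)"
   using n by (simp add: sum.distrib add_divide_distrib sum_distrib_left)
  also have "\<dots> < e" using N[of n] n by linarith
  finally show "norm ((\<Sum>k<n. \<bar>measure S (A \<inter> SP.pre (int k) B) - measure S A * measure S B\<bar>) / real n - 0) < e" by (simp add: sum_nonneg)
 qed
qed

lemma null_S_iff: "E \<in> sets S \<Longrightarrow> E \<in> null_sets S \<longleftrightarrow> measure S E = 0" by (simp add: null_sets_def S.emeasure_eq_measure)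

lemma invariant_pre:
 assumes E: "E \<in> sets S" and inv: "measure S (sym_diff E (SP.pre 1 E)) = 0"
 shows "measure S (sym_diff E (SP.pre (int k) E)) = 0"
proof (induction k)
 case 0
 have "SP.pre 0 E = E" using sub_space[OF E] by (intro SP.pre_0) simp
 then show ?case by simp
next
 case (Suc k)
 have "measure S (sym_diff E (SP.pre (int (Suc k)) E)) \<le> measure S (sym_diff E (SP.pre 1 E) \<union> SP.pre 1 (sym_diff E (SP.pre (int k) E)))"
 proof (rule S.finite_measure_mono)
  show "sym_diff E (SP.pre (int (Suc k)) E) \<subseteq> sym_diff E (SP.pre 1 E) \<union> SP.pre 1 (sym_diff E (SP.pre (int k) E))"
   by (auto simp: SP.pre_Diff SP.pre_Un SP.pre_pre)
 qed (use E in \<open>intro sets.Un sets_sym_diff spre_sets; simp\<close>)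
 also have "\<dots> \<le> measure S (sym_diff E (SP.pre 1 E)) + measure S (SP.pre 1 (sym_diff E (SP.pre (int k) E)))"
  using E by (intro measure_Un_le sets_sym_diff spre_sets) auto
 also have "\<dots> = 0" using Suc inv E by (subst spre_measure) (simp_all add: sets_sym_diff)
 finally show ?case by (simp add: measure_le_0_iff)
qed

lemma ergodic_iff: "ergodic S T' \<longleftrightarrow> (\<forall>E\<in>sets S. sym_diff E (SP.pre 1 E) \<in> null_sets S \<longrightarrow> measure S E = 0 \<or> measure S E = 1)" unfolding ergodic_def
proof (intro ball_cong refl)
 fix E assume E: "E \<in> sets S"
 have "T' -` E \<inter> space S = SP.pre 1 E" using vimage_funpow[of 1 E] by simp
 moreover have "space S - E \<in> null_sets S \<longleftrightarrow> measure S E = 1" using E S.prob_compl[OF E] by (subst null_S_iff) auto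
 ultimately show "(sym_diff E (T' -` E \<inter> space S) \<in> null_sets S \<longrightarrow> E \<in> null_sets S \<or> space S - E \<in> null_sets S) \<longleftrightarrow>
  (sym_diff E (SP.pre 1 E) \<in> null_sets S \<longrightarrow> measure S E = 0 \<or> measure S E = 1)" using E null_S_iff by simp
qed

lemma weakly_mixing_imp_ergodic:
 assumes "weakly_mixing S T'" shows "ergodic S T'" unfolding ergodic_iff
proof (intro ballI impI)
 fix E assume E: "E \<in> sets S" and inv: "sym_diff E (SP.pre 1 E) \<in> null_sets S"
 have "measure S (E \<inter> SP.pre (int k) E) = measure S E" for k proof -
  have "measure S (sym_diff E (SP.pre (int k) E)) = 0" using invariant_pre[OF E] measure_eq_0_null_sets[OF inv] by simp
  moreover have "\<bar>measure S (E \<inter> SP.pre (int k) E) - measure S E\<bar> \<le> measure S (sym_diff E (SP.pre (int k) E))" by (rule S_close) (use E in auto)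
  ultimately show ?thesis by simp
 qed
 then have "(\<lambda>n. (\<Sum>k<n. \<bar>measure S E - measure S E * measure S E\<bar>) / real n) \<longlonglongrightarrow> 0"
  using assms E unfolding weakly_mixing_def vimage_funpow by fastforce
 moreover have "(\<lambda>n. (\<Sum>k<n. \<bar>measure S E - measure S E * measure S E\<bar>) / real n) \<longlonglongrightarrow> \<bar>measure S E - measure S E * measure S E\<bar>"
  by (rule tendsto_eventually) (use eventually_gt_at_top[of 0] in eventually_elim, simp)
 ultimately have "\<bar>measure S E - measure S E * measure S E\<bar> = 0" using LIMSEQ_unique by blast
 then show "measure S E = 0 \<or> measure S E = 1" by (auto simp: algebra_simps)
qed

text \<open>The void event of an invariant set is invariant, and its probability
  \<open>exp (- measure M A)\<close> is never \<open>0\<close> and equals \<open>1\<close> only for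
  a null set.\<close>

lemma ergodic_imp_no_finite_invariant:
 assumes "ergodic S T'" shows no_finite_invariant unfolding no_finite_invariant_def
proof (intro ballI impI)
 fix A assume A: "A \<in> fmeasurable M" and inv: "sym_diff A (pre 1 A) \<in> null_sets M"
 have As: "A \<in> sets M" using A by auto
 let ?E = "void A"
 have Es: "?E \<in> sets P" using As by simp
 have "AE w in P. w \<notin> sym_diff ?E (SP.pre 1 ?E)" using AE_N_null[OF inv] AE_space proof eventually_elim
  fix w assume 0: "emeasure w (sym_diff A (pre 1 A)) = 0" and w: "w \<in> space P"
  then have "sym_diff A (pre 1 A) \<in> null_sets w" "A \<in> sets w" "pre 1 A \<in> sets w" using As pre_sets[OF As] by (auto simp: space_P)
  then have "emeasure w A = emeasure w (pre 1 A)" by (intro emeasure_eq_AE) (auto dest!: AE_not_in)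
  then show "w \<notin> sym_diff ?E (SP.pre 1 ?E)" using w As by (auto simp: spre_N0)
 qed
 then have "sym_diff ?E (SP.pre 1 ?E) \<in> null_sets P" using Es SP.pre_sets[OF Es] by (subst AE_iff_null_sets) auto
 then have "measure S ?E = 0 \<or> measure S ?E = 1" using assms Es unfolding ergodic_iff by (auto intro: null_sets_completionI)
 then have "measure M A = 0" using prob_N0[OF A] Es by auto
 then show "A \<in> null_sets M" using A by (auto simp: fmeasurable_def emeasure_eq_ennreal_measure)
qed

end

section \<open>Hopf decomposition\<close>

text \<open>Chebyshev for counting measure: along an orbit with finite sum, a positive function
  attains its maximum.\<close>

lemma finite_ge_of_nn_integral_count_space:
 fixes f :: "'b \<Rightarrow> ennreal"
 assumes fin: "(\<integral>\<^sup>+n. f n \<partial>count_space UNIV) < \<infinity>" and e: "e > 0"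
 shows "finite {n. e \<le> f n}"
proof (rule ccontr)
 assume inf: "infinite {n. e \<le> f n}"
 have "e * emeasure (count_space UNIV) {n. e \<le> f n} = (\<integral>\<^sup>+n. e * indicator {n. e \<le> f n} n \<partial>count_space UNIV)"
  by (simp add: nn_integral_cmult_indicator)
 also have "\<dots> \<le> (\<integral>\<^sup>+n. f n \<partial>count_space UNIV)" by (intro nn_integral_mono) (auto simp: indicator_def)
 finally show False using fin inf e by (auto simp: emeasure_count_space_infinite ennreal_mult_top top_unique split: if_splits)
qed

context aut
begin

section \<open>Wandering sets and restriction to invariant sets\<close>

lemma wanderingD:
 assumes "wandering M T W"
 shows "W \<in> sets M" "m \<noteq> n \<Longrightarrow> pre m W \<inter> pre n W \<in> null_sets M"
proof -
 show W: "W \<in> sets M" using assms by (simp add: wandering_def)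
 assume "m \<noteq> n"
 then have "Z (- m) ` W \<inter> Z (- n) ` W \<in> null_sets M" using assms unfolding wandering_def by auto
 then show "pre m W \<inter> pre n W \<in> null_sets M" using sub_space[OF W] by (simp add: pre_image)
qed

text \<open>The translates of a wandering set may overlap in null sets. The points of
  \<open>W\<close> that return to \<open>W\<close> at some nonzero time form a null set, and without
  them the translates are disjoint.\<close>

lemma wandering_exact:
 assumes "wandering M T W"
 obtains W0 where "W0 \<in> sets M" "W0 \<subseteq> W" "W - W0 \<in> null_sets M" "\<And>m n. m \<noteq> n \<Longrightarrow> pre m W0 \<inter> pre n W0 = {}"
proof -
 have W: "W \<in> sets M" by (rule wanderingD[OF assms])
 define B where "B = (\<Union>n\<in>{n::int. n \<noteq> 0}. pre 0 W \<inter> pre n W)"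
 have B: "B \<in> null_sets M" unfolding B_def by (intro null_sets_UN' countableI_type wanderingD[OF assms]) auto
 show ?thesis proof (rule that[of "W - B"])
  show "W - B \<in> sets M" using W B by auto
  show "W - (W - B) \<in> null_sets M" using B W by (intro null_sets_subset[OF B]) auto
  fix m n :: int assume mn: "m \<noteq> n"
  show "pre m (W - B) \<inter> pre n (W - B) = {}" proof (rule ccontr)
   assume "pre m (W - B) \<inter> pre n (W - B) \<noteq> {}"
   then obtain x where "x \<in> pre m (W - B)" "x \<in> pre n (W - B)" by blast
   then have x: "x \<in> space M" "Z m x \<in> W - B" "Z n x \<in> W" by (auto simp: pre_iff)
   have "Z (n - m) (Z m x) = Z n x" using Z_add[OF x(1), of "n - m" m] by simp
   then have "Z m x \<in> pre 0 W \<inter> pre (n - m) W" using x Z_in by (auto simp: pre_iff)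
   then have "Z m x \<in> B" unfolding B_def using mn by (intro UN_I[of "n - m"]) auto
   then show False using x by simp
  qed
 qed auto
qed

text \<open>The summands are the integrals of \<open>g\<close> over the translates of
  \<open>W\<close>, which are disjoint; \<open>int_decode\<close> arranges the integers in a
  sequence.\<close>

lemma exact_wandering_sum:
 assumes W: "W \<in> sets M" and disj: "\<And>m n. m \<noteq> n \<Longrightarrow> pre m W \<inter> pre n W = {}" and g [measurable]: "g \<in> borel_measurable M"
 shows "(\<Sum>k. \<integral>\<^sup>+x. g (Z (int_decode k) x) * indicator W x \<partial>M) \<le> (\<integral>\<^sup>+x. g x \<partial>M)"
proof -
 have [measurable]: "pre n W \<in> sets M" for n using W by auto
 have "(\<integral>\<^sup>+x. g (Z n x) * indicator W x \<partial>M) = emeasure (density M g) (pre (- n) W)" for n proof -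
  have "emeasure (density M g) (pre (- n) W) = (\<integral>\<^sup>+x. g x * indicator (pre (- n) W) x \<partial>distr M M (Z n))" by (simp add: emeasure_density Z_distr)
  also have "\<dots> = (\<integral>\<^sup>+x. g (Z n x) * indicator (pre (- n) W) (Z n x) \<partial>M)" by (subst nn_integral_distr) auto
  also have "\<dots> = (\<integral>\<^sup>+x. g (Z n x) * indicator W x \<partial>M)" by (intro nn_integral_cong) (auto simp: indicator_def pre_iff Z_in Z_inv)
  finally show ?thesis ..
 qed
 then have "(\<Sum>k. \<integral>\<^sup>+x. g (Z (int_decode k) x) * indicator W x \<partial>M) = (\<Sum>k. emeasure (density M g) (pre (- int_decode k) W))" by simp
 also have "\<dots> = emeasure (density M g) (\<Union>k. pre (- int_decode k) W)" proof (rule suminf_emeasure)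
  show "disjoint_family (\<lambda>k. pre (- int_decode k) W)"
   unfolding disjoint_family_on_def by (intro ballI impI disj) (simp add: inj_eq[OF bij_is_inj[OF bij_int_decode]])
 qed auto
 also have "\<dots> \<le> emeasure (density M g) (space M)" by (intro emeasure_mono) (auto simp: pre_def)
 also have "\<dots> = (\<integral>\<^sup>+x. g x \<partial>M)" by (simp add: emeasure_density cong: nn_integral_cong)
 finally show ?thesis .
qed

lemma restrict_invariant:
 assumes C: "C \<in> sets M" and TC: "T ` C = C"
 shows "automorphism (restrict_space M C) T" and "\<And>n x. x \<in> C \<Longrightarrow> int_iterate (restrict_space M C) T n x = Z n x" and "\<And>n. pre n C = C"
proof -
 have sub: "C \<subseteq> space M" using C by (rule sub_space)
 have sp: "space (restrict_space M C) = C" using sub by (auto simp: space_restrict_space)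
 have inj: "inj_on T (space M)" using bij_T by (simp add: bij_betw_def)
 have bij: "bij_betw T C C" using inj sub TC by (auto simp: bij_betw_def intro: inj_on_subset)
 have inv: "the_inv_into C T x = the_inv_into (space M) T x" if "x \<in> C" for x proof -
  have "x \<in> T ` C" using that TC by simp
  then obtain y where y: "y \<in> C" "x = T y" by (rule imageE)
  then have "the_inv_into C T x = y" using bij by (auto simp: bij_betw_def intro: the_inv_into_f_f)
  moreover have "the_inv_into (space M) T x = y" using y sub by (auto simp: Ti_T)
  ultimately show ?thesis by simp
 qed
 have invC: "the_inv_into (space M) T x \<in> C" if "x \<in> C" for x using bij_betw_the_inv_into[OF bij] that inv by (auto simp: bij_betw_def)
 have T_C: "T x \<in> C" if "x \<in> C" for x using TC that by auto
 show it: "int_iterate (restrict_space M C) T n x = Z n x" if x: "x \<in> C" for n x proof -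
  have "(the_inv_into C T ^^ k) x = (the_inv_into (space M) T ^^ k) x \<and> (the_inv_into (space M) T ^^ k) x \<in> C" for k
   by (induction k) (auto simp: x inv invC)
  then show ?thesis by (simp add: int_iterate_def sp)
 qed
 have Z_C: "Z n x \<in> C" if "x \<in> C" for n x proof -
  have "(the_inv_into (space M) T ^^ k) x \<in> C" "(T ^^ k) x \<in> C" for k using that by (induction k) (auto simp: invC T_C)
  then show ?thesis by (simp add: int_iterate_def)
 qed
 show pC: "pre n C = C" for n proof
  show "pre n C \<subseteq> C" proof
   fix x assume "x \<in> pre n C"
   then have "Z (- n) (Z n x) \<in> C" "x \<in> space M" by (auto simp: pre_iff Z_C)
   then show "x \<in> C" by (simp add: Z_inv)
  qed
  show "C \<subseteq> pre n C" using sub Z_C by (auto simp: pre_iff)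
 qed
 have mT: "T \<in> measurable (restrict_space M C) (restrict_space M C)"
  by (rule measurable_restrict_space2) (use T_C sub in \<open>auto intro: measurable_restrict_space1 simp: sp\<close>)
 have mTi: "the_inv_into (space M) T \<in> measurable (restrict_space M C) (restrict_space M C)"
  by (rule measurable_restrict_space2) (use invC sub in \<open>auto intro: measurable_restrict_space1 simp: sp\<close>)
 show "automorphism (restrict_space M C) T" unfolding automorphism_def sp proof (intro conjI)
  show "bij_betw T C C" by (rule bij)
  show "T \<in> measurable (restrict_space M C) (restrict_space M C)" by (rule mT)
  show "the_inv_into C T \<in> measurable (restrict_space M C) (restrict_space M C)"
   using measurable_cong[of "restrict_space M C" "the_inv_into C T" "the_inv_into (space M) T"] inv mTi by (simp add: sp)
  show "distr (restrict_space M C) (restrict_space M C) T = restrict_space M C" proof (rule measure_eqI)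
   fix A assume "A \<in> sets (distr (restrict_space M C) (restrict_space M C) T)"
   then have A': "A \<in> sets (restrict_space M C)" by simp
   then have A: "A \<in> sets M" "A \<subseteq> C" using C by (auto simp: sets_restrict_space_iff)
   have "emeasure (distr (restrict_space M C) (restrict_space M C) T) A = emeasure (restrict_space M C) (T -` A \<inter> C)"
    using A' mT by (simp add: emeasure_distr sp)
   also have "\<dots> = emeasure M (T -` A \<inter> C)" using C by (intro emeasure_restrict_space) auto
   also have "T -` A \<inter> C = pre 1 A" using pre_mono[OF A(2), of 1] pC[of 1] sub by (auto simp: pre_iff Z_1)
   also have "emeasure M (pre 1 A) = emeasure M A" using A by (intro pre_emeasure)
   also have "\<dots> = emeasure (restrict_space M C) A" using A C by (intro emeasure_restrict_space[symmetric]) auto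
   finally show "emeasure (distr (restrict_space M C) (restrict_space M C) T) A = emeasure (restrict_space M C) A" .
  qed simp
 qed
qed

section \<open>Invariant sets, invariant probabilities and the Hopf decomposition\<close>

lemma invariant_iterate:
 assumes A: "A \<in> sets M" and inv: "sym_diff A (pre 1 A) \<in> null_sets M"
 shows "sym_diff A (pre n A) \<in> null_sets M"
proof -
 have 1: "AE x in M. x \<in> A \<longleftrightarrow> T x \<in> A" using AE_not_in[OF inv] AE_space by eventually_elim (auto simp: pre_iff Z_1)
 have "AE x in M. x \<in> A \<longleftrightarrow> Z n x \<in> A" proof (induction n rule: int_induct[where k=0])
  case base then show ?case by simp
 next
  case (step1 n)
  show ?case using step1(2) AE_Z[OF 1, of n] AE_space by eventually_elim (simp add: Z_Suc)
 next
  case (step2 n)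
  show ?case using step2(2) AE_Z[OF 1, of "n - 1"] AE_space proof eventually_elim
   case (elim x)
   then show ?case using Z_Suc[of x "n - 1"] by simp
  qed
 qed
 then have "AE x in M. x \<notin> sym_diff A (pre n A)" using AE_space by eventually_elim (auto simp: pre_iff)
 then show ?thesis using A pre_sets[OF A] by (subst AE_iff_null_sets) auto
qed

text \<open>The density of an invariant probability is an invariant function with integral
  \<open>1\<close>. Its superlevel sets at positive heights have finite measure by Chebyshev and are
  invariant, hence null, so the density would vanish.\<close>

lemma no_invariant_prob:
 assumes "sigma_finite_measure M" and ni: no_finite_invariant
 shows "\<not> (\<exists>Q. prob_space Q \<and> sets Q = sets M \<and> absolutely_continuous M Q \<and> distr Q M T = Q)"
proof
 interpret sigma_finite_measure M by fact
 assume "\<exists>Q. prob_space Q \<and> sets Q = sets M \<and> absolutely_continuous M Q \<and> distr Q M T = Q"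
 then obtain Q where Q: "prob_space Q" "sets Q = sets M" "absolutely_continuous M Q" "distr Q M T = Q" by blast
 obtain f where f [measurable]: "f \<in> borel_measurable M" and fQ: "density M f = Q" using Radon_Nikodym[OF Q(3,2)] by blast
 have spQ: "space Q = space M" using Q(2) by (rule sets_eq_imp_space_eq)
 \<comment> \<open>As \<mu> is invariant, composing the density with \<open>T\<close> amounts to
   moving the measure by the inverse of \<open>T\<close>, which leaves \<open>Q\<close> unchanged.
   Uniqueness of densities then gives the invariance of \<open>f\<close>.\<close>
 have "density M (\<lambda>x. f (T x)) = density M f" proof (rule measure_eqI)
  fix B assume "B \<in> sets (density M (\<lambda>x. f (T x)))"
  then have B [measurable]: "B \<in> sets M" by simp
  have B' [measurable]: "pre (-1) B \<in> sets M" by (rule pre_sets[OF B])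
  have "emeasure (density M (\<lambda>x. f (T x))) B = (\<integral>\<^sup>+x. f (T x) * indicator B x \<partial>M)" by (simp add: emeasure_density)
  also have "\<dots> = (\<integral>\<^sup>+x. f (T x) * indicator (pre (-1) B) (T x) \<partial>M)" proof (intro nn_integral_cong)
   fix x assume x: "x \<in> space M"
   have "Z (-1) (T x) = x" using Z_inv(1)[OF x, of 1] by (simp add: Z_1)
   then show "f (T x) * indicator B x = f (T x) * indicator (pre (-1) B) (T x)" using x T_in by (auto simp: indicator_def pre_iff)
  qed
  also have "\<dots> = (\<integral>\<^sup>+x. f x * indicator (pre (-1) B) x \<partial>distr M M T)" by (subst nn_integral_distr) auto
  also have "\<dots> = emeasure Q (pre (-1) B)" unfolding distr_T fQ[symmetric] by (simp add: emeasure_density)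
  also have "\<dots> = emeasure (distr Q M T) (pre (-1) B)" by (simp add: Q)
  also have "\<dots> = emeasure Q (T -` pre (-1) B \<inter> space M)" using measurable_cong_sets[OF Q(2) refl, of M] by (subst emeasure_distr) (auto simp: spQ)
  also have "T -` pre (-1) B \<inter> space M = pre 1 (pre (-1) B)" by (simp add: pre_def[of 1] Z_1)
  also have "\<dots> = B" using sub_space[OF B] by (simp add: pre_pre pre_0)
  finally show "emeasure (density M (\<lambda>x. f (T x))) B = emeasure (density M f) B" by (simp add: fQ)
 qed simp
 then have inv: "AE x in M. f (T x) = f x" by (intro density_unique) auto
 have int1: "(\<integral>\<^sup>+x. f x \<partial>M) = 1" proof -
  have "(\<integral>\<^sup>+x. f x \<partial>M) = emeasure (density M f) (space M)" by (simp add: emeasure_density cong: nn_integral_cong)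
  also have "\<dots> = 1" using prob_space.emeasure_space_1[OF Q(1)] fQ spQ by simp
  finally show ?thesis .
 qed
 have "AE x in M. f x \<le> ennreal (1 / real (Suc n))" for n proof -
  define c where "c = ennreal (1 / real (Suc n))"
  define A where "A = {x\<in>space M. c < f x}"
  have [measurable]: "A \<in> sets M" unfolding A_def by measurable
  have "c * emeasure M A = (\<integral>\<^sup>+x. c * indicator A x \<partial>M)" by (simp add: nn_integral_cmult_indicator)
  also have "\<dots> \<le> (\<integral>\<^sup>+x. f x \<partial>M)" by (intro nn_integral_mono) (auto simp: indicator_def A_def)
  finally have "c * emeasure M A < \<infinity>" unfolding int1 by (simp add: le_less_trans[OF _ ennreal_one_less_top])
  then have fm: "A \<in> fmeasurable M" by (auto simp: fmeasurable_def c_def ennreal_mult_less_top)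
  have "AE x in M. x \<notin> sym_diff A (pre 1 A)" using inv AE_space by eventually_elim (auto simp: A_def pre_iff Z_1 T_in)
  then have "sym_diff A (pre 1 A) \<in> null_sets M" by (subst AE_iff_null_sets) auto
  then have "A \<in> null_sets M" using ni fm unfolding no_finite_invariant_def by blast
  then show ?thesis using AE_not_in AE_space by (force simp: A_def c_def not_less)
 qed
 then have "AE x in M. \<forall>n. f x \<le> ennreal (1 / real (Suc n))" by (subst AE_all_countable) auto
 then have "AE x in M. f x = 0" proof eventually_elim
  fix x assume *: "\<forall>n. f x \<le> ennreal (1 / real (Suc n))"
  have "(\<lambda>n. ennreal (1 / real (Suc n))) \<longlonglongrightarrow> ennreal 0" by (intro tendsto_ennrealI) (use LIMSEQ_inverse_real_of_nat in \<open>simp add: divide_inverse\<close>)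
  then have "f x \<le> ennreal 0" by (rule LIMSEQ_le_const) (use * in auto)
  then show "f x = 0" by simp
 qed
 then have "(\<integral>\<^sup>+x. f x \<partial>M) = (\<integral>\<^sup>+x. 0 \<partial>M)" by (intro nn_integral_cong_AE) auto
 then show False using int1 by simp
qed

lemma invariant_prob:
 assumes A: "A \<in> fmeasurable M" and inv: "sym_diff A (pre 1 A) \<in> null_sets M" and pos: "A \<notin> null_sets M"
 shows "\<exists>Q. prob_space Q \<and> sets Q = sets M \<and> absolutely_continuous M Q \<and> distr Q M T = Q"
proof (intro exI[of _ "uniform_measure M A"] conjI)
 have As [measurable]: "A \<in> sets M" using A by auto
 have p: "emeasure M A \<noteq> 0" "emeasure M A \<noteq> \<infinity>" using A pos by (auto simp: fmeasurable_def null_sets_def)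
 show "prob_space (uniform_measure M A)" using p by (rule prob_space_uniform_measure)
 show "absolutely_continuous M (uniform_measure M A)" unfolding uniform_measure_def by (intro absolutely_continuousI_density) measurable
 show "distr (uniform_measure M A) M T = uniform_measure M A" proof (rule measure_eqI)
  fix B assume "B \<in> sets (distr (uniform_measure M A) M T)"
  then have B [measurable]: "B \<in> sets M" by simp
  have B' [measurable]: "pre 1 B \<in> sets M" by (rule pre_sets[OF B])
  have "emeasure (distr (uniform_measure M A) M T) B = emeasure (uniform_measure M A) (pre 1 B)" by (subst emeasure_distr) (auto simp: pre_def Z_1)
  also have "\<dots> = emeasure M (A \<inter> pre 1 B) / emeasure M A" by simp
  also have "emeasure M (A \<inter> pre 1 B) = emeasure M (pre 1 A \<inter> pre 1 B)" using AE_not_in[OF inv] pre_sets[OF As] by (intro emeasure_eq_AE) auto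
  also have "\<dots> = emeasure M (A \<inter> B)" using pre_emeasure[of "A \<inter> B" 1] by (simp add: pre_Int)
  also have "emeasure M (A \<inter> B) / emeasure M A = emeasure (uniform_measure M A) B" by simp
  finally show "emeasure (distr (uniform_measure M A) M T) B = emeasure (uniform_measure M A) B" .
 qed simp
qed simp

lemma dissipative_exact:
 assumes "dissipative M T"
 obtains W where "W \<in> sets M" "\<And>m n. m \<noteq> n \<Longrightarrow> pre m W \<inter> pre n W = {}" "space M - (\<Union>n. pre n W) \<in> null_sets M"
proof -
 obtain W where W: "wandering M T W" "space M - (\<Union>n. Z n ` W) \<in> null_sets M" using assms unfolding dissipative_def by blast
 have Ws: "W \<in> sets M" by (rule wanderingD[OF W(1)])
 obtain W0 where W0: "W0 \<in> sets M" "W0 \<subseteq> W" "W - W0 \<in> null_sets M" "\<And>m n. m \<noteq> n \<Longrightarrow> pre m W0 \<inter> pre n W0 = {}"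
  by (rule wandering_exact[OF W(1)]) (rule that)
 have "(\<Union>n. pre n (W - W0)) \<in> null_sets M" by (intro null_sets_UN' countableI_type pre_null W0)
 then have N: "(space M - (\<Union>n. Z n ` W)) \<union> (\<Union>n. pre n (W - W0)) \<in> null_sets M" using W(2) by auto
 have "Z n ` W = pre (- n) W" for n using sub_space[OF Ws] by (rule pre_image)
 then have "space M - (\<Union>n. pre n W0) \<subseteq> (space M - (\<Union>n. Z n ` W)) \<union> (\<Union>n. pre n (W - W0))" by (auto simp: pre_iff)
 then have "space M - (\<Union>n. pre n W0) \<in> null_sets M" using N W0(1) pre_sets[OF W0(1)] by (intro null_sets_subset[OF N]) auto
 then show ?thesis using that[OF W0(1,4)] by blast
qed

text \<open>For an invariant \<open>A\<close> all the sets \<open>A \<inter> pre n W\<close> have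
  the same measure. Infinitely many of them fit disjointly into a set of finite measure, so they are
  null, and they exhaust \<open>A\<close>.\<close>

lemma dissipative_no_finite_invariant:
 assumes "dissipative M T" shows no_finite_invariant unfolding no_finite_invariant_def
proof (intro ballI impI)
 fix A assume A: "A \<in> fmeasurable M" and inv: "sym_diff A (pre 1 A) \<in> null_sets M"
 have As: "A \<in> sets M" using A by auto
 obtain W where W: "W \<in> sets M" "\<And>m n. m \<noteq> n \<Longrightarrow> pre m W \<inter> pre n W = {}" "space M - (\<Union>n. pre n W) \<in> null_sets M"
  by (rule dissipative_exact[OF assms]) (rule that)
 have same: "emeasure M (A \<inter> pre n W) = emeasure M (A \<inter> W)" for n proof -
  have "emeasure M (A \<inter> pre n W) = emeasure M (pre n A \<inter> pre n W)"
   using AE_not_in[OF invariant_iterate[OF As inv, of n]] As W pre_sets by (intro emeasure_eq_AE) auto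
  also have "\<dots> = emeasure M (A \<inter> W)" using pre_emeasure[of "A \<inter> W" n] As W by (simp add: pre_Int)
  finally show ?thesis .
 qed
 have "(\<Sum>k::nat. emeasure M (A \<inter> W)) = (\<Sum>k. emeasure M (A \<inter> pre (int k) W))" by (simp add: same)
 also have "\<dots> = emeasure M (\<Union>k. A \<inter> pre (int k) W)" proof (rule suminf_emeasure)
  show "disjoint_family (\<lambda>k. A \<inter> pre (int k) W)"
   unfolding disjoint_family_on_def using W(2) by (metis Int_assoc Int_empty_right Int_left_commute of_nat_eq_iff)
 qed (use As W pre_sets in auto)
 also have "\<dots> \<le> emeasure M A" using As by (intro emeasure_mono) auto
 also have "\<dots> < \<infinity>" using A by (simp add: fmeasurable_def)
 finally have "(\<Sum>k::nat. emeasure M (A \<inter> W)) < \<infinity>" .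
 moreover have "(\<Sum>k::nat. emeasure M (A \<inter> W)) = emeasure M (A \<inter> W) * \<infinity>"
  unfolding nn_integral_count_space_nat[symmetric] by (simp add: emeasure_count_space_infinite)
 ultimately have 0: "emeasure M (A \<inter> W) = 0" by (auto simp: ennreal_mult_top split: if_splits)
 have "(\<Union>n. A \<inter> pre n W) \<in> null_sets M" using same 0 As W pre_sets by (intro null_sets_UN' countableI_type) auto
 then have "(\<Union>n. A \<inter> pre n W) \<union> (space M - (\<Union>n. pre n W)) \<in> null_sets M" using W(3) by auto
 then show "A \<in> null_sets M" by (rule null_sets_subset) (use As sub_space[OF As] in auto)
qed

text \<open>For a positive integrable \<open>g\<close>, the sum \<open>h\<close> of \<open>g\<close>
  along the two-sided orbit is exactly invariant, so the set \<open>C\<close> where it is infinite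
  is mapped onto itself exactly. Over a set with disjoint translates \<open>h\<close> has finite
  integral, so within \<open>C\<close> such a set is null; where \<open>h\<close> is finite, each
  orbit has a distinguished point.\<close>

lemma Hopf_decomposition:
 assumes "sigma_finite_measure M"
 obtains C where "conservative_part M T C"
proof -
 interpret sigma_finite_measure M by fact
 obtain g where g [measurable]: "g \<in> borel_measurable M" and gfin: "integral\<^sup>N M g \<noteq> \<infinity>"
  and gpos: "\<And>x. x \<in> space M \<Longrightarrow> 0 < g x" using Ex_finite_integrable_function by blast
 define h where "h x = (\<Sum>k. g (Z (int_decode k) x))" for x
 have [measurable]: "h \<in> borel_measurable M" unfolding h_def by measurable
 have h_int: "h x = (\<integral>\<^sup>+n. g (Z n x) \<partial>count_space UNIV)" for x unfolding h_def nn_integral_count_space_nat[symmetric]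
  by (rule nn_integral_bij_count_space[OF bij_int_decode, of "\<lambda>n. g (Z n x)"])
 have h_T: "h (T x) = h x" if x: "x \<in> space M" for x proof -
  have "h (T x) = (\<integral>\<^sup>+n. g (Z (n + 1) x) \<partial>count_space UNIV)" unfolding h_int using Z_add[OF x, of _ 1] by (simp add: Z_1)
  also have "\<dots> = (\<integral>\<^sup>+n. g (Z n x) \<partial>count_space UNIV)" by (rule nn_integral_bij_count_space[of "\<lambda>n::int. n + 1" UNIV UNIV "\<lambda>n. g (Z n x)"])
    (auto intro!: bij_betwI[of _ _ _ "\<lambda>n. n - 1"])
  finally show ?thesis by (simp add: h_int)
 qed
 define C where "C = {x\<in>space M. h x = \<infinity>}"
 define D where "D = space M - C"
 have C [measurable]: "C \<in> sets M" unfolding C_def by measurable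
 have D [measurable]: "D \<in> sets M" unfolding D_def by measurable
 have img: "T ` space M = space M" using bij_T by (simp add: bij_betw_def)
 have TC: "T ` C = C" proof
  show "T ` C \<subseteq> C" using T_in h_T by (auto simp: C_def)
  show "C \<subseteq> T ` C" proof
   fix y assume y: "y \<in> C"
   then obtain x where "x \<in> space M" "y = T x" using img by (auto simp: C_def)
   then show "y \<in> T ` C" using y h_T by (auto simp: C_def)
  qed
 qed
 have TD: "T ` D = D" proof
  show "T ` D \<subseteq> D" using T_in h_T by (auto simp: C_def D_def)
  show "D \<subseteq> T ` D" proof
   fix y assume y: "y \<in> D"
   then obtain x where "x \<in> space M" "y = T x" using img by (auto simp: D_def)
   then show "y \<in> T ` D" using y h_T by (auto simp: C_def D_def)
  qed
 qed
 have cons: "conservative (restrict_space M C) T" unfolding conservative_def proof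
  assume "\<exists>W. wandering (restrict_space M C) T W \<and> 0 < emeasure (restrict_space M C) W"
  then obtain W where W: "wandering (restrict_space M C) T W" "0 < emeasure (restrict_space M C) W" by blast
  have WC: "W \<in> sets M" "W \<subseteq> C" using W(1) C by (auto simp: wandering_def sets_restrict_space_iff)
  have "wandering M T W" unfolding wandering_def proof (intro conjI allI impI WC)
   fix n m :: int assume "n \<noteq> m"
   then have "int_iterate (restrict_space M C) T n ` W \<inter> int_iterate (restrict_space M C) T m ` W \<in> null_sets (restrict_space M C)"
    using W(1) unfolding wandering_def by blast
   moreover have "int_iterate (restrict_space M C) T n ` W = Z n ` W" for n using restrict_invariant(2)[OF C TC] WC by (intro image_cong) auto
   ultimately show "Z n ` W \<inter> Z m ` W \<in> null_sets M" using C by (simp add: null_sets_restrict_space)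
  qed
  then obtain W0 where W0: "W0 \<in> sets M" "W0 \<subseteq> W" "W - W0 \<in> null_sets M" "\<And>m n. m \<noteq> n \<Longrightarrow> pre m W0 \<inter> pre n W0 = {}" using wandering_exact by blast
  note [measurable] = W0(1)
  have "(\<integral>\<^sup>+x. h x * indicator W0 x \<partial>M) = (\<integral>\<^sup>+x. (\<Sum>k. g (Z (int_decode k) x) * indicator W0 x) \<partial>M)"
   unfolding h_def by (simp add: ennreal_suminf_multc)
  also have "\<dots> = (\<Sum>k. \<integral>\<^sup>+x. g (Z (int_decode k) x) * indicator W0 x \<partial>M)" by (intro nn_integral_suminf) measurable
  also have "\<dots> \<le> (\<integral>\<^sup>+x. g x \<partial>M)" by (rule exact_wandering_sum[OF W0(1,4) g])
  finally have "(\<integral>\<^sup>+x. h x * indicator W0 x \<partial>M) \<noteq> \<infinity>" using gfin by (auto simp: top_unique)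
  then have "AE x in M. h x * indicator W0 x \<noteq> \<infinity>" by (intro nn_integral_PInf_AE) auto
  then have "AE x in M. x \<notin> W0" using AE_space by eventually_elim (use W0(2) WC(2) in \<open>auto simp: C_def\<close>)
  then have "W0 \<in> null_sets M" by (subst AE_iff_null_sets) auto
  then have "W0 \<union> (W - W0) \<in> null_sets M" using W0(3) by (rule null_sets.Un)
  then have "W \<in> null_sets M" by (rule null_sets_subset) (use WC in auto)
  then show False using W(2) WC C by (simp add: emeasure_restrict_space null_setsD1)
 qed
 have diss: "dissipative (restrict_space M D) T" proof -
  \<comment> \<open>The points at which \<open>g\<close> is maximal along the orbit, the earliest
    one in case of ties: later values may be equal, earlier ones must be smaller. This selects
    exactly one point of each orbit in \<open>D\<close>.\<close>
  define W where "W = {x\<in>D. (\<forall>n\<in>{n::int. n > 0}. g (Z n x) \<le> g x) \<and> (\<forall>n\<in>{n::int. n < 0}. g (Z n x) < g x)}"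
  have "W = {x\<in>space M. x \<in> D \<and> (\<forall>n\<in>{n::int. n > 0}. g (Z n x) \<le> g x) \<and> (\<forall>n\<in>{n::int. n < 0}. g (Z n x) < g x)}" by (auto simp: W_def D_def)
  also have "\<dots> \<in> sets M" by measurable
  finally have W: "W \<in> sets M" .
  have WD: "W \<subseteq> D" by (auto simp: W_def)
  have im: "int_iterate (restrict_space M D) T n ` W = Z n ` W" for n using restrict_invariant(2)[OF D TD] WD by (intro image_cong) auto
  have no: False if w: "w \<in> W" "Z k w \<in> W" and k: "k > 0" for w k proof -
   have ws: "w \<in> space M" using w by (auto simp: W_def D_def)
   have "g (Z k w) \<le> g w" using w k by (auto simp: W_def)
   moreover have "g (Z (- k) (Z k w)) < g (Z k w)" using w(2) k unfolding W_def by auto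
   ultimately show False using ws by (simp add: Z_inv)
  qed
  have disj: "Z n ` W \<inter> Z m ` W = {}" if nm: "n \<noteq> m" for n m proof (rule ccontr)
   assume "Z n ` W \<inter> Z m ` W \<noteq> {}"
   then obtain w w' where w: "w \<in> W" "w' \<in> W" "Z n w = Z m w'" by auto
   have sp: "w \<in> space M" "w' \<in> space M" using w by (auto simp: W_def D_def)
   have "Z (n - m) w = w'" using Z_add[OF sp(1), of "- m" n] w(3) Z_inv(1)[OF sp(2), of m] by simp
   moreover have "Z (m - n) w' = w" using Z_add[OF sp(2), of "- n" m] w(3) Z_inv(1)[OF sp(1), of n] by simp
   ultimately show False using no[of w "n - m"] no[of w' "m - n"] w nm by (cases "n > m") auto
  qed
  have cover: "D \<subseteq> (\<Union>n. Z n ` W)" proof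
   fix x assume x: "x \<in> D"
   then have xs: "x \<in> space M" by (auto simp: D_def)
   have fin: "(\<integral>\<^sup>+n. g (Z n x) \<partial>count_space UNIV) < \<infinity>" using x by (auto simp: D_def C_def h_int less_top[symmetric])
   let ?F = "{n. g x \<le> g (Z n x)}"
   have F: "finite ?F" by (rule finite_ge_of_nn_integral_count_space[OF fin gpos[OF xs]])
   have F0: "0 \<in> ?F" by simp
   define v where "v = Max ((\<lambda>n. g (Z n x)) ` ?F)"
   have v_ge: "g (Z n x) \<le> v" for n proof (cases "n \<in> ?F")
    case True then show ?thesis using F unfolding v_def by (intro Max_ge) auto
   next
    case False
    then have "g (Z n x) \<le> g (Z 0 x)" by auto
    also have "\<dots> \<le> v" unfolding v_def by (rule Max_ge[OF finite_imageI[OF F] imageI[OF F0]])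
    finally show ?thesis .
   qed
   let ?V = "{n\<in>?F. g (Z n x) = v}"
   have "v \<in> (\<lambda>n. g (Z n x)) ` ?F" unfolding v_def by (rule Max_in[OF finite_imageI[OF F]]) (use F0 in blast)
   then have V: "finite ?V" "?V \<noteq> {}" using F by auto
   define n0 where "n0 = Min ?V"
   have n0: "n0 \<in> ?V" unfolding n0_def using V by (rule Min_in)
   have "g (Z m x) < v" if "m < n0" for m proof (rule ccontr)
    assume "\<not> ?thesis"
    then have mv: "g (Z m x) = v" using v_ge[of m] by simp
    have "g x \<le> v" using v_ge[of 0] by simp
    then have "m \<in> ?V" using mv by simp
    then have "n0 \<le> m" unfolding n0_def using V by (intro Min_le) auto
    then show False using that by simp
   qed
   moreover have "x \<in> pre n0 D" using x restrict_invariant(3)[OF D TD] by simp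
   then have "Z n0 x \<in> D" by (simp add: pre_iff)
   moreover have "Z m (Z n0 x) = Z (m + n0) x" for m using Z_add[OF xs] by simp
   ultimately have "Z n0 x \<in> W" using n0 v_ge \<open>Z n0 x \<in> D\<close> by (auto simp: W_def)
   moreover have "x = Z (- n0) (Z n0 x)" using xs by (simp add: Z_inv)
   ultimately show "x \<in> (\<Union>n. Z n ` W)" by blast
  qed
  have spD: "space (restrict_space M D) = D" by (auto simp: space_restrict_space D_def)
  show ?thesis unfolding dissipative_def proof (intro exI[of _ W] conjI)
   show "wandering (restrict_space M D) T W" unfolding wandering_def im using disj W WD D by (auto simp: sets_restrict_space_iff)
   have "space (restrict_space M D) - (\<Union>n. int_iterate (restrict_space M D) T n ` W) = {}" unfolding im spD using cover by auto
   then show "space (restrict_space M D) - (\<Union>n. int_iterate (restrict_space M D) T n ` W) \<in> null_sets (restrict_space M D)"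
    by (simp only: null_sets.empty_sets)
  qed
 qed
 show ?thesis by (rule that[of C]) (use C TC cons diss in \<open>simp add: conservative_part_def D_def\<close>)
qed

lemma restrict_no_finite_invariant:
 assumes C: "C \<in> sets M" and TC: "T ` C = C"
 shows "aut.no_finite_invariant (restrict_space M C) T \<longleftrightarrow> (\<forall>A\<in>fmeasurable M. A \<subseteq> C \<longrightarrow> sym_diff A (pre 1 A) \<in> null_sets M \<longrightarrow> A \<in> null_sets M)"
proof -
 interpret R: aut "restrict_space M C" T by standard (rule restrict_invariant(1)[OF C TC])
 have sp: "space (restrict_space M C) = C" using sub_space[OF C] by (auto simp: space_restrict_space)
 have pC: "pre 1 A \<subseteq> C" if "A \<subseteq> C" for A using pre_mono[OF that, of 1] restrict_invariant(3)[OF C TC, of 1] by simp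
 have pre: "R.pre 1 A = pre 1 A" if "A \<subseteq> C" for A using pC[OF that] restrict_invariant(2)[OF C TC, of _ 1] sub_space[OF C]
  by (auto simp: R.pre_iff pre_iff sp subset_eq)
 have fm: "A \<in> fmeasurable (restrict_space M C) \<longleftrightarrow> A \<in> fmeasurable M \<and> A \<subseteq> C" for A
  using C by (auto simp: fmeasurable_def sets_restrict_space_iff emeasure_restrict_space)
 have eq: "sym_diff A (R.pre 1 A) \<in> null_sets (restrict_space M C) \<longleftrightarrow> sym_diff A (pre 1 A) \<in> null_sets M"
   "A \<in> null_sets (restrict_space M C) \<longleftrightarrow> A \<in> null_sets M" if "A \<subseteq> C" for A
 proof -
  have "sym_diff A (pre 1 A) \<subseteq> C" using that pC[OF that] by auto
  then show "sym_diff A (R.pre 1 A) \<in> null_sets (restrict_space M C) \<longleftrightarrow> sym_diff A (pre 1 A) \<in> null_sets M"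
   by (simp only: null_sets_restrict_space[OF C] pre[OF that]) simp
  show "A \<in> null_sets (restrict_space M C) \<longleftrightarrow> A \<in> null_sets M" using that by (simp only: null_sets_restrict_space[OF C]) simp
 qed
 show ?thesis unfolding R.no_finite_invariant_def Ball_def fm proof (intro iffI allI impI)
  fix A assume "\<forall>A. A \<in> fmeasurable M \<and> A \<subseteq> C \<longrightarrow> sym_diff A (R.pre 1 A) \<in> null_sets (restrict_space M C) \<longrightarrow> A \<in> null_sets (restrict_space M C)"
   "A \<in> fmeasurable M" "A \<subseteq> C" "sym_diff A (pre 1 A) \<in> null_sets M"
  then show "A \<in> null_sets M" using eq[of A] by blast
 next
  fix A assume "\<forall>A. A \<in> fmeasurable M \<longrightarrow> A \<subseteq> C \<longrightarrow> sym_diff A (pre 1 A) \<in> null_sets M \<longrightarrow> A \<in> null_sets M"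
   "A \<in> fmeasurable M \<and> A \<subseteq> C" "sym_diff A (R.pre 1 A) \<in> null_sets (restrict_space M C)"
  then show "A \<in> null_sets (restrict_space M C)" using eq[of A] by blast
 qed
qed

text \<open>On the conservative part, invariant probabilities and invariant sets of finite positive
  measure exist together: normalised restriction in one direction, level sets of a density in the
  other. The dissipative part contains no such set, so the condition may be stated on the whole
  space.\<close>

lemma type_II_infinity_iff:
 assumes sf: "sigma_finite_measure M"
 shows "type_II_infinity_on_conservative_part M T \<longleftrightarrow> no_finite_invariant"
proof
 assume ni: no_finite_invariant
 obtain C where C: "conservative_part M T C" using Hopf_decomposition[OF sf] .
 then have C': "C \<in> sets M" "T ` C = C" "conservative (restrict_space M C) T" by (auto simp: conservative_part_def)
 interpret R: aut "restrict_space M C" T by standard (rule restrict_invariant(1)[OF C'(1,2)])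
 have "R.no_finite_invariant" unfolding restrict_no_finite_invariant[OF C'(1,2)] using ni unfolding no_finite_invariant_def by blast
 then have "type_II_infinity (restrict_space M C) T"
  unfolding type_II_infinity_def using C'(3) R.no_invariant_prob[OF sigma_finite_measure_restrict_space[OF sf C'(1)]] by blast
 then show "type_II_infinity_on_conservative_part M T" unfolding type_II_infinity_on_conservative_part_def using C by blast
next
 assume "type_II_infinity_on_conservative_part M T"
 then obtain C where C: "conservative_part M T C" "type_II_infinity (restrict_space M C) T"
  unfolding type_II_infinity_on_conservative_part_def by blast
 then have C': "C \<in> sets M" "T ` C = C" "dissipative (restrict_space M (space M - C)) T" by (auto simp: conservative_part_def)
 have sub: "C \<subseteq> space M" using C'(1) by (rule sub_space)
 interpret R: aut "restrict_space M C" T by standard (rule restrict_invariant(1)[OF C'(1,2)])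
 have 1: "R.no_finite_invariant" unfolding R.no_finite_invariant_def using R.invariant_prob C(2) unfolding type_II_infinity_def by blast
 let ?D = "space M - C"
 have D: "?D \<in> sets M" using C' by auto
 have TD: "T ` ?D = ?D" using bij_T C'(2) sub by (auto simp: bij_betw_def inj_on_image_set_diff[of T "space M"])
 interpret R2: aut "restrict_space M ?D" T by standard (rule restrict_invariant(1)[OF D TD])
 have 2: "R2.no_finite_invariant" using R2.dissipative_no_finite_invariant[OF C'(3)] .
 show no_finite_invariant unfolding no_finite_invariant_def proof (intro ballI impI)
  fix A assume A: "A \<in> fmeasurable M" and inv: "sym_diff A (pre 1 A) \<in> null_sets M"
  have As: "A \<in> sets M" using A by auto
  have part: "A \<inter> C1 \<in> null_sets M" if C1: "C1 \<in> sets M" "T ` C1 = C1" "aut.no_finite_invariant (restrict_space M C1) T" for C1 proof -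
   have "sym_diff (A \<inter> C1) (pre 1 (A \<inter> C1)) \<in> null_sets M" proof (rule null_sets_subset[OF inv])
    show "sym_diff (A \<inter> C1) (pre 1 (A \<inter> C1)) \<in> sets M" using As C1 pre_sets by auto
    show "sym_diff (A \<inter> C1) (pre 1 (A \<inter> C1)) \<subseteq> sym_diff A (pre 1 A)" using restrict_invariant(3)[OF C1(1,2), of 1] by (auto simp: pre_Int)
   qed
   moreover have "A \<inter> C1 \<in> fmeasurable M" using A C1 by (intro fmeasurableI2[OF A]) auto
   ultimately show ?thesis using C1(3) unfolding restrict_no_finite_invariant[OF C1(1,2)] by auto
  qed
  have "(A \<inter> C) \<union> (A \<inter> ?D) \<in> null_sets M" using part[OF C'(1,2) 1] part[OF D TD 2] by auto
  moreover have "(A \<inter> C) \<union> (A \<inter> ?D) = A" using sub_space[OF As] by auto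
  ultimately show "A \<in> null_sets M" by simp
 qed
qed

end

section \<open>Mild mixing\<close>

text \<open>The measures live on a field that may be larger than the one generated by
  \<open>G\<close>, so agreement is claimed on the latter only; equality of the total masses stands
  in for an exhausting sequence in \<open>G\<close>.\<close>

lemma finite_measures_agree:
 assumes fin: "finite_measure K" "finite_measure L" and s: "sets K = sets L" and G: "Int_stable G" "G \<subseteq> sets K"
  and eq: "\<And>X. X \<in> G \<Longrightarrow> emeasure K X = emeasure L X" and sp: "emeasure K (space K) = emeasure L (space K)" and X: "X \<in> sigma_sets (space K) G"
 shows "emeasure K X = emeasure L X"
proof -
 interpret K: finite_measure K by fact
 interpret L: finite_measure L by fact
 have spL: "space L = space K" using sets_eq_imp_space_eq[OF s] by simp
 have sub: "sigma_sets (space K) G \<subseteq> sets K" by (rule sets.sigma_sets_subset[OF G(2)])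
 have P: "G \<subseteq> Pow (space K)" using G(2) sub_space by blast
 show ?thesis proof (rule sigma_sets_induct_disjoint[OF G(1) P X])
  fix A assume A: "A \<in> sigma_sets (space K) G" "emeasure K A = emeasure L A"
  have "A \<in> sets K" "A \<in> sets L" using A sub s by auto
  then show "emeasure K (space K - A) = emeasure L (space K - A)" using A(2) sp emeasure_compl[of A K] emeasure_compl[of A L] spL by simp
 next
  fix A :: "nat \<Rightarrow> _" assume A: "disjoint_family A" "range A \<subseteq> sigma_sets (space K) G" "\<And>i. emeasure K (A i) = emeasure L (A i)"
  have r: "range A \<subseteq> sets K" "range A \<subseteq> sets L" using A(2) sub s by auto
  show "emeasure K (\<Union>i. A i) = emeasure L (\<Union>i. A i)"
   unfolding suminf_emeasure[OF r(1) A(1), symmetric] suminf_emeasure[OF r(2) A(1), symmetric] A(3) by (rule refl)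
 qed (simp_all add: eq)
qed

text \<open>Subadditivity bounds \<open>d\<close> on finite unions by partial sums of the series;
  \<open>bound\<close> keeps the measures of these unions bounded, so the infinite union has finite
  measure, and the Lipschitz hypothesis \<open>cont\<close> carries the estimate to the
  limit.\<close>

lemma summable_Sup_limsup_bound:
 fixes d :: "'a set \<Rightarrow> real"
 assumes nonneg: "\<And>B. B \<in> fmeasurable M \<Longrightarrow> 0 \<le> d B" and submod: "\<And>A B. A \<in> fmeasurable M \<Longrightarrow> B \<in> fmeasurable M \<Longrightarrow> d (A \<union> B) \<le> d A + d B"
  and cont: "\<And>A B. A \<in> fmeasurable M \<Longrightarrow> B \<in> fmeasurable M \<Longrightarrow> A \<subseteq> B \<Longrightarrow> \<bar>d A - d B\<bar> \<le> K * measure M (B - A)"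
  and bound: "\<And>B. B \<in> fmeasurable M \<Longrightarrow> measure M B \<le> K' * (1 + d B)" and K: "K \<ge> 0" "K' \<ge> 0"
  and B: "\<And>k::nat. B k \<in> fmeasurable M" and sum: "summable (\<lambda>k. d (B k))"
 shows "(\<Union>k\<in>{j..}. B k) \<in> fmeasurable M" "d (\<Union>k\<in>{j..}. B k) \<le> (\<Sum>k. d (B (k + j)))"
proof -
 define V where "V n = (\<Union>k\<in>{j..<j+n}. B k)" for n
 define sig where "sig = (\<Sum>k. d (B (k + j)))"
 have V: "V n \<in> fmeasurable M" for n unfolding V_def using B by (intro fmeasurable.finite_UN) auto
 have sm: "summable (\<lambda>k. d (B (k + j)))" by (rule summable_ignore_initial_segment[OF sum])
 have dV: "d (V (Suc n)) \<le> (\<Sum>k<Suc n. d (B (k + j)))" for n proof (induction n)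
  case 0
  have "V (Suc 0) = B j" by (auto simp: V_def)
  then show ?case by simp
 next
  case (Suc n)
  have "V (Suc (Suc n)) = V (Suc n) \<union> B (Suc n + j)" by (auto simp: V_def atLeastLessThanSuc add.commute)
  then have "d (V (Suc (Suc n))) \<le> d (V (Suc n)) + d (B (Suc n + j))" using submod[OF V B] by simp
  then show ?case using Suc by simp
 qed
 have d_sig: "d (V (Suc n)) \<le> sig" for n using dV[of n] sum_le_suminf[OF sm, of "{..<Suc n}"] nonneg B unfolding sig_def by fastforce
 have mV: "measure M (V (Suc n)) \<le> K' * (1 + sig)" for n
  using bound[OF V, of "Suc n"] mult_left_mono[OF _ K(2), of "1 + d (V (Suc n))" "1 + sig"] d_sig[of n] by linarith
 have U: "(\<Union>k\<in>{j..}. B k) = (\<Union>n. V (Suc n))" proof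
  show "(\<Union>k\<in>{j..}. B k) \<subseteq> (\<Union>n. V (Suc n))" proof
   fix x assume "x \<in> (\<Union>k\<in>{j..}. B k)"
   then obtain k where "k \<ge> j" "x \<in> B k" by auto
   then have "x \<in> V (Suc (k - j))" by (auto simp: V_def)
   then show "x \<in> (\<Union>n. V (Suc n))" by blast
  qed
 qed (auto simp: V_def)
 have inc: "incseq (\<lambda>n. V (Suc n))" unfolding incseq_def V_def by (intro allI impI UN_mono) auto
 have rng: "range (\<lambda>n. V (Suc n)) \<subseteq> sets M" using V by (auto simp: fmeasurableD)
 have lim: "(\<lambda>n. emeasure M (V (Suc n))) \<longlonglongrightarrow> emeasure M (\<Union>n. V (Suc n))" by (rule Lim_emeasure_incseq[OF rng inc])
 have "emeasure M (\<Union>n. V (Suc n)) \<le> ennreal (K' * (1 + sig))" proof (rule LIMSEQ_le_const2[OF lim], intro exI allI impI)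
  fix n show "emeasure M (V (Suc n)) \<le> ennreal (K' * (1 + sig))"
   using mV[of n] V[of "Suc n"] by (subst emeasure_eq_measure2) (auto intro: ennreal_leI)
 qed
 then show Ufm: "(\<Union>k\<in>{j..}. B k) \<in> fmeasurable M" unfolding U using rng by (auto simp: fmeasurable_def intro: le_less_trans)
 have "(\<lambda>n. measure M (V (Suc n))) \<longlonglongrightarrow> measure M (\<Union>n. V (Suc n))"
  using Ufm unfolding U by (intro Lim_measure_incseq[OF rng inc]) (auto simp: fmeasurable_def)
 then have "(\<lambda>n. K * (measure M (\<Union>n. V (Suc n)) - measure M (V (Suc n)))) \<longlonglongrightarrow> K * (measure M (\<Union>n. V (Suc n)) - measure M (\<Union>n. V (Suc n)))"
  by (intro tendsto_intros)
 then have l2: "(\<lambda>n. sig + K * (measure M (\<Union>n. V (Suc n)) - measure M (V (Suc n)))) \<longlonglongrightarrow> sig + 0" by (intro tendsto_add tendsto_const) simp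
 have "d (\<Union>n. V (Suc n)) \<le> sig + 0" proof (rule LIMSEQ_le_const[OF l2], intro exI allI impI)
  fix n
  have sub: "V (Suc n) \<subseteq> (\<Union>n. V (Suc n))" by blast
  have "measure M ((\<Union>n. V (Suc n)) - V (Suc n)) = measure M (\<Union>n. V (Suc n)) - measure M (V (Suc n))"
   using Ufm V[of "Suc n"] sub unfolding U by (intro measure_Diff) (auto simp: fmeasurable_def)
  then show "d (\<Union>n. V (Suc n)) \<le> sig + K * (measure M (\<Union>n. V (Suc n)) - measure M (V (Suc n)))"
   using cont[OF V _ sub] Ufm d_sig[of n] unfolding U by (simp add: abs_le_iff)
 qed
 then show "d (\<Union>k\<in>{j..}. B k) \<le> (\<Sum>k. d (B (k + j)))" by (simp add: U sig_def)
qed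

lemma fast_subseq_to_0:
 fixes x :: "nat \<Rightarrow> real"
 assumes "x \<longlonglongrightarrow> 0"
 obtains r where "strict_mono r" "\<And>k. x (r k) \<le> (1/2)^k"
proof -
 have "\<exists>r. strict_mono r \<and> (\<forall>k. \<bar>x (r k)\<bar> < (1/2)^k)" proof -
  have "\<exists>N. \<forall>k. \<forall>n\<ge>N k. \<bar>x n\<bar> < (1/2)^k" proof (rule choice, rule allI)
   fix k
   show "\<exists>y. \<forall>n\<ge>y. \<bar>x n\<bar> < (1/2)^k" using LIMSEQ_D[OF assms, of "(1/2)^k"] by auto
  qed
  then obtain N where N: "\<And>k n. n \<ge> N k \<Longrightarrow> \<bar>x n\<bar> < (1/2)^k" by blast
  define r where "r k = (\<Sum>j\<le>k. N j) + k" for k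
  have "r k \<ge> N k" for k by (auto simp: r_def intro!: trans_le_add1 member_le_sum)
  moreover have "strict_mono r" by (rule strict_monoI_Suc) (simp add: r_def)
  ultimately show ?thesis using N by blast
 qed
 then show ?thesis using that by (metis abs_ge_self less_imp_le order_trans)
qed

text \<open>Applied to \<open>d B = sup J - J B\<close> for a supermodular \<open>J\<close>: maximisers exist, and a largest one attracts
 every maximising sequence of sets of its measure.\<close>

lemma attracting_maximizer:
 fixes d :: "'a set \<Rightarrow> real"
 assumes nonneg: "\<And>B. B \<in> fmeasurable M \<Longrightarrow> 0 \<le> d B" and submod: "\<And>A B. A \<in> fmeasurable M \<Longrightarrow> B \<in> fmeasurable M \<Longrightarrow> d (A \<union> B) \<le> d A + d B"
  and cont: "\<And>A B. A \<in> fmeasurable M \<Longrightarrow> B \<in> fmeasurable M \<Longrightarrow> A \<subseteq> B \<Longrightarrow> \<bar>d A - d B\<bar> \<le> K * measure M (B - A)"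
  and bound: "\<And>B. B \<in> fmeasurable M \<Longrightarrow> measure M B \<le> K' * (1 + d B)" and K: "K \<ge> 0" "K' \<ge> 0" and inf: "\<And>e. e > 0 \<Longrightarrow> \<exists>B\<in>fmeasurable M. d B < e"
 obtains Bmax where "Bmax \<in> fmeasurable M" "d Bmax = 0"
  "\<And>B. (\<And>k::nat. B k \<in> fmeasurable M) \<Longrightarrow> (\<And>k. measure M (B k) = measure M Bmax) \<Longrightarrow> (\<lambda>k. d (B k)) \<longlonglongrightarrow> 0 \<Longrightarrow>
   \<exists>r. strict_mono r \<and> (\<lambda>k. measure M (sym_diff Bmax (B (r k)))) \<longlonglongrightarrow> 0"
proof -
 have ub: "(\<Union>k\<in>{j..}. B k) \<in> fmeasurable M" "d (\<Union>k\<in>{j..}. B k) \<le> (\<Sum>k. d (B (k + j)))"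
  if B: "\<And>k::nat. B k \<in> fmeasurable M" and sum: "summable (\<lambda>k. d (B k))" for B j
 proof -
  show "(\<Union>k\<in>{j..}. B k) \<in> fmeasurable M" by (rule summable_Sup_limsup_bound(1)[of M d K K', OF _ _ _ _ K B sum])
    (erule nonneg, erule (1) submod, erule (2) cont, erule bound)
  show "d (\<Union>k\<in>{j..}. B k) \<le> (\<Sum>k. d (B (k + j)))" by (rule summable_Sup_limsup_bound(2)[of M d K K', OF _ _ _ _ K B sum])
    (erule nonneg, erule (1) submod, erule (2) cont, erule bound)
 qed
 \<comment> \<open>The upper limit of the sets: tails of a convergent series tend to
   \<open>0\<close>, so it is a zero of \<open>d\<close>, and the tail unions shrink to it in
   measure.\<close>
 have lim: "(\<Inter>j. \<Union>k\<in>{j..}. B k) \<in> fmeasurable M \<and> d (\<Inter>j. \<Union>k\<in>{j..}. B k) = 0 \<and> (\<lambda>j. measure M ((\<Union>k\<in>{j..}. B k) - (\<Inter>j. \<Union>k\<in>{j..}. B k))) \<longlonglongrightarrow> 0"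
  if B: "\<And>k::nat. B k \<in> fmeasurable M" and sum: "summable (\<lambda>k. d (B k))" for B
 proof -
  let ?U = "\<lambda>j. \<Union>k\<in>{j..}. B k" and ?L = "\<Inter>j. \<Union>k\<in>{j..}. B k"
  have U: "?U j \<in> fmeasurable M" "d (?U j) \<le> (\<Sum>k. d (B (k + j)))" for j using ub[OF B sum] by auto
  have Us: "?U j \<in> sets M" for j using U(1) by blast
  have Ls: "?L \<in> sets M" using Us by auto
  have sub: "?L \<subseteq> ?U j" for j by blast
  have L: "?L \<in> fmeasurable M" by (rule fmeasurableI2[OF U(1)[of 0] sub Ls])
  have dec: "decseq ?U" by (intro decseq_SucI UN_mono) auto
  have "(\<lambda>j. measure M (?U j)) \<longlonglongrightarrow> measure M ?L" by (intro Lim_measure_decseq dec) (use Us fmeasurableD2[OF U(1)] in auto)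
  then have "(\<lambda>j. measure M (?U j) - measure M ?L) \<longlonglongrightarrow> measure M ?L - measure M ?L" by (intro tendsto_intros)
  moreover have dm: "measure M (?U j - ?L) = measure M (?U j) - measure M ?L" for j
   using U(1)[of j] Ls sub by (intro measure_Diff) (auto simp: fmeasurable_def)
  ultimately have m0: "(\<lambda>j. measure M (?U j - ?L)) \<longlonglongrightarrow> 0" by simp
  have t0: "(\<lambda>j. (\<Sum>k. d (B (k + j)))) \<longlonglongrightarrow> 0" using suminf_exist_split2[OF sum] by simp
  have "(\<lambda>j. (\<Sum>k. d (B (k + j))) + K * measure M (?U j - ?L)) \<longlonglongrightarrow> 0 + K * 0" by (intro tendsto_intros t0 m0)
  then have "d ?L \<le> 0 + K * 0" proof (rule LIMSEQ_le_const, intro exI allI impI)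
   fix j show "d ?L \<le> (\<Sum>k. d (B (k + j))) + K * measure M (?U j - ?L)" using cont[OF L U(1)[of j] sub] U(2)[of j] by (simp add: abs_le_iff)
  qed
  then show ?thesis using L m0 nonneg[OF L] by simp
 qed
 have ex0: "\<exists>B\<in>fmeasurable M. d B = 0" proof -
  have "\<forall>k::nat. \<exists>B. B \<in> fmeasurable M \<and> d B < (1/2)^k" using inf by (metis zero_less_power half_gt_zero zero_less_one)
  then obtain B where B: "\<And>k::nat. B k \<in> fmeasurable M" "\<And>k. d (B k) < (1/2)^k" by metis
  have "summable (\<lambda>k. d (B k))"
   by (rule summable_comparison_test[where g = "\<lambda>k. (1/2)^k"]) (use B nonneg in \<open>auto simp: summable_geometric intro!: exI[of _ 0] less_imp_le\<close>)
  from lim[OF B(1) this] show ?thesis by blast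
 qed
 \<comment> \<open>The zeros of \<open>d\<close> have bounded measure and are stable under countable
   unions, so there is a zero of largest measure; it contains every other zero up to a null
   set.\<close>
 let ?M0 = "measure M ` {B\<in>fmeasurable M. d B = 0}"
 have bdd: "bdd_above ?M0" using bound by (intro bdd_aboveI[of _ "K' * (1 + 0)"]) force
 have ne: "?M0 \<noteq> {}" using ex0 by auto
 define m where "m = Sup ?M0"
 have "\<forall>k::nat. \<exists>B. B \<in> fmeasurable M \<and> d B = 0 \<and> m - 1 / real (Suc k) < measure M B" proof
  fix k :: nat
  have "m - 1 / real (Suc k) < Sup ?M0" by (simp add: m_def)
  then show "\<exists>B. B \<in> fmeasurable M \<and> d B = 0 \<and> m - 1 / real (Suc k) < measure M B" using less_cSup_iff[OF ne bdd] by auto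
 qed
 then obtain B where B: "\<And>k::nat. B k \<in> fmeasurable M" "\<And>k. d (B k) = 0" "\<And>k. m - 1 / real (Suc k) < measure M (B k)" by metis
 have "summable (\<lambda>k. d (B k))" using B(2) by simp
 note u = ub[OF B(1) this, of 0]
 define Bm where "Bm = (\<Union>k\<in>{0..}. B k)"
 have Bm: "Bm \<in> fmeasurable M" "d Bm = 0" using u B(2) nonneg[of Bm] unfolding Bm_def by auto
 have mBm: "m \<le> measure M Bm" proof (rule field_le_epsilon)
  fix e :: real assume "e > 0"
  then obtain k where "1 / real (Suc k) < e" using nat_approx_posE by blast
  moreover have "measure M (B k) \<le> measure M Bm" using Bm B(1) by (intro measure_mono_fmeasurable) (auto simp: Bm_def)
  ultimately show "m \<le> measure M Bm + e" using B(3)[of k] by linarith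
 qed
 have maximal: "measure M (L - Bm) = 0" if L: "L \<in> fmeasurable M" "d L = 0" for L proof -
  have LB: "L \<union> Bm \<in> fmeasurable M" using L Bm by auto
  have "d (L \<union> Bm) = 0" using submod[OF L(1) Bm(1)] nonneg[OF LB] L Bm by simp
  then have "measure M (L \<union> Bm) \<le> m" unfolding m_def using LB bdd by (intro cSup_upper) auto
  moreover have "measure M (L \<union> Bm) = measure M Bm + measure M (L - Bm)" proof -
   have "measure M (Bm \<union> (L - Bm)) = measure M Bm + measure M (L - Bm)"
    using L Bm fmeasurable_Diff[OF L(1), of Bm] by (intro measure_Union) (auto simp: fmeasurable_def)
   then show ?thesis by (simp add: Un_commute)
  qed
  ultimately show ?thesis using mBm measure_nonneg[of M "L - Bm"] by linarith
 qed
 show thesis proof (rule that[OF Bm])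
  fix B :: "nat \<Rightarrow> 'a set"
  assume B: "\<And>k. B k \<in> fmeasurable M" "\<And>k. measure M (B k) = measure M Bm" and d0: "(\<lambda>k. d (B k)) \<longlonglongrightarrow> 0"
  obtain r where r: "strict_mono r" "\<And>k. d (B (r k)) \<le> (1/2)^k" by (rule fast_subseq_to_0[OF d0]) (rule that)
  have sm: "summable (\<lambda>k. d (B (r k)))"
   by (rule summable_comparison_test[where g = "\<lambda>k. (1/2)^k"]) (use B nonneg r in \<open>auto simp: summable_geometric intro!: exI[of _ 0]\<close>)
  let ?U = "\<lambda>j. \<Union>k\<in>{j..}. B (r k)" and ?L = "\<Inter>j. \<Union>k\<in>{j..}. B (r k)"
  have L: "?L \<in> fmeasurable M" "d ?L = 0" "(\<lambda>j. measure M (?U j - ?L)) \<longlonglongrightarrow> 0" using lim[OF _ sm] B(1) by auto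
  have U: "?U j \<in> fmeasurable M" for j using ub(1)[of "\<lambda>k. B (r k)", OF _ sm] B(1) by auto
  have le: "measure M (sym_diff Bm (B (r j))) \<le> 2 * measure M (?U j - ?L)" for j proof -
   have D: "B (r j) - Bm \<in> fmeasurable M" "Bm - B (r j) \<in> fmeasurable M" using B Bm by (auto intro: fmeasurable_Diff)
   have "measure M (B (r j) - Bm) \<le> measure M ((?U j - ?L) \<union> (?L - Bm))"
    using U L Bm D by (intro measure_mono_fmeasurable) (auto intro!: fmeasurable.Un fmeasurable_Diff)
   also have "\<dots> \<le> measure M (?U j - ?L) + measure M (?L - Bm)" using U[of j] L(1) Bm(1) by (intro measure_Un_le sets.Diff) auto
   finally have 1: "measure M (B (r j) - Bm) \<le> measure M (?U j - ?L)" using maximal[OF L(1,2)] by simp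
   have IB: "B (r j) \<inter> Bm \<in> fmeasurable M" using B Bm by auto
   have "measure M (B (r j) \<inter> Bm) + measure M (B (r j) - Bm) = measure M (B (r j))"
    using IB D by (subst measure_Union[symmetric]) (auto simp: fmeasurable_def Int_Diff_Un)
   moreover have "measure M (B (r j) \<inter> Bm) + measure M (Bm - B (r j)) = measure M Bm" proof -
    have "measure M ((B (r j) \<inter> Bm) \<union> (Bm - B (r j))) = measure M (B (r j) \<inter> Bm) + measure M (Bm - B (r j))"
     using IB D by (intro measure_Union) (auto simp: fmeasurable_def)
    moreover have "(B (r j) \<inter> Bm) \<union> (Bm - B (r j)) = Bm" by auto
    ultimately show ?thesis by simp
   qed
   \<comment> \<open>Here equality of the measures enters: it turns the one-sided estimate for
     \<open>B (r j) - Bm\<close> into one for the symmetric difference.\<close>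
   ultimately have 2: "measure M (Bm - B (r j)) = measure M (B (r j) - Bm)" using B(2)[of "r j"] by linarith
   have "measure M (sym_diff Bm (B (r j))) \<le> measure M (Bm - B (r j)) + measure M (B (r j) - Bm)" using D by (intro measure_Un_le) auto
   then show ?thesis using 1 2 by linarith
  qed
  have l2: "(\<lambda>j. 2 * measure M (?U j - ?L)) \<longlonglongrightarrow> 2 * 0" by (intro tendsto_intros L)
  have "(\<lambda>j. measure M (sym_diff Bm (B (r j)))) \<longlonglongrightarrow> 0" proof (rule tendsto_sandwich[OF _ _ tendsto_const])
   show "eventually (\<lambda>j. 0 \<le> measure M (sym_diff Bm (B (r j)))) sequentially" by (intro always_eventually allI measure_nonneg)
   show "eventually (\<lambda>j. measure M (sym_diff Bm (B (r j))) \<le> 2 * measure M (?U j - ?L)) sequentially" by (intro always_eventually allI le)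
   show "(\<lambda>j. 2 * measure M (?U j - ?L)) \<longlonglongrightarrow> 0" using l2 by simp
  qed
  then show "\<exists>r. strict_mono r \<and> (\<lambda>k. measure M (sym_diff Bm (B (r k)))) \<longlonglongrightarrow> 0" using r(1) by blast
 qed
qed

section \<open>Conditioning on the points in a set\<close>

context poisson
begin

abbreviation Fld :: "'a set \<Rightarrow> 'a measure measure" where "Fld B \<equiv> cylm M (below B)"

lemma subalgebra_Fld: "subalgebra P (Fld B)" unfolding subalgebra_def sets_cylm space_cylm space_P using cyl_sub[of "below B"] by auto

lemma sfs: "sigma_finite_subalgebra P (Fld B)" by (rule finite_measure_subalgebra_is_sigma_finite, unfold_locales, rule subalgebra_Fld)

lemma Fld_meas_P: "f \<in> borel_measurable (Fld B) \<Longrightarrow> f \<in> borel_measurable P" by (rule measurable_from_subalg[OF subalgebra_Fld])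

lemma Fld_mono: assumes "A \<subseteq> B" "f \<in> borel_measurable (Fld A)" shows "f \<in> borel_measurable (Fld B)"
proof -
 have "subalgebra (Fld B) (Fld A)" unfolding subalgebra_def sets_cylm space_cylm using assms(1) cyl_mono[of "below A" "below B" M] by auto
 then show ?thesis using assms(2) by (rule measurable_from_subalg)
qed

text \<open>A version of the conditional probability with values in \<open>[0, 1]\<close>
  everywhere; the truncation changes it on a null set only, and bounds then hold without exceptional
  sets.\<close>

definition cexp :: "'a measure set \<Rightarrow> 'a set \<Rightarrow> 'a measure \<Rightarrow> real" where "cexp E B w = max 0 (min 1 (real_cond_exp P (Fld B) (indicator E) w))"

lemma cexp_meas: "cexp E B \<in> borel_measurable (Fld B)" unfolding cexp_def[abs_def] by measurable

lemma cexp_meas_P [measurable]: "cexp E B \<in> borel_measurable P" by (rule Fld_meas_P[OF cexp_meas])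

lemma cexp_01 [simp]: "0 \<le> cexp E B w" "cexp E B w \<le> 1" by (auto simp: cexp_def)

lemma bounded_integrable:
 fixes f :: "'a measure \<Rightarrow> real"
 shows "f \<in> borel_measurable P \<Longrightarrow> (\<And>x. \<bar>f x\<bar> \<le> K) \<Longrightarrow> integrable P f" by (rule integrable_const_bound[where B=K]) auto

lemma cexp_AE: assumes E: "E \<in> events" shows "AE w in P. cexp E B w = real_cond_exp P (Fld B) (indicator E) w"
proof -
 interpret s: sigma_finite_subalgebra P "Fld B" by (rule sfs)
 have i: "integrable P (indicator E :: _ \<Rightarrow> real)" using E by (intro bounded_integrable[where K=1]) auto
 have "AE w in P. real_cond_exp P (Fld B) (indicator E) w \<ge> 0" "AE w in P. real_cond_exp P (Fld B) (indicator E) w \<le> 1"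
  using i by (auto intro!: s.real_cond_exp_ge_c s.real_cond_exp_le_c simp: indicator_def)
 then show ?thesis by eventually_elim (simp add: cexp_def)
qed

lemma cexp_intg:
 assumes E: "E \<in> events" and g: "g \<in> borel_measurable (Fld B)" and b: "\<And>x. \<bar>g x\<bar> \<le> K"
 shows "(\<integral>x. g x * cexp E B x \<partial>P) = (\<integral>x. g x * indicator E x \<partial>P)"
proof -
 interpret s: sigma_finite_subalgebra P "Fld B" by (rule sfs)
 have gP [measurable]: "g \<in> borel_measurable P" by (rule Fld_meas_P[OF g])
 have K: "0 \<le> K" using b[of undefined] by linarith
 have "(\<integral>x. g x * cexp E B x \<partial>P) = (\<integral>x. g x * real_cond_exp P (Fld B) (indicator E) x \<partial>P)"
  using cexp_AE[OF E, of B] by (intro integral_cong_AE) (auto intro: borel_measurable_cond_exp2)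
 also have "\<dots> = (\<integral>x. g x * indicator E x \<partial>P)"
  by (intro s.real_cond_exp_intg g bounded_integrable[where K=K]) (use E b K in \<open>auto simp: indicator_def\<close>)
 finally show ?thesis .
qed

lemma cexp_int_event: assumes "E \<in> events" "G \<in> cyl M (below B)" shows "(\<integral>x. indicator G x * cexp E B x \<partial>P) = prob (E \<inter> G)"
proof -
 have G: "indicator G \<in> borel_measurable (Fld B)" using assms(2) by (intro borel_measurable_indicator) (simp add: sets_cylm)
 have "(\<integral>x. indicator G x * cexp E B x \<partial>P) = (\<integral>x. indicator G x * indicator E x \<partial>P)"
  by (rule cexp_intg[OF assms(1) G, where K=1]) (auto simp: indicator_def)
 also have "\<dots> = (\<integral>x. indicator (E \<inter> G) x \<partial>P)" by (intro bint_cong) (auto simp: indicator_def)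
 also have "\<dots> = prob (E \<inter> G)" using assms cyl_below_events[OF assms(2)] by simp
 finally show ?thesis .
qed

lemma cexp_unique:
 assumes E: "E \<in> events" and h: "h \<in> borel_measurable (Fld B)" "\<And>x. \<bar>h x\<bar> \<le> K"
  and eq: "\<And>G. G \<in> cyl M (below B) \<Longrightarrow> (\<integral>x. indicator G x * h x \<partial>P) = prob (E \<inter> G)"
 shows "AE x in P. cexp E B x = h x"
proof -
 interpret s: sigma_finite_subalgebra P "Fld B" by (rule sfs)
 have hP [measurable]: "h \<in> borel_measurable P" by (rule Fld_meas_P[OF h(1)])
 have "AE x in P. real_cond_exp P (Fld B) (indicator E) x = h x" proof (rule s.real_cond_exp_charact)
  fix G assume "G \<in> sets (Fld B)"
  then have G: "G \<in> cyl M (below B)" by (simp add: sets_cylm)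
  have "(\<integral>x\<in>G. indicator E x \<partial>P) = (\<integral>x. indicator (E \<inter> G) x \<partial>P)"
   unfolding set_lebesgue_integral_def by (intro bint_cong) (auto simp: indicator_def)
  also have "\<dots> = prob (E \<inter> G)" using E cyl_below_events[OF G] by simp
  also have "\<dots> = (\<integral>x\<in>G. h x \<partial>P)" using eq[OF G] by (simp add: set_lebesgue_integral_def)
  finally show "(\<integral>x\<in>G. indicator E x \<partial>P) = (\<integral>x\<in>G. h x \<partial>P)" .
 next
  show "integrable P (indicator E :: _ \<Rightarrow> real)" using E by (intro bounded_integrable[where K=1]) auto
  show "integrable P h" using h by (intro bounded_integrable[where K=K]) auto
 qed fact
 then show ?thesis using cexp_AE[OF E, of B] by eventually_elim simp
qed

text \<open>The squared norm of the projection of \<open>indicator E\<close> onto the functions of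
  the points in \<open>B\<close>: it measures how much of \<open>E\<close> is seen in
  \<open>B\<close>, between the square of the probability of \<open>E\<close> and that probability
  itself.\<close>

definition wgt :: "'a measure set \<Rightarrow> 'a set \<Rightarrow> real" where "wgt E B = (\<integral>w. (cexp E B w)\<^sup>2 \<partial>P)"

lemma int_prod:
 fixes f g :: "'a measure \<Rightarrow> real"
 assumes [measurable]: "f \<in> borel_measurable P" "g \<in> borel_measurable P" and "\<And>x. \<bar>f x\<bar> \<le> 1" "\<And>x. \<bar>g x\<bar> \<le> 1"
 shows "integrable P (\<lambda>x. f x * g x)" by (rule bounded_integrable[where K=1]) (use assms in \<open>auto simp: abs_mult intro: mult_le_one\<close>)

lemma wgt_alt: assumes "E \<in> events" shows "wgt E B = (\<integral>w. cexp E B w * indicator E w \<partial>P)"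
 unfolding wgt_def power2_eq_square by (rule cexp_intg[OF assms cexp_meas, where K=1]) auto

lemma cexp_cexp: assumes "E \<in> events" "A \<subseteq> B" shows "(\<integral>w. cexp E A w * cexp E B w \<partial>P) = wgt E A" unfolding wgt_alt[OF assms(1)]
 by (rule cexp_intg[OF assms(1) Fld_mono[OF assms(2) cexp_meas], where K=1]) auto

lemma wgt_nonneg: "0 \<le> wgt E B" unfolding wgt_def by (intro bint_nonneg) auto

lemma wgt_le_1: "wgt E B \<le> 1"
proof -
 have "wgt E B \<le> (\<integral>w. 1 \<partial>P)" unfolding wgt_def power2_eq_square by (intro Bochner_Integration.integral_mono int_prod) (auto intro: mult_le_one)
 then show ?thesis by (simp add: prob_space)
qed

lemma indep_integral:
 assumes "A \<inter> B = {}" and G: "G \<in> cyl M (below B)" and f: "f \<in> borel_measurable (Fld A)" "\<And>x. \<bar>f x\<bar> \<le> K"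
 shows "(\<integral>x. f x * indicator G x \<partial>P) = (\<integral>x. f x \<partial>P) * prob G"
proof -
 have Ge: "G \<in> events" by (rule cyl_below_events[OF G])
 have "AE x in P. cexp G A x = prob G" proof (rule cexp_unique[OF Ge])
  fix H assume H: "H \<in> cyl M (below A)"
  have "(\<integral>x. indicator H x * prob G \<partial>P) = prob H * prob G" using cyl_below_events[OF H] by simp
  also have "\<dots> = prob (H \<inter> G)" using indep_two[OF assms(1) H G] by simp
  finally show "(\<integral>x. indicator H x * prob G \<partial>P) = prob (G \<inter> H)" by (simp add: Int_commute)
 qed auto
 then have "(\<integral>x. f x * cexp G A x \<partial>P) = (\<integral>x. f x * prob G \<partial>P)" using Fld_meas_P[OF f(1)] by (intro integral_cong_AE) auto
 moreover have "(\<integral>x. f x * cexp G A x \<partial>P) = (\<integral>x. f x * indicator G x \<partial>P)" by (rule cexp_intg[OF Ge f])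
 ultimately show ?thesis by simp
qed

text \<open>The projections onto the fields of \<open>A\<close> and \<open>B\<close> commute, with product the projection onto the field of \<open>A \<inter> B\<close>.\<close>

lemma cexp_Int:
 assumes E: "E \<in> events" and A: "A \<in> sets M" and B: "B \<in> sets M"
 shows "(\<integral>w. cexp E A w * cexp E B w \<partial>P) = wgt E (A \<inter> B)"
proof -
 let ?p = "cexp E A" and ?r = "cexp E (A \<inter> B)"
 \<comment> \<open>These products generate the field of \<open>B\<close>, as every count in
   \<open>B\<close> splits into a count in \<open>A \<inter> B\<close> and one in
   \<open>B - A\<close>. The second factor is independent of everything seen in
   \<open>A\<close>.\<close>
 define Pi0 where "Pi0 = {G1 \<inter> G2 | G1 G2. G1 \<in> cyl M (below (A \<inter> B)) \<and> G2 \<in> cyl M (below (B - A))}"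
 have int: "integrable P (\<lambda>x. cexp E C x * indicator G x)" if "G \<in> events" for G C using that by (intro int_prod) auto
 have pr: "(\<integral>x. ?p x * indicator G1 x \<partial>P) = (\<integral>x. ?r x * indicator G1 x \<partial>P)" if G1: "G1 \<in> cyl M (below (A \<inter> B))" for G1 proof -
  have G1A: "G1 \<in> cyl M (below A)" using G1 cyl_mono[of "below (A \<inter> B)" "below A" M] by auto
  show ?thesis using cexp_int_event[OF E G1] cexp_int_event[OF E G1A] by (simp add: mult.commute)
 qed
 have pi_good: "(\<integral>x. ?p x * indicator G x \<partial>P) = (\<integral>x. ?r x * indicator G x \<partial>P)" if "G \<in> Pi0" for G proof -
  obtain G1 G2 where G: "G = G1 \<inter> G2" "G1 \<in> cyl M (below (A \<inter> B))" "G2 \<in> cyl M (below (B - A))" using \<open>G \<in> Pi0\<close> by (auto simp: Pi0_def)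
  have step: "(\<integral>x. cexp E C x * indicator G x \<partial>P) = (\<integral>x. cexp E C x * indicator G1 x \<partial>P) * prob G2" if C: "C \<subseteq> A" "A \<inter> B \<subseteq> C" for C proof -
   have m: "(\<lambda>x. cexp E C x * indicator G1 x) \<in> borel_measurable (Fld C)" proof (intro borel_measurable_times cexp_meas borel_measurable_indicator)
    show "G1 \<in> sets (Fld C)" using G(2) cyl_mono[of "below (A \<inter> B)" "below C" M] C by (auto simp: sets_cylm)
   qed
   have "(\<integral>x. (cexp E C x * indicator G1 x) * indicator G2 x \<partial>P) = (\<integral>x. cexp E C x * indicator G1 x \<partial>P) * prob G2"
    by (rule indep_integral[OF _ G(3) m, where K=1]) (use C in \<open>auto simp: indicator_def\<close>)
   then show ?thesis unfolding G(1) by (simp add: indicator_inter_arith mult.assoc)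
  qed
  show ?thesis using step[of A] step[of "A \<inter> B"] pr[OF G(2)] by simp
 qed
 have stable: "Int_stable Pi0" proof (rule Int_stableI)
  fix a b assume "a \<in> Pi0" "b \<in> Pi0"
  then obtain a1 a2 b1 b2 where ab: "a = a1 \<inter> a2" "b = b1 \<inter> b2" "a1 \<in> cyl M (below (A \<inter> B))" "b1 \<in> cyl M (below (A \<inter> B))"
   "a2 \<in> cyl M (below (B - A))" "b2 \<in> cyl M (below (B - A))" by (auto simp: Pi0_def)
  interpret s1: sigma_algebra "config M" "cyl M (below (A \<inter> B))" by (rule sigma_algebra_cyl)
  interpret s2: sigma_algebra "config M" "cyl M (below (B - A))" by (rule sigma_algebra_cyl)
  have "a \<inter> b = (a1 \<inter> b1) \<inter> (a2 \<inter> b2)" using ab by auto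
  moreover have "a1 \<inter> b1 \<in> cyl M (below (A \<inter> B))" "a2 \<inter> b2 \<in> cyl M (below (B - A))" using s1.Int[OF ab(3,4)] s2.Int[OF ab(5,6)] .
  ultimately show "a \<inter> b \<in> Pi0" unfolding Pi0_def by blast
 qed
 have PiP: "Pi0 \<subseteq> Pow (config M)" unfolding Pi0_def using cyl_Pow by fastforce
 have top: "config M \<in> cyl M AA" for AA unfolding cyl_def by (rule sigma_sets_top)
 have cylP: "G \<inter> config M = G" "config M \<inter> G = G" if "G \<in> cyl M AA" for G AA using cyl_Pow[of M AA] that by auto
 have sub: "cyl M (below (A \<inter> B)) \<subseteq> Pi0" "cyl M (below (B - A)) \<subseteq> Pi0"
  unfolding Pi0_def by (intro subsetI CollectI exI conjI, rule cylP[symmetric], assumption, assumption, rule top)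
   (intro subsetI CollectI exI conjI, rule cylP(2)[symmetric], assumption, rule top, assumption)
 \<comment> \<open>Integrals over events are read as finite measures with these densities, so that
   agreement on the products in \<open>Pi0\<close> extends to the generated field.\<close>
 have em: "emeasure (density P (\<lambda>x. ennreal (cexp E C x))) G = ennreal (\<integral>x. cexp E C x * indicator G x \<partial>P)" if G: "G \<in> events" for G C proof -
  have "emeasure (density P (\<lambda>x. ennreal (cexp E C x))) G = (\<integral>\<^sup>+x. ennreal (cexp E C x * indicator G x) \<partial>P)"
   using G by (subst emeasure_density) (auto intro!: nn_integral_cong simp: indicator_def)
  then show ?thesis using nn_integral_eq_integral[OF int[OF G]] by simp
 qed
 have Pie: "Pi0 \<subseteq> events" unfolding Pi0_def using cyl_below_events by blast
 have fin: "finite_measure (density P (\<lambda>x. ennreal (cexp E C x)))" for C by (rule finite_measureI) (simp add: em[OF sets.top])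
 have spPi: "space P \<in> Pi0" unfolding space_P by (rule subsetD[OF sub(1) top])
 have sig: "(\<integral>x. ?p x * indicator G x \<partial>P) = (\<integral>x. ?r x * indicator G x \<partial>P)" if G: "G \<in> sigma_sets (space P) Pi0" for G proof -
  have Ge: "G \<in> events" using sets.sigma_sets_subset[OF Pie] G by blast
  have "emeasure (density P (\<lambda>x. ennreal (?p x))) G = emeasure (density P (\<lambda>x. ennreal (?r x))) G"
  proof (rule finite_measures_agree[OF fin fin _ stable])
   show "emeasure (density P (\<lambda>x. ennreal (?p x))) X = emeasure (density P (\<lambda>x. ennreal (?r x))) X" if "X \<in> Pi0" for X
    using em[OF subsetD[OF Pie that]] pi_good[OF that] by simp
   from this[OF spPi] show "emeasure (density P (\<lambda>x. ennreal (?p x))) (space (density P (\<lambda>x. ennreal (?p x))))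
    = emeasure (density P (\<lambda>x. ennreal (?r x))) (space (density P (\<lambda>x. ennreal (?p x))))" by simp
  qed (use Pie G in simp_all)
  then show ?thesis unfolding em[OF Ge] by (subst (asm) ennreal_inj) (auto intro!: bint_nonneg)
 qed
 have gen: "cyl M (below B) \<subseteq> sigma_sets (space P) Pi0" proof -
  let ?N = "sigma (config M) Pi0"
  have sN: "sets ?N = sigma_sets (space P) Pi0" "space ?N = config M" using PiP by (simp_all add: sets_measure_of space_measure_of space_P)
  have m: "(cnt C) \<in> borel_measurable ?N" if "C \<in> below (A \<inter> B) \<or> C \<in> below (B - A)" for C
   using that subsetD[OF measurable_mono1[OF PiP sub(1)] emeasure_cylm, of C] subsetD[OF measurable_mono1[OF PiP sub(2)] emeasure_cylm, of C]
   by (elim disjE) simp_all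
  show ?thesis proof (rule cyl_leI[OF _ sN(2) sN(1)])
   show "sigma_algebra (config M) (sigma_sets (space P) Pi0)" using sigma_algebra_sigma_sets[OF PiP] by (simp add: space_P)
   fix C assume C: "C \<in> below B"
   show "(cnt C) \<in> borel_measurable ?N" proof (subst measurable_cong)
    fix w assume "w \<in> space ?N"
    then have "sets w = sets M" by (simp add: sN)
    then have "emeasure w (C \<inter> A) + emeasure w (C - A) = emeasure w ((C \<inter> A) \<union> (C - A))" using C A by (intro plus_emeasure) auto
    then show "emeasure w C = emeasure w (C \<inter> A) + emeasure w (C - A)" by (simp add: Int_Diff_Un)
   next
    show "(\<lambda>w. emeasure w (C \<inter> A) + emeasure w (C - A)) \<in> borel_measurable ?N" using C A by (intro borel_measurable_add m) auto
   qed
  qed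
 qed
 have good: "(\<integral>x. ?p x * indicator G x \<partial>P) = (\<integral>x. ?r x * indicator G x \<partial>P)" if "G \<in> cyl M (below B)" for G using gen sig that by blast
 interpret s: sigma_finite_subalgebra P "Fld B" by (rule sfs)
 have rF: "?r \<in> borel_measurable (Fld B)" by (rule Fld_mono[OF _ cexp_meas]) auto
 have ip: "integrable P (cexp E C)" for C by (intro bounded_integrable[where K=1]) auto
 have "AE x in P. real_cond_exp P (Fld B) ?p x = ?r x" by (rule s.real_cond_exp_charact[OF _ ip ip rF])
   (use good in \<open>simp add: set_lebesgue_integral_def sets_cylm mult.commute\<close>)
 then have "(\<integral>x. cexp E B x * real_cond_exp P (Fld B) ?p x \<partial>P) = (\<integral>x. cexp E B x * ?r x \<partial>P)"
  by (intro integral_cong_AE) (auto intro: borel_measurable_cond_exp2)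
 moreover have "(\<integral>x. cexp E B x * real_cond_exp P (Fld B) ?p x \<partial>P) = (\<integral>x. cexp E B x * ?p x \<partial>P)"
  by (intro s.real_cond_exp_intg int_prod cexp_meas) auto
 ultimately have "(\<integral>x. ?p x * cexp E B x \<partial>P) = (\<integral>x. ?r x * cexp E B x \<partial>P)" by (simp add: mult.commute)
 also have "\<dots> = wgt E (A \<inter> B)" by (rule cexp_cexp[OF E]) auto
 finally show ?thesis .
qed

text \<open>With \<open>p\<close>, \<open>q\<close>, \<open>r\<close>, \<open>s\<close> the
  projections for \<open>A\<close>, \<open>B\<close>, \<open>A \<inter> B\<close>,
  \<open>A \<union> B\<close>, commutation of the projections evaluates all mixed products, and the
  square norm of \<open>s - p - q + r\<close> becomes \<open>wgt E (A \<union> B) - wgt E A - wgt E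
  B + wgt E (A \<inter> B)\<close>.\<close>

lemma wgt_supermodular:
 assumes E: "E \<in> events" and A: "A \<in> sets M" and B: "B \<in> sets M"
 shows "wgt E A + wgt E B \<le> wgt E (A \<union> B) + wgt E (A \<inter> B)"
proof -
 let ?p = "cexp E A" and ?q = "cexp E B" and ?r = "cexp E (A \<inter> B)" and ?s = "cexp E (A \<union> B)"
 have i: "integrable P (\<lambda>x. cexp E C x * cexp E D x)" for C D by (intro int_prod) auto
 have sq: "(\<integral>x. cexp E C x * cexp E C x \<partial>P) = wgt E C" for C by (simp add: wgt_def power2_eq_square)
 have v: "(\<integral>x. ?p x * ?s x \<partial>P) = wgt E A" "(\<integral>x. ?q x * ?s x \<partial>P) = wgt E B" "(\<integral>x. ?r x * ?s x \<partial>P) = wgt E (A \<inter> B)"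
  "(\<integral>x. ?r x * ?p x \<partial>P) = wgt E (A \<inter> B)" "(\<integral>x. ?r x * ?q x \<partial>P) = wgt E (A \<inter> B)" "(\<integral>x. ?p x * ?q x \<partial>P) = wgt E (A \<inter> B)"
  by (auto intro!: cexp_cexp[OF E] cexp_Int[OF E A B])
 have "0 \<le> (\<integral>x. (?s x - ?p x - ?q x + ?r x)\<^sup>2 \<partial>P)" by (intro bint_nonneg) auto
 also have "\<dots> = (\<integral>x. (?s x * ?s x + ?p x * ?p x + ?q x * ?q x + ?r x * ?r x + 2 * (?p x * ?q x) + 2 * (?r x * ?s x))
   - (2 * (?p x * ?s x) + 2 * (?q x * ?s x) + 2 * (?r x * ?p x) + 2 * (?r x * ?q x)) \<partial>P)"
  by (intro bint_cong refl) (simp add: power2_eq_square algebra_simps)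
 also have "\<dots> = (wgt E (A \<union> B) + wgt E A + wgt E B + wgt E (A \<inter> B) + 2 * wgt E (A \<inter> B) + 2 * wgt E (A \<inter> B))
   - (2 * wgt E A + 2 * wgt E B + 2 * wgt E (A \<inter> B) + 2 * wgt E (A \<inter> B))" using i by (simp add: sq v)
 finally show ?thesis by simp
qed

text \<open>\<open>g\<close> evaluates \<open>f\<close> at the configuration restricted to
  \<open>B\<close>. If there are no points in \<open>A - B\<close>, the restriction changes no count
  inside \<open>A\<close>, and \<open>f\<close> is a function of those counts.\<close>

lemma cyl_restrict:
 assumes B: "B \<in> sets M" and f: "f \<in> borel_measurable (Fld A)"
 obtains g :: "'a measure \<Rightarrow> real" where "g \<in> borel_measurable (Fld B)" "range g \<subseteq> range f"
  "\<And>w. w \<in> config M \<Longrightarrow> emeasure w (A - B) = 0 \<Longrightarrow> A \<in> sets M \<Longrightarrow> g w = f w"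
proof -
 define R where "R w = density w (indicator B)" for w :: "'a measure"
 have Rc: "R w \<in> config M" if "w \<in> config M" for w using that by (simp add: R_def)
 have Re: "emeasure (R w) C = emeasure w (C \<inter> B)" if "w \<in> config M" "C \<in> sets M" for w C proof -
  have "emeasure (R w) C = (\<integral>\<^sup>+x. indicator B x * indicator C x \<partial>w)" using that B unfolding R_def by (subst emeasure_density) auto
  also have "\<dots> = (\<integral>\<^sup>+x. indicator (C \<inter> B) x \<partial>w)" by (intro nn_integral_cong) (auto simp: indicator_def)
  finally show ?thesis using that B by simp
 qed
 have "cyl_gen M (below A) \<subseteq> Pow (config M)" by (rule cyl_gen_Pow)
 have RM: "R \<in> measurable (Fld B) (Fld A)" proof (rule measurable_sigma_sets[where \<Omega>="config M" and A="cyl_gen M (below A)"])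
  show "sets (Fld A) = sigma_sets (config M) (cyl_gen M (below A))" by (subst sets_cylm) (rule cyl_def)
  show "cyl_gen M (below A) \<subseteq> Pow (config M)" by (rule cyl_gen_Pow)
  show "R \<in> space (Fld B) \<rightarrow> config M" using Rc by (simp add: space_cylm)
  fix y assume "y \<in> cyl_gen M (below A)"
  then obtain C U where C: "C \<in> below A" "U \<in> sets borel" "y = (cnt C) -` U \<inter> config M" by (auto simp: cyl_gen_def)
  have "R -` y \<inter> space (Fld B) = {w. sets w = sets M \<and> emeasure w (C \<inter> B) \<in> U}" unfolding space_cylm C(3) using Re Rc C(1) by auto
  also have "\<dots> \<in> cyl M (below B)" using C B by (intro cyl_basic) auto
  finally show "R -` y \<inter> space (Fld B) \<in> sets (Fld B)" by (simp only: sets_cylm)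
 qed
 show thesis proof (rule that[of "\<lambda>w. f (R w)"])
  show "(\<lambda>w. f (R w)) \<in> borel_measurable (Fld B)" by (rule measurable_compose[OF RM f])
  show "range (\<lambda>w. f (R w)) \<subseteq> range f" by auto
  fix w assume w: "w \<in> config M" and 0: "emeasure w (A - B) = 0" and A: "A \<in> sets M"
  have "f -` {f w} \<inter> space (Fld A) \<in> sets (Fld A)" by (rule measurable_sets[OF f]) simp
  \<comment> \<open>\<open>f\<close> is known only through its measurability, so equality of values
    is expressed by membership in a level set, an event on which \<open>w\<close> and its
    restriction cannot differ.\<close>
  then have lev: "f -` {f w} \<inter> config M \<in> cyl M (below A)" by (simp only: space_cylm sets_cylm)
  have "w \<in> f -` {f w} \<inter> config M \<longleftrightarrow> R w \<in> f -` {f w} \<inter> config M" using lev unfolding cyl_def proof (induction rule: sigma_sets.induct)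
   case (Basic G)
   then obtain C U where C: "C \<in> below A" "G = (cnt C) -` U \<inter> config M" by (auto simp: cyl_gen_def)
   have Cs: "C \<in> sets w" "B \<in> sets w" "A \<in> sets w" using C A B w by auto
   have "emeasure w (C - B) \<le> emeasure w (A - B)" using C Cs by (intro emeasure_mono) auto
   then have "emeasure w (C - B) = 0" using 0 by simp
   moreover have "emeasure w (C \<inter> B) + emeasure w (C - B) = emeasure w ((C \<inter> B) \<union> (C - B))" using Cs by (intro plus_emeasure) auto
   ultimately have "emeasure (R w) C = emeasure w C" using Re[OF w] C by (simp add: Int_Diff_Un)
   then show ?case using C w Rc[OF w] by simp
  qed (use w Rc[OF w] in auto)
  then show "f (R w) = f w" using w by auto
 qed
qed

text \<open>Monotonicity is Pythagoras. For the upper bound, \<open>cyl_restrict\<close> gives a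
  function \<open>g\<close> of the points in \<open>A\<close> that differs from the projection for
  \<open>B\<close> only if a point falls in \<open>B - A\<close>; since the projection for
  \<open>A\<close> is the best approximation, \<open>wgt E B - wgt E A\<close> is at most the square
  distance to \<open>g\<close>.\<close>

lemma wgt_mono_cont:
 assumes E: "E \<in> events" and A: "A \<in> sets M" and B: "B \<in> sets M" and sub: "A \<subseteq> B" and fin: "B - A \<in> fmeasurable M"
 shows "wgt E A \<le> wgt E B" "wgt E B \<le> wgt E A + measure M (B - A)"
proof -
 let ?p = "cexp E B" and ?r = "cexp E A"
 have i: "integrable P (\<lambda>x. cexp E C x * cexp E D x)" for C D by (intro int_prod) auto
 have sq: "(\<integral>x. cexp E C x * cexp E C x \<partial>P) = wgt E C" for C by (simp add: wgt_def power2_eq_square)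
 have rp: "(\<integral>x. ?r x * ?p x \<partial>P) = wgt E A" by (rule cexp_cexp[OF E sub])
 have "0 \<le> (\<integral>x. (?p x - ?r x)\<^sup>2 \<partial>P)" by (intro bint_nonneg) auto
 also have "\<dots> = (\<integral>x. ?p x * ?p x + ?r x * ?r x - 2 * (?r x * ?p x) \<partial>P)"
  by (intro bint_cong refl) (simp add: power2_eq_square algebra_simps)
 also have "\<dots> = wgt E B + wgt E A - 2 * wgt E A" using i by (simp add: sq rp)
 finally show "wgt E A \<le> wgt E B" by simp
 obtain g :: "'a measure \<Rightarrow> real" where g: "g \<in> borel_measurable (Fld A)" "range g \<subseteq> range ?p"
  "\<And>w. w \<in> config M \<Longrightarrow> emeasure w (B - A) = 0 \<Longrightarrow> B \<in> sets M \<Longrightarrow> g w = ?p w" by (rule cyl_restrict[OF A cexp_meas]) (rule that)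
 have g01: "0 \<le> g x" "g x \<le> 1" for x proof -
  have "g x \<in> range ?p" using g(2) by blast
  then show "0 \<le> g x" "g x \<le> 1" by auto
 qed
 have gb: "\<bar>g x\<bar> \<le> 1" for x using g01[of x] by simp
 have [measurable]: "g \<in> borel_measurable P" by (rule Fld_meas_P[OF g(1)])
 have ig: "integrable P (\<lambda>x. g x * g x)" "integrable P (\<lambda>x. g x * cexp E C x)" for C using gb by (auto intro!: int_prod)
 have gp: "(\<integral>x. g x * ?p x \<partial>P) = (\<integral>x. g x * ?r x \<partial>P)" using cexp_intg[OF E g(1) gb] cexp_intg[OF E Fld_mono[OF sub g(1)] gb] by simp
 have sq1: "(?p x - g x)\<^sup>2 \<le> 1" for x proof -
  have "\<bar>?p x - g x\<bar> \<le> 1" using g01[of x] cexp_01[of E B x] by linarith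
  then show ?thesis by (simp add: abs_square_le_1)
 qed
 let ?Z = "{w\<in>space P. emeasure w (B - A) \<noteq> 0}"
 have Z: "?Z \<in> events" using A B by (intro N_neq_sets) auto
 have "0 \<le> (\<integral>x. (?r x - g x)\<^sup>2 \<partial>P)" by (intro bint_nonneg) auto
 also have "\<dots> = (\<integral>x. ?r x * ?r x + g x * g x - 2 * (g x * ?r x) \<partial>P)"
  by (intro bint_cong refl) (simp add: power2_eq_square algebra_simps)
 also have "\<dots> = wgt E A + (\<integral>x. g x * g x \<partial>P) - 2 * (\<integral>x. g x * ?r x \<partial>P)" using i ig by (simp add: sq)
 finally have 1: "0 \<le> wgt E A + (\<integral>x. g x * g x \<partial>P) - 2 * (\<integral>x. g x * ?r x \<partial>P)" .
 have "(\<integral>x. (?p x - g x)\<^sup>2 \<partial>P) = (\<integral>x. ?p x * ?p x + g x * g x - 2 * (g x * ?p x) \<partial>P)"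
  by (intro bint_cong refl) (simp add: power2_eq_square algebra_simps)
 also have "\<dots> = wgt E B + (\<integral>x. g x * g x \<partial>P) - 2 * (\<integral>x. g x * ?r x \<partial>P)" using i ig by (simp add: sq gp)
 finally have 2: "wgt E B - wgt E A \<le> (\<integral>x. (?p x - g x)\<^sup>2 \<partial>P)" using 1 by linarith
 have "(\<integral>x. (?p x - g x)\<^sup>2 \<partial>P) \<le> (\<integral>x. indicator ?Z x \<partial>P)" proof (rule Bochner_Integration.integral_mono)
  show "integrable P (\<lambda>x. (?p x - g x)\<^sup>2)" by (rule bounded_integrable[where K=1]) (simp_all add: sq1)
  show "integrable P (indicator ?Z :: _ \<Rightarrow> real)" using Z by (intro bounded_integrable[where K=1]) auto
  fix x assume x: "x \<in> space P"
  show "(?p x - g x)\<^sup>2 \<le> indicator ?Z x" using g(3)[of x] x B sq1[of x] by (auto simp: indicator_def space_P)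
 qed
 also have "\<dots> = prob ?Z" using Z by simp
 also have "\<dots> \<le> measure M (B - A)" by (rule prob_N_pos_le[OF fin])
 finally show "wgt E B \<le> wgt E A + measure M (B - A)" using 2 by linarith
qed

text \<open>Projections are self-adjoint, so the mixed terms agree, and the difference is the
  integral of \<open>cexp E B + cexp F B\<close>, which is at most \<open>2\<close>, against the
  difference of the indicators.\<close>

lemma wgt_Lipschitz:
 assumes E: "E \<in> events" and F: "F \<in> events"
 shows "\<bar>wgt E B - wgt F B\<bar> \<le> 2 * prob (sym_diff E F)"
proof -
 let ?e = "cexp E B" and ?f = "cexp F B"
 define D where "D = sym_diff E F"
 have D: "D \<in> events" unfolding D_def by (rule sets_sym_diff[OF E F])
 have 1: "(\<integral>x. ?f x * indicator E x \<partial>P) = (\<integral>x. ?e x * indicator F x \<partial>P)"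
  using cexp_intg[OF E cexp_meas[of F], where K=1] cexp_intg[OF F cexp_meas[of E], where K=1] by (simp add: mult.commute)
 have i: "integrable P (\<lambda>x. cexp G B x * indicator H x)" if "H \<in> events" for G H using that by (intro int_prod) auto
 have "wgt E B - wgt F B = (\<integral>x. ?e x * indicator E x \<partial>P) + (\<integral>x. ?f x * indicator E x \<partial>P)
   - ((\<integral>x. ?e x * indicator F x \<partial>P) + (\<integral>x. ?f x * indicator F x \<partial>P))" unfolding wgt_alt[OF E] wgt_alt[OF F] 1 by simp
 also have "\<dots> = (\<integral>x. (?e x * indicator E x + ?f x * indicator E x) - (?e x * indicator F x + ?f x * indicator F x) \<partial>P)" using i[OF E] i[OF F] by simp
 also have "\<dots> = (\<integral>x. (?e x + ?f x) * (indicator E x - indicator F x) \<partial>P)" by (intro bint_cong refl) (simp add: algebra_simps)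
 finally have "wgt E B - wgt F B = (\<integral>x. (?e x + ?f x) * (indicator E x - indicator F x) \<partial>P)" .
 then have "\<bar>wgt E B - wgt F B\<bar> \<le> (\<integral>x. \<bar>(?e x + ?f x) * (indicator E x - indicator F x)\<bar> \<partial>P)" by (simp only: integral_abs_bound)
 also have "\<dots> \<le> (\<integral>x. 2 * indicator D x \<partial>P)" proof (rule integral_mono_AE')
  show "integrable P (\<lambda>x. 2 * indicator D x :: real)" using D by (intro bounded_integrable[where K=2]) (auto simp: indicator_def)
  show "AE x in P. \<bar>(?e x + ?f x) * (indicator E x - indicator F x)\<bar> \<le> 2 * indicator D x" proof (rule AE_I2)
   fix x
   have "\<bar>?e x + ?f x\<bar> \<le> 2" using cexp_01[of E B x] cexp_01[of F B x] by linarith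
   then show "\<bar>(?e x + ?f x) * (indicator E x - indicator F x)\<bar> \<le> 2 * indicator D x" by (auto simp: indicator_def abs_mult D_def)
  qed
 qed auto
 also have "\<dots> = 2 * prob D" using D by simp
 finally show ?thesis unfolding D_def .
qed

text \<open>The empty set shows nothing of a configuration, so its field is independent of
  \<open>E\<close> and the projection is the mean.\<close>

lemma wgt_empty: assumes E: "E \<in> events" shows "wgt E {} = (prob E)\<^sup>2"
proof -
 have Ec: "E \<in> cyl M (below (space M))" proof -
  have "below (space M) = sets M" using sub_space by auto
  then show ?thesis using E by (simp add: sets_P)
 qed
 have "AE x in P. cexp E {} x = prob E" proof (rule cexp_unique[OF E])
  fix G assume G: "G \<in> cyl M (below {})"
  have "prob (E \<inter> G) = prob E * prob G" by (rule indep_two[OF _ Ec G]) auto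
  then show "(\<integral>x. indicator G x * prob E \<partial>P) = prob (E \<inter> G)" using cyl_below_events[OF G] by simp
 qed auto
 then have "wgt E {} = (\<integral>x. (prob E)\<^sup>2 \<partial>P)" unfolding wgt_def by (intro integral_cong_AE) auto
 then show ?thesis by (simp add: prob_space)
qed

text \<open>\<open>F\<close> is measurable for the field of \<open>B\<close>, so
  \<open>wgt F B\<close> is its full probability. Passing to \<open>E\<close> costs two distances by
  \<open>wgt_Lipschitz\<close> and one for the probabilities.\<close>

lemma wgt_approx:
 assumes E: "E \<in> events" and F: "F \<in> cyl M (below B)"
 shows "prob E - 3 * prob (sym_diff E F) \<le> wgt E B"
proof -
 have Fe: "F \<in> events" by (rule cyl_below_events[OF F])
 have "(\<integral>x. indicator F x * cexp F B x \<partial>P) = prob (F \<inter> F)" by (rule cexp_int_event[OF Fe F])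
 then have "wgt F B = prob F" using wgt_alt[OF Fe, of B] by (simp add: mult.commute)
 moreover have "\<bar>prob E - prob F\<bar> \<le> prob (sym_diff E F)" using E Fe by (intro prob_close) auto
 ultimately show ?thesis using wgt_Lipschitz[OF E Fe, of B] by linarith
qed

end

section \<open>Rigid functions, rigid events and rigid sets\<close>

lemma cmod_indicator_diff:
 assumes "x \<in> F \<longleftrightarrow> y \<in> E"
 shows "(cmod (indicator E y - indicator E x))\<^sup>2 = indicator (sym_diff E F) x" using assms by (auto simp: indicator_def)

lemma level_gap:
 fixes a b c d :: real
 shows "\<bar>b - a\<bar> < d \<Longrightarrow> \<not> (c < a \<and> a \<le> c + d) \<Longrightarrow> \<not> (c < b \<and> b \<le> c + d) \<Longrightarrow> (c < a) = (c < b)" by (auto simp: abs_less_iff)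

lemma tendsto_null_squeeze:
 fixes f g :: "nat \<Rightarrow> real"
 assumes "\<And>k. 0 \<le> f k" "\<And>k. f k \<le> g k" "g \<longlonglongrightarrow> 0"
 shows "f \<longlonglongrightarrow> 0" by (rule tendsto_sandwich[OF _ _ tendsto_const assms(3)]) (auto intro!: always_eventually assms)

text \<open>Each rational level is either exceeded almost surely or almost surely not exceeded; off
  one null set, no two values of \<open>u\<close> can then be separated by a rational.\<close>

lemma (in prob_space) AE_constant_if_levels_trivial:
 fixes u :: "'a \<Rightarrow> real"
 assumes [measurable]: "u \<in> borel_measurable M" and triv: "\<And>c. prob {x\<in>space M. u x > c} = 0 \<or> prob {x\<in>space M. u x > c} = 1"
 shows "\<exists>c. AE x in M. u x = c"
proof -
 have ev: "{x\<in>space M. u x > c} \<in> events" for c by measurable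
 define Q where "Q = {c::rat. prob {x\<in>space M. u x > of_rat c} = 1}"
 have "AE x in M. \<forall>c. (c \<in> Q \<longrightarrow> u x > of_rat c) \<and> (c \<notin> Q \<longrightarrow> u x \<le> of_rat c)" unfolding AE_all_countable proof
  fix c :: rat
  show "AE x in M. (c \<in> Q \<longrightarrow> u x > of_rat c) \<and> (c \<notin> Q \<longrightarrow> u x \<le> of_rat c)" proof (cases "c \<in> Q")
   case True
   then have "AE x in M. x \<in> {x\<in>space M. u x > of_rat c}" using ev by (intro AE_prob_1) (simp add: Q_def)
   then show ?thesis by eventually_elim (simp add: True)
  next
   case False
   then have "prob {x\<in>space M. u x > of_rat c} = 0" using triv by (auto simp: Q_def)
   then have "{x\<in>space M. u x > of_rat c} \<in> null_sets M" using ev by (simp add: null_sets_def emeasure_eq_measure)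
   then have "AE x in M. x \<notin> {x\<in>space M. u x > of_rat c}" by (rule AE_not_in)
   then show ?thesis using AE_space by eventually_elim (simp add: False not_less)
  qed
 qed
 then obtain N where N: "{x\<in>space M. \<not> (\<forall>c. (c \<in> Q \<longrightarrow> u x > of_rat c) \<and> (c \<notin> Q \<longrightarrow> u x \<le> of_rat c))} \<subseteq> N" "N \<in> null_sets M"
  by (auto elim!: AE_E simp: null_sets_def)
 have "space M - N \<noteq> {}" proof
  assume "space M - N = {}"
  then have "space M \<in> null_sets M" using N(2) by (intro null_sets_subset[OF N(2)]) auto
  then show False using emeasure_space_1 by auto
 qed
 then obtain x0 where x0: "x0 \<in> space M" "x0 \<notin> N" by auto
 have le: "u x \<le> u y" if "x \<in> space M" "x \<notin> N" "y \<in> space M" "y \<notin> N" for x y proof (rule ccontr)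
  assume "\<not> u x \<le> u y"
  then obtain c where "u y < of_rat c" "of_rat c < u x" using of_rat_dense by (meson not_le)
  moreover have "(c \<in> Q \<longrightarrow> u z > of_rat c) \<and> (c \<notin> Q \<longrightarrow> u z \<le> of_rat c)" if "z \<in> space M" "z \<notin> N" for z using that N(1) by blast
  ultimately show False using that by (cases "c \<in> Q") (force simp: not_less)+
 qed
 have "AE x in M. x \<notin> N" by (rule AE_not_in[OF N(2)])
 then have "AE x in M. u x = u x0" using AE_space by eventually_elim (use le x0 in \<open>auto intro: antisym\<close>)
 then show ?thesis by blast
qed

context suspension
begin

lemma t_Fld: assumes B: "B \<in> sets M" shows "t n \<in> measurable (Fld (pre n B)) (Fld B)"
proof (rule measurableI)
 fix G assume "G \<in> sets (Fld B)"
 then have "G \<in> cyl M (below B)" by (simp only: sets_cylm)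
 then have "SP.pre n G \<in> cyl M (below (pre n B))" by (rule spre_below)
 then show "t n -` G \<inter> space (Fld (pre n B)) \<in> sets (Fld (pre n B))" by (simp only: spre space_cylm sets_cylm)
qed (use t_conf in \<open>simp add: space_cylm\<close>)

text \<open>This makes the translate of a maximiser for \<open>E\<close> a maximiser for the
  translate of \<open>E\<close>, and so nearly one for \<open>E\<close> itself when \<open>E\<close>
  is rigid.\<close>

lemma wgt_equiv:
 assumes E: "E \<in> events" and B: "B \<in> sets M"
 shows "wgt (SP.pre n E) (pre n B) = wgt E B"
proof -
 define h where "h x = cexp E B (t n x)" for x
 have hm: "h \<in> borel_measurable (Fld (pre n B))" unfolding h_def by (rule measurable_compose[OF t_Fld[OF B] cexp_meas])
 have push: "(\<integral>x. f (t n x) \<partial>P) = (\<integral>x. f x \<partial>P)" if "f \<in> borel_measurable P" for f :: "'a measure \<Rightarrow> real"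
  using integral_distr[OF t_meas that, of n] by (simp add: t_distr)
 have "AE x in P. cexp (SP.pre n E) (pre n B) x = h x" proof (rule cexp_unique[OF SP.pre_sets[OF E] hm, where K=1])
  show "\<bar>h x\<bar> \<le> 1" for x by (simp add: h_def)
  fix G assume G: "G \<in> cyl M (below (pre n B))"
  have Ge: "G \<in> events" by (rule cyl_below_events[OF G])
  let ?G' = "SP.pre (- n) G"
  have "?G' \<in> cyl M (below (pre (- n) (pre n B)))" by (rule spre_below[OF G])
  then have G': "?G' \<in> cyl M (below B)" using B by (simp add: pre_pre pre_0 sub_space)
  have G'e: "?G' \<in> events" by (rule cyl_below_events[OF G'])
  have pG: "SP.pre n ?G' = G" using Ge by (simp add: SP.pre_pre SP.pre_0 sub_space)
  have ind: "indicator G x = (indicator ?G' (t n x) :: real)" if "x \<in> space P" for x proof -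
   have "x \<in> G \<longleftrightarrow> x \<in> SP.pre n ?G'" by (simp only: pG)
   also have "\<dots> \<longleftrightarrow> t n x \<in> ?G'" using that unfolding spre[of n] by (auto simp: space_P)
   finally show ?thesis by (simp add: indicator_def)
  qed
  have "(\<integral>x. indicator G x * h x \<partial>P) = (\<integral>x. indicator ?G' (t n x) * cexp E B (t n x) \<partial>P)"
   unfolding h_def by (intro bint_cong refl) (simp only: ind)
  also have "\<dots> = (\<integral>x. indicator ?G' x * cexp E B x \<partial>P)"
   by (intro push[of "\<lambda>x. indicator ?G' x * cexp E B x"] borel_measurable_times borel_measurable_indicator G'e cexp_meas_P)
  also have "\<dots> = prob (E \<inter> ?G')" by (rule cexp_int_event[OF E G'])
  also have "\<dots> = prob (SP.pre n (E \<inter> ?G'))" using E G'e by (intro SP.pre_measure[symmetric]) auto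
  also have "\<dots> = prob (SP.pre n E \<inter> G)" unfolding SP.pre_Int pG ..
  finally show "(\<integral>x. indicator G x * h x \<partial>P) = prob (SP.pre n E \<inter> G)" .
 qed
 then have "wgt (SP.pre n E) (pre n B) = (\<integral>x. (h x)\<^sup>2 \<partial>P)" unfolding wgt_def using Fld_meas_P[OF hm] by (intro integral_cong_AE) auto
 also have "\<dots> = wgt E B" unfolding h_def wgt_def by (intro push[of "\<lambda>x. (cexp E B x)\<^sup>2"]) measurable
 finally show ?thesis .
qed

text \<open>The set maximises the part of \<open>E\<close> seen by its points against a cost proportional to its measure.\<close>

lemma rigid_event_imp_rigid_set:
 assumes E: "E \<in> events" and nt: "prob E \<noteq> 0" "prob E \<noteq> 1" and rig: "(\<lambda>k::nat. prob (sym_diff E (SP.pre (n k) E))) \<longlonglongrightarrow> 0"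
 obtains A r where "A \<in> fmeasurable M" "emeasure M A > 0" "strict_mono r" "(\<lambda>k. measure M (sym_diff A (pre (n (r k)) A))) \<longlonglongrightarrow> 0"
proof -
 have lt: "(prob E)\<^sup>2 < prob E" proof -
  have "0 < prob E" "prob E < 1" using nt prob_le_1[of E] measure_nonneg[of P E] by linarith+
  then show ?thesis by (simp add: power2_eq_square)
 qed
 have "(prob E - (prob E)\<^sup>2) / 3 > 0" using lt by simp
 from approx_fincyl[OF E this] obtain F where F: "F \<in> fincyl M (sets M)" "prob (sym_diff E F) < (prob E - (prob E)\<^sup>2) / 3" by blast
 obtain B0 where B0: "B0 \<in> fmeasurable M" "F \<in> cyl M (below B0)" using fincyl_below[OF F(1)] by blast
 \<comment> \<open>What the points in \<open>B0\<close> reveal of \<open>E\<close> beyond its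
   probability. The division by \<open>3\<close> in the accuracy for \<open>F\<close> matches the
   loss in \<open>wgt_approx\<close> and makes \<open>eta\<close> positive.\<close>
 define eta where "eta = wgt E B0 - wgt E {}"
 have "3 * prob (sym_diff E F) < prob E - (prob E)\<^sup>2" using F(2) by simp
 then have eta: "eta > 0" using wgt_approx[OF E B0(2)] wgt_empty[OF E] unfolding eta_def by linarith
 \<comment> \<open>The cost of \<open>B0\<close> is at most half of its gain \<open>eta\<close>, so
   \<open>B0\<close> beats the empty set and the maximiser has positive measure.\<close>
 define c where "c = eta / (2 * (measure M B0 + 1))"
 have c: "c > 0" using eta by (simp add: c_def add_nonneg_pos)
 define J where "J B = wgt E B - c * measure M B" for B
 have "c * measure M B0 \<le> eta / 2" proof -
  have "c * (2 * (measure M B0 + 1)) = eta" proof -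
   have K: "x / (2 * K) * (2 * K) = x" if "K \<noteq> 0" for x K :: real using that by simp
   show ?thesis unfolding c_def using measure_nonneg[of M B0] by (intro K) linarith
  qed
  then show ?thesis using c by (simp add: algebra_simps)
 qed
 then have J0: "J {} < J B0" using eta by (simp add: J_def eta_def)
 have bdd: "bdd_above (J ` fmeasurable M)" proof (rule bdd_aboveI[of _ 1])
  fix y assume "y \<in> J ` fmeasurable M"
  then obtain B where "y = J B" by blast
  moreover have "0 \<le> c * measure M B" using c by simp
  ultimately show "y \<le> 1" using wgt_le_1[of E B] by (simp add: J_def)
 qed
 define s where "s = Sup (J ` fmeasurable M)"
 define d where "d B = s - J B" for B
 have J_le: "J B \<le> s" if "B \<in> fmeasurable M" for B unfolding s_def using that bdd by (intro cSup_upper) auto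
 have s0: "0 \<le> s" using J_le[of "{}"] wgt_nonneg[of E "{}"] by (simp add: J_def)
 have cont: "\<bar>d A - d B\<bar> \<le> (1 + c) * measure M (B - A)" if A: "A \<in> fmeasurable M" and B: "B \<in> fmeasurable M" and AB: "A \<subseteq> B" for A B proof -
  have BA: "B - A \<in> fmeasurable M" using A B by (auto intro: fmeasurable_Diff)
  have "measure M (B - A) = measure M B - measure M A" using A B AB by (intro measure_Diff) (auto simp: fmeasurable_def)
  then have "c * measure M (B - A) = c * measure M B - c * measure M A" by (simp add: right_diff_distrib)
  moreover have "wgt E A \<le> wgt E B" "wgt E B \<le> wgt E A + measure M (B - A)" using wgt_mono_cont[OF E _ _ AB BA] A B by auto
  moreover have "0 \<le> c * measure M (B - A)" using c by simp
  ultimately show ?thesis by (simp add: d_def J_def abs_le_iff distrib_right)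
 qed
 obtain Bm where Bm: "Bm \<in> fmeasurable M" "d Bm = 0"
  and attr: "\<And>B. (\<And>k::nat. B k \<in> fmeasurable M) \<Longrightarrow> (\<And>k. measure M (B k) = measure M Bm) \<Longrightarrow> (\<lambda>k. d (B k)) \<longlonglongrightarrow> 0 \<Longrightarrow>
   \<exists>r. strict_mono r \<and> (\<lambda>k. measure M (sym_diff Bm (B (r k)))) \<longlonglongrightarrow> 0"
 proof (rule attracting_maximizer[of M d "1 + c" "1 / c"])
  show "0 \<le> d B" if "B \<in> fmeasurable M" for B using J_le[OF that] by (simp add: d_def)
  show "d (A \<union> B) \<le> d A + d B" if A: "A \<in> fmeasurable M" and B: "B \<in> fmeasurable M" for A B proof -
   have "measure M (A \<union> B) = measure M A + measure M B - measure M (A \<inter> B)" by (rule measure_Un3[OF A B])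
   then have "c * measure M (A \<union> B) = c * measure M A + c * measure M B - c * measure M (A \<inter> B)" by (simp only: right_diff_distrib distrib_left)
   moreover have "wgt E A + wgt E B \<le> wgt E (A \<union> B) + wgt E (A \<inter> B)" using A B by (intro wgt_supermodular E) auto
   moreover have "J (A \<inter> B) \<le> s" using A B by (intro J_le) auto
   ultimately show ?thesis by (simp add: d_def J_def)
  qed
  show "measure M B \<le> 1 / c * (1 + d B)" if B: "B \<in> fmeasurable M" for B proof -
   have "c * measure M B \<le> 1 + d B" using wgt_le_1[of E B] s0 by (simp add: d_def J_def)
   then show ?thesis using c by (simp add: field_simps)
  qed
  show "\<exists>B\<in>fmeasurable M. d B < e" if "e > 0" for e proof -
   have "s - e < Sup (J ` fmeasurable M)" using that by (simp add: s_def)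
   then obtain B where "B \<in> fmeasurable M" "s - e < J B" using bdd by (subst (asm) less_cSup_iff) auto
   then show ?thesis by (intro bexI[of _ B]) (auto simp: d_def)
  qed
 qed (use c cont in auto)
 have pos: "emeasure M Bm > 0" proof (rule ccontr)
  assume "\<not> ?thesis"
  then have "measure M Bm = 0" by (simp add: measure_def)
  then have "d {} = 0" using cont[of "{}" Bm] Bm by simp
  then show False using J0 J_le[OF B0(1)] by (simp add: d_def)
 qed
 have "\<exists>r. strict_mono r \<and> (\<lambda>k. measure M (sym_diff Bm (pre (n (r k)) Bm))) \<longlonglongrightarrow> 0" proof (rule attr)
  show "pre (n k) Bm \<in> fmeasurable M" for k by (rule pre_fmeasurable[OF Bm(1)])
  show mk: "measure M (pre (n k) Bm) = measure M Bm" for k using Bm by (intro pre_measure) auto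
  have up: "d (pre (n k) Bm) \<le> 2 * prob (sym_diff E (SP.pre (n k) E))" for k proof -
   have "\<bar>wgt E (pre (n k) Bm) - wgt (SP.pre (n k) E) (pre (n k) Bm)\<bar> \<le> 2 * prob (sym_diff E (SP.pre (n k) E))"
    by (rule wgt_Lipschitz[OF E SP.pre_sets[OF E]])
   moreover have "wgt (SP.pre (n k) E) (pre (n k) Bm) = wgt E Bm" using Bm by (intro wgt_equiv[OF E]) auto
   ultimately show ?thesis using Bm(2) by (simp add: d_def J_def mk abs_le_iff)
  qed
  have "(\<lambda>k. 2 * prob (sym_diff E (SP.pre (n k) E))) \<longlonglongrightarrow> 0" using tendsto_mult[OF tendsto_const[of 2] rig] by simp
  then show "(\<lambda>k. d (pre (n k) Bm)) \<longlonglongrightarrow> 0"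
   by (rule tendsto_null_squeeze[rotated 2]) (use up J_le[OF pre_fmeasurable[OF Bm(1)]] in \<open>simp_all add: d_def\<close>)
 qed
 then show thesis using that[OF Bm(1) pos] by blast
qed

lemma tends_up_subseq: assumes "tends_up_to_infinity n" "strict_mono r" shows "tends_up_to_infinity (\<lambda>k. n (r k))"
 using assms unfolding tends_up_to_infinity_def by (auto intro: filterlim_compose[OF _ filterlim_subseq] simp: incseq_def strict_mono_less_eq)

text \<open>A rigid square-integrable function that is not constant has a real or imaginary part
  with a nontrivial superlevel set. That set is a rigid event, and
  \<open>rigid_event_imp_rigid_set\<close> applies to an event of \<open>P\<close> that equals it up
  to a null set.\<close>

lemma rigidity_free_imp_mildly_mixing:
 assumes rf: "rigidity_free M T" shows "mildly_mixing S T'" unfolding mildly_mixing_def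
proof
 assume "\<exists>(f :: 'a measure \<Rightarrow> complex) n. f \<in> borel_measurable S \<and> integrable S (\<lambda>x. (cmod (f x))\<^sup>2) \<and>
    \<not> (\<exists>c. AE x in S. f x = c) \<and> tends_up_to_infinity n \<and> (\<lambda>k. \<integral>x. (cmod (f ((T' ^^ n k) x) - f x))\<^sup>2 \<partial>S) \<longlonglongrightarrow> 0"
 then obtain f :: "'a measure \<Rightarrow> complex" and n where f [measurable]: "f \<in> borel_measurable S"
  and fi: "integrable S (\<lambda>x. (cmod (f x))\<^sup>2)" and nc: "\<not> (\<exists>c. AE x in S. f x = c)" and n: "tends_up_to_infinity n"
  and lim: "(\<lambda>k. \<integral>x. (cmod (f ((T' ^^ n k) x) - f x))\<^sup>2 \<partial>S) \<longlonglongrightarrow> 0" by blast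
 let ?D2 = "\<lambda>k x. (cmod (f ((T' ^^ k) x) - f x))\<^sup>2"
 have Tm [measurable]: "T' ^^ k \<in> measurable S S" for k by (rule SS.funpow_measurable[OF SS.meas_T])
 have "\<exists>u :: 'a measure \<Rightarrow> real. u \<in> borel_measurable S \<and> \<not> (\<exists>c. AE x in S. u x = c) \<and> (\<forall>x y. \<bar>u x - u y\<bar> \<le> cmod (f x - f y))"
 proof (cases "\<exists>c. AE x in S. Re (f x) = c")
  case False
  then show ?thesis by (intro exI[of _ "\<lambda>x. Re (f x)"]) (auto simp: abs_Re_le_cmod simp flip: minus_complex.simps)
 next
  case True
  then obtain c1 where c1: "AE x in S. Re (f x) = c1" by blast
  have "\<not> (\<exists>c. AE x in S. Im (f x) = c)" proof
   assume "\<exists>c. AE x in S. Im (f x) = c"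
   then obtain c2 where c2: "AE x in S. Im (f x) = c2" by blast
   have "AE x in S. f x = Complex c1 c2" using c1 c2 by eventually_elim (simp add: complex_eq_iff)
   then show False using nc by blast
  qed
  then show ?thesis by (intro exI[of _ "\<lambda>x. Im (f x)"]) (auto simp: abs_Im_le_cmod simp flip: minus_complex.simps)
 qed
 then obtain u :: "'a measure \<Rightarrow> real" where u [measurable]: "u \<in> borel_measurable S" and unc: "\<not> (\<exists>c. AE x in S. u x = c)"
  and uf: "\<And>x y. \<bar>u x - u y\<bar> \<le> cmod (f x - f y)" by blast
 obtain c where c: "S.prob {x\<in>space S. u x > c} \<noteq> 0" "S.prob {x\<in>space S. u x > c} \<noteq> 1" using S.AE_constant_if_levels_trivial[OF u] unc by blast
 define E where "E = {x\<in>space S. u x > c}"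
 have E: "E \<in> sets S" unfolding E_def by measurable
 have markov: "S.prob {x\<in>space S. del\<^sup>2 \<le> ?D2 k x} \<le> (\<integral>x. ?D2 k x \<partial>S) / del\<^sup>2" if "del > 0" for del k
 proof (rule integral_Markov_inequality_measure[where A="space S"])
  have fT: "integrable S (\<lambda>x. (cmod (f ((T' ^^ k) x)))\<^sup>2)" proof -
   have "integrable (distr S S (T' ^^ k)) (\<lambda>x. (cmod (f x))\<^sup>2)" using fi SS.funpow_distr[OF SS.meas_T SS.distr_T, of k] by simp
   then show ?thesis by (rule integrable_distr[OF Tm])
  qed
  have "integrable S (\<lambda>x. 2 * (cmod (f ((T' ^^ k) x)))\<^sup>2 + 2 * (cmod (f x))\<^sup>2)" using fi fT by simp
  then show "integrable S (\<lambda>x. ?D2 k x)" proof (rule bint_bound)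
   show "AE x in S. norm (?D2 k x) \<le> norm (2 * (cmod (f ((T' ^^ k) x)))\<^sup>2 + 2 * (cmod (f x))\<^sup>2)" proof (rule AE_I2)
    fix x
    let ?a = "cmod (f ((T' ^^ k) x))" and ?b = "cmod (f x)"
    have "?D2 k x \<le> (?a + ?b)\<^sup>2" by (intro power_mono norm_triangle_ineq4) auto
    also have "\<dots> \<le> 2 * ?a\<^sup>2 + 2 * ?b\<^sup>2" using zero_le_power2[of "?a - ?b"] by (simp add: power2_eq_square algebra_simps)
    finally show "norm (?D2 k x) \<le> norm (2 * ?a\<^sup>2 + 2 * ?b\<^sup>2)" by simp
   qed
  qed measurable
 qed (use that in auto)
 have rigS: "(\<lambda>k. S.prob (sym_diff E (SP.pre (int (n k)) E))) \<longlonglongrightarrow> 0" proof (rule LIMSEQ_I)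
  fix e :: real assume e: "0 < e"
  \<comment> \<open>A half-open band above the level \<open>c\<close>: the bands decrease to the
    empty set even if \<open>u\<close> takes the value \<open>c\<close> with positive probability.
    If both points avoid the band, a displacement smaller than its width cannot lead across
    \<open>c\<close>.\<close>
  define L where "L m = {x\<in>space S. c < u x \<and> u x \<le> c + 1 / real (Suc m)}" for m
  have L: "L m \<in> sets S" for m unfolding L_def by measurable
  have "(\<lambda>m. S.prob (L m)) \<longlonglongrightarrow> S.prob (\<Inter>m. L m)" proof (rule S.finite_Lim_measure_decseq)
   show "decseq L" unfolding decseq_def L_def by (auto intro: order_trans[OF _ add_left_mono[OF divide_left_mono]])
  qed (use L in auto)
  moreover have "(\<Inter>m. L m) = {}" proof (rule equals0I)
   fix x assume "x \<in> (\<Inter>m. L m)"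
   then have x: "c < u x" "\<And>m. u x - c \<le> 1 / real (Suc m)" by (auto simp: L_def algebra_simps)
   obtain m where "1 / real (Suc m) < u x - c" using nat_approx_posE[of "u x - c"] x(1) by auto
   then show False using x(2)[of m] by linarith
  qed
  ultimately have "(\<lambda>m. S.prob (L m)) \<longlonglongrightarrow> 0" by simp
  from LIMSEQ_D[OF this, of "e/4"] e obtain m where m: "S.prob (L m) < e / 4" by auto
  define del where "del = 1 / real (Suc m)"
  have del: "del > 0" by (simp add: del_def)
  have "e / 2 * del\<^sup>2 > 0" using e del by simp
  from LIMSEQ_D[OF lim this] obtain K where K: "\<And>k. k \<ge> K \<Longrightarrow> (\<integral>x. ?D2 (n k) x \<partial>S) < e / 2 * del\<^sup>2" by (auto simp: abs_less_iff)
  show "\<exists>no. \<forall>k\<ge>no. norm (S.prob (sym_diff E (SP.pre (int (n k)) E)) - 0) < e" proof (intro exI[of _ K] allI impI)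
   fix k assume k: "k \<ge> K"
   let ?D = "{x\<in>space S. del\<^sup>2 \<le> ?D2 (n k) x}"
   have D: "?D \<in> sets S" by measurable
   have "S.prob ?D \<le> (\<integral>x. ?D2 (n k) x \<partial>S) / del\<^sup>2" by (rule markov[OF del])
   also have "\<dots> < e / 2" using K[OF k] del by (simp add: divide_less_eq)
   finally have D2: "S.prob ?D < e / 2" .
   have sub: "sym_diff E (SP.pre (int (n k)) E) \<subseteq> L m \<union> (SP.pre (int (n k)) (L m) \<union> ?D)" proof
    fix x assume x: "x \<in> sym_diff E (SP.pre (int (n k)) E)"
    let ?y = "(T' ^^ n k) x"
    have xs: "x \<in> space S" using x SP.pre_subset[of "int (n k)" E] by (auto simp: E_def)
    have ys: "?y \<in> space S" using measurable_space[OF Tm xs] .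
    have pr: "x \<in> SP.pre (int (n k)) A \<longleftrightarrow> ?y \<in> A" for A using xs by (simp add: SP.pre_iff SP.Z_of_nat)
    show "x \<in> L m \<union> (SP.pre (int (n k)) (L m) \<union> ?D)" proof (rule ccontr)
     assume "x \<notin> L m \<union> (SP.pre (int (n k)) (L m) \<union> ?D)"
     then have a: "x \<notin> L m" "?y \<notin> L m" and b: "(cmod (f ?y - f x))\<^sup>2 < del\<^sup>2" using xs unfolding Un_iff pr by (simp_all add: not_le)
     have "cmod (f ?y - f x) < del" using b del by (rule power2_less_imp_less[OF _ less_imp_le])
     then have "\<bar>u ?y - u x\<bar> < del" using uf[of ?y x] by linarith
     have "L m = {x\<in>space S. c < u x \<and> u x \<le> c + del}" by (simp add: L_def del_def)
     then have mL: "z \<in> L m \<longleftrightarrow> c < u z \<and> u z \<le> c + del" if "z \<in> space S" for z using that by blast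
     have mE: "z \<in> E \<longleftrightarrow> c < u z" if "z \<in> space S" for z using that unfolding E_def by blast
     have "(x \<in> E) \<noteq> (?y \<in> E)" using x unfolding Un_iff Diff_iff pr by blast
     then show False using level_gap[of "u ?y" "u x" del c] \<open>\<bar>u ?y - u x\<bar> < del\<close> a unfolding mL[OF xs] mL[OF ys] mE[OF xs] mE[OF ys] by blast
    qed
   qed
   have "S.prob (sym_diff E (SP.pre (int (n k)) E)) \<le> S.prob (L m \<union> (SP.pre (int (n k)) (L m) \<union> ?D))"
    by (rule S.finite_measure_mono[OF sub]) (intro sets.Un spre_sets L D)
   also have "\<dots> \<le> S.prob (L m) + S.prob (SP.pre (int (n k)) (L m) \<union> ?D)" by (intro measure_Un_le sets.Un spre_sets L D)
   also have "S.prob (SP.pre (int (n k)) (L m) \<union> ?D) \<le> S.prob (SP.pre (int (n k)) (L m)) + S.prob ?D" by (intro measure_Un_le spre_sets L D)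
   also have "S.prob (SP.pre (int (n k)) (L m)) = S.prob (L m)" by (rule spre_measure[OF L])
   finally show "norm (S.prob (sym_diff E (SP.pre (int (n k)) E)) - 0) < e" using m D2 by simp
  qed
 qed
 obtain E0 where E0: "E0 \<in> sets P" "sym_diff E E0 \<in> null_sets S" using S_approx_P[OF E] .
 have nullD: "sym_diff E E0 \<in> sets S" using E0 by auto
 have N: "sym_diff E E0 \<union> SP.pre k (sym_diff E E0) \<in> null_sets S" for k using E0(2) SS.pre_null[OF E0(2), of k] by (simp only: sspre null_sets.Un)
 have eqE: "prob (sym_diff E0 (SP.pre k E0)) \<le> S.prob (sym_diff E (SP.pre k E))" for k proof -
  have "prob (sym_diff E0 (SP.pre k E0)) = S.prob (sym_diff E0 (SP.pre k E0))"
   using E0 SP.pre_sets by (intro measure_completion[symmetric] sets_sym_diff) auto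
  also have "\<dots> \<le> S.prob (sym_diff E (SP.pre k E) \<union> (sym_diff E E0 \<union> SP.pre k (sym_diff E E0)))" proof (rule S.finite_measure_mono)
   show "sym_diff E (SP.pre k E) \<union> (sym_diff E E0 \<union> SP.pre k (sym_diff E E0)) \<in> S.events"
    by (rule sets.Un[OF sets_sym_diff[OF E spre_sets[OF E]] null_setsD2[OF N]])
   show "sym_diff E0 (SP.pre k E0) \<subseteq> sym_diff E (SP.pre k E) \<union> (sym_diff E E0 \<union> SP.pre k (sym_diff E E0))" unfolding SP.pre_Un SP.pre_Diff by blast
  qed
  also have "\<dots> \<le> S.prob (sym_diff E (SP.pre k E)) + S.prob (sym_diff E E0 \<union> SP.pre k (sym_diff E E0))"
   by (rule measure_Un_le[OF sets_sym_diff[OF E spre_sets[OF E]] null_setsD2[OF N]])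
  also have "S.prob (sym_diff E E0 \<union> SP.pre k (sym_diff E E0)) = 0" by (rule measure_eq_0_null_sets[OF N])
  finally show ?thesis by simp
 qed
 have pE0: "prob E0 = S.prob E" proof -
  have "\<bar>S.prob E - S.prob E0\<bar> \<le> S.prob (sym_diff E E0)" using E E0 by (intro S_close nullD) auto
  then show ?thesis using measure_eq_0_null_sets[OF E0(2)] E0(1) by simp
 qed
 have rigP: "(\<lambda>k. prob (sym_diff E0 (SP.pre (int (n k)) E0))) \<longlonglongrightarrow> 0" by (rule tendsto_null_squeeze[OF measure_nonneg eqE rigS])
 have "prob E0 \<noteq> 0" "prob E0 \<noteq> 1" unfolding pE0 E_def by (fact c)+
 from rigid_event_imp_rigid_set[OF E0(1) this rigP]
 obtain A r where A: "A \<in> fmeasurable M" "emeasure M A > 0" "strict_mono r" "(\<lambda>k. measure M (sym_diff A (pre (int (n (r k))) A))) \<longlonglongrightarrow> 0" by blast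
 have "liminf (\<lambda>k. emeasure M (sym_diff A ((T ^^ n (r k)) ` A))) > 0"
  using rf[unfolded rigidity_free_def, rule_format, OF tends_up_subseq[OF n A(3)] A(1,2)] .
 moreover have "(\<lambda>k. emeasure M (sym_diff A ((T ^^ n (r k)) ` A))) \<longlonglongrightarrow> ennreal 0" proof -
  have "emeasure M (sym_diff A ((T ^^ n (r k)) ` A)) = ennreal (measure M (sym_diff A (pre (int (n (r k))) A)))" for k
   using A(1) pre_fmeasurable[OF A(1)] by (subst emeasure_sym_diff_image) (auto intro!: emeasure_eq_measure2 fmeasurable_sym_diff)
  then show ?thesis using A(4) by (simp only: tendsto_ennrealI)
 qed
 then have "liminf (\<lambda>k. emeasure M (sym_diff A ((T ^^ n (r k)) ` A))) = ennreal 0" by (intro lim_imp_Liminf) auto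
 ultimately show False by simp
qed

text \<open>A vanishing lower limit gives a subsequence along which \<open>A\<close> is rigid. The
  void event of \<open>A\<close> is then rigid too, since it changes only if a point falls in the
  symmetric difference, and its probability lies strictly between \<open>0\<close> and
  \<open>1\<close>.\<close>

lemma mildly_mixing_imp_rigidity_free:
 assumes mm: "mildly_mixing S T'" shows "rigidity_free M T" unfolding rigidity_free_def
proof (intro allI impI ballI, rule ccontr)
 fix n A assume n: "tends_up_to_infinity n" and A: "A \<in> fmeasurable M" and pos: "0 < emeasure M A"
  and "\<not> 0 < liminf (\<lambda>k. emeasure M (sym_diff A ((T ^^ n k) ` A)))"
 then have l0: "liminf (\<lambda>k. emeasure M (sym_diff A ((T ^^ n k) ` A))) = 0" by simp
 have As: "A \<in> sets M" using A by auto
 obtain r where r: "strict_mono r" "((\<lambda>k. emeasure M (sym_diff A ((T ^^ n k) ` A))) \<circ> r) \<longlonglongrightarrow> 0"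
  using liminf_subseq_lim[of "\<lambda>k. emeasure M (sym_diff A ((T ^^ n k) ` A))"] l0 by auto
 let ?E = "void A"
 have Es: "?E \<in> sets P" using As by simp
 define f :: "'a measure \<Rightarrow> complex" where "f = indicator ?E"
 have f [measurable]: "f \<in> borel_measurable S" unfolding f_def using Es by (intro borel_measurable_indicator) auto
 have sq: "(cmod (f x))\<^sup>2 = indicator ?E x" for x by (auto simp: f_def indicator_def)
 have fi: "integrable S (\<lambda>x. (cmod (f x))\<^sup>2)" unfolding sq using Es by (intro integrable_real_indicator) (auto simp: S.emeasure_eq_measure)
 have a0: "measure M A > 0" using pos A by (simp add: measure_def enn2real_positive_iff fmeasurable_def)
 have pE: "S.prob ?E = exp (- measure M A)" using prob_N0[OF A] Es by simp
 have nc: "\<not> (\<exists>c. AE x in S. f x = c)" proof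
  assume "\<exists>c. AE x in S. f x = c"
  then obtain c where c: "AE x in S. f x = c" by blast
  show False proof (cases "c = 1")
   case True
   from c have "AE x in S. x \<in> ?E" by eventually_elim (use True in \<open>auto simp: f_def indicator_def split: if_splits\<close>)
   then have "S.prob ?E = 1" using S.AE_in_set_eq_1[of ?E] Es by simp
   then show False using pE a0 by simp
  next
   case False
   from c have "AE x in S. x \<notin> ?E" by eventually_elim (use False in \<open>auto simp: f_def indicator_def\<close>)
   then have "?E \<in> null_sets S" using Es by (subst AE_iff_null_sets) auto
   then have "S.prob ?E = 0" by (rule measure_eq_0_null_sets)
   then show False using pE by simp
  qed
 qed
 have int: "(\<integral>x. (cmod (f ((T' ^^ k) x) - f x))\<^sup>2 \<partial>S) = S.prob (sym_diff ?E (SP.pre (int k) ?E))" for k proof -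
  have "(\<integral>x. (cmod (f ((T' ^^ k) x) - f x))\<^sup>2 \<partial>S) = (\<integral>x. indicator (sym_diff ?E (SP.pre (int k) ?E)) x \<partial>S)" proof (intro bint_cong refl)
   fix x assume "x \<in> space S"
   then have "x \<in> SP.pre (int k) ?E \<longleftrightarrow> (T' ^^ k) x \<in> ?E" by (simp add: SP.pre_iff SP.Z_of_nat)
   then show "(cmod (f ((T' ^^ k) x) - f x))\<^sup>2 = indicator (sym_diff ?E (SP.pre (int k) ?E)) x" unfolding f_def by (rule cmod_indicator_diff)
  qed
  then show ?thesis using Es by simp
 qed
 have le: "S.prob (sym_diff ?E (SP.pre k ?E)) \<le> measure M (sym_diff A (pre k A))" for k proof -
  have D: "sym_diff A (pre k A) \<in> fmeasurable M" using A pre_fmeasurable[OF A] by (intro fmeasurable_sym_diff)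
  have "S.prob (sym_diff ?E (SP.pre k ?E)) = prob (sym_diff ?E (SP.pre k ?E))"
   by (rule measure_completion[OF sets_sym_diff[OF Es SP.pre_sets[OF Es]]])
  also have "\<dots> \<le> prob {w\<in>space P. emeasure w (sym_diff A (pre k A)) \<noteq> 0}" proof (rule finite_measure_mono)
   show "{w\<in>space P. emeasure w (sym_diff A (pre k A)) \<noteq> 0} \<in> events" using D by (intro N_neq_sets) auto
   show "sym_diff ?E (SP.pre k ?E) \<subseteq> {w\<in>space P. emeasure w (sym_diff A (pre k A)) \<noteq> 0}" proof
    fix w assume w: "w \<in> sym_diff ?E (SP.pre k ?E)"
    then have sp: "w \<in> space P" using SP.pre_subset[of k ?E] by auto
    have "emeasure w A = emeasure w (pre k A)" if "emeasure w (sym_diff A (pre k A)) = 0" proof -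
     have S: "A \<in> sets w" "pre k A \<in> sets w" using sp As pre_sets[OF As] by (auto simp: space_P)
     have "sym_diff A (pre k A) \<in> null_sets w" using that sets_sym_diff[OF S] by (simp only: null_sets_def) simp
     then show ?thesis using S by (intro emeasure_eq_AE) (auto dest!: AE_not_in)
    qed
    then show "w \<in> {w\<in>space P. emeasure w (sym_diff A (pre k A)) \<noteq> 0}" using w sp unfolding spre_N0[OF As] by auto
   qed
  qed
  also have "\<dots> \<le> measure M (sym_diff A (pre k A))" by (rule prob_N_pos_le[OF D])
  finally show ?thesis .
 qed
 have "(\<lambda>k. measure M (sym_diff A (pre (int (n (r k))) A))) \<longlonglongrightarrow> 0" proof (rule tendsto_ennrealD)
  have "ennreal (measure M (sym_diff A (pre (int (n (r k))) A))) = emeasure M (sym_diff A ((T ^^ n (r k)) ` A))" for k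
   using A pre_fmeasurable[OF A] As by (subst emeasure_sym_diff_image) (auto intro!: emeasure_eq_measure2[symmetric] fmeasurable_sym_diff)
  then show "(\<lambda>k. ennreal (measure M (sym_diff A (pre (int (n (r k))) A)))) \<longlonglongrightarrow> ennreal 0" using r(2) by (simp add: comp_def)
 qed auto
 then have "(\<lambda>k. \<integral>x. (cmod (f ((T' ^^ n (r k)) x) - f x))\<^sup>2 \<partial>S) \<longlonglongrightarrow> 0" unfolding int by (rule tendsto_null_squeeze[OF measure_nonneg le])
 then show False using mm f fi nc tends_up_subseq[OF n r(1)] unfolding mildly_mixing_def by blast
qed

end

section \<open>K property\<close>

text \<open>The isomorphism in \<open>lebesgue_space\<close> leads to a completed measure, so its
  range and the images of measurable sets are Borel only modulo null sets. The range is shrunk to a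
  Borel set \<open>N0\<close>; for images, a Borel set inside and one outside with null difference
  are kept.\<close>

lemma lebesgue_coordinate:
 assumes "lebesgue_space M"
 obtains X0 N0 and psi :: "'a \<Rightarrow> real" where "X0 \<in> sets M" "space M - X0 \<in> null_sets M" "N0 \<in> sets borel"
  "psi \<in> borel_measurable M" "inj_on psi X0" "psi ` X0 = N0"
  "\<And>A. A \<in> sets M \<Longrightarrow> A \<subseteq> X0 \<Longrightarrow> \<exists>B1\<in>sets borel. \<exists>B2\<in>sets borel. B1 \<subseteq> psi ` A \<and> psi ` A \<subseteq> B2 \<and> B2 \<subseteq> N0 \<and>
   psi -` (B2 - B1) \<inter> X0 \<in> null_sets M"
proof -
 obtain N :: "real measure" and phi where N: "sets N = sets borel" and iso: "iso_mod0 M (completion N) phi"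
  using assms unfolding lebesgue_space_def by blast
 obtain M0 N1 where M0: "M0 \<in> sets M" "N1 \<in> sets (completion N)" "space M - M0 \<in> null_sets M" "bij_betw phi M0 N1"
  and iff: "\<And>B. B \<subseteq> N1 \<Longrightarrow> (B \<in> sets (completion N) \<longleftrightarrow> phi -` B \<inter> M0 \<in> sets M)"
  and em: "\<And>B. B \<in> sets (completion N) \<Longrightarrow> B \<subseteq> N1 \<Longrightarrow> emeasure M (phi -` B \<inter> M0) = emeasure (completion N) B" using iso unfolding iso_mod0_def by metis
 obtain N0 R R' where N0: "N1 = N0 \<union> R" "R \<subseteq> R'" "R' \<in> null_sets N" "N0 \<in> sets N" using M0(2) by (rule sets_completionE)
 have nullN: "C \<in> sets (completion N) \<and> emeasure (completion N) C = 0" if "C \<subseteq> R'" "R' \<in> null_sets N" for C R' proof -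
  have "C \<in> null_sets (completion N)" by (rule null_sets_completion_subset[OF that(1) null_sets_completionI[OF that(2)]])
  then show ?thesis by auto
 qed
 define X0 where "X0 = phi -` N0 \<inter> M0"
 have N0N1: "N0 \<subseteq> N1" using N0(1) by blast
 have X0: "X0 \<in> sets M" unfolding X0_def using iff[OF N0N1] N0(4) by simp
 have inj: "inj_on phi M0" and img: "phi ` M0 = N1" using M0(4) by (auto simp: bij_betw_def)
 have X0M0: "X0 \<subseteq> M0" by (auto simp: X0_def)
 have img0: "phi ` X0 = N0" proof
  show "N0 \<subseteq> phi ` X0" proof
   fix y assume y: "y \<in> N0"
   then obtain x where "x \<in> M0" "y = phi x" using N0N1 img by blast
   then show "y \<in> phi ` X0" using y by (auto simp: X0_def)
  qed
 qed (auto simp: X0_def)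
 have M0X0: "M0 - X0 \<in> null_sets M" proof -
  have eq: "M0 - X0 = phi -` (N1 - N0) \<inter> M0" using img by (auto simp: X0_def)
  have c: "N1 - N0 \<in> sets (completion N)" "emeasure (completion N) (N1 - N0) = 0" using nullN[of "N1 - N0" R'] N0 by auto
  show ?thesis unfolding eq using em[OF c(1)] iff[of "N1 - N0"] c by (auto simp: null_sets_def)
 qed
 \<comment> \<open>The value \<open>0\<close> off \<open>X0\<close> makes \<open>psi\<close>
   measurable on the whole space; injectivity is claimed on \<open>X0\<close> only.\<close>
 define psi where "psi x = (if x \<in> X0 then phi x else 0)" for x
 have pre_psi: "psi -` U \<inter> X0 = phi -` (U \<inter> N0) \<inter> M0" for U using img0 by (auto simp: psi_def X0_def)
 show thesis proof (rule that[of X0 N0 psi])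
  show "X0 \<in> sets M" by fact
  have "space M - X0 \<subseteq> (space M - M0) \<union> (M0 - X0)" by auto
  then show "space M - X0 \<in> null_sets M" by (rule null_sets_subset[OF null_sets.Un[OF M0(3) M0X0] sets.compl_sets[OF X0]])
  show "N0 \<in> sets borel" using N0(4) N by simp
  show "psi \<in> borel_measurable M" proof (rule measurableI)
   fix U :: "real set" assume U: "U \<in> sets borel"
   have "U \<inter> N0 \<in> sets N" using U N0(4) N by auto
   then have 1: "psi -` U \<inter> X0 \<in> sets M" unfolding pre_psi using iff[of "U \<inter> N0"] N0N1 by auto
   have "psi -` U \<inter> space M = (psi -` U \<inter> X0) \<union> (if 0 \<in> U then space M - X0 else {})"
    using sub_space[OF X0] by (cases "0 \<in> U") (auto simp: psi_def split: if_splits)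
   then show "psi -` U \<inter> space M \<in> sets M" using 1 X0 by auto
  qed simp
  show "inj_on psi X0" using inj X0M0 by (auto simp: psi_def inj_on_def)
  show "psi ` X0 = N0" using img0 by (auto simp: psi_def)
  fix A assume A: "A \<in> sets M" "A \<subseteq> X0"
  have psiA: "psi ` A = phi ` A" using A by (auto simp: psi_def)
  have "phi ` A \<subseteq> N0" using A img0 by blast
  then have AN: "phi ` A \<subseteq> N1" using N0N1 by blast
  have "phi -` (phi ` A) \<inter> M0 = A" using inj A X0M0 by (auto simp: inj_on_def)
  then have "phi ` A \<in> sets (completion N)" using iff[OF AN] A by simp
  then obtain B1 Q Q' where B1: "phi ` A = B1 \<union> Q" "Q \<subseteq> Q'" "Q' \<in> null_sets N" "B1 \<in> sets N" by (rule sets_completionE)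
  let ?B2 = "(B1 \<union> Q') \<inter> N0"
  show "\<exists>B1\<in>sets borel. \<exists>B2\<in>sets borel. B1 \<subseteq> psi ` A \<and> psi ` A \<subseteq> B2 \<and> B2 \<subseteq> N0 \<and> psi -` (B2 - B1) \<inter> X0 \<in> null_sets M"
  proof (rule bexI[of _ B1], rule bexI[of _ ?B2], intro conjI)
   show "B1 \<subseteq> psi ` A" unfolding psiA B1(1) by (rule Un_upper1)
   show "psi ` A \<subseteq> ?B2" unfolding psiA using B1(1,2) \<open>phi ` A \<subseteq> N0\<close> by blast
   show "?B2 \<subseteq> N0" by (rule Int_lower2)
   show "B1 \<in> sets borel" "?B2 \<in> sets borel" using B1 N0 N by auto
   have c: "(?B2 - B1) \<inter> N0 \<in> sets (completion N)" "emeasure (completion N) ((?B2 - B1) \<inter> N0) = 0" using nullN[of "(?B2 - B1) \<inter> N0" Q'] B1 by auto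
   have sub: "(?B2 - B1) \<inter> N0 \<subseteq> N1" using N0N1 by blast
   show "psi -` (?B2 - B1) \<inter> X0 \<in> null_sets M" unfolding pre_psi using em[OF c(1) sub] iff[OF sub] c by (auto simp: null_sets_def)
  qed
 qed
qed

lemma nonatomic_singleton:
 assumes na: "non_atomic M" and x: "{x} \<in> sets M"
 shows "emeasure M {x} = 0"
proof (rule ccontr)
 assume pos: "emeasure M {x} \<noteq> 0"
 have "\<exists>A\<in>sets M. emeasure M A > 0 \<and> (\<forall>B\<in>sets M. B \<subseteq> A \<longrightarrow> emeasure M B = 0 \<or> emeasure M (A - B) = 0)" proof (intro bexI[of _ "{x}"] conjI ballI impI x)
  show "emeasure M {x} > 0" using pos by (simp add: zero_less_iff_neq_zero)
  fix B assume "B \<subseteq> {x}"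
  then show "emeasure M B = 0 \<or> emeasure M ({x} - B) = 0" by (auto simp: subset_singleton_iff)
 qed
 then show False using na unfolding non_atomic_def by blast
qed

text \<open>Since single points are null, the distribution function of the coordinate on
  \<open>A\<close> is continuous and takes the values \<open>i * measure M A / K\<close>; cutting
  there gives pieces of equal measure.\<close>

lemma small_partition:
 fixes K :: nat
 assumes leb: "lebesgue_space M" and na: "non_atomic M" and A: "A \<in> fmeasurable M" and K: "K \<ge> 1"
 obtains D :: "nat \<Rightarrow> 'a set" where "disjoint_family_on D {..<K}" "(\<Union>i<K. D i) \<subseteq> A" "A - (\<Union>i<K. D i) \<in> null_sets M"
  "\<And>i. D i \<in> fmeasurable M" "\<And>i. i < K \<Longrightarrow> measure M (D i) = measure M A / K"
proof -
 obtain X0 N0 and psi :: "'a \<Rightarrow> real" where c: "X0 \<in> sets M" "space M - X0 \<in> null_sets M" "psi \<in> borel_measurable M" "inj_on psi X0"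
  by (rule lebesgue_coordinate[OF leb]) (rule that)
 note [measurable] = c(1,3)
 have As [measurable]: "A \<in> sets M" using A by auto
 define R where "R = restrict_space M (A \<inter> X0)"
 have AX: "A \<inter> X0 \<in> fmeasurable M" using A by (intro fmeasurableI2[OF A]) auto
 define a where "a = measure M (A \<inter> X0)"
 have nullAX: "A - X0 \<in> null_sets M" using c(2) sub_space[OF As] by (intro null_sets_subset[OF c(2)]) auto
 have aA: "a = measure M A" proof -
  have "emeasure M (A \<inter> X0) = emeasure M A" using AE_not_in[OF nullAX] by (intro emeasure_eq_AE) auto
  then show ?thesis by (simp add: a_def measure_def)
 qed
 define rho where "rho = distr R borel psi"
 have spR: "space R = A \<inter> X0" using sub_space[OF As] by (auto simp: R_def space_restrict_space)
 have psiR [measurable]: "psi \<in> borel_measurable R" unfolding R_def by (rule measurable_restrict_space1[OF c(3)])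
 have eR: "emeasure R B = emeasure M B" if "B \<subseteq> A \<inter> X0" for B unfolding R_def using that by (intro emeasure_restrict_space) auto
 have rho: "emeasure rho U = emeasure M (psi -` U \<inter> (A \<inter> X0))" if "U \<in> sets borel" for U
  unfolding rho_def using that eR[of "psi -` U \<inter> (A \<inter> X0)", OF Int_lower2] by (simp add: emeasure_distr spR)
 interpret F0: finite_measure rho using rho[of UNIV] AX by (intro finite_measureI) (simp add: rho_def fmeasurable_def)
 interpret F: finite_borel_measure rho by standard (simp add: rho_def)
 have m_rho: "measure rho U = measure M (psi -` U \<inter> (A \<inter> X0))" if "U \<in> sets borel" for U using rho[OF that] by (simp add: measure_def)
 have pt: "measure rho {y} = 0" for y proof (cases "psi -` {y} \<inter> (A \<inter> X0) = {}")
  case True then show ?thesis using m_rho[of "{y}"] by simp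
 next
  case False
  then obtain x where x: "x \<in> A \<inter> X0" "psi x = y" by auto
  then have eq: "psi -` {y} \<inter> (A \<inter> X0) = {x}" using c(4) by (auto simp: inj_on_def)
  have "psi -` {y} \<inter> (A \<inter> X0) = (psi -` {y} \<inter> space M) \<inter> (A \<inter> X0)" using sub_space[OF As] by auto
  also have "\<dots> \<in> sets M" by measurable
  finally have "{x} \<in> sets M" unfolding eq .
  then show ?thesis using m_rho[of "{y}"] nonatomic_singleton[OF na] unfolding eq by (simp add: measure_def)
 qed
 have cont: "continuous_on UNIV (cdf rho)" using pt F.isCont_cdf by (simp add: continuous_at_imp_continuous_on)
 have a_rho: "measure rho (space rho) = a" using m_rho[of UNIV] by (simp add: rho_def a_def)
 have "\<exists>t. \<forall>i. 0 < i \<and> i < K \<and> a > 0 \<longrightarrow> cdf rho (t i) = real i * a / K" proof (rule choice, rule allI)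
  fix i :: nat
  show "\<exists>t. 0 < i \<and> i < K \<and> a > 0 \<longrightarrow> cdf rho t = real i * a / K" proof (cases "0 < i \<and> i < K \<and> a > 0")
   case True
   let ?y = "real i * a / K"
   have y: "0 < ?y" "?y < a" using True by (auto simp: field_simps)
   obtain l where l: "cdf rho l < ?y" using order_tendstoD(2)[OF F.cdf_lim_at_bot y(1)] by (auto simp: eventually_at_bot_linorder)
   obtain h where h: "?y < cdf rho h" using order_tendstoD(1)[OF F.cdf_lim_at_top[unfolded a_rho] y(2)] by (auto simp: eventually_at_top_linorder)
   have "l \<le> h" using F.cdf_nondecreasing[of h l] l h by linarith
   then obtain t where "cdf rho t = ?y" using IVT'[of "cdf rho" l ?y h] l h continuous_on_subset[OF cont] by auto
   then show ?thesis by blast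
  qed auto
 qed
 then obtain t where t: "\<And>i. 0 < i \<Longrightarrow> i < K \<Longrightarrow> a > 0 \<Longrightarrow> cdf rho (t i) = real i * a / K" by blast
 \<comment> \<open>If \<open>a = 0\<close>, the cut points \<open>t i\<close> carry no information,
   and the last piece takes everything.\<close>
 define H where "H i = (if i = 0 then {} else if i < K then (if a > 0 then {..t i} else {}) else UNIV)" for i
 have Hb [measurable]: "H i \<in> sets borel" for i by (simp add: H_def)
 have Hm: "measure rho (H i) = real i * a / K" if "i \<le> K" for i proof -
  have "0 \<le> a" by (simp add: a_def)
  consider "i = 0" | "0 < i" "i < K" | "i = K" "i > 0" using \<open>i \<le> K\<close> K by fastforce
  then show ?thesis proof cases
   case 1 then show ?thesis by (simp add: H_def)
  next
   case 2 then show ?thesis using t[OF 2] \<open>0 \<le> a\<close> by (auto simp: H_def cdf_def)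
  next
   case 3 then show ?thesis using a_rho K by (simp add: H_def F.borel_UNIV)
  qed
 qed
 have Hmono: "H i \<subseteq> H (Suc i)" for i proof -
  have "t i \<le> t (Suc i)" if "0 < i" "Suc i < K" "a > 0" proof (rule ccontr)
   assume "\<not> ?thesis"
   then have "cdf rho (t (Suc i)) \<le> cdf rho (t i)" by (intro F.cdf_nondecreasing) simp
   moreover have "cdf rho (t i) = real i * a / K" "cdf rho (t (Suc i)) = real (Suc i) * a / K" using that t[of i] t[of "Suc i"] by auto
   moreover have "cdf rho (t i) = cdf rho (t (Suc i)) \<or> cdf rho (t i) < cdf rho (t (Suc i))"
    unfolding calculation(2,3) using that by (simp add: divide_right_mono field_simps)
   moreover have "cdf rho (t i) \<noteq> cdf rho (t (Suc i))" unfolding calculation(2,3) using that by (auto simp: field_simps)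
   ultimately show False by linarith
  qed
  then show ?thesis by (auto simp: H_def)
 qed
 have Hmono2: "H i \<subseteq> H j" if "i \<le> j" for i j using that Hmono by (rule lift_Suc_mono_le[where f=H, rotated])
 define D where "D i = psi -` (H (Suc i) - H i) \<inter> (A \<inter> X0)" for i
 have Dsp: "D i = (psi -` (H (Suc i) - H i) \<inter> space M) \<inter> (A \<inter> X0)" for i using sub_space[OF As] by (auto simp: D_def)
 have Ds: "D i \<in> sets M" for i unfolding Dsp by measurable
 show thesis proof (rule that[of D])
  show "disjoint_family_on D {..<K}" unfolding disjoint_family_on_def proof (intro ballI impI)
   fix m n assume "m \<in> {..<K}" "n \<in> {..<K}" "m \<noteq> n"
   then consider "Suc m \<le> n" | "Suc n \<le> m" by force
   then show "D m \<inter> D n = {}" by cases (use Hmono2[of "Suc m" n] Hmono2[of "Suc n" m] in \<open>auto simp: D_def\<close>)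
  qed
  show "(\<Union>i<K. D i) \<subseteq> A" by (auto simp: D_def)
  have "A \<inter> X0 \<subseteq> (\<Union>i<K. D i)" proof
   fix x assume x: "x \<in> A \<inter> X0"
   define m where "m = (LEAST i. psi x \<in> H i)"
   have ex: "psi x \<in> H K" using K by (simp add: H_def)
   then have m: "psi x \<in> H m" "m \<le> K" unfolding m_def by (rule LeastI, rule Least_le)
   then have "m \<noteq> 0" using K by (cases "m = 0") (auto simp: H_def)
   then obtain i where i: "m = Suc i" by (cases m) auto
   have "psi x \<notin> H i" using not_less_Least[of i "\<lambda>i. psi x \<in> H i"] i unfolding m_def by auto
   then have "x \<in> D i" using m i x by (auto simp: D_def)
   then show "x \<in> (\<Union>i<K. D i)" using m(2) i by auto
  qed
  then show "A - (\<Union>i<K. D i) \<in> null_sets M" using Ds by (intro null_sets_subset[OF nullAX]) (auto intro!: sets.Diff sets.finite_UN)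
  show Df: "D i \<in> fmeasurable M" for i by (rule fmeasurableI2[OF AX _ Ds]) (auto simp: D_def)
  show "measure M (D i) = measure M A / K" if "i < K" for i proof -
   have "measure M (D i) = measure rho (H (Suc i) - H i)" unfolding D_def by (rule m_rho[symmetric]) simp
   also have "\<dots> = measure rho (H (Suc i)) - measure rho (H i)" by (rule F0.finite_measure_Diff) (use Hb Hmono F.M_is_borel in auto)
   also have "\<dots> = a / K" using Hm[of i] Hm[of "Suc i"] that K by (simp add: field_simps)
   finally show ?thesis by (simp add: aA)
  qed
 qed
qed

lemma pmf_poisson_law: "r \<ge> 0 \<Longrightarrow> pmf (poisson_law r) k = r ^ k / fact k * exp (- r)" by (cases "r = 0") (auto simp: poisson_law_def power_0_left)

section \<open>Approximation of events by void events\<close>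

context poisson
begin

text \<open>Two or more points are an event of second order,
  \<open>1 - (1 + a) * exp (- a) \<le> a^2\<close>, so cutting a set into \<open>K\<close> equal
  pieces brings the total of these probabilities down to \<open>a^2 / K\<close>.\<close>

lemma prob_N_ge2: assumes A: "A \<in> fmeasurable M" shows "prob {w\<in>space P. emeasure w A \<notin> {0, 1}} \<le> (measure M A)\<^sup>2"
proof -
 let ?a = "measure M A"
 let ?p = "poisson_law ?a"
 have m: "{0, 1} \<in> sets (borel :: ennreal measure)" by (intro borel_closed finite_imp_closed) auto
 have As: "A \<in> sets M" using A by auto
 have "prob (occ A ({0, 1})) = measure (measure_pmf ?p) {n. of_nat n \<in> {0, 1 :: ennreal}}" by (rule prob_N[OF A m])
 also have "{n::nat. of_nat n \<in> {0, 1 :: ennreal}} = {0, 1}" by auto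
 also have "measure (measure_pmf ?p) {0, 1} = pmf ?p 0 + pmf ?p 1" by (subst measure_measure_pmf_finite) auto
 also have "\<dots> = exp (- ?a) * (1 + ?a)" by (simp add: pmf_poisson_law algebra_simps)
 finally have 1: "prob (occ A ({0, 1})) = exp (- ?a) * (1 + ?a)" .
 have "{w\<in>space P. emeasure w A \<notin> {0, 1}} = space P - (occ A ({0, 1}))" by blast
 then have "prob {w\<in>space P. emeasure w A \<notin> {0, 1}} = 1 - exp (- ?a) * (1 + ?a)" using prob_compl[OF N_sets[OF As m]] 1 by simp
 moreover have "(1 - ?a) * (1 + ?a) \<le> exp (- ?a) * (1 + ?a)" using exp_ge_add_one_self[of "- ?a"] by (intro mult_right_mono) auto
 ultimately show ?thesis by (simp add: algebra_simps power2_eq_square)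
qed

definition voids :: "'a measure set set" where "voids = {(void A) | A. A \<in> fmeasurable M}"

lemma voids_events: "voids \<subseteq> events" by (auto simp: voids_def)

lemma Int_stable_voids: "Int_stable voids"
proof (rule Int_stableI)
 fix E F assume "E \<in> voids" "F \<in> voids"
 then obtain A B where AB: "A \<in> fmeasurable M" "B \<in> fmeasurable M" "E = (void A)" "F = (void B)"
  by (auto simp: voids_def)
 have "emeasure w (A \<union> B) = 0 \<longleftrightarrow> emeasure w A = 0 \<and> emeasure w B = 0" if "w \<in> space P" for w proof -
  have S: "A \<in> sets w" "B \<in> sets w" using AB that by (auto simp: space_P)
  have "emeasure w A \<le> emeasure w (A \<union> B)" "emeasure w B \<le> emeasure w (A \<union> B)" using S by (auto intro!: emeasure_mono)
  moreover have "emeasure w (A \<union> B) \<le> emeasure w A + emeasure w B" using S by (rule emeasure_subadditive)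
  ultimately show ?thesis by auto
 qed
 then have "E \<inter> F = (void (A \<union> B))" unfolding AB by auto
 then show "E \<inter> F \<in> voids" unfolding voids_def using AB by blast
qed

text \<open>A set of finite measure \<open>a\<close> is cut into \<open>K\<close> pieces of equal
  measure. Unless some piece holds more than one point, the count is the number of occupied pieces,
  a function of void events; the exception has probability at most \<open>a^2 / K\<close>.\<close>

lemma voids_approx:
 assumes leb: "lebesgue_space M" and na: "non_atomic M" and E: "E \<in> events" and e: "e > 0"
 shows "\<exists>V\<in>sigma_sets (space P) voids. prob (sym_diff E V) < e"
proof -
 let ?V = "sigma_sets (space P) voids"
 have VP: "voids \<subseteq> Pow (space P)" using voids_events sub_space by blast
 have sV: "sigma_algebra (space P) ?V" by (rule sigma_algebra_sigma_sets[OF VP])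
 have Ve: "?V \<subseteq> events" using sets.sigma_sets_subset[OF voids_events] .
 have aV: "algebra (space P) ?V" using sV by (rule sigma_algebra.axioms)
 have sig: "sigma_algebra (space P) (approximable P ?V)" by (rule sigma_algebra_approximable[OF finite_measure_axioms aV Ve])
 let ?N = "sigma (space P) (approximable P ?V)"
 have sN: "sets ?N = approximable P ?V" "space ?N = config M"
  using sigma_algebra.sets_measure_of_eq[OF sig] by (simp_all add: space_measure_of_conv space_P)
 let ?W = "sigma (space P) ?V"
 have sW: "sets ?W = ?V" "space ?W = space P" using sigma_algebra.sets_measure_of_eq[OF sV] by (simp_all add: space_measure_of_conv)
 have basic: "(occ A U) \<in> approximable P ?V" if A: "A \<in> fmeasurable M" and U: "U \<in> sets borel" for A U unfolding approximable_def
 proof (intro CollectI conjI allI impI)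
  have As: "A \<in> sets M" using A by auto
  show ev: "(occ A U) \<in> events" using As U by (rule N_sets)
  fix e :: real assume e: "e > 0"
  let ?a = "measure M A"
  obtain K0 :: nat where K0: "?a\<^sup>2 / e < real K0" using reals_Archimedean2 by blast
  define K where "K = Suc K0"
  have K: "K \<ge> 1" "?a\<^sup>2 / K < e" using K0 e by (auto simp: K_def field_simps)
  obtain D where D: "disjoint_family_on D {..<K}" "(\<Union>i<K. D i) \<subseteq> A" "A - (\<Union>i<K. D i) \<in> null_sets M"
   "\<And>i. D i \<in> fmeasurable M" "\<And>i. i < K \<Longrightarrow> measure M (D i) = ?a / K" by (rule small_partition[OF leb na A K(1)]) (rule that)
  have Ds: "D i \<in> sets M" for i using D(4) by auto
  define c where "c w = (\<Sum>i<K. if emeasure w (D i) = 0 then 0 else 1 :: ennreal)" for w :: "'a measure"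
  have cm: "c \<in> borel_measurable ?W" unfolding c_def proof (intro borel_measurable_sum measurable_If)
   fix i
   have "{w\<in>space ?W. emeasure w (D i) = 0} \<in> voids" unfolding sW unfolding voids_def using D(4) by blast
   then show "{w\<in>space ?W. emeasure w (D i) = 0} \<in> sets ?W" unfolding sW by (rule sigma_sets.Basic)
  qed simp_all
  let ?VV = "c -` U \<inter> space ?W"
  have V0: "?VV \<in> ?V" using measurable_sets[OF cm U] unfolding sW .
  have V0e: "?VV \<in> events" using V0 Ve by blast
  let ?B = "\<Union>i<K. {w\<in>space P. emeasure w (D i) \<notin> {0, 1}}"
  have m01: "- {0, 1} \<in> sets (borel :: ennreal measure)" by (intro borel_comp borel_closed finite_imp_closed) auto
  have Bi: "{w\<in>space P. emeasure w (D i) \<notin> {0, 1}} \<in> events" for i using N_sets[OF Ds m01, of i] by simp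
  have Be: "?B \<in> events" using Bi by (intro sets.finite_UN) auto
  have sde: "sym_diff (occ A U) ?VV \<in> events" by (rule sets_sym_diff[OF ev V0e])
  have "prob (sym_diff (occ A U) ?VV) \<le> prob ?B" proof (rule finite_measure_mono_AE[OF _ Be])
   show "AE w in P. w \<in> sym_diff (occ A U) ?VV \<longrightarrow> w \<in> ?B" using AE_N_null[OF D(3)] AE_space proof eventually_elim
    fix w assume 0: "emeasure w (A - (\<Union>i<K. D i)) = 0" and w: "w \<in> space P"
    have S: "A \<in> sets w" "(\<Union>i<K. D i) \<in> sets w" using w As Ds by (auto simp: space_P intro!: sets.finite_UN)
    have "emeasure w A = c w" if "w \<notin> ?B" proof -
     have "emeasure w A = emeasure w ((\<Union>i<K. D i) \<union> (A - (\<Union>i<K. D i)))" using D(2) by (intro arg_cong[where f="emeasure w"]) auto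
     also have "\<dots> = emeasure w (\<Union>i<K. D i) + emeasure w (A - (\<Union>i<K. D i))" using S by (intro plus_emeasure[symmetric]) auto
     also have "\<dots> = (\<Sum>i<K. emeasure w (D i))" using 0 D(1) Ds w by (subst sum_emeasure[symmetric]) (auto simp: space_P)
     also have "\<dots> = c w" unfolding c_def using that w by (intro sum.cong refl) auto
     finally show ?thesis .
    qed
    then show "w \<in> sym_diff (occ A U) ?VV \<longrightarrow> w \<in> ?B" using w unfolding sW by force
   qed
  qed
  also have "\<dots> \<le> (\<Sum>i<K. prob {w\<in>space P. emeasure w (D i) \<notin> {0, 1}})" using Bi by (intro measure_UNION_le) auto
  also have "\<dots> \<le> (\<Sum>i<K. (?a / K)\<^sup>2)" proof (rule sum_mono)
   fix i assume "i \<in> {..<K}"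
   then have "measure M (D i) = ?a / K" using D(5) by simp
   then show "prob {w\<in>space P. emeasure w (D i) \<notin> {0, 1}} \<le> (?a / K)\<^sup>2" using prob_N_ge2[OF D(4), of i] by simp
  qed
  also have "\<dots> = ?a\<^sup>2 / K" using K(1) by (simp add: power2_eq_square)
  also have "\<dots> < e" by (rule K)
  finally show "\<exists>V\<in>?V. prob (sym_diff (occ A U) V) < e" using V0 by blast
 qed
 have fin: "(cnt A) \<in> borel_measurable ?N" if A: "A \<in> fmeasurable M" for A proof (rule measurableI)
  fix U :: "ennreal set" assume "U \<in> sets borel"
  then have "(occ A U) \<in> sets ?N" unfolding sN by (rule basic[OF A])
  moreover have "(cnt A) -` U \<inter> space ?N = (occ A U)" unfolding sN(2) unfolding space_P by blast
  ultimately show "(cnt A) -` U \<inter> space ?N \<in> sets ?N" by simp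
 qed simp
 have "cyl M (sets M) \<subseteq> approximable P ?V" proof (rule cyl_leI[OF _ sN(2) sN(1)])
  show "sigma_algebra (config M) (approximable P ?V)" using sig by (simp add: space_P)
  fix A assume "A \<in> sets M"
  from decompose_fmeasurable[OF this] obtain B :: "nat \<Rightarrow> 'a set" where
   B: "A = (\<Union>i. B i)" "disjoint_family B" "range B \<subseteq> {B\<in>sets M. B \<subseteq> A} \<inter> fmeasurable M" by blast
  show "(cnt A) \<in> borel_measurable ?N" by (rule measurable_sum_disjoint[OF B(1,2) _ sN(2) fin]) (use B(3) in auto)
 qed
 then show ?thesis using E e unfolding sets_P approximable_def by blast
qed

text \<open>Void events form an intersection-stable family, so \<open>E\<close> is independent of
  the field they generate. That field approximates \<open>E\<close>, so \<open>E\<close> is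
  independent of itself.\<close>

lemma void_independent_trivial:
 assumes leb: "lebesgue_space M" and na: "non_atomic M" and E: "E \<in> events"
  and ind: "\<And>A. A \<in> fmeasurable M \<Longrightarrow> prob (E \<inter> (void A)) = prob E * prob (void A)"
 shows "prob E = 0 \<or> prob E = 1"
proof -
 have "indep_set {E} voids" using E voids_events ind by (intro indep_setI) (auto simp: voids_def)
 then have sind: "indep_set (sigma_sets (space P) {E}) (sigma_sets (space P) voids)"
  by (rule indep_set_sigma_sets[OF _ _ Int_stable_voids]) (auto simp: Int_stable_def)
 have Ve: "sigma_sets (space P) voids \<subseteq> events" using sets.sigma_sets_subset[OF voids_events] .
 have "\<bar>prob E - prob E * prob E\<bar> \<le> 0" proof (rule field_le_epsilon)
  fix e :: real assume "e > 0"
  then have "e / 2 > 0" by simp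
  from voids_approx[OF leb na E this] obtain V where V: "V \<in> sigma_sets (space P) voids" "prob (sym_diff E V) < e / 2" by blast
  have Vev: "V \<in> events" using V Ve by blast
  have 1: "prob (E \<inter> V) = prob E * prob V" using indep_setD[OF sind sigma_sets.Basic V(1)] by simp
  have D: "sym_diff E V \<in> events" by (rule sets_sym_diff[OF E Vev])
  have 2: "\<bar>prob E - prob (E \<inter> V)\<bar> \<le> prob (sym_diff E V)" using E Vev D by (intro prob_close) auto
  have 3: "\<bar>prob E - prob V\<bar> \<le> prob (sym_diff E V)" using E Vev D by (intro prob_close) auto
  have "\<bar>prob E * prob V - prob E * prob E\<bar> = prob E * \<bar>prob V - prob E\<bar>" by (simp add: right_diff_distrib[symmetric] abs_mult)
  also have "\<dots> \<le> 1 * \<bar>prob V - prob E\<bar>" by (intro mult_right_mono) auto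
  finally have 4: "\<bar>prob E * prob V - prob E * prob E\<bar> \<le> \<bar>prob V - prob E\<bar>" by simp
  have "\<bar>p - r\<bar> \<le> 0 + e" if "\<bar>q - r\<bar> \<le> \<bar>v - p\<bar>" "\<bar>p - q\<bar> \<le> d" "\<bar>p - v\<bar> \<le> d" "d < e / 2" for p q r v d :: real using that by linarith
  from this[OF 4 2[unfolded 1] 3 V(2)] show "\<bar>prob E - prob E * prob E\<bar> \<le> 0 + e" .
 qed
 then show ?thesis by (auto simp: algebra_simps)
qed

end

text \<open>If \<open>b = 0\<close>, and so \<open>a = 0\<close>, division by zero gives the density \<open>1\<close>.\<close>

definition tilt :: "real \<Rightarrow> real \<Rightarrow> nat \<Rightarrow> real" where "tilt a b k = exp a * (1 - a / b) ^ k"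

lemma tilt_nonneg: "0 \<le> a \<Longrightarrow> a \<le> b \<Longrightarrow> 0 \<le> tilt a b k" by (cases "b = 0") (auto simp: tilt_def divide_le_eq_1)

lemma tilt_poisson:
 assumes "0 \<le> a" "a \<le> b"
 shows "pmf (poisson_law b) k * tilt a b k = pmf (poisson_law (b - a)) k"
proof (cases "b = 0")
 case True then show ?thesis using assms by (simp add: tilt_def)
next
 case False
 then have "b ^ k * (1 - a / b) ^ k = (b - a) ^ k" by (simp add: power_mult_distrib[symmetric] algebra_simps)
 moreover have "exp (- b) * exp a = exp (- (b - a))" by (simp add: exp_add[symmetric])
 ultimately show ?thesis proof -
  have "pmf (poisson_law b) k * tilt a b k = (b ^ k * (1 - a / b) ^ k) / fact k * (exp (- b) * exp a)"
   using assms by (simp add: tilt_def pmf_poisson_law)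
  then show ?thesis using assms \<open>b ^ k * (1 - a / b) ^ k = (b - a) ^ k\<close> \<open>exp (- b) * exp a = exp (- (b - a))\<close> by (simp add: pmf_poisson_law)
 qed
qed

text \<open>An exponential series with argument \<open>(b - a) * (1 - a / b)\<close>. For
  \<open>b\<close> the measure of a cell \<open>C\<close> and \<open>a\<close> that of
  \<open>A \<inter> C\<close>, the exponent \<open>a^2 / b\<close> is the contribution of
  \<open>C\<close> to the square norm of the conditional expectation of \<open>indicator A\<close>
  given the cells.\<close>

lemma tilt_second_moment:
 assumes "0 \<le> a" "a \<le> b"
 shows "(\<integral>\<^sup>+n. ennreal ((tilt a b n)\<^sup>2) \<partial>measure_pmf (poisson_law b)) = ennreal (exp (a\<^sup>2 / b))"
proof -
 let ?x = "(b - a) * (1 - a / b)"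
 have e: "exp (2 * a - b) * exp ?x = exp (a\<^sup>2 / b)" proof (cases "b = 0")
  case False
  have "2 * a - b + ?x = a\<^sup>2 / b" using False by (simp add: field_simps power2_eq_square)
  then show ?thesis by (simp add: exp_add[symmetric])
 qed (use assms in simp)
 have t: "pmf (poisson_law b) n * (tilt a b n)\<^sup>2 = exp (2 * a - b) * (?x ^ n /\<^sub>R fact n)" for n proof -
  have "pmf (poisson_law b) n * (tilt a b n)\<^sup>2 = pmf (poisson_law (b - a)) n * tilt a b n"
   using tilt_poisson[OF assms, of n] by (simp add: power2_eq_square mult.assoc[symmetric])
  also have "\<dots> = exp (- (b - a)) * exp a * (?x ^ n /\<^sub>R fact n)"
   using assms by (simp add: pmf_poisson_law tilt_def power_mult_distrib divide_inverse mult_ac)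
  also have "exp (- (b - a)) * exp a = exp (2 * a - b)" by (simp add: exp_add[symmetric])
  finally show ?thesis .
 qed
 have s: "(\<lambda>n. pmf (poisson_law b) n * (tilt a b n)\<^sup>2) sums exp (a\<^sup>2 / b)" unfolding t e[symmetric] by (intro sums_mult exp_converges)
 have "(\<integral>\<^sup>+n. ennreal ((tilt a b n)\<^sup>2) \<partial>measure_pmf (poisson_law b)) = (\<Sum>n. ennreal (pmf (poisson_law b) n * (tilt a b n)\<^sup>2))"
  by (simp add: nn_integral_measure_pmf nn_integral_count_space_nat ennreal_mult)
 also have "\<dots> = ennreal (exp (a\<^sup>2 / b))" by (rule suminf_ennreal_eq[OF _ s]) simp
 finally show ?thesis .
qed

text \<open>Counts are \<open>ennreal\<close>-valued, but their laws are carried by the natural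
  numbers, on which this inverts \<open>of_nat\<close>.\<close>

definition to_nat_count :: "ennreal \<Rightarrow> nat" where "to_nat_count x = nat \<lfloor>enn2real x\<rfloor>"

lemma to_nat_count_of_nat [simp]: "to_nat_count (of_nat n) = n" by (simp add: to_nat_count_def ennreal_of_nat_eq_real_of_nat)

lemma measurable_to_nat_count [measurable]: "to_nat_count \<in> measurable borel (count_space UNIV)" unfolding to_nat_count_def by measurable

lemma measurable_tilt_count [measurable]: "(\<lambda>x. f (to_nat_count x)) \<in> borel_measurable borel"
 by (rule measurable_compose[OF measurable_to_nat_count]) simp

section \<open>Conditional law of counts given a void event\<close>

context poisson
begin

lemma nn_integral_N:
 assumes C: "C \<in> fmeasurable M" and f: "f \<in> borel_measurable borel"
 shows "(\<integral>\<^sup>+w. f (emeasure w C) \<partial>P) = (\<integral>\<^sup>+n. f (of_nat n) \<partial>measure_pmf (poisson_law (measure M C)))"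
proof -
 have Cs: "C \<in> sets M" using C by auto
 have "(\<integral>\<^sup>+w. f (emeasure w C) \<partial>P) = (\<integral>\<^sup>+x. f x \<partial>distr P borel (cnt C))"
  using f by (intro nn_integral_distr[symmetric] N_meas[OF Cs]) simp
 also have "\<dots> = (\<integral>\<^sup>+n. f (of_nat n) \<partial>measure_pmf (poisson_law (measure M C)))" unfolding distr_N[OF C] using f by (intro nn_integral_distr) simp_all
 finally show ?thesis .
qed

lemma tilted_N:
 assumes A: "A \<in> fmeasurable M" and C: "C \<in> fmeasurable M" and U: "U \<in> sets borel"
 shows "(\<integral>\<^sup>+w. indicator U (emeasure w C) * ennreal (tilt (measure M (A \<inter> C)) (measure M C) (to_nat_count (emeasure w C))) \<partial>P)
  = emeasure P (occ (C - A) U)"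
proof -
 let ?a = "measure M (A \<inter> C)" and ?b = "measure M C"
 have CA: "C - A \<in> fmeasurable M" using A C by (simp add: fmeasurable_Diff)
 have a: "0 \<le> ?a" "?a \<le> ?b" using A C by (auto intro!: measure_mono_fmeasurable)
 have ba: "measure M (C - A) = ?b - ?a" using measure_Diff[of M C "A \<inter> C"] A C fmeasurableD2[OF C] by (simp add: Diff_Int_distrib2 Diff_Int)
 have "(\<integral>\<^sup>+w. indicator U (emeasure w C) * ennreal (tilt ?a ?b (to_nat_count (emeasure w C))) \<partial>P)
  = (\<integral>\<^sup>+n. indicator U (of_nat n) * ennreal (tilt ?a ?b n) \<partial>measure_pmf (poisson_law ?b))"
  by (subst nn_integral_N[OF C, where f="\<lambda>x. indicator U x * ennreal (tilt ?a ?b (to_nat_count x))"]) (use U in simp_all)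
 also have "\<dots> = (\<integral>\<^sup>+n. ennreal (pmf (poisson_law (?b - ?a)) n) * indicator U (of_nat n) \<partial>count_space UNIV)"
  unfolding nn_integral_measure_pmf tilt_poisson[OF a, symmetric] by (intro nn_integral_cong) (simp add: ennreal_mult tilt_nonneg[OF a] mult_ac)
 also have "\<dots> = (\<integral>\<^sup>+n. indicator U (of_nat n) \<partial>measure_pmf (poisson_law (measure M (C - A))))" unfolding nn_integral_measure_pmf ba ..
 also have "\<dots> = (\<integral>\<^sup>+w. indicator U (emeasure w (C - A)) \<partial>P)" by (subst nn_integral_N[OF CA, where f="indicator U"]) (use U in simp_all)
 also have "\<dots> = (\<integral>\<^sup>+w. indicator (occ (C - A) U) w \<partial>P)" by (intro nn_integral_cong) (simp add: indicator_def)
 also have "\<dots> = emeasure P (occ (C - A) U)" by (rule nn_integral_indicator) (use CA U in auto)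
 finally show ?thesis .
qed

definition rectangles :: "'a set set \<Rightarrow> 'a measure set set" where "rectangles CC = {{w\<in>space P. \<forall>C\<in>CC. emeasure w C \<in> U C} | U. \<forall>C. U C \<in> sets borel}"

lemma Int_stable_rectangles: "Int_stable (rectangles CC)"
proof (rule Int_stableI)
 fix E F assume "E \<in> rectangles CC" "F \<in> rectangles CC"
 then obtain U V where U: "\<forall>C. U C \<in> sets borel" "E = {w\<in>space P. \<forall>C\<in>CC. emeasure w C \<in> U C}"
  and V: "\<forall>C. V C \<in> sets borel" "F = {w\<in>space P. \<forall>C\<in>CC. emeasure w C \<in> V C}" unfolding rectangles_def by blast
 have "E \<inter> F = {w\<in>space P. \<forall>C\<in>CC. emeasure w C \<in> U C \<inter> V C}" unfolding U V by blast
 moreover have "\<forall>C. U C \<inter> V C \<in> sets borel" using U V by auto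
 ultimately show "E \<inter> F \<in> rectangles CC" unfolding rectangles_def by (intro CollectI exI[of _ "\<lambda>C. U C \<inter> V C"] conjI)
qed

lemma rectangles_events:
 assumes "finite CC" "CC \<subseteq> sets M"
 shows "rectangles CC \<subseteq> events"
proof
 fix E assume "E \<in> rectangles CC"
 then obtain U where U: "\<forall>C. U C \<in> sets borel" "E = {w\<in>space P. \<forall>C\<in>CC. emeasure w C \<in> U C}" unfolding rectangles_def by blast
 show "E \<in> events" unfolding U(2) by (rule sets.sets_Collect_finite_All[OF _ assms(1)]) (use U assms in auto)
qed

lemma cyl_rectangles: "cyl M CC \<subseteq> sigma_sets (space P) (rectangles CC)" unfolding cyl_def space_P[symmetric]
proof (rule sigma_sets_mono')
 show "cyl_gen M CC \<subseteq> rectangles CC" proof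
  fix E assume "E \<in> cyl_gen M CC"
  then obtain A U where A: "A \<in> CC" "U \<in> sets borel" "E = (cnt A) -` U \<inter> config M" unfolding cyl_gen_def by blast
  let ?U = "\<lambda>C. if C = A then U else UNIV"
  have "E = {w\<in>space P. \<forall>C\<in>CC. emeasure w C \<in> ?U C}" unfolding A(3) space_P using A(1) by auto
  moreover have "\<forall>C. ?U C \<in> sets borel" using A(2) by simp
  ultimately show "E \<in> rectangles CC" unfolding rectangles_def by (intro CollectI exI[of _ ?U] conjI)
 qed
qed

text \<open>The sets \<open>C - A\<close> together with \<open>A\<close> are pairwise disjoint, so
  their counts are independent, and on the void event of \<open>A\<close> the counts of
  \<open>C\<close> and \<open>C - A\<close> agree.\<close>

lemma rectangle_void:
 assumes fin: "finite CC" and disj: "disjoint CC" and CC: "CC \<subseteq> fmeasurable M" and A: "A \<in> fmeasurable M" and U: "\<And>C. U C \<in> sets borel"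
 shows "prob ({w\<in>space P. \<forall>C\<in>CC. emeasure w C \<in> U C} \<inter> (void A))
  = exp (- measure M A) * (\<Prod>C\<in>CC. prob (occ (C - A) (U C)))"
proof -
 \<comment> \<open>\<open>None\<close> stands for \<open>A\<close>, so that \<open>A\<close> has an
   index of its own even if it coincides, as a set, with one of the others.\<close>
 let ?D = "\<lambda>z. case z of None \<Rightarrow> A | Some C \<Rightarrow> C - A"
 let ?V = "\<lambda>z. case z of None \<Rightarrow> {0} | Some C \<Rightarrow> U C"
 let ?I = "insert None (Some ` CC)"
 have As: "A \<in> sets M" and Cs: "\<And>C. C \<in> CC \<Longrightarrow> C \<in> sets M" using A CC by auto
 have ind: "indep_vars (\<lambda>_. borel) (\<lambda>z w. emeasure w (?D z)) ?I" proof (rule disj_indep)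
  show "finite ?I" using fin by simp
  show "?D z \<in> fmeasurable M" if "z \<in> ?I" for z using that A CC by (auto intro!: fmeasurable_Diff)
  show "disjoint_family_on ?D ?I" unfolding disjoint_family_on_def using disj by (auto simp: disjoint_def)
 qed
 have "prob (\<Inter>z\<in>?I. (cnt (?D z)) -` ?V z \<inter> space P)
   = (\<Prod>z\<in>?I. prob ((cnt (?D z)) -` ?V z \<inter> space P))" by (rule indep_varsD_finite[OF ind]) (use fin U in \<open>auto split: option.splits\<close>)
 also have "\<dots> = prob ((cnt A) -` {0} \<inter> space P) * (\<Prod>C\<in>CC. prob ((cnt (C - A)) -` U C \<inter> space P))"
  using fin by (subst prod.insert) (auto simp: prod.reindex)
 also have "(cnt A) -` {0} \<inter> space P = (void A)" by auto
 also have "prob \<dots> = exp (- measure M A)" by (rule prob_N0[OF A])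
 also have "(\<lambda>C. prob ((cnt (C - A)) -` U C \<inter> space P)) = (\<lambda>C. prob (occ (C - A) (U C)))"
  by (intro ext arg_cong[where f=prob]) auto
 also have "(\<Inter>z\<in>?I. (cnt (?D z)) -` ?V z \<inter> space P)
   = {w\<in>space P. \<forall>C\<in>CC. emeasure w (C - A) \<in> U C} \<inter> (void A)" by (rule set_eqI) (simp, blast)
 also have "\<dots> = {w\<in>space P. \<forall>C\<in>CC. emeasure w C \<in> U C} \<inter> (void A)" proof -
  have "emeasure w (C - A) = emeasure w C" if "w \<in> space P" "emeasure w A = 0" "C \<in> CC" for w C
   using that As Cs by (intro emeasure_Diff_null_set) (auto simp: null_sets_def space_P)
  then show ?thesis by auto
 qed
 finally show ?thesis .
qed

text \<open>\<open>q\<close> is the density of the law of the counts of \<open>CC\<close> given that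
  \<open>A\<close> is void, relative to their unconditional law: a product of one-dimensional
  densities. The last equation compares two finite measures in \<open>F\<close>, which agree on
  \<open>rectangles CC\<close>.\<close>

lemma tilted_cyl:
 assumes fin: "finite CC" and disj: "disjoint CC" and CC: "CC \<subseteq> fmeasurable M" and A: "A \<in> fmeasurable M"
  and q_def: "q = (\<lambda>w. \<Prod>C\<in>CC. tilt (measure M (A \<inter> C)) (measure M C) (to_nat_count (emeasure w C)))" and F: "F \<in> cyl M CC"
 shows "q \<in> borel_measurable P" "\<And>w. q w \<ge> 0" "(\<integral>\<^sup>+w. ennreal ((q w)\<^sup>2) \<partial>P) = ennreal (exp (\<Sum>C\<in>CC. (measure M (A \<inter> C))\<^sup>2 / measure M C))"
  "emeasure P (F \<inter> (void A)) = ennreal (exp (- measure M A)) * (\<integral>\<^sup>+w. ennreal (q w) * indicator F w \<partial>P)"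
proof -
 have As: "A \<in> sets M" and Cs: "\<And>C. C \<in> CC \<Longrightarrow> C \<in> sets M" using A CC by auto
 have a: "0 \<le> measure M (A \<inter> C)" "measure M (A \<inter> C) \<le> measure M C" if "C \<in> CC" for C using that A CC by (auto intro!: measure_mono_fmeasurable)
 have ind: "indep_vars (\<lambda>_. borel) (\<lambda>C w. emeasure w C) CC"
  using disj CC by (intro disj_indep[OF fin, of "\<lambda>C. C"]) (auto simp: disjoint_def disjoint_family_on_def)
 let ?l = "\<lambda>C x. tilt (measure M (A \<inter> C)) (measure M C) (to_nat_count x)"
 have lm: "?l C \<in> borel_measurable borel" for C by measurable
 show qm: "q \<in> borel_measurable P" unfolding q_def using Cs by (intro borel_measurable_prod measurable_compose[OF N_meas lm]) auto
 show q0: "q w \<ge> 0" for w unfolding q_def using a by (intro prod_nonneg ballI tilt_nonneg) auto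
 have "(\<integral>\<^sup>+w. ennreal ((q w)\<^sup>2) \<partial>P) = (\<integral>\<^sup>+w. (\<Prod>C\<in>CC. ennreal ((?l C (emeasure w C))\<^sup>2)) \<partial>P)"
  unfolding q_def by (intro nn_integral_cong) (simp add: prod_power_distrib[symmetric] prod_ennreal)
 also have "\<dots> = (\<Prod>C\<in>CC. \<integral>\<^sup>+w. ennreal ((?l C (emeasure w C))\<^sup>2) \<partial>P)"
  by (rule indep_vars_nn_integral[OF fin indep_vars_compose2[OF ind]]) (use lm in auto)
 also have "\<dots> = (\<Prod>C\<in>CC. ennreal (exp ((measure M (A \<inter> C))\<^sup>2 / measure M C)))" proof (rule prod.cong[OF refl])
  fix C assume C: "C \<in> CC"
  then have "(\<integral>\<^sup>+w. ennreal ((?l C (emeasure w C))\<^sup>2) \<partial>P)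
   = (\<integral>\<^sup>+n. ennreal ((?l C (of_nat n))\<^sup>2) \<partial>measure_pmf (poisson_law (measure M C)))" using CC lm by (intro nn_integral_N) auto
  then show "(\<integral>\<^sup>+w. ennreal ((?l C (emeasure w C))\<^sup>2) \<partial>P) = ennreal (exp ((measure M (A \<inter> C))\<^sup>2 / measure M C))"
   using tilt_second_moment[OF a[OF C]] by simp
 qed
 also have "\<dots> = ennreal (exp (\<Sum>C\<in>CC. (measure M (A \<inter> C))\<^sup>2 / measure M C))" using fin by (simp add: prod_ennreal exp_sum)
 finally show sq: "(\<integral>\<^sup>+w. ennreal ((q w)\<^sup>2) \<partial>P) = ennreal (exp (\<Sum>C\<in>CC. (measure M (A \<inter> C))\<^sup>2 / measure M C))" .
 let ?E = "void A"
 let ?K = "density P (indicator ?E)" and ?L = "density P (\<lambda>w. ennreal (exp (- measure M A)) * ennreal (q w))"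
 have E: "?E \<in> events" using As by simp
 have em: "(\<lambda>w. ennreal (exp (- measure M A)) * ennreal (q w)) \<in> borel_measurable P" using qm by measurable
 have eqK: "emeasure ?K X = emeasure P (X \<inter> ?E)" if "X \<in> events" for X using emeasure_restricted[OF E that] by (simp add: Int_commute)
 have eqL: "emeasure ?L X = ennreal (exp (- measure M A)) * (\<integral>\<^sup>+w. ennreal (q w) * indicator X w \<partial>P)" if "X \<in> events" for X
  using qm that by (simp add: emeasure_density[OF em that] mult.assoc nn_integral_cmult)
 have rect: "emeasure ?K X = emeasure ?L X" if "X \<in> rectangles CC" for X proof -
  obtain U where U: "\<And>C. U C \<in> sets borel" "X = {w\<in>space P. \<forall>C\<in>CC. emeasure w C \<in> U C}" using \<open>X \<in> rectangles CC\<close> unfolding rectangles_def by blast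
  have Xe: "X \<in> events" using rectangles_events[OF fin] Cs \<open>X \<in> rectangles CC\<close> by blast
  have "(\<integral>\<^sup>+w. ennreal (q w) * indicator X w \<partial>P)
   = (\<integral>\<^sup>+w. (\<Prod>C\<in>CC. indicator (U C) (emeasure w C) * ennreal (?l C (emeasure w C))) \<partial>P)"
  proof (rule nn_integral_cong)
   fix w assume w: "w \<in> space P"
   have "(\<Prod>C\<in>CC. indicator (U C) (emeasure w C)) = (indicator X w :: ennreal)" proof (cases "w \<in> X")
    case True then show ?thesis unfolding U(2) by simp
   next
    case False
    then obtain C where "C \<in> CC" "emeasure w C \<notin> U C" using w unfolding U(2) by blast
    then show ?thesis using False fin by (auto simp: prod_zero_iff intro!: bexI[of _ C])
   qed
   moreover have "ennreal (q w) = (\<Prod>C\<in>CC. ennreal (?l C (emeasure w C)))"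
    unfolding q_def using a by (intro prod_ennreal[symmetric] tilt_nonneg) auto
   ultimately show "ennreal (q w) * indicator X w = (\<Prod>C\<in>CC. indicator (U C) (emeasure w C) * ennreal (?l C (emeasure w C)))"
    by (simp add: prod.distrib mult.commute)
  qed
  also have "\<dots> = (\<Prod>C\<in>CC. \<integral>\<^sup>+w. indicator (U C) (emeasure w C) * ennreal (?l C (emeasure w C)) \<partial>P)"
   by (rule indep_vars_nn_integral[OF fin indep_vars_compose2[OF ind]]) (use lm U(1) in auto)
  also have "\<dots> = (\<Prod>C\<in>CC. emeasure P (occ (C - A) (U C)))" using CC by (intro prod.cong refl tilted_N[OF A _ U(1)]) auto
  also have "\<dots> = ennreal (\<Prod>C\<in>CC. prob (occ (C - A) (U C)))" by (simp add: emeasure_eq_measure prod_ennreal)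
  finally have "emeasure ?L X = ennreal (exp (- measure M A)) * ennreal (\<Prod>C\<in>CC. prob (occ (C - A) (U C)))"
   by (simp only: eqL[OF Xe])
  also have "\<dots> = ennreal (exp (- measure M A) * (\<Prod>C\<in>CC. prob (occ (C - A) (U C))))" by (simp add: ennreal_mult prod_nonneg)
  also have "\<dots> = ennreal (prob (X \<inter> ?E))" unfolding U(2) by (simp only: rectangle_void[OF fin disj CC A U(1)])
  finally show ?thesis by (simp only: eqK[OF Xe] emeasure_eq_measure)
 qed
 have spr: "space P \<in> rectangles CC" unfolding rectangles_def by (rule CollectI, rule exI[of _ "\<lambda>_. UNIV"]) simp
 have finK: "finite_measure ?K" by (rule finite_measureI) (simp only: space_density eqK[OF sets.top] infinity_ennreal_def emeasure_finite not_False_eq_True simp_thms)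
 have finL: "finite_measure ?L" proof (rule finite_measureI)
  have "emeasure ?L (space P) = emeasure P (space P \<inter> ?E)" by (simp only: rect[OF spr, symmetric] eqK[OF sets.top])
  then show "emeasure ?L (space ?L) \<noteq> \<infinity>" unfolding space_density by (simp only: infinity_ennreal_def emeasure_finite not_False_eq_True simp_thms)
 qed
 have "emeasure ?K F = emeasure ?L F" proof (rule finite_measures_agree[OF finK finL _ Int_stable_rectangles[of CC] _ rect])
  show "rectangles CC \<subseteq> sets ?K" using rectangles_events[OF fin] Cs by auto
  show "emeasure ?K (space ?K) = emeasure ?L (space ?K)" using rect[OF spr] by (simp only: space_density)
  show "F \<in> sigma_sets (space ?K) (rectangles CC)" using cyl_rectangles F by auto
 qed simp_all
 moreover have "F \<in> events" using F cyl_sub[of CC] Cs by auto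
 ultimately show "emeasure P (F \<inter> ?E) = ennreal (exp (- measure M A)) * (\<integral>\<^sup>+w. ennreal (q w) * indicator F w \<partial>P)" by (simp only: eqK eqL)
qed

text \<open>Given \<open>{N A = 0}\<close>, the counts \<open>N C\<close> have the rates \<open>\<mu>(C - A)\<close>; the bound is the variance of the density.\<close>

lemma void_dependence:
 assumes fin: "finite CC" and disj: "disjoint CC" and CC: "CC \<subseteq> fmeasurable M" and A: "A \<in> fmeasurable M" and F: "F \<in> cyl M CC"
 shows "(prob (F \<inter> (void A)) - prob F * prob (void A))\<^sup>2
  \<le> exp (\<Sum>C\<in>CC. (measure M (A \<inter> C))\<^sup>2 / measure M C) - 1"
proof -
 define q where "q = (\<lambda>w. \<Prod>C\<in>CC. tilt (measure M (A \<inter> C)) (measure M C) (to_nat_count (emeasure w C)))"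
 note q = tilted_cyl[OF fin disj CC A q_def]
 note [measurable] = q(1)[OF F]
 let ?X = "exp (\<Sum>C\<in>CC. (measure M (A \<inter> C))\<^sup>2 / measure M C)" and ?e = "exp (- measure M A)"
 let ?E = "void A"
 have E: "?E \<in> events" using A by auto
 have Fe: "F \<in> events" using F cyl_sub[of CC] CC by auto
 have q0: "q w \<ge> 0" for w by (rule q(2)[OF F])
 have i2: "integrable P (\<lambda>w. (q w)\<^sup>2)" using q(3)[OF F] by (intro integrableI_bounded) auto
 have e2: "expectation (\<lambda>w. (q w)\<^sup>2) = ?X" using q(3)[OF F] by (subst integral_eq_nn_integral) auto
 have i1: "integrable P q" using i2 by (rule square_integrable_imp_integrable[rotated]) simp
 have int: "prob (X \<inter> ?E) = ?e * expectation (\<lambda>w. q w * indicator X w)" if X: "X \<in> cyl M CC" for X proof -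
  have Xe: "X \<in> events" using X cyl_sub[of CC] CC by auto
  have i: "integrable P (\<lambda>w. q w * indicator X w)" by (rule integrable_real_mult_indicator[OF Xe i1])
  have "(\<integral>\<^sup>+w. ennreal (q w) * indicator X w \<partial>P) = (\<integral>\<^sup>+w. ennreal (q w * indicator X w) \<partial>P)" by (intro nn_integral_cong) (simp add: indicator_def)
  also have "\<dots> = ennreal (expectation (\<lambda>w. q w * indicator X w))" using i q0 by (intro nn_integral_eq_integral) auto
  finally have "ennreal (prob (X \<inter> ?E)) = ennreal (?e * expectation (\<lambda>w. q w * indicator X w))"
   using q(4)[OF X] by (simp add: emeasure_eq_measure ennreal_mult')
  then show ?thesis using q0 by (subst (asm) ennreal_inj) (auto intro!: bint_nonneg)
 qed
 have sp: "space P \<in> cyl M CC" unfolding space_P by (rule algebra.top[OF sigma_algebra.axioms(1)[OF sigma_algebra_cyl[of M CC]]])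
 have "space P \<inter> ?E = ?E" by blast
 then have "?e = ?e * expectation (\<lambda>w. q w * indicator (space P) w)" using int[OF sp] prob_N0[OF A] by (simp only:)
 also have "expectation (\<lambda>w. q w * indicator (space P) w) = expectation q" by (intro bint_cong) auto
 finally have e1: "expectation q = 1" by simp
 let ?Y = "\<lambda>w. (q w - 1) * indicator F w"
 have iq1: "integrable P (\<lambda>w. q w - 1)" using i1 by simp
 have iY: "integrable P ?Y" by (rule integrable_real_mult_indicator[OF Fe iq1])
 have iq2: "integrable P (\<lambda>w. (q w - 1)\<^sup>2)" using i1 i2 by (simp add: power2_diff)
 have eq2: "expectation (\<lambda>w. (q w - 1)\<^sup>2) = ?X - 1" using i1 i2 e1 e2 by (simp add: power2_diff prob_space)
 have Y2: "?Y w ^ 2 = (q w - 1)\<^sup>2 * indicator F w" for w by (simp add: indicator_def)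
 have iY2: "integrable P (\<lambda>w. ?Y w ^ 2)" unfolding Y2 by (rule integrable_real_mult_indicator[OF Fe iq2])
 have "prob (F \<inter> ?E) - prob F * prob ?E = ?e * expectation ?Y" proof -
  have iF: "integrable P (indicator F :: _ \<Rightarrow> real)" using Fe by (simp add: integrable_indicator_iff less_top[symmetric])
  have "expectation ?Y = expectation (\<lambda>w. q w * indicator F w - indicator F w)" by (simp add: left_diff_distrib)
  also have "\<dots> = expectation (\<lambda>w. q w * indicator F w) - prob F"
   using integrable_real_mult_indicator[OF Fe i1] iF Fe by (subst bint_diff) simp_all
  finally have eq: "expectation ?Y = expectation (\<lambda>w. q w * indicator F w) - prob F" .
  show ?thesis unfolding int[OF F] prob_N0[OF A] eq by (simp add: right_diff_distrib)
 qed
 then have "(prob (F \<inter> ?E) - prob F * prob ?E)\<^sup>2 = ?e\<^sup>2 * (expectation ?Y)\<^sup>2" by (simp add: power_mult_distrib)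
 also have "\<dots> \<le> 1 * (expectation ?Y)\<^sup>2" by (intro mult_right_mono power_le_one) auto
 \<comment> \<open>Cauchy-Schwarz in the form that a variance is nonnegative.\<close>
 also have "\<dots> \<le> expectation (\<lambda>w. ?Y w ^ 2)" using variance_eq[OF iY iY2] variance_positive[of ?Y] by simp
 also have "\<dots> \<le> expectation (\<lambda>w. (q w - 1)\<^sup>2)" by (rule integral_mono[OF iY2 iq2]) (simp add: indicator_def)
 finally show ?thesis by (simp add: eq2)
qed

text \<open>By \<open>g\<close>, which averages to the proportion of \<open>A\<close> on every cell
  of \<open>G\<close>, the exponent in \<open>void_dependence\<close> is at most the integral of the
  square of \<open>g\<close>. The bound is thus uniform over finite families of cells and passes to
  limits of events.\<close>

lemma void_dependence_cond:
 assumes sub: "sets G \<subseteq> sets M"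
  and dec: "\<And>B. B \<in> sets G \<Longrightarrow> \<exists>C::nat \<Rightarrow> 'a set. B = (\<Union>i. C i) \<and> disjoint_family C \<and> range C \<subseteq> sets G \<inter> fmeasurable M"
  and A: "A \<in> fmeasurable M" and gm: "g \<in> borel_measurable M" and g2: "integrable M (\<lambda>x. (g x :: real)\<^sup>2)"
  and g: "\<And>C. C \<in> sets G \<Longrightarrow> C \<in> fmeasurable M \<Longrightarrow> measure M (A \<inter> C) = (\<integral>x. g x * indicator C x \<partial>M)" and F: "F \<in> cyl M (sets G)"
 shows "\<bar>prob (F \<inter> (void A)) - prob F * prob (void A)\<bar> \<le> sqrt (exp (\<integral>x. (g x)\<^sup>2 \<partial>M) - 1)"
proof -
 let ?E = "void A"
 let ?V = "\<integral>x. (g x)\<^sup>2 \<partial>M"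
 have E: "?E \<in> events" using A by auto
 note [measurable] = gm
 have one: "(measure M (A \<inter> C))\<^sup>2 / measure M C \<le> (\<integral>x. (g x)\<^sup>2 * indicator C x \<partial>M)"
  if C: "C \<in> sets G" "C \<in> fmeasurable M" for C
 proof -
  let ?a = "measure M (A \<inter> C)" and ?b = "measure M C"
  have Cs [measurable]: "C \<in> sets M" using C by auto
  have i2: "integrable M (\<lambda>x. (g x)\<^sup>2 * indicator C x)" by (rule integrable_real_mult_indicator[OF Cs g2])
  have i0: "integrable M (indicator C :: 'a \<Rightarrow> real)" using C by (simp add: fmeasurable_def integrable_indicator_iff)
  have i1: "integrable M (\<lambda>x. g x * indicator C x)" proof (rule bint_bound[OF Bochner_Integration.integrable_add[OF i2 i0]])
   have "\<bar>y\<bar> \<le> y\<^sup>2 + 1" for y :: real using zero_le_power2[of "\<bar>y\<bar> - 1"] by (simp add: power2_diff)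
   then show "AE x in M. norm (g x * indicator C x) \<le> norm ((g x)\<^sup>2 * indicator C x + indicator C x)"
    by (intro AE_I2) (simp add: indicator_def abs_mult)
  qed simp
  show ?thesis proof (cases "?b = 0")
   case True then show ?thesis by (simp add: bint_nonneg)
  next
   case False
   \<comment> \<open>Cauchy-Schwarz on the cell: \<open>?a / ?b\<close> is the mean of
     \<open>g\<close> over \<open>C\<close>, and the variance around it is nonnegative.\<close>
   have "0 \<le> (\<integral>x. (g x - ?a / ?b)\<^sup>2 * indicator C x \<partial>M)" by (rule bint_nonneg) simp
   also have "\<dots> = (\<integral>x. (g x)\<^sup>2 * indicator C x - (2 * (?a / ?b)) * (g x * indicator C x) + (?a / ?b)\<^sup>2 * indicator C x \<partial>M)"
    by (intro bint_cong refl) (simp add: power2_diff algebra_simps)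
   also have "\<dots> = (\<integral>x. (g x)\<^sup>2 * indicator C x \<partial>M) - (2 * (?a / ?b)) * ?a + (?a / ?b)\<^sup>2 * ?b" using i0 i1 i2 g[OF C] by simp
   also have "\<dots> = (\<integral>x. (g x)\<^sup>2 * indicator C x \<partial>M) - ?a\<^sup>2 / ?b" using False by (simp add: field_simps power2_eq_square)
   finally show ?thesis by simp
  qed
 qed
 have fincyl: "\<bar>prob (F \<inter> ?E) - prob F * prob ?E\<bar> \<le> sqrt (exp ?V - 1)" if F: "F \<in> fincyl M (sets G)" for F proof -
  obtain BB where B: "finite BB" "BB \<subseteq> sets G \<inter> fmeasurable M" "F \<in> cyl M BB" using F by (rule fincylE)
  let ?C = "atoms BB - {{}}"
  have C: "finite ?C" "?C \<subseteq> sets G" "?C \<subseteq> fmeasurable M" "disjoint ?C"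
   using B finite_atoms[of BB] atoms_sets[of BB G] atoms_fmeasurable[of BB M] disjoint_atoms[of BB] by (auto simp: disjoint_def)
  have Fc: "F \<in> cyl M ?C" using B cyl_atoms[of BB M] sub by blast
  have "(\<Sum>C\<in>?C. (measure M (A \<inter> C))\<^sup>2 / measure M C) \<le> (\<Sum>C\<in>?C. \<integral>x. (g x)\<^sup>2 * indicator C x \<partial>M)" using C by (intro sum_mono one) auto
  also have "\<dots> = (\<integral>x. (\<Sum>C\<in>?C. (g x)\<^sup>2 * indicator C x) \<partial>M)"
   using C sub by (intro Bochner_Integration.integral_sum[symmetric] integrable_real_mult_indicator[OF _ g2]) auto
  also have "\<dots> \<le> ?V" proof (rule integral_mono[OF _ g2])
   show "integrable M (\<lambda>x. \<Sum>C\<in>?C. (g x)\<^sup>2 * indicator C x)"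
    using C sub by (intro Bochner_Integration.integrable_sum integrable_real_mult_indicator[OF _ g2]) auto
   fix x
   have "(\<Sum>C\<in>?C. indicator C x :: real) = indicator (\<Union>?C) x"
    using C(1,4) by (intro indicator_UN_disjoint[where f="\<lambda>C. C", simplified, symmetric]) (auto simp: disjoint_def disjoint_family_on_def)
   then show "(\<Sum>C\<in>?C. (g x)\<^sup>2 * indicator C x) \<le> (g x)\<^sup>2" by (simp add: sum_distrib_left[symmetric] indicator_def)
  qed
  finally have "exp (\<Sum>C\<in>?C. (measure M (A \<inter> C))\<^sup>2 / measure M C) \<le> exp ?V" by simp
  then have "(prob (F \<inter> ?E) - prob F * prob ?E)\<^sup>2 \<le> exp ?V - 1" using void_dependence[OF C(1,4,3) A Fc] by linarith
  then have "sqrt ((prob (F \<inter> ?E) - prob F * prob ?E)\<^sup>2) \<le> sqrt (exp ?V - 1)" by (rule real_sqrt_le_mono)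
  then show ?thesis by simp
 qed
 have fe: "fincyl M (sets G) \<subseteq> events" by (rule fincyl_sub[OF sub])
 have "cyl M (sets G) \<subseteq> sigma_sets (space P) (fincyl M (sets G))" unfolding space_P by (rule cyl_subset_sigma_fincyl[OF sub dec])
 also have "\<dots> \<subseteq> approximable P (fincyl M (sets G))"
  by (rule approximable_sigma_sets[OF finite_measure_axioms _ fe approximable_superset[OF fe]]) (simp add: space_P algebra_fincyl)
 finally have Fa: "F \<in> approximable P (fincyl M (sets G))" using F by blast
 have Fe: "F \<in> events" using Fa by (simp add: approximable_def)
 show ?thesis proof (rule field_le_epsilon)
  fix e :: real assume "e > 0"
  then have "e / 2 > 0" by simp
  then obtain F' where F': "F' \<in> fincyl M (sets G)" "prob (sym_diff F F') < e / 2" using Fa unfolding approximable_def by blast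
  have F'e: "F' \<in> events" using F' fe by blast
  have D: "sym_diff F F' \<in> events" by (rule sets_sym_diff[OF Fe F'e])
  have 1: "\<bar>prob F - prob F'\<bar> \<le> prob (sym_diff F F')" by (rule prob_close[OF Fe F'e D]) simp
  have 2: "\<bar>prob (F \<inter> ?E) - prob (F' \<inter> ?E)\<bar> \<le> prob (sym_diff F F')" by (rule prob_close[OF sets.Int[OF Fe E] sets.Int[OF F'e E] D]) blast
  have "\<bar>prob F * prob ?E - prob F' * prob ?E\<bar> = \<bar>prob F - prob F'\<bar> * prob ?E" by (simp add: left_diff_distrib[symmetric] abs_mult)
  also have "\<dots> \<le> \<bar>prob F - prob F'\<bar> * 1" by (rule mult_left_mono) simp_all
  finally have 3: "\<bar>prob F * prob ?E - prob F' * prob ?E\<bar> \<le> prob (sym_diff F F')" using 1 by simp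
  have "\<bar>x - y\<bar> \<le> s + e" if "\<bar>x' - y'\<bar> \<le> s" "\<bar>x - x'\<bar> \<le> d" "\<bar>y - y'\<bar> \<le> d" "d < e / 2" for x y x' y' s d :: real using that by linarith
  from this[OF fincyl[OF F'(1)] 2 3 F'(2)]
  show "\<bar>prob (F \<inter> ?E) - prob F * prob ?E\<bar> \<le> sqrt (exp ?V - 1) + e" .
 qed
qed

end

text \<open>A decreasing martingale: the square norms decrease, orthogonality makes the
  \<open>g n\<close> Cauchy, and the limit is measurable for every \<open>G n\<close> up to null
  sets. The intersection of the fields need not be sigma-finite, so there is no conditioning on it;
  instead the level sets of the limit are tail sets of finite measure, hence null.\<close>

lemma tail_cond_exp_tendsto_0:
 fixes A :: "'a set" and G :: "nat \<Rightarrow> 'a measure"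
 assumes sub: "\<And>n. sigma_finite_subalgebra M (G n)" and dec: "\<And>m n. m \<le> n \<Longrightarrow> sets (G n) \<subseteq> sets (G m)" and nulls: "\<And>n. null_sets M \<subseteq> sets (G n)"
  and tail: "\<And>B. (\<And>n. B \<in> sets (G n)) \<Longrightarrow> emeasure M B = 0 \<or> emeasure M B = \<infinity>" and A: "A \<in> fmeasurable M"
 defines "g \<equiv> \<lambda>n. real_cond_exp M (G n) (indicator A)"
 shows "integrable M (\<lambda>x. (g n x)\<^sup>2)" "(\<lambda>n. \<integral>x. (g n x)\<^sup>2 \<partial>M) \<longlonglongrightarrow> 0"
proof -
 have As [measurable]: "A \<in> sets M" using A by auto
 have iA: "integrable M (indicator A :: 'a \<Rightarrow> real)" using A by (simp add: integrable_indicator_iff fmeasurable_def)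
 have spG: "space (G n) = space M" and GM: "sets (G n) \<subseteq> sets M" for n using sigma_finite_subalgebra.subalg[OF sub] by (auto simp: subalgebra_def)
 have gG: "g n \<in> borel_measurable (G n)" for n unfolding g_def by simp
 have gm [measurable]: "g n \<in> borel_measurable M" for n unfolding g_def by simp
 have gi: "integrable M (g n)" for n unfolding g_def by (rule sigma_finite_subalgebra.real_cond_exp_int(1)[OF sub iA])
 have g0: "AE x in M. 0 \<le> g n x" for n unfolding g_def by (rule sigma_finite_subalgebra.real_cond_exp_pos[OF sub]) auto
 have g1: "AE x in M. g n x \<le> 1" for n unfolding g_def by (rule sigma_finite_subalgebra.real_cond_exp_le_c[OF sub iA]) (auto simp: indicator_def)
 have g01: "AE x in M. \<bar>g n x\<bar> \<le> 1" for n using g0[of n] g1[of n] by eventually_elim simp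
 have gmn: "integrable M (\<lambda>x. g m x * g n x)" for m n by (rule bint_bound[OF gi[of n]])
   (use g01[of m] in \<open>auto elim!: eventually_mono simp: abs_mult intro!: mult_left_le_one_le\<close>)
 have i2: "integrable M (\<lambda>x. (g n x)\<^sup>2)" for n using gmn[of n n] by (simp add: power2_eq_square)
 then show "integrable M (\<lambda>x. (g n x)\<^sup>2)" .
 define s where "s n = (\<integral>x. (g n x)\<^sup>2 \<partial>M)" for n
 have prod_le: "(\<integral>x. g n x * g m x \<partial>M) = (\<integral>x. g n x * indicator A x \<partial>M)" if "m \<le> n" for m n proof -
  have "g n \<in> borel_measurable (G m)" by (rule measurable_from_subalg[OF _ gG]) (use dec[OF that] spG in \<open>auto simp: subalgebra_def\<close>)
  then show ?thesis unfolding g_def by (intro sigma_finite_subalgebra.real_cond_exp_intg(2)[OF sub])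
    (use integrable_real_mult_indicator[OF As gi[of n]] in \<open>simp_all add: g_def\<close>)
 qed
 have prod: "(\<integral>x. g n x * g m x \<partial>M) = s n" if "m \<le> n" for m n using prod_le[OF that] prod_le[of n n] by (simp add: s_def power2_eq_square)
 have diff: "(\<integral>x. (g m x - g n x)\<^sup>2 \<partial>M) = s m - s n" if "m \<le> n" for m n proof -
  have "(\<integral>x. (g m x - g n x)\<^sup>2 \<partial>M) = (\<integral>x. (g m x)\<^sup>2 + (g n x)\<^sup>2 - 2 * (g n x * g m x) \<partial>M)"
   by (intro bint_cong refl) (simp add: power2_diff mult_ac)
  also have "\<dots> = s m + s n - 2 * s n" using i2 gmn prod[OF that] by (simp add: s_def)
  finally show ?thesis by simp
 qed
 have s0: "0 \<le> s n" for n unfolding s_def by (rule bint_nonneg) simp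
 have "decseq s" unfolding decseq_def proof (intro allI impI)
  fix m n :: nat assume "m \<le> n"
  have "0 \<le> (\<integral>x. (g m x - g n x)\<^sup>2 \<partial>M)" by (rule bint_nonneg) simp
  then show "s n \<le> s m" using diff[OF \<open>m \<le> n\<close>] by simp
 qed
 then have conv: "convergent s" using s0 by (metis decseq_convergent convergentI)
 have nn: "(nsq M (\<lambda>x. g m x - g n x)) = ennreal \<bar>s m - s n\<bar>" for m n proof -
  have i: "integrable M (\<lambda>x. (g m x - g n x)\<^sup>2)" using i2 gmn by (simp add: power2_diff mult.assoc)
  have "(\<integral>x. (g m x - g n x)\<^sup>2 \<partial>M) = \<bar>s m - s n\<bar>" proof (cases "m \<le> n")
   case True then show ?thesis using diff[OF True] \<open>decseq s\<close> by (simp add: decseqD)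
  next
   case False
   then have "n \<le> m" by simp
   then show ?thesis using diff[OF \<open>n \<le> m\<close>] decseqD[OF \<open>decseq s\<close> \<open>n \<le> m\<close>] by (simp add: power2_commute)
  qed
  then show ?thesis using nn_integral_eq_integral[OF i] by simp
 qed
 have Cauchy: "\<exists>N. \<forall>m\<ge>N. \<forall>n\<ge>N. (nsq M (\<lambda>x. g m x - g n x)) < ennreal e" if "e > 0" for e
  using convergent_Cauchy[OF conv] CauchyD[of s e] that unfolding nn by (simp add: ennreal_less_iff)
 obtain r where r: "strict_mono r" "AE x in M. (\<lambda>i. g (r i) x) \<longlonglongrightarrow> lim (\<lambda>i. g (r i) x)"
   "(\<lambda>n. nsq M (\<lambda>x. g n x - lim (\<lambda>i. g (r i) x))) \<longlonglongrightarrow> 0" by (rule L2_Cauchy_limit[of g M, OF gm Cauchy]) (assumption, rule that)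
 define h where "h x = lim (\<lambda>i. g (r i) x)" for x
 have hm [measurable]: "h \<in> borel_measurable M" unfolding h_def by measurable
 have lim: "(\<lambda>n. nsq M (\<lambda>x. g n x - h x)) \<longlonglongrightarrow> 0" using r(3) by (simp add: h_def)
 have gn: "(nsq M (\<lambda>x. g n x)) = ennreal (s n)" for n using nn_integral_eq_integral[OF i2[of n]] by (simp add: s_def)
 have "(\<lambda>n. nsq M (\<lambda>x. g n x)) \<longlonglongrightarrow> 0" proof (rule L2_vanish[OF gm hm lim])
  fix c :: real
  let ?B = "{x\<in>space M. c < (h x)\<^sup>2}"
  have "?B \<in> sets (G k)" for k proof -
   \<comment> \<open>Without the first \<open>k\<close> terms all functions are measurable for
     \<open>G k\<close>, as \<open>r (i + k)\<close> is at least \<open>k\<close>. The limit is the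
     same almost everywhere, and \<open>G k\<close> contains the null sets.\<close>
   define hk where "hk x = lim (\<lambda>i. g (r (i + k)) x)" for x
   have rk: "k \<le> r (i + k)" for i using seq_suble[OF r(1), of "i + k"] by simp
   have "g (r (i + k)) \<in> borel_measurable (G k)" for i
    by (rule measurable_from_subalg[OF _ gG]) (use dec[OF rk] spG in \<open>auto simp: subalgebra_def\<close>)
   then have hk: "hk \<in> borel_measurable (G k)" unfolding hk_def by (rule borel_measurable_lim_metric)
   have hkM: "hk \<in> borel_measurable M" by (rule measurable_from_subalg[OF sigma_finite_subalgebra.subalg[OF sub] hk])
   have "AE x in M. hk x = h x" using r(2) proof eventually_elim
    fix x assume "(\<lambda>i. g (r i) x) \<longlonglongrightarrow> lim (\<lambda>i. g (r i) x)"
    then have "(\<lambda>i. g (r (i + k)) x) \<longlonglongrightarrow> h x" unfolding h_def by (rule LIMSEQ_ignore_initial_segment)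
    then show "hk x = h x" unfolding hk_def by (rule limI)
   qed
   then have D: "{x\<in>space M. hk x \<noteq> h x} \<in> null_sets M" using hkM hm by (intro AE_iff_null[THEN iffD1]) auto
   have BM: "?B - {x\<in>space (G k). c < (hk x)\<^sup>2} \<in> sets M" "{x\<in>space (G k). c < (hk x)\<^sup>2} - ?B \<in> sets M" using hkM hm unfolding spG by measurable
   have "?B - {x\<in>space (G k). c < (hk x)\<^sup>2} \<in> null_sets M" by (rule null_sets_subset[OF D BM(1)]) (auto simp: spG)
   moreover have "{x\<in>space (G k). c < (hk x)\<^sup>2} - ?B \<in> null_sets M" by (rule null_sets_subset[OF D BM(2)]) (auto simp: spG)
   ultimately have N: "?B - {x\<in>space (G k). c < (hk x)\<^sup>2} \<in> sets (G k)" "{x\<in>space (G k). c < (hk x)\<^sup>2} - ?B \<in> sets (G k)"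
    using nulls[of k] by blast+
   have Bk: "{x\<in>space (G k). c < (hk x)\<^sup>2} \<in> sets (G k)" using hk by measurable
   have "?B = ({x\<in>space (G k). c < (hk x)\<^sup>2} - ({x\<in>space (G k). c < (hk x)\<^sup>2} - ?B)) \<union> (?B - {x\<in>space (G k). c < (hk x)\<^sup>2})" by blast
   also have "\<dots> \<in> sets (G k)" by (intro sets.Un sets.Diff Bk N)
   finally show ?thesis .
  qed
  then have "emeasure M ?B = 0 \<or> emeasure M ?B = \<infinity>" by (rule tail)
  moreover assume "emeasure M ?B < \<infinity>"
  ultimately show "emeasure M ?B = 0" by auto
 qed (simp add: gn)
 then have "(\<lambda>n. ennreal (s n)) \<longlonglongrightarrow> ennreal 0" by (simp add: gn)
 then have "s \<longlonglongrightarrow> 0" using s0 by (subst (asm) tendsto_ennreal_iff) auto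
 then show "(\<lambda>n. \<integral>x. (g n x)\<^sup>2 \<partial>M) \<longlonglongrightarrow> 0" by (simp add: s_def[abs_def])
qed

lemma sigma_finite_subalgebra_decompose:
 assumes "sigma_finite_subalgebra M G" and B: "B \<in> sets G"
 shows "\<exists>C::nat \<Rightarrow> 'a set. B = (\<Union>i. C i) \<and> disjoint_family C \<and> range C \<subseteq> sets G \<inter> fmeasurable M"
proof -
 interpret sigma_finite_subalgebra M G by fact
 interpret R: sigma_finite_measure "restr_to_subalg M G" by (rule sigma_fin_subalg)
 obtain A :: "nat \<Rightarrow> 'a set" where A: "range A \<subseteq> sets (restr_to_subalg M G)" "(\<Union>i. A i) = space (restr_to_subalg M G)"
  "\<And>i. emeasure (restr_to_subalg M G) (A i) \<noteq> \<infinity>" "disjoint_family A" using R.sigma_finite_disjoint by blast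
 have AG: "A i \<in> sets G" for i using A(1) by (auto simp: sets_restr_to_subalg[OF subalg])
 have GM: "sets G \<subseteq> sets M" "space G = space M" using subalg by (auto simp: subalgebra_def)
 have Af: "A i \<in> fmeasurable M" for i
  using A(3)[of i] AG[of i] GM(1) by (auto simp: emeasure_restr_to_subalg[OF subalg] fmeasurable_def less_top[symmetric])
 have BA: "B \<inter> A i \<in> sets G \<inter> fmeasurable M" for i using fmeasurableI2[OF Af[of i], of "B \<inter> A i"] AG[of i] B GM(1) by blast
 show ?thesis proof (intro exI[of _ "\<lambda>i. B \<inter> A i"] conjI)
  show "B = (\<Union>i. B \<inter> A i)" using A(2) sub_space[OF B] GM(2) by (auto simp: space_restr_to_subalg)
  show "disjoint_family (\<lambda>i. B \<inter> A i)" using A(4) by (auto simp: disjoint_family_on_def)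
  show "range (\<lambda>i. B \<inter> A i) \<subseteq> sets G \<inter> fmeasurable M" using BA by blast
 qed
qed

text \<open>The bound of \<open>void_dependence_cond\<close> applies to \<open>E\<close> with each
  \<open>G n\<close> and tends to \<open>0\<close>, so \<open>E\<close> is independent of every void
  event.\<close>

lemma (in poisson) tail_trivial:
 fixes G :: "nat \<Rightarrow> 'a measure"
 assumes leb: "lebesgue_space M" and na: "non_atomic M"
  and sub: "\<And>n. sigma_finite_subalgebra M (G n)" and dec: "\<And>m n. m \<le> n \<Longrightarrow> sets (G n) \<subseteq> sets (G m)" and nulls: "\<And>n. null_sets M \<subseteq> sets (G n)"
  and tail: "\<And>B. (\<And>n. B \<in> sets (G n)) \<Longrightarrow> emeasure M B = 0 \<or> emeasure M B = \<infinity>"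
  and E: "E \<in> events" and F: "\<And>n. \<exists>F\<in>cyl M (sets (G n)). prob (sym_diff E F) = 0"
 shows "prob E = 0 \<or> prob E = 1"
proof (rule void_independent_trivial[OF leb na E])
 fix A assume A: "A \<in> fmeasurable M"
 let ?V = "void A"
 let ?g = "\<lambda>n. real_cond_exp M (G n) (indicator A)"
 note g = tail_cond_exp_tendsto_0[OF sub dec nulls tail A]
 have V: "?V \<in> events" using A by auto
 have As: "A \<in> sets M" using A by auto
 have iA: "integrable M (indicator A :: 'a \<Rightarrow> real)" using A by (simp add: integrable_indicator_iff fmeasurable_def)
 have le: "\<bar>prob (E \<inter> ?V) - prob E * prob ?V\<bar> \<le> sqrt (exp (\<integral>x. (?g n x)\<^sup>2 \<partial>M) - 1)" for n proof -
  have GM: "sets (G n) \<subseteq> sets M" "space (G n) = space M" using sigma_finite_subalgebra.subalg[OF sub, of n] by (auto simp: subalgebra_def)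
  obtain F where F: "F \<in> cyl M (sets (G n))" "prob (sym_diff E F) = 0" using F by blast
  have Fe: "F \<in> events" using F(1) cyl_sub[OF GM(1)] by blast
  have D: "sym_diff E F \<in> events" by (rule sets_sym_diff[OF E Fe])
  have 1: "prob E = prob F" using prob_close[OF E Fe D] F(2) by simp
  have 2: "prob (E \<inter> ?V) = prob (F \<inter> ?V)" using prob_close[OF sets.Int[OF E V] sets.Int[OF Fe V] D] F(2) by force
  have c: "measure M (A \<inter> C) = (\<integral>x. ?g n x * indicator C x \<partial>M)" if C: "C \<in> sets (G n)" "C \<in> fmeasurable M" for C proof -
   have "(\<integral>x. ?g n x * indicator C x \<partial>M) = (\<integral>x\<in>C. ?g n x \<partial>M)" by (simp add: set_lebesgue_integral_def mult.commute)
   also have "\<dots> = (\<integral>x\<in>C. indicator A x \<partial>M)" by (rule sigma_finite_subalgebra.real_cond_exp_intA[OF sub iA C(1), symmetric])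
   also have "\<dots> = (\<integral>x. indicator (A \<inter> C) x \<partial>M)"
    unfolding set_lebesgue_integral_def by (intro bint_cong) (auto simp: indicator_def)
   also have "\<dots> = measure M (A \<inter> C)" using As C(2) by simp
   finally show ?thesis by simp
  qed
  show ?thesis unfolding 1 2 proof (rule void_dependence_cond[OF GM(1) _ A _ g(1) _ F(1)])
   show "\<exists>C::nat \<Rightarrow> 'a set. B = (\<Union>i. C i) \<and> disjoint_family C \<and> range C \<subseteq> sets (G n) \<inter> fmeasurable M" if "B \<in> sets (G n)" for B
    by (rule sigma_finite_subalgebra_decompose[OF sub that])
  qed (simp_all add: c)
 qed
 have "(\<lambda>n. sqrt (exp (\<integral>x. (?g n x)\<^sup>2 \<partial>M) - 1)) \<longlonglongrightarrow> sqrt (exp 0 - 1)" by (intro tendsto_intros g(2))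
 then have "\<bar>prob (E \<inter> ?V) - prob E * prob ?V\<bar> \<le> sqrt (exp 0 - 1)" by (rule LIMSEQ_le_const) (use le in auto)
 then show "prob (E \<inter> ?V) = prob E * prob ?V" by simp
qed

text \<open>Subfields are compared exactly once they contain all null sets; this is the enlargement
  of \<open>C\<close> that achieves it.\<close>

definition mod_null :: "'a measure \<Rightarrow> 'a set set \<Rightarrow> 'a set set" where "mod_null M C = {E\<in>sets M. \<exists>F\<in>C. sym_diff E F \<in> null_sets M}"

lemma sigma_algebra_mod_null:
 assumes C: "sigma_algebra (space M) C" "C \<subseteq> sets M"
 shows "sigma_algebra (space M) (mod_null M C)" unfolding sigma_algebra_iff2
proof (intro conjI ballI allI impI)
 interpret C: sigma_algebra "space M" C by (rule C(1))
 show "mod_null M C \<subseteq> Pow (space M)" using sub_space by (auto simp: mod_null_def)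
 show "{} \<in> mod_null M C" by (auto simp: mod_null_def intro!: bexI[of _ "{}"])
 {
  fix E assume "E \<in> mod_null M C"
  then obtain F where F: "E \<in> sets M" "F \<in> C" "sym_diff E F \<in> null_sets M" by (auto simp: mod_null_def)
  have "sym_diff (space M - E) (space M - F) = sym_diff E F" using sub_space[OF F(1)] C.sets_into_space[OF F(2)] by blast
  then show "space M - E \<in> mod_null M C" unfolding mod_null_def using F by (auto intro!: bexI[of _ "space M - F"])
 }
 fix E :: "nat \<Rightarrow> 'a set" assume "range E \<subseteq> mod_null M C"
 then have "\<forall>i. \<exists>F. E i \<in> sets M \<and> F \<in> C \<and> sym_diff (E i) F \<in> null_sets M" unfolding mod_null_def by blast
 then obtain F where F: "\<And>i. E i \<in> sets M" "\<And>i. F i \<in> C" "\<And>i. sym_diff (E i) (F i) \<in> null_sets M" by metis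
 have Es: "(\<Union>i. E i) \<in> sets M" using F(1) by blast
 have FC: "(\<Union>i. F i) \<in> C" using F(2) by blast
 have FM: "(\<Union>i. F i) \<in> sets M" using FC C(2) by blast
 have "sym_diff (\<Union>i. E i) (\<Union>i. F i) \<in> null_sets M"
  by (rule null_sets_subset[OF null_sets_UN[of "\<lambda>i. sym_diff (E i) (F i)", OF F(3)] sets_sym_diff[OF Es FM]]) blast
 then show "(\<Union>i. E i) \<in> mod_null M C" unfolding mod_null_def using Es FC by blast
qed

lemma mod_null_eqI:
 assumes J: "sigma_algebra (space M) J" "null_sets M \<subseteq> J" and F: "F \<in> J" "F \<in> sets M" and E: "E \<in> sets M" "sym_diff E F \<in> null_sets M"
 shows "E \<in> J"
proof -
 interpret J: sigma_algebra "space M" J by (rule J(1))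
 have "E - F \<in> null_sets M" by (rule null_sets_subset[OF E(2) sets.Diff[OF E(1) F(2)]]) blast
 moreover have "F - E \<in> null_sets M" by (rule null_sets_subset[OF E(2) sets.Diff[OF F(2) E(1)]]) blast
 ultimately have "(F - (F - E)) \<union> (E - F) \<in> J" using J(2) F(1) by blast
 moreover have "(F - (F - E)) \<union> (E - F) = E" by blast
 ultimately show ?thesis by simp
qed

section \<open>Transfer of an exhaustive subfield to the suspension\<close>

context suspension
begin

lemma preimage_sets_eq: "preimage_sets M T G n = pre n ` sets G" by (simp add: preimage_sets_def pre_def[abs_def])

lemma preimage_sets_S_eq: "preimage_sets S T' G n = SP.pre n ` sets G" unfolding preimage_sets_def SP.pre_def[abs_def] int_iterate_completion by simp

text \<open>The subfield \<open>T^-n G\<close> as a measure space, the form in which conditional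
  expectations take it.\<close>

definition pullback :: "'a measure \<Rightarrow> int \<Rightarrow> 'a measure" where "pullback G n = vimage_algebra (space M) (Z n) G"

lemma sets_pullback: assumes "space G = space M" shows "sets (pullback G n) = pre n ` sets G"
 unfolding pullback_def using assms Z_in by (subst sets_vimage_algebra2) (auto simp: pre_def)

lemma space_pullback: "space (pullback G n) = space M" by (simp add: pullback_def)

lemma pullback_antimono:
 assumes sp: "space G = space M" and dec: "pre 1 ` sets G \<subseteq> sets G" and "m \<le> n"
 shows "pre n ` sets G \<subseteq> pre m ` sets G" using \<open>m \<le> n\<close>
proof (induction rule: int_ge_induct)
 case (step i)
 have "pre (i + 1) A \<in> pre m ` sets G" if "A \<in> sets G" for A proof -
  have "pre (i + 1) A = pre i (pre 1 A)" by (simp add: pre_pre)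
  then show ?thesis using step.IH dec that by blast
 qed
 then show ?case by blast
qed simp

lemma sigma_finite_pullback:
 assumes G: "sigma_finite_subalgebra M G"
 shows "sigma_finite_subalgebra M (pullback G n)"
proof -
 interpret sigma_finite_subalgebra M G by fact
 have GM: "sets G \<subseteq> sets M" "space G = space M" using subalg by (auto simp: subalgebra_def)
 have sub: "subalgebra M (pullback G n)" using GM pre_sets by (auto simp: subalgebra_def space_pullback sets_pullback)
 have "space G \<in> sets G" by simp
 from sigma_finite_subalgebra_decompose[OF G this] obtain C :: "nat \<Rightarrow> 'a set" where
  C: "space M = (\<Union>i. C i)" "range C \<subseteq> sets G \<inter> fmeasurable M" unfolding GM by blast
 let ?R = "restr_to_subalg M (pullback G n)"
 have s: "pre n (C i) \<in> sets (pullback G n)" for i using C(2) by (auto simp: sets_pullback[OF GM(2)])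
 have f: "emeasure ?R (pre n (C i)) \<noteq> \<infinity>" for i
  unfolding emeasure_restr_to_subalg[OF sub s] using fmeasurableD2[OF pre_fmeasurable, of "C i" n] C(2) by auto
 have "sigma_finite_measure ?R" proof
  show "\<exists>A. countable A \<and> A \<subseteq> sets ?R \<and> \<Union>A = space ?R \<and> (\<forall>a\<in>A. emeasure ?R a \<noteq> \<infinity>)" proof (intro exI[of _ "range (\<lambda>i. pre n (C i))"] conjI)
   show "range (\<lambda>i. pre n (C i)) \<subseteq> sets ?R" using s by (auto simp: sets_restr_to_subalg[OF sub])
   have "pre n (space M) = (\<Union>i. pre n (C i))" unfolding C(1) by (rule pre_UN)
   then show "\<Union>(range (\<lambda>i. pre n (C i))) = space ?R" by (simp add: space_restr_to_subalg pre_space)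
   show "\<forall>a\<in>range (\<lambda>i. pre n (C i)). emeasure ?R a \<noteq> \<infinity>" using f by blast
  qed simp
 qed
 then show ?thesis using sub by (simp add: sigma_finite_subalgebra_def)
qed

text \<open>Counts of the generators in \<open>W\<close> do not determine counts of complements
  where they are infinite. Within a piece \<open>Y i\<close> the count of a complement is a
  difference of finite counts almost surely, and the exceptional null sets belong to
  \<open>J\<close>; the pieces are then summed.\<close>

lemma generated_measurable:
 assumes J: "sigma_algebra (space P) J" "null_sets S \<subseteq> J" and W: "Int_stable W" "W \<subseteq> sets M" "sigma_sets (space M) W = sets M" "space M \<in> W"
  and cyl: "\<And>B. B \<in> W \<Longrightarrow> cyl M {B} \<subseteq> J" and Y: "\<And>i::nat. Y i \<in> W \<inter> fmeasurable M" "disjoint_family Y" "(\<Union>i. Y i) = space M"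
 shows "sets P \<subseteq> J"
proof -
 let ?J = "sigma (space P) J"
 have sJ: "sets ?J = J" "space ?J = config M"
  using sigma_algebra.sets_measure_of_eq[OF J(1)] by (simp_all add: space_measure_of_conv space_P)
 have JI: "f \<in> borel_measurable ?J" if "\<And>U. U \<in> sets borel \<Longrightarrow> {w\<in>space P. f w \<in> U} \<in> J" for f :: "'a measure \<Rightarrow> ennreal" proof (rule measurableI)
  fix U :: "ennreal set" assume "U \<in> sets borel"
  then have "{w\<in>space P. f w \<in> U} \<in> J" by (rule that)
  moreover have "f -` U \<inter> space ?J = {w\<in>space P. f w \<in> U}" unfolding sJ(2) unfolding space_P by blast
  ultimately show "f -` U \<inter> space ?J \<in> sets ?J" unfolding sJ(1) by simp
 qed simp
 have JD: "{w\<in>space P. f w \<in> U} \<in> J" if "f \<in> borel_measurable ?J" "U \<in> sets borel" for f :: "'a measure \<Rightarrow> ennreal" and U proof -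
  have "f -` U \<inter> space ?J \<in> J" using measurable_sets[OF that] unfolding sJ(1) .
  moreover have "f -` U \<inter> space ?J = {w\<in>space P. f w \<in> U}" unfolding sJ(2) unfolding space_P by blast
  ultimately show ?thesis by simp
 qed
 have base: "(cnt B) \<in> borel_measurable ?J" if "B \<in> W" for B proof (rule JI)
  fix U :: "ennreal set" assume "U \<in> sets borel"
  then have "{w. sets w = sets M \<and> emeasure w B \<in> U} \<in> cyl M {B}" by (intro cyl_basic) auto
  moreover have "{w. sets w = sets M \<and> emeasure w B \<in> U} = (occ B U)" unfolding space_P by blast
  ultimately show "(occ B U) \<in> J" using cyl[OF that] by auto
 qed
 have part: "(cnt (A \<inter> Y i)) \<in> borel_measurable ?J" if A: "A \<in> sets M" for A i proof -
  have WP: "W \<subseteq> Pow (space M)" using W(2) sub_space by blast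
  have A': "A \<in> sigma_sets (space M) W" using A W(3) by simp
  have Yi: "Y i \<in> W" "Y i \<in> fmeasurable M" "Y i \<in> sets M" using Y(1)[of i] by auto
  show ?thesis proof (rule sigma_sets_induct_disjoint[OF W(1) WP A'])
   fix A assume "A \<in> W"
   then show "(cnt (A \<inter> Y i)) \<in> borel_measurable ?J" using Yi(1) W(1) by (intro base) (auto simp: Int_stable_def)
  next
   show "(cnt ({} \<inter> Y i)) \<in> borel_measurable ?J" by simp
  next
   fix A assume "A \<in> sigma_sets (space M) W" and IH: "(cnt (A \<inter> Y i)) \<in> borel_measurable ?J"
   then have A: "A \<in> sets M" using W(3) by simp
   let ?f = "\<lambda>w. emeasure w (Y i) - emeasure w (A \<inter> Y i)"
   have fm: "?f \<in> borel_measurable ?J" using base[OF Yi(1)] IH by (rule borel_measurable_minus_ennreal)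
   show "(cnt ((space M - A) \<inter> Y i)) \<in> borel_measurable ?J" proof (rule JI)
    fix U :: "ennreal set" assume U: "U \<in> sets borel"
    have eq: "(space M - A) \<inter> Y i = Y i - A \<inter> Y i" using sub_space[OF Yi(3)] by blast
    have sM: "(space M - A) \<inter> Y i \<in> sets M" using A Yi by auto
    have N: "{w\<in>space P. emeasure w (Y i) = \<infinity>} \<in> null_sets S" proof (rule null_sets_completionI)
     have "AE w in P. w \<notin> {w\<in>space P. emeasure w (Y i) = \<infinity>}" using AE_N_finite[OF Yi(2)] by eventually_elim (simp add: less_top)
     then show "{w\<in>space P. emeasure w (Y i) = \<infinity>} \<in> null_sets P" by (subst AE_iff_null_sets[OF N_eq_sets[OF Yi(3)]])
    qed
    have E: "(occ ((space M - A) \<inter> Y i) U) \<in> sets S" using N_sets[OF sM U] by simp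
    have fP: "?f \<in> borel_measurable P" using A Yi(3) by measurable
    have F: "{w\<in>space P. ?f w \<in> U} \<in> sets S" using measurable_sets[OF fP U] by (auto simp: vimage_def Int_def conj_commute)
    have D: "sym_diff (occ ((space M - A) \<inter> Y i) U) {w\<in>space P. ?f w \<in> U} \<in> null_sets S" proof (rule null_sets_subset[OF N sets_sym_diff[OF E F]])
     have "emeasure w ((space M - A) \<inter> Y i) = ?f w" if "w \<in> space P" "emeasure w (Y i) \<noteq> \<infinity>" for w proof -
      have s: "Y i \<in> sets w" "A \<inter> Y i \<in> sets w" using that(1) A Yi(3) by (auto simp: space_P)
      have "emeasure w (A \<inter> Y i) \<le> emeasure w (Y i)" using s by (intro emeasure_mono) auto
      then have "emeasure w (A \<inter> Y i) \<noteq> \<infinity>" using that(2) by (auto simp: top_unique)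
      then show ?thesis unfolding eq using s by (intro emeasure_Diff) auto
     qed
     then show "sym_diff (occ ((space M - A) \<inter> Y i) U) {w\<in>space P. ?f w \<in> U}
      \<subseteq> {w\<in>space P. emeasure w (Y i) = \<infinity>}" by (intro subsetI CollectI conjI; elim UnE; metis (mono_tags, lifting) DiffE mem_Collect_eq)
    qed
    show "(occ ((space M - A) \<inter> Y i) U) \<in> J"
     by (rule mod_null_eqI[OF _ J(2) JD[OF fm U] F E D]) (use J(1) in \<open>simp only: space_completion\<close>)
   qed
  next
   fix A :: "nat \<Rightarrow> 'a set" assume A: "disjoint_family A" "range A \<subseteq> sigma_sets (space M) W"
    and IH: "\<And>j. (cnt (A j \<inter> Y i)) \<in> borel_measurable ?J"
   show "(cnt ((\<Union>j. A j) \<inter> Y i)) \<in> borel_measurable ?J" proof (rule measurable_sum_disjoint[OF _ _ _ sJ(2) IH])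
    show "(\<Union>j. A j) \<inter> Y i = (\<Union>j. A j \<inter> Y i)" by blast
    show "disjoint_family (\<lambda>j. A j \<inter> Y i)" using A(1) by (auto simp: disjoint_family_on_def)
    show "A j \<inter> Y i \<in> sets M" for j using A(2) W(3) Yi(3) by blast
   qed
  qed
 qed
 show ?thesis unfolding sets_P proof (rule cyl_leI[OF _ sJ(2,1)])
  show "sigma_algebra (config M) J" using J(1) unfolding space_P .
  fix A assume A: "A \<in> sets M"
  show "(cnt A) \<in> borel_measurable ?J" proof (rule measurable_sum_disjoint[OF _ _ _ sJ(2) part[OF A]])
   show "A = (\<Union>i. A \<inter> Y i)" using Y(3) sub_space[OF A] by blast
   show "disjoint_family (\<lambda>i. A \<inter> Y i)" using Y(2) by (auto simp: disjoint_family_on_def)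
   show "A \<inter> Y i \<in> sets M" for i using A Y(1)[of i] by auto
  qed
 qed
qed

lemma remotely_infinite_imp_K:
 assumes leb: "lebesgue_space M" and na: "non_atomic M" and ri: "remotely_infinite M T"
 shows "K_automorphism S T'"
proof -
 obtain G where ex: "exhaustive_subalgebra M T G" and sf: "sigma_finite_subalgebra M G"
  and tail: "\<not> (\<exists>A \<in> (\<Inter>n. preimage_sets M T G n). 0 < emeasure M A \<and> emeasure M A < \<infinity>)" using ri unfolding remotely_infinite_def by blast
 have GM: "sets G \<subseteq> sets M" "space G = space M" and nullG: "null_sets M \<subseteq> sets G"
  and inc: "pre 1 ` sets G \<subseteq> sets G" and gen: "sigma_sets (space M) (\<Union>n. pre n ` sets G) = sets M"
  using ex unfolding exhaustive_subalgebra_def subalgebra_def preimage_sets_eq by auto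
 note anti = pullback_antimono[OF GM(2) inc]
 have pre0: "pre 0 ` sets G = sets G" proof -
  have "pre 0 A = A" if "A \<in> sets G" for A using sub_space[OF that] GM(2) by (simp add: pre_0)
  then show ?thesis by simp
 qed
 let ?C = "cyl M (sets G)"
 have Ce: "?C \<subseteq> sets P" by (rule cyl_sub[OF GM(1)])
 then have CS: "?C \<subseteq> sets S" by auto
 \<comment> \<open>The subfield for the suspension: events that depend on the counts of sets in
   \<open>G\<close>, enlarged by the null sets of the completion.\<close>
 define H where "H = mod_null S ?C"
 have sgC: "sigma_algebra (space S) ?C" unfolding space_completion space_P by (rule sigma_algebra_cyl)
 have sgH: "sigma_algebra (space S) H" unfolding H_def by (rule sigma_algebra_mod_null[OF sgC CS])
 define G' where "G' = sigma (space S) H"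
 have G': "sets G' = H" "space G' = space S" unfolding G'_def using sigma_algebra.sets_measure_of_eq[OF sgH] by (simp_all add: space_measure_of_conv)
 have HS: "H \<subseteq> sets S" by (auto simp: H_def mod_null_def)
 have nullH: "null_sets S \<subseteq> H" proof
  fix N assume N: "N \<in> null_sets S"
  have "{} \<in> ?C" unfolding cyl_def by (rule sigma_sets.Empty)
  then show "N \<in> H" unfolding H_def mod_null_def using N by (auto intro!: bexI[of _ "{}"])
 qed
 have CH: "?C \<subseteq> H" proof
  fix F assume F: "F \<in> ?C"
  have "sym_diff F F \<in> null_sets S" by simp
  then show "F \<in> H" unfolding H_def mod_null_def using F CS by blast
 qed
 have preH: "\<exists>F\<in>cyl M (pre n ` sets G). sym_diff (SP.pre n E) F \<in> null_sets S" if E: "E \<in> H" for E n proof -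
  obtain F where F: "F \<in> ?C" "sym_diff E F \<in> null_sets S" using E unfolding H_def mod_null_def by blast
  have "SP.pre n (sym_diff E F) \<in> null_sets S" using SS.pre_null[OF F(2)] unfolding sspre .
  then have "sym_diff (SP.pre n E) (SP.pre n F) \<in> null_sets S" by (simp only: SP.pre_Un SP.pre_Diff)
  then show ?thesis using spre_cyl[OF GM(1) F(1)] by blast
 qed
 have exh: "exhaustive_subalgebra S T' G'" unfolding exhaustive_subalgebra_def subalgebra_def G' preimage_sets_S_eq proof (intro conjI)
  show "space S = space S" by simp
  show "H \<subseteq> sets S" "null_sets S \<subseteq> H" by fact+
  show "SP.pre 1 ` H \<subseteq> H" proof
   fix E' assume "E' \<in> SP.pre 1 ` H"
   then obtain E where E: "E \<in> H" "E' = SP.pre 1 E" by blast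
   obtain F where F: "F \<in> cyl M (pre 1 ` sets G)" "sym_diff (SP.pre 1 E) F \<in> null_sets S" using preH[OF E(1)] by blast
   have "F \<in> ?C" using F(1) cyl_mono[OF inc] by blast
   moreover have "SP.pre 1 E \<in> sets S" using E(1) HS by auto
   ultimately show "E' \<in> H" unfolding H_def mod_null_def E(2) using F(2) by blast
  qed
  let ?J = "sigma_sets (space S) (\<Union>n. SP.pre n ` H)"
  have sub: "(\<Union>n. SP.pre n ` H) \<subseteq> sets S" using HS by auto
  show "?J = sets S" proof
   show "?J \<subseteq> sets S" by (rule sets.sigma_sets_subset[OF sub])
   have sgJ: "sigma_algebra (space S) ?J" by (rule sigma_algebra_sigma_sets) (use sub sub_space in blast)
   have HJ: "SP.pre n E \<in> ?J" if "E \<in> H" for n E using that by (intro sigma_sets.Basic) blast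
   have "H \<subseteq> ?J" proof
    fix E assume E: "E \<in> H"
    then have "E \<subseteq> space P" using HS sub_space[of E S] by auto
    then show "E \<in> ?J" using HJ[OF E, of 0] by (simp only: SP.pre_0)
   qed
   then have nJ: "null_sets S \<subseteq> ?J" using nullH by blast
   \<comment> \<open>The translated fields increase as \<open>n\<close> decreases, so their union is
     stable under intersections and can serve as a generator.\<close>
   let ?W = "\<Union>n. pre n ` sets G"
   have "space G \<in> sets G" by simp
   from sigma_finite_subalgebra_decompose[OF sf this] obtain Y :: "nat \<Rightarrow> 'a set" where
    Y: "space M = (\<Union>i. Y i)" "disjoint_family Y" "range Y \<subseteq> sets G \<inter> fmeasurable M" unfolding GM by blast
   have "sets P \<subseteq> ?J" proof (rule generated_measurable[OF _ nJ _ _ gen _ _ _ Y(2) Y(1)[symmetric]])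
    show "sigma_algebra (space P) ?J" using sgJ unfolding space_completion .
    show "Int_stable ?W" proof (rule Int_stableI)
     fix A B assume "A \<in> ?W" "B \<in> ?W"
     then obtain m n where mn: "A \<in> pre m ` sets G" "B \<in> pre n ` sets G" by blast
     then have "A \<in> pre (min m n) ` sets G" "B \<in> pre (min m n) ` sets G" using anti[of "min m n" m] anti[of "min m n" n] by auto
     then have "A \<inter> B \<in> pre (min m n) ` sets G" unfolding sets_pullback[OF GM(2), symmetric] by (rule sets.Int)
     then show "A \<inter> B \<in> ?W" by blast
    qed
    show "?W \<subseteq> sets M" using GM(1) pre_sets by blast
    have GW: "sets G \<subseteq> ?W" using pre0 by blast
    have "space M \<in> sets G" using sets.top[of G] GM(2) by simp
    then show "space M \<in> ?W" by (rule subsetD[OF GW])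
    show "Y i \<in> ?W \<inter> fmeasurable M" for i using Y(3) GW by blast
    fix B assume "B \<in> ?W"
    then obtain n A where A: "A \<in> sets G" "B = pre n A" by blast
    show "cyl M {B} \<subseteq> ?J" unfolding cyl_def proof (rule sigma_algebra.sigma_sets_subset)
     show "sigma_algebra (config M) ?J" using sgJ unfolding space_completion unfolding space_P .
     show "cyl_gen M {B} \<subseteq> ?J" proof
      fix E assume "E \<in> cyl_gen M {B}"
      then obtain U where U: "U \<in> sets borel" "E = (cnt B) -` U \<inter> config M" unfolding cyl_gen_def by blast
      have As: "A \<in> sets M" using A GM by blast
      have "E = (occ (pre n A) U)" unfolding U(2) A(2) space_P by blast
      also have "\<dots> = SP.pre n (occ A U)" by (rule spre_N[OF As, symmetric])
      finally have "E = SP.pre n (occ A U)" .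
      moreover have "(occ A U) \<in> ?C" using cyl_basic[OF A(1) U(1)] unfolding space_P by simp
      ultimately show "E \<in> ?J" using HJ CH by blast
     qed
    qed
   qed
   show "sets S \<subseteq> ?J" proof
    fix E assume E: "E \<in> sets S"
    obtain E0 where E0: "E0 \<in> sets P" "sym_diff E E0 \<in> null_sets S" using S_approx_P[OF E] .
    show "E \<in> ?J" by (rule mod_null_eqI[OF sgJ nJ _ _ E E0(2)]) (use E0(1) \<open>sets P \<subseteq> ?J\<close> in auto)
   qed
  qed
 qed
 have "measure S E = 0 \<or> measure S E = 1" if E: "E \<in> (\<Inter>n. preimage_sets S T' G' n)" for E proof -
  have En: "E \<in> SP.pre n ` H" for n using E unfolding preimage_sets_S_eq G' by blast
  obtain E1 where "E1 \<in> H" "E = SP.pre 0 E1" using En[of 0] by blast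
  then have ES: "E \<in> sets S" using HS by auto
  obtain E0 where E0: "E0 \<in> sets P" "sym_diff E E0 \<in> null_sets S" using S_approx_P[OF ES] .
  have E0S: "E0 \<in> sets S" using E0 by auto
  have "measure S E = measure S E0"
   using S_close[OF ES E0S sets_sym_diff[OF ES E0S]] E0(2) null_S_iff[of "sym_diff E E0"] by (auto simp: null_sets_def measure_def)
  moreover have "prob E0 = 0 \<or> prob E0 = 1" proof (rule tail_trivial[OF leb na, of "\<lambda>n. pullback G (int n)"])
   show "sigma_finite_subalgebra M (pullback G (int n))" for n by (rule sigma_finite_pullback[OF sf])
   show "sets (pullback G (int n)) \<subseteq> sets (pullback G (int m))" if "m \<le> n" for m n
    unfolding sets_pullback[OF GM(2)] using that by (intro anti) simp
   show "null_sets M \<subseteq> sets (pullback G (int n))" for n proof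
    fix N assume N: "N \<in> null_sets M"
    then have "pre (- int n) N \<in> sets G" using pre_null nullG by blast
    moreover have "N = pre (int n) (pre (- int n) N)" using sub_space[OF null_setsD2[OF N]] by (simp add: pre_pre pre_0)
    ultimately show "N \<in> sets (pullback G (int n))" unfolding sets_pullback[OF GM(2)] by blast
   qed
   show "emeasure M B = 0 \<or> emeasure M B = \<infinity>" if B: "\<And>n. B \<in> sets (pullback G (int n))" for B proof -
    have "B \<in> pre k ` sets G" for k proof -
     \<comment> \<open>Only nonnegative shifts are given; a negative \<open>k\<close> lies below
       \<open>int (nat k) = 0\<close>, and the fields decrease with the shift.\<close>
     have "B \<in> pre (int (nat k)) ` sets G" using B[of "nat k"] unfolding sets_pullback[OF GM(2)] .
     moreover have "k \<le> int (nat k)" by simp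
     ultimately show ?thesis using anti by blast
    qed
    then have "B \<in> (\<Inter>n. preimage_sets M T G n)" unfolding preimage_sets_eq by blast
    then have "\<not> (0 < emeasure M B \<and> emeasure M B < \<infinity>)" using tail by blast
    then show ?thesis by (auto simp: less_top zero_less_iff_neq_zero)
   qed
   show "E0 \<in> events" by (rule E0(1))
   fix n
   obtain E' where E': "E' \<in> H" "E = SP.pre (int n) E'" using En[of "int n"] by blast
   obtain F where F: "F \<in> cyl M (pre (int n) ` sets G)" "sym_diff E F \<in> null_sets S" using preH[OF E'(1), of "int n"] E'(2) by blast
   have Fe: "F \<in> events" using F(1) cyl_sub[of "pre (int n) ` sets G"] GM(1) pre_sets by blast
   have D: "sym_diff E0 F \<in> events" by (rule sets_sym_diff[OF E0(1) Fe])
   have "sym_diff E0 F \<in> null_sets S" by (rule null_sets_subset[OF null_sets.Un[OF E0(2) F(2)]]) (use D in auto)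
   then have "measure S (sym_diff E0 F) = 0" by (simp add: measure_def null_setsD1)
   then have "prob (sym_diff E0 F) = 0" using D by simp
   then show "\<exists>F\<in>cyl M (sets (pullback G (int n))). prob (sym_diff E0 F) = 0" unfolding sets_pullback[OF GM(2)] using F(1) by blast
  qed
  moreover have "measure S E0 = prob E0" using E0(1) by simp
  ultimately show ?thesis by simp
 qed
 then show ?thesis unfolding K_automorphism_def using exh by blast
qed

end

section \<open>Bernoulli property\<close>

text \<open>Base \<open>3\<close> with the digits \<open>0\<close> and \<open>1\<close> only: what
  follows a digit amounts to at most half a unit of its place, so \<open>digit\<close> recovers
  every bit exactly, without the ambiguity of binary expansions.\<close>

definition code :: "(nat \<Rightarrow> bool) \<Rightarrow> real" where "code b = (\<Sum>i. of_bool (b i) / 3 ^ Suc i)"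

definition digit :: "real \<Rightarrow> nat \<Rightarrow> bool" where "digit r i \<longleftrightarrow> \<lfloor>3 ^ Suc i * r\<rfloor> mod 3 = 1"

lemma code_sums: "(\<lambda>i. of_bool (b i) / 3 ^ Suc i :: real) sums code b" and code_bounds: "0 \<le> code b" "code b \<le> 1 / 2"
proof -
 have g: "(\<lambda>i. (1 / 3 :: real) ^ Suc i) sums (1 / 2)" using sums_mult[OF geometric_sums[of "1 / 3 :: real"], of "1 / 3"] by simp
 have s: "summable (\<lambda>i. of_bool (b i) / 3 ^ Suc i :: real)" by (rule summable_comparison_test[OF _ sums_summable[OF g]]) (auto simp: power_divide)
 then show "(\<lambda>i. of_bool (b i) / 3 ^ Suc i :: real) sums code b" unfolding code_def by (rule summable_sums)
 show "0 \<le> code b" unfolding code_def by (rule suminf_nonneg[OF s]) simp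
 have "code b \<le> (\<Sum>i. (1 / 3 :: real) ^ Suc i)" unfolding code_def by (rule suminf_le[OF _ s sums_summable[OF g]]) (auto simp: power_divide)
 then show "code b \<le> 1 / 2" using sums_unique[OF g] by simp
qed

lemma code_shift: "3 * code b = of_bool (b 0) + code (\<lambda>i. b (Suc i))"
proof -
 have "(\<lambda>i. of_bool (b (Suc i)) / 3 ^ Suc (Suc i) :: real) sums (code b - of_bool (b 0) / 3)" using code_sums[of b] by (subst sums_Suc_iff) simp
 from sums_mult[OF this, of 3] have "(\<lambda>i. of_bool (b (Suc i)) / 3 ^ Suc i :: real) sums (3 * code b - of_bool (b 0))" by (simp add: algebra_simps)
 from sums_unique2[OF this code_sums[of "\<lambda>i. b (Suc i)"]] show ?thesis by simp
qed

lemma digit_code: "digit (code b) i = b i"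
proof (induction i arbitrary: b)
 case 0
 have "\<lfloor>of_bool (b 0) + code (\<lambda>i. b (Suc i))\<rfloor> = of_bool (b 0)" using code_bounds[of "\<lambda>i. b (Suc i)"] by (intro floor_unique) auto
 then show ?case by (simp add: digit_def code_shift)
next
 case (Suc i)
 have "3 ^ Suc (Suc i) * code b = 3 ^ Suc i * (3 * code b)" by simp
 also have "\<dots> = of_int (3 * (3 ^ i * of_bool (b 0))) + 3 ^ Suc i * code (\<lambda>i. b (Suc i))" by (simp add: code_shift distrib_left)
 finally have "\<lfloor>3 ^ Suc (Suc i) * code b\<rfloor> = 3 * (3 ^ i * of_bool (b 0)) + \<lfloor>3 ^ Suc i * code (\<lambda>i. b (Suc i))\<rfloor>"
  by (simp only: int_add_floor[symmetric])
 then have "\<lfloor>3 ^ Suc (Suc i) * code b\<rfloor> mod 3 = \<lfloor>3 ^ Suc i * code (\<lambda>i. b (Suc i))\<rfloor> mod 3" by simp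
 then show ?case using Suc.IH[of "\<lambda>i. b (Suc i)"] by (simp add: digit_def)
qed

lemma measurable_code:
 assumes "\<And>i. Measurable.pred N (\<lambda>x. b x i)"
 shows "(\<lambda>x. code (b x)) \<in> borel_measurable N" unfolding code_def using assms by measurable

lemma measurable_digit [measurable]: "Measurable.pred borel (\<lambda>r. digit r i)" unfolding digit_def by measurable

section \<open>Integer-valued measures on the line and their quantiles\<close>

definition rational :: "nat \<Rightarrow> real" where "rational l = of_rat (from_nat l)"

lemma rational_between: assumes "x < y" obtains l where "x < rational l" "rational l < y"
proof -
 obtain q where q: "x < of_rat q" "of_rat q < y" using of_rat_dense[OF assms] by blast
 then show thesis using that[of "to_nat q"] by (simp add: rational_def)
qed

text \<open>If \<open>b l\<close> tells whether a distribution function has reached a given level at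
  \<open>rational l\<close>, this infimum is the place where it reaches that level;
  \<open>\<infinity>\<close> means that it never does.\<close>

definition quantile :: "(nat \<Rightarrow> bool) \<Rightarrow> ereal" where "quantile b = (INF l. if b l then ereal (rational l) else \<infinity>)"

text \<open>Bits at rational points decide about all real \<open>t\<close>: one direction is right
  continuity of the distribution function, the other density of the rationals.\<close>

lemma quantile_le_iff:
 assumes "finite_borel_measure rho" and b: "\<And>l. b l \<longleftrightarrow> c \<le> cdf rho (rational l)"
 shows "quantile b \<le> ereal t \<longleftrightarrow> c \<le> cdf rho t"
proof
 interpret finite_borel_measure rho by fact
 assume le: "quantile b \<le> ereal t"
 have "c \<le> cdf rho u" if "t < u" for u proof -
  have "quantile b < ereal u" using le that by (simp add: order_le_less_trans)
  then obtain l where l: "(if b l then ereal (rational l) else \<infinity>) < ereal u" unfolding quantile_def INF_less_iff by blast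
  then have "b l" "rational l < u" by (auto split: if_splits)
  then show ?thesis using b[of l] cdf_nondecreasing[of "rational l" u] by simp
 qed
 then have "eventually (\<lambda>u. c \<le> cdf rho u) (at_right t)" by (auto simp: eventually_at_right_field intro: exI[of _ "t + 1"])
 moreover have "(cdf rho \<longlongrightarrow> cdf rho t) (at_right t)" using cdf_is_right_cont[of t] by (simp add: continuous_within)
 ultimately show "c \<le> cdf rho t" by (intro tendsto_lowerbound) auto
next
 interpret finite_borel_measure rho by fact
 assume c: "c \<le> cdf rho t"
 show "quantile b \<le> ereal t" proof (rule dense_ge)
  fix z assume "ereal t < z"
  then obtain u where u: "ereal t < ereal u" "ereal u < z" using ereal_dense2 by blast
  then have "t < u" by simp
  then obtain l where l: "t < rational l" "rational l < u" by (rule rational_between)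
  then have "b l" using b[of l] c cdf_nondecreasing[of t "rational l"] by simp
  then have "quantile b \<le> ereal (rational l)" unfolding quantile_def by (intro INF_lower2[of l]) auto
  also have "\<dots> \<le> ereal u" using l(2) by simp
  also have "\<dots> \<le> z" using u(2) by simp
  finally show "quantile b \<le> z" .
 qed
qed

lemma measurable_quantile:
 assumes [measurable]: "\<And>l. Measurable.pred N (\<lambda>x. b x l)"
 shows "(\<lambda>x. quantile (b x)) \<in> borel_measurable N" unfolding quantile_def by measurable

lemma count_space_inj_image:
 assumes "inj_on f X" shows "emeasure (count_space UNIV) (f ` X) = emeasure (count_space UNIV) X"
 using assms by (simp add: emeasure_count_space finite_image_iff card_image)

text \<open>A finite measure with integer-valued distribution function consists of unit masses, with
  repetitions, at the places where that function reaches \<open>1\<close>, \<open>2\<close> and so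
  on; the quantile for \<open>j\<close> belongs to the level \<open>Suc j\<close>. Both sides are
  Borel measures with the same distribution function.\<close>

lemma integer_measure_quantiles:
 assumes fb: "finite_borel_measure rho" and int: "\<And>l. cdf rho (rational l) \<in> \<nat>"
  and b: "\<And>j l. b j l \<longleftrightarrow> real (Suc j) \<le> cdf rho (rational l)" and U: "U \<in> sets borel"
 shows "emeasure rho U = emeasure (count_space UNIV) {j. \<exists>x\<in>U. quantile (b j) = ereal x}"
proof -
 interpret finite_borel_measure rho by fact
 have le: "quantile (b j) \<le> ereal t \<longleftrightarrow> real (Suc j) \<le> cdf rho t" for j t by (rule quantile_le_iff[OF fb b])
 \<comment> \<open>Right continuity extends integrality from the rationals: just right of
   \<open>t\<close> the function stays below the ceiling of its value at \<open>t\<close>, but is an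
   integer at some rational there.\<close>
 have nat: "cdf rho t \<in> \<nat>" for t proof (rule ccontr)
  assume n: "cdf rho t \<notin> \<nat>"
  have "0 \<le> cdf rho t" by (rule cdf_nonneg)
  have "cdf rho t < of_int \<lceil>cdf rho t\<rceil>" proof (rule ccontr)
   assume "\<not> ?thesis"
   then have "cdf rho t = of_int \<lceil>cdf rho t\<rceil>" by linarith
   then have "cdf rho t = real (nat \<lceil>cdf rho t\<rceil>)" using \<open>0 \<le> cdf rho t\<close> by simp
   then show False using n by (metis of_nat_in_Nats)
  qed
  moreover have "(cdf rho \<longlongrightarrow> cdf rho t) (at_right t)" using cdf_is_right_cont[of t] by (simp add: continuous_within)
  ultimately have "eventually (\<lambda>u. cdf rho u < of_int \<lceil>cdf rho t\<rceil>) (at_right t)" by (rule order_tendstoD(2)[rotated])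
  then obtain v where v: "t < v" "\<And>u. t < u \<Longrightarrow> u < v \<Longrightarrow> cdf rho u < of_int \<lceil>cdf rho t\<rceil>" by (auto simp: eventually_at_right_field)
  obtain l where l: "t < rational l" "rational l < v" using v(1) by (rule rational_between)
  obtain N where N: "cdf rho (rational l) = real N" using int[of l] by (auto simp: Nats_def)
  have "real N < of_int \<lceil>cdf rho t\<rceil>" using v(2)[OF l] N by simp
  then have "int N < \<lceil>cdf rho t\<rceil>" by linarith
  moreover have "cdf rho t \<le> real N" using cdf_nondecreasing[of t "rational l"] l N by simp
  ultimately show False by linarith
 qed
 \<comment> \<open>The ranks that occur: a level above the total mass is never reached and has
   quantile \<open>\<infinity>\<close>.\<close>
 define J where "J = {j. \<bar>quantile (b j)\<bar> \<noteq> \<infinity>}"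
 have Jiff: "j \<in> J \<longleftrightarrow> (\<exists>x. quantile (b j) = ereal x)" for j unfolding J_def by (cases "quantile (b j)") auto
 have bot: "quantile (b j) \<noteq> - \<infinity>" for j proof
  assume "quantile (b j) = - \<infinity>"
  then have "1 \<le> cdf rho t" for t using le[of j t] by simp
  moreover have "eventually (\<lambda>t. cdf rho t < 1) at_bot" by (rule order_tendstoD(2)[OF cdf_lim_at_bot]) simp
  ultimately show False by (auto simp: eventually_at_bot_linorder not_less[symmetric])
 qed
 have finJ: "finite J" proof (rule finite_subset)
  show "J \<subseteq> {j. real (Suc j) \<le> measure rho (space rho)}" proof
   fix j assume "j \<in> J"
   then obtain x where "quantile (b j) = ereal x" unfolding Jiff by blast
   then have "real (Suc j) \<le> cdf rho x" using le[of j x] by simp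
   also have "\<dots> \<le> measure rho (space rho)" by (rule cdf_bounded)
   finally show "j \<in> {j. real (Suc j) \<le> measure rho (space rho)}" by simp
  qed
  show "finite {j. real (Suc j) \<le> measure rho (space rho)}" proof (rule finite_subset)
   show "{j. real (Suc j) \<le> measure rho (space rho)} \<subseteq> {..nat \<lceil>measure rho (space rho)\<rceil>}" by auto linarith
  qed simp
 qed
 define kap where "kap = distr (count_space J) borel (\<lambda>j. real_of_ereal (quantile (b j)))"
 have em: "emeasure kap V = emeasure (count_space UNIV) {j. \<exists>x\<in>V. quantile (b j) = ereal x}" if V: "V \<in> sets borel" for V proof -
  have "emeasure kap V = emeasure (count_space J) ((\<lambda>j. real_of_ereal (quantile (b j))) -` V \<inter> space (count_space J))"
   unfolding kap_def by (rule emeasure_distr[OF _ V]) simp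
  also have "(\<lambda>j. real_of_ereal (quantile (b j))) -` V \<inter> space (count_space J) = {j. \<exists>x\<in>V. quantile (b j) = ereal x}" by (auto simp: Jiff)
  also have "emeasure (count_space J) \<dots> = emeasure (count_space UNIV) {j. \<exists>x\<in>V. quantile (b j) = ereal x}" proof -
   have "{j. \<exists>x\<in>V. quantile (b j) = ereal x} \<subseteq> J" by (auto simp: Jiff)
   then show ?thesis by (auto simp: emeasure_count_space)
  qed
  finally show ?thesis .
 qed
 interpret K: finite_borel_measure kap
 proof -
  have "finite_measure kap" unfolding kap_def using finJ by (intro finite_measure.finite_measure_distr finite_measure_count_space) simp_all
  then interpret finite_measure kap .
  show "finite_borel_measure kap" by standard (simp add: kap_def)
 qed
 have "cdf rho = cdf kap" proof
  fix t
  obtain N where N: "cdf rho t = real N" using nat[of t] by (auto simp: Nats_def)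
  have "(\<exists>x\<in>{..t}. quantile (b j) = ereal x) \<longleftrightarrow> j < N" for j proof -
   have "(\<exists>x\<in>{..t}. quantile (b j) = ereal x) \<longleftrightarrow> quantile (b j) \<le> ereal t" using bot[of j] by (cases "quantile (b j)") auto
   also have "\<dots> \<longleftrightarrow> j < N" unfolding le N by auto
   finally show ?thesis .
  qed
  then have "{j. \<exists>x\<in>{..t}. quantile (b j) = ereal x} = {..<N}" by auto
  then have "measure kap {..t} = real N" using em[of "{..t}"] by (simp add: measure_def)
  then show "cdf rho t = cdf kap t" using N by (simp add: cdf_def)
 qed
 then have "rho = kap" by (rule cdf_unique'[OF fb K.finite_borel_measure_axioms])
 then show ?thesis using em[OF U] by simp
qed

text \<open>The inverse \<open>\<theta>\<close> is measurable only for a subfield \<open>D\<close>,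
  but every event lies between two events of \<open>D\<close> with null difference, and completion
  on both sides absorbs the gap. That \<open>N0\<close> has full measure follows since
  \<open>phi\<close> maps \<open>M0\<close> into it.\<close>

lemma iso_mod0_completionI:
 assumes D: "space D = space P" "sets D \<subseteq> sets P" and approx: "\<And>E. E \<in> sets P \<Longrightarrow> \<exists>D1\<in>sets D. \<exists>D2\<in>sets D. D1 \<subseteq> E \<and> E \<subseteq> D2 \<and> D2 - D1 \<in> null_sets P"
  and M0: "M0 \<in> sets D" "space P - M0 \<in> null_sets P" and phi: "phi \<in> measurable P Q" "distr P Q phi = Q"
  and N0: "N0 \<in> sets Q" and maps: "\<And>x. x \<in> M0 \<Longrightarrow> phi x \<in> N0" "\<And>y. y \<in> N0 \<Longrightarrow> \<theta> y \<in> M0" and inv: "\<And>x. x \<in> M0 \<Longrightarrow> \<theta> (phi x) = x" "\<And>y. y \<in> N0 \<Longrightarrow> phi (\<theta> y) = y"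
  and \<theta>: "\<And>E. E \<in> sets D \<Longrightarrow> {y\<in>N0. \<theta> y \<in> E} \<in> sets Q"
 shows "iso_mod0 (completion P) (completion Q) phi"
proof -
 have M0P: "M0 \<in> sets P" using M0 D by blast
 have pre: "phi -` B \<inter> M0 \<in> sets P" if "B \<in> sets Q" for B proof -
  have "phi -` B \<inter> M0 = (phi -` B \<inter> space P) \<inter> M0" using sub_space[OF M0P] by blast
  then show ?thesis using measurable_sets[OF phi(1) that] M0P by simp
 qed
 have em: "emeasure P (phi -` B \<inter> M0) = emeasure Q B" if B: "B \<in> sets Q" for B proof -
  have "emeasure Q B = emeasure P (phi -` B \<inter> space P)" using emeasure_distr[OF phi(1) B] phi(2) by simp
  also have "\<dots> = emeasure P (phi -` B \<inter> M0)" using AE_not_in[OF M0(2)] pre[OF B] measurable_sets[OF phi(1) B] sub_space[OF M0P]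
   by (intro emeasure_eq_AE) (auto elim!: eventually_mono)
  finally show ?thesis by simp
 qed
 have nulls: "phi -` B \<inter> M0 \<in> null_sets P" if "B \<in> null_sets Q" for B using that em[of B] pre[of B] by (auto simp: null_sets_def)
 have compl: "\<exists>B1\<in>sets Q. \<exists>N'\<in>null_sets Q. \<exists>N. B = B1 \<union> N \<and> N \<subseteq> N'" if "B \<in> sets (completion Q)" for B using that by (elim sets_completionE) blast
 have to: "phi -` B \<inter> M0 \<in> sets (completion P) \<and> emeasure (completion P) (phi -` B \<inter> M0) = emeasure (completion Q) B"
  if B: "B \<in> sets (completion Q)" for B
 proof -
  obtain B1 N N' where b: "B = B1 \<union> N" "N \<subseteq> N'" "N' \<in> null_sets Q" "B1 \<in> sets Q" using B by (rule sets_completionE)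
  have N: "phi -` N \<inter> M0 \<in> null_sets (completion P)"
   by (rule null_sets_completion_subset[OF _ null_sets_completionI[OF nulls[OF b(3)]]]) (use b(2) in blast)
  have NQ: "N \<in> null_sets (completion Q)" by (rule null_sets_completion_subset[OF b(2) null_sets_completionI[OF b(3)]])
  have eq: "phi -` B \<inter> M0 = (phi -` B1 \<inter> M0) \<union> (phi -` N \<inter> M0)" unfolding b(1) by blast
  have s: "phi -` B1 \<inter> M0 \<in> sets (completion P)" using pre[OF b(4)] by simp
  have "emeasure (completion P) (phi -` B \<inter> M0) = emeasure (completion P) (phi -` B1 \<inter> M0)" unfolding eq by (rule emeasure_Un_null_set[OF s N])
  also have "\<dots> = emeasure Q B1" using pre[OF b(4)] em[OF b(4)] by simp
  also have "\<dots> = emeasure (completion Q) B1" using b(4) by simp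
  also have "\<dots> = emeasure (completion Q) B" unfolding b(1) using b(4) by (intro emeasure_Un_null_set[symmetric] NQ) simp
  finally show ?thesis using eq s N by auto
 qed
 have from_: "B \<in> sets (completion Q)" if B: "B \<subseteq> N0" "phi -` B \<inter> M0 \<in> sets (completion P)" for B proof -
  obtain A N N' where a: "phi -` B \<inter> M0 = A \<union> N" "N \<subseteq> N'" "N' \<in> null_sets P" "A \<in> sets P" using B(2) by (rule sets_completionE)
  obtain D1 D2 where d: "D1 \<in> sets D" "D2 \<in> sets D" "D1 \<subseteq> A" "A \<subseteq> D2" "D2 - D1 \<in> null_sets P" using approx[OF a(4)] by blast
  \<comment> \<open>The null set \<open>N'\<close> has to be enclosed in an event of
    \<open>D\<close> as well, since \<open>\<theta>\<close> pulls back only events of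
    \<open>D\<close>.\<close>
  have "N' \<in> sets P" using a(3) by auto
  from approx[OF this] obtain D3 D4 where e: "D3 \<in> sets D" "D4 \<in> sets D" "D3 \<subseteq> N'" "N' \<subseteq> D4" "D4 - D3 \<in> null_sets P" by blast
  have nP: "(D2 - D1) \<union> D4 \<in> null_sets P" proof -
   have "(D2 - D1) \<union> (N' \<union> (D4 - D3)) \<in> null_sets P" by (intro null_sets.Un d(5) a(3) e(5))
   moreover have "(D2 - D1) \<union> D4 \<in> sets P" using d e D(2) by blast
   ultimately show ?thesis by (rule null_sets_subset) (use e(3) in blast)
  qed
  let ?t = "\<lambda>E. {y\<in>N0. \<theta> y \<in> E}"
  have tn: "?t ((D2 - D1) \<union> D4) \<in> null_sets Q" proof -
   have s: "?t ((D2 - D1) \<union> D4) \<in> sets Q" using d e by (intro \<theta>) auto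
   have "phi -` ?t ((D2 - D1) \<union> D4) \<inter> M0 \<in> null_sets P" by (rule null_sets_subset[OF nP pre[OF s]]) (use inv(1) in auto)
   then show ?thesis using em[OF s] s by (auto simp: null_sets_def)
  qed
  have Bt: "y \<in> B \<longleftrightarrow> y \<in> N0 \<and> \<theta> y \<in> A \<union> N" for y proof
   assume "y \<in> B"
   then have "y \<in> N0" using B(1) by blast
   then have "\<theta> y \<in> phi -` B \<inter> M0" using maps(2) inv(2) \<open>y \<in> B\<close> by auto
   then show "y \<in> N0 \<and> \<theta> y \<in> A \<union> N" using a(1) \<open>y \<in> N0\<close> by blast
  next
   assume y: "y \<in> N0 \<and> \<theta> y \<in> A \<union> N"
   then have "\<theta> y \<in> phi -` B \<inter> M0" using a(1) by blast
   then show "y \<in> B" using inv(2)[of y] y by auto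
  qed
  have sub: "?t D1 \<subseteq> B" "B - ?t D1 \<subseteq> ?t ((D2 - D1) \<union> D4)" using Bt d(3,4) a(2) e(4) by blast+
  have n: "B - ?t D1 \<in> null_sets (completion Q)" by (rule null_sets_completion_subset[OF sub(2) null_sets_completionI[OF tn]])
  have "?t D1 \<in> sets (completion Q)" using \<theta>[OF d(1)] by simp
  then have "?t D1 \<union> (B - ?t D1) \<in> sets (completion Q)" by (rule sets.Un[OF _ null_setsD2[OF n]])
  moreover have "?t D1 \<union> (B - ?t D1) = B" using sub(1) by blast
  ultimately show ?thesis by simp
 qed
 show ?thesis unfolding iso_mod0_def proof (intro bexI[of _ M0] bexI[of _ N0] conjI allI impI ballI)
  show "M0 \<in> sets (completion P)" "N0 \<in> sets (completion Q)" using M0P N0 by simp_all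
  show "space (completion P) - M0 \<in> null_sets (completion P)" using M0(2) by (simp add: null_sets_completionI)
  have sQ: "space Q - N0 \<in> sets Q" using N0 by auto
  have "phi -` (space Q - N0) \<inter> M0 = {}" using maps(1) by auto
  then have "space Q - N0 \<in> null_sets Q" using em[OF sQ] sQ by (auto simp: null_sets_def)
  then show "space (completion Q) - N0 \<in> null_sets (completion Q)" by (simp add: null_sets_completionI)
  show "bij_betw phi M0 N0" by (rule bij_betw_byWitness[where f'=\<theta>]) (use maps inv in auto)
  show "B \<in> sets (completion Q) \<longleftrightarrow> phi -` B \<inter> M0 \<in> sets (completion P)" if "B \<subseteq> N0" for B using to[of B] from_[OF that] by blast
  show "emeasure (completion P) (phi -` B \<inter> M0) = emeasure (completion Q) B" if "B \<in> sets (completion Q)" "B \<subseteq> N0" for B using to[OF that(1)] by blast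
 qed
qed

text \<open>Images under \<open>psi\<close> are Borel only up to null sets. The wandering set is
  therefore cut into pieces of finite measure; \<open>R k\<close> is a Borel subset of the image of
  the \<open>k\<close>-th piece, leaving out a null part of it, and \<open>W\<close> is what lies
  over the sets \<open>R k\<close>. Its image is then exactly Borel.\<close>

lemma (in suspension) fundamental_coordinate:
 assumes leb: "lebesgue_space M" and dis: "dissipative M T"
 obtains W and psi :: "'a \<Rightarrow> real" and R :: "nat \<Rightarrow> real set"
 where "W \<in> sets M" "psi \<in> borel_measurable M" "inj_on psi W" "\<And>k. R k \<in> sets borel" "disjoint_family R" "psi ` W = (\<Union>k. R k)"
  "\<And>k. W \<inter> psi -` R k \<in> fmeasurable M" "\<And>m n. m \<noteq> n \<Longrightarrow> pre m W \<inter> pre n W = {}" "space M - (\<Union>n. pre n W) \<in> null_sets M"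
  "\<And>A. A \<in> sets M \<Longrightarrow> A \<subseteq> W \<Longrightarrow> \<exists>B1\<in>sets borel. \<exists>B2\<in>sets borel. B1 \<subseteq> psi ` A \<and> psi ` A \<subseteq> B2 \<and> W \<inter> psi -` (B2 - B1) \<in> null_sets M"
proof -
 obtain W0 where W0: "W0 \<in> sets M" "\<And>m n. m \<noteq> n \<Longrightarrow> pre m W0 \<inter> pre n W0 = {}" "space M - (\<Union>n. pre n W0) \<in> null_sets M"
  by (rule dissipative_exact[OF dis]) (rule that)
 obtain X0 N0 and psi :: "'a \<Rightarrow> real" where X0: "X0 \<in> sets M" "space M - X0 \<in> null_sets M" "N0 \<in> sets borel"
  "psi \<in> borel_measurable M" "inj_on psi X0" "psi ` X0 = N0"
  and sandwich: "\<And>A. A \<in> sets M \<Longrightarrow> A \<subseteq> X0 \<Longrightarrow> \<exists>B1\<in>sets borel. \<exists>B2\<in>sets borel. B1 \<subseteq> psi ` A \<and> psi ` A \<subseteq> B2 \<and> B2 \<subseteq> N0 \<and>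
   psi -` (B2 - B1) \<inter> X0 \<in> null_sets M" by (rule lebesgue_coordinate[OF leb]) (rule that)
 obtain X :: "nat \<Rightarrow> 'a set" where X: "range X \<subseteq> fmeasurable M" "disjoint_family X" "(\<Union>i. X i) = space M" by (rule partition)
 define A where "A k = W0 \<inter> X0 \<inter> X k" for k
 have Af: "A k \<in> fmeasurable M" for k using fmeasurableI2[of "X k" M "A k"] X(1) W0(1) X0(1) by (auto simp: A_def)
 have AX: "A k \<subseteq> X0" for k by (auto simp: A_def)
 have "\<exists>B1. B1 \<in> sets borel \<and> B1 \<subseteq> psi ` A k \<and> A k - psi -` B1 \<in> null_sets M" for k proof -
  have As: "A k \<in> sets M" using Af[of k] by auto
  obtain B1 B2 where B: "B1 \<in> sets borel" "B1 \<subseteq> psi ` A k" "psi ` A k \<subseteq> B2" "psi -` (B2 - B1) \<inter> X0 \<in> null_sets M" using sandwich[OF As AX] by blast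
  have "A k - psi -` B1 = A k - (psi -` B1 \<inter> space M)" using sub_space[OF As] by blast
  then have s: "A k - psi -` B1 \<in> sets M" using As measurable_sets[OF X0(4) B(1)] by simp
  have "A k - psi -` B1 \<in> null_sets M" by (rule null_sets_subset[OF B(4) s]) (use B(3) AX in blast)
  then show ?thesis using B by blast
 qed
 then obtain R where R: "\<And>k. R k \<in> sets borel" "\<And>k. R k \<subseteq> psi ` A k" "\<And>k. A k - psi -` R k \<in> null_sets M" by metis
 define W where "W = X0 \<inter> psi -` (\<Union>k. R k)"
 have vim: "X0 \<inter> psi -` U = X0 \<inter> (psi -` U \<inter> space M)" for U using sub_space[OF X0(1)] by blast
 have Ws: "W \<in> sets M" unfolding W_def vim using X0(1) measurable_sets[OF X0(4), of "\<Union>k. R k"] R(1) by auto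
 have WX: "W \<subseteq> X0" by (auto simp: W_def)
 have piece: "X0 \<inter> psi -` R k \<subseteq> A k" for k proof
  fix x assume x: "x \<in> X0 \<inter> psi -` R k"
  then obtain x' where "x' \<in> A k" "psi x = psi x'" using R(2)[of k] by blast
  then show "x \<in> A k" using X0(5) x AX by (metis IntD1 inj_onD subsetD)
 qed
 have WW0: "W \<subseteq> W0" using piece by (auto simp: W_def A_def)
 have disjA: "A j \<inter> A k = {}" if "j \<noteq> k" for j k using X(2) that by (auto simp: A_def disjoint_family_on_def)
 have W0W: "W0 - W \<in> null_sets M" proof -
  have "(space M - X0) \<union> (\<Union>k. A k - psi -` R k) \<in> null_sets M" by (intro null_sets.Un X0(2) null_sets_UN R(3))
  moreover have "W0 - W \<in> sets M" using W0(1) Ws by simp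
  ultimately show ?thesis proof (rule null_sets_subset)
   show "W0 - W \<subseteq> (space M - X0) \<union> (\<Union>k. A k - psi -` R k)" proof
    fix x assume x: "x \<in> W0 - W"
    then have xs: "x \<in> space M" using sub_space[OF W0(1)] by blast
    then obtain k where "x \<in> X k" using X(3) by blast
    then show "x \<in> (space M - X0) \<union> (\<Union>k. A k - psi -` R k)" using x xs by (auto simp: W_def A_def)
   qed
  qed
 qed
 show thesis proof (rule that[of W psi R])
  show "W \<in> sets M" by (rule Ws)
  show "psi \<in> borel_measurable M" by (rule X0(4))
  show "inj_on psi W" by (rule inj_on_subset[OF X0(5) WX])
  show "R k \<in> sets borel" for k by (rule R(1))
  show "disjoint_family R" unfolding disjoint_family_on_def proof (intro ballI impI)
   fix j k :: nat assume "j \<noteq> k"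
   have "psi ` A j \<inter> psi ` A k = psi ` (A j \<inter> A k)" by (rule inj_on_image_Int[OF X0(5) AX AX, symmetric])
   then have "psi ` A j \<inter> psi ` A k = {}" unfolding disjA[OF \<open>j \<noteq> k\<close>] by simp
   then show "R j \<inter> R k = {}" using R(2)[of j] R(2)[of k] by blast
  qed
  show "psi ` W = (\<Union>k. R k)" proof
   show "(\<Union>k. R k) \<subseteq> psi ` W" proof
    fix y assume y: "y \<in> (\<Union>k. R k)"
    then obtain k where "y \<in> R k" by blast
    then obtain x where "x \<in> A k" "y = psi x" using R(2)[of k] by blast
    then show "y \<in> psi ` W" using y AX[of k] by (auto simp: W_def)
   qed
  qed (auto simp: W_def)
  show "W \<inter> psi -` R k \<in> fmeasurable M" for k proof (rule fmeasurableI2[OF Af[of k]])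
   show "W \<inter> psi -` R k \<subseteq> A k" using piece[of k] WX by blast
   have "W \<inter> psi -` R k = W \<inter> (psi -` R k \<inter> space M)" using sub_space[OF Ws] by blast
   then show "W \<inter> psi -` R k \<in> sets M" using Ws measurable_sets[OF X0(4) R(1)] by simp
  qed
  show "pre m W \<inter> pre n W = {}" if "m \<noteq> n" for m n using W0(2)[OF that] pre_mono[OF WW0, of m] pre_mono[OF WW0, of n] by blast
  have "(space M - (\<Union>n. pre n W0)) \<union> (\<Union>n. pre n (W0 - W)) \<in> null_sets M" by (intro null_sets.Un W0(3) null_sets_UN pre_null W0W)
  then show "space M - (\<Union>n. pre n W) \<in> null_sets M" proof (rule null_sets_subset)
   show "space M - (\<Union>n. pre n W) \<in> sets M" using Ws by (intro sets.Diff sets.top sets.countable_UN') auto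
  qed (auto simp: pre_Diff)
  fix B assume B: "B \<in> sets M" "B \<subseteq> W"
  then have "B \<subseteq> X0" using WX by blast
  from sandwich[OF B(1) this] obtain B1 B2 where b: "B1 \<in> sets borel" "B2 \<in> sets borel" "B1 \<subseteq> psi ` B" "psi ` B \<subseteq> B2"
   "psi -` (B2 - B1) \<inter> X0 \<in> null_sets M" by blast
  have "W \<inter> psi -` (B2 - B1) = W \<inter> (psi -` (B2 - B1) \<inter> space M)" using sub_space[OF Ws] by blast
  then have "W \<inter> psi -` (B2 - B1) \<in> sets M" using Ws measurable_sets[OF X0(4), of "B2 - B1"] b by simp
  then have "W \<inter> psi -` (B2 - B1) \<in> null_sets M" by (rule null_sets_subset[OF b(5)]) (use WX in blast)
  then show "\<exists>B1\<in>sets borel. \<exists>B2\<in>sets borel. B1 \<subseteq> psi ` B \<and> psi ` B \<subseteq> B2 \<and> W \<inter> psi -` (B2 - B1) \<in> null_sets M" using b by blast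
 qed
qed

section \<open>Coding a configuration by one real number for each translate of
  \<open>W\<close>\<close>

locale coded_suspension = suspension M T P for M :: "'a measure" and T :: "'a \<Rightarrow> 'a" and P :: "'a measure measure" +
 fixes W :: "'a set" and psi :: "'a \<Rightarrow> real" and R :: "nat \<Rightarrow> real set"
 assumes W_sets: "W \<in> sets M" and psi_meas: "psi \<in> borel_measurable M" and psi_inj: "inj_on psi W"
  and R_borel: "R k \<in> sets borel" and R_disj: "disjoint_family R" and psi_image: "psi ` W = (\<Union>k. R k)" and R_fin: "W \<inter> psi -` R k \<in> fmeasurable M"
  and W_wander: "m \<noteq> n \<Longrightarrow> pre m W \<inter> pre n W = {}" and W_exhaust: "space M - (\<Union>n. pre n W) \<in> null_sets M" and W_sandwich: "A \<in> sets M \<Longrightarrow> A \<subseteq> W \<Longrightarrow>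
   \<exists>B1\<in>sets borel. \<exists>B2\<in>sets borel. B1 \<subseteq> psi ` A \<and> psi ` A \<subseteq> B2 \<and> W \<inter> psi -` (B2 - B1) \<in> null_sets M"
begin

definition C :: "int \<Rightarrow> real set \<Rightarrow> 'a set" where "C n U = pre n (W \<inter> psi -` U)"

definition rest :: "'a set" where "rest = space M - (\<Union>n. pre n W)"

lemma C_iff: "x \<in> C n U \<longleftrightarrow> x \<in> pre n W \<and> psi (Z n x) \<in> U" by (auto simp: C_def pre_iff)

lemma C_sets: assumes "U \<in> sets borel" shows "C n U \<in> sets M"
proof -
 have "W \<inter> psi -` U = W \<inter> (psi -` U \<inter> space M)" using sub_space[OF W_sets] by blast
 then have "W \<inter> psi -` U \<in> sets M" using W_sets measurable_sets[OF psi_meas assms] by simp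
 then show ?thesis unfolding C_def by (rule pre_sets)
qed

lemma C_fmeasurable: assumes "U \<in> sets borel" shows "C n (R k \<inter> U) \<in> fmeasurable M"
proof (rule fmeasurableI2[OF pre_fmeasurable[OF R_fin[of k], of n]])
 show "C n (R k \<inter> U) \<subseteq> pre n (W \<inter> psi -` R k)" unfolding C_def by (intro pre_mono) blast
 show "C n (R k \<inter> U) \<in> sets M" using assms R_borel by (intro C_sets) auto
qed

lemma C_sub: "C n U \<subseteq> pre n W" by (auto simp: C_iff)

lemma pre_C: "pre m (C n U) = C (m + n) U" by (simp add: C_def pre_pre)

lemma C_singleton: assumes x: "x \<in> pre n W" shows "C n {psi (Z n x)} = {x}"
proof
 show "C n {psi (Z n x)} \<subseteq> {x}" proof
  fix x' assume "x' \<in> C n {psi (Z n x)}"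
  then have x': "x' \<in> pre n W" "psi (Z n x') = psi (Z n x)" by (auto simp: C_iff)
  then have "Z n x' = Z n x" using psi_inj x by (auto simp: pre_iff inj_on_def)
  then show "x' \<in> {x}" using Z_inv(1)[of x n] Z_inv(1)[of x' n] x x'(1) by (auto simp: pre_iff)
 qed
qed (use x in \<open>simp add: C_iff\<close>)

lemma rest_null: "rest \<in> null_sets M" unfolding rest_def by (rule W_exhaust)

lemma rest_sets: "rest \<in> sets M" using rest_null by auto

text \<open>Decoding is measurable for the field of the cells only, which exhausts the cylinder events modulo null sets.\<close>

definition cells :: "'a set set" where "cells = insert rest {C n U | n U. U \<in> sets borel}"

lemma cells_sets: "cells \<subseteq> sets M" using C_sets rest_sets by (auto simp: cells_def)

abbreviation D :: "'a measure measure" where "D \<equiv> cylm M cells"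

lemma sets_D: "sets D = cyl M cells" by (rule sets_cylm)
lemma space_D: "space D = config M" by (rule space_cylm)
lemma sets_D_P: "sets D \<subseteq> sets P" unfolding sets_D by (rule cyl_sub[OF cells_sets])

lemma C_meas: "U \<in> sets borel \<Longrightarrow> (cnt (C n U)) \<in> borel_measurable D" by (rule emeasure_cylm) (auto simp: cells_def)

lemma D_sets: "f \<in> borel_measurable D \<Longrightarrow> U \<in> sets borel \<Longrightarrow> {w\<in>space P. f w \<in> U} \<in> sets D"
 using measurable_sets[of f D borel U] by (simp only: space_D space_P vimage_def Int_def mem_Collect_eq conj_commute)

lemma fibred_meas:
 assumes U: "\<And>n. U n \<in> sets borel"
 shows "(\<Union>n. C n (U n)) \<in> sets M" "(cnt (\<Union>n. C n (U n))) \<in> borel_measurable D"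
proof -
 show "(\<Union>n. C n (U n)) \<in> sets M" using C_sets[OF U] by (intro sets.countable_UN') auto
 have eq: "(\<Union>n. C n (U n)) = (\<Union>i. C (int_decode i) (U (int_decode i)))" proof (rule set_eqI, rule iffI)
  fix x assume "x \<in> (\<Union>n. C n (U n))"
  then obtain n where "x \<in> C n (U n)" by blast
  then have "x \<in> C (int_decode (int_encode n)) (U (int_decode (int_encode n)))" by simp
  then show "x \<in> (\<Union>i. C (int_decode i) (U (int_decode i)))" by (rule UN_I[OF UNIV_I])
 next
  fix x assume "x \<in> (\<Union>i. C (int_decode i) (U (int_decode i)))"
  then show "x \<in> (\<Union>n. C n (U n))" by blast
 qed
 show "(cnt (\<Union>n. C n (U n))) \<in> borel_measurable D" proof (rule measurable_sum_disjoint[OF eq _ _ space_D])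
  show "disjoint_family (\<lambda>i. C (int_decode i) (U (int_decode i)))" unfolding disjoint_family_on_def proof (intro ballI impI)
   fix i j :: nat assume "i \<noteq> j"
   then have "int_decode i \<noteq> int_decode j" by (simp add: inj_eq[OF inj_int_decode])
   from W_wander[OF this] show "C (int_decode i) (U (int_decode i)) \<inter> C (int_decode j) (U (int_decode j)) = {}" using C_sub by blast
  qed
  show "C (int_decode i) (U (int_decode i)) \<in> sets M" for i by (rule C_sets[OF U])
  show "(\<lambda>w. emeasure w (C (int_decode i) (U (int_decode i)))) \<in> borel_measurable D" for i by (rule C_meas[OF U])
 qed
qed

text \<open>In each translate, \<open>A\<close> lies between two cells that differ by a null set.
  Unless a point falls in one of these null sets or in \<open>rest\<close>, the count of
  \<open>A\<close> is that of a countable union of cells; so all counts are measurable for the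
  completion of the measure restricted to \<open>D\<close>.\<close>

lemma D_approx:
 assumes "E \<in> sets P"
 shows "\<exists>D1\<in>sets D. \<exists>D2\<in>sets D. D1 \<subseteq> E \<and> E \<subseteq> D2 \<and> D2 - D1 \<in> null_sets P"
proof -
 have sub: "subalgebra P D" unfolding subalgebra_def using sets_D_P by (simp only: space_D space_P simp_thms)
 let ?K = "restr_to_subalg P D"
 have sK: "sets ?K = sets D" by (rule sets_restr_to_subalg[OF sub])
 have spK: "space ?K = config M" by (simp only: space_restr_to_subalg space_P)
 have eK: "emeasure ?K X = emeasure P X" if "X \<in> sets D" for X by (rule emeasure_restr_to_subalg[OF sub that])
 have nullK: "X \<in> null_sets P" if "X \<in> null_sets ?K" for X proof -
  have "X \<in> sets D" "emeasure ?K X = 0" using that unfolding null_sets_def sK by auto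
  then show ?thesis using eK[of X] sets_D_P by (auto simp: null_sets_def)
 qed
 have "cyl M (sets M) \<subseteq> sets (completion ?K)" proof (rule cyl_leI[of M "sets (completion ?K)" "completion ?K"])
  show "space (completion ?K) = config M" using spK by (simp only: space_completion)
  then show "sigma_algebra (config M) (sets (completion ?K))" using sets.sigma_algebra_axioms[of "completion ?K"] by (simp only:)
  fix A assume A: "A \<in> sets M"
  have "\<exists>B1 B2. B1 \<in> sets borel \<and> B2 \<in> sets borel \<and> B1 \<subseteq> psi ` (pre (- n) A \<inter> W) \<and> psi ` (pre (- n) A \<inter> W) \<subseteq> B2 \<and>
   W \<inter> psi -` (B2 - B1) \<in> null_sets M" for n
  proof -
   have "pre (- n) A \<inter> W \<in> sets M" using A W_sets by auto
   from W_sandwich[OF this] show ?thesis by blast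
  qed
  then obtain B1 B2 where B: "\<And>n. B1 n \<in> sets borel" "\<And>n. B2 n \<in> sets borel" "\<And>n. B1 n \<subseteq> psi ` (pre (- n) A \<inter> W)"
   "\<And>n. psi ` (pre (- n) A \<inter> W) \<subseteq> B2 n" "\<And>n. W \<inter> psi -` (B2 n - B1 n) \<in> null_sets M" by metis
  have BB: "B2 n - B1 n \<in> sets borel" for n using B(1,2) by blast
  let ?A1 = "\<Union>n. C n (B1 n)" and ?N = "\<Union>n. C n (B2 n - B1 n)"
  have A1: "?A1 \<subseteq> A" proof
   fix x assume "x \<in> ?A1"
   then obtain n where n: "x \<in> pre n W" "psi (Z n x) \<in> B1 n" by (auto simp: C_iff)
   then obtain z where z: "z \<in> pre (- n) A" "z \<in> W" "psi (Z n x) = psi z" using B(3)[of n] by blast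
   then have "Z n x = z" using psi_inj n(1) by (auto simp: pre_iff inj_on_def)
   then show "x \<in> A" using z(1) Z_inv(1)[of x n] n(1) by (auto simp: pre_iff)
  qed
  have A2: "A - ?A1 \<subseteq> ?N \<union> rest" proof
   fix x assume x: "x \<in> A - ?A1"
   have xs: "x \<in> space M" using x sub_space[OF A] by blast
   show "x \<in> ?N \<union> rest" proof (cases "x \<in> rest")
    case False
    then obtain n where n: "x \<in> pre n W" using xs by (auto simp: rest_def)
    have "Z n x \<in> pre (- n) A \<inter> W" using n x xs by (auto simp: pre_iff Z_in Z_inv)
    then have "psi (Z n x) \<in> B2 n" using B(4)[of n] by blast
    moreover have "psi (Z n x) \<notin> B1 n" using x n by (auto simp: C_iff)
    ultimately show ?thesis using n by (auto simp: C_iff)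
   qed simp
  qed
  have Nnull: "?N \<in> null_sets M" unfolding C_def by (intro null_sets_UN pre_null B(5))
  have s: "?A1 \<in> sets M" "?N \<in> sets M" "rest \<in> sets M" using fibred_meas(1)[of B1, OF B(1)] fibred_meas(1)[of "\<lambda>n. B2 n - B1 n", OF BB] rest_sets by simp_all
  show "(cnt A) \<in> borel_measurable (completion ?K)" proof (rule measurableI)
   fix U :: "ennreal set" assume U: "U \<in> sets borel"
   let ?z = "{w\<in>space P. emeasure w ?N \<in> - {0}} \<union> {w\<in>space P. emeasure w rest \<in> - {0}}"
   have zD: "?z \<in> sets D" using emeasure_cylm[of rest cells M] by (intro sets.Un D_sets fibred_meas(2) BB) (auto simp: cells_def)
   have zn: "?z \<in> null_sets ?K" proof -
    have "AE w in P. w \<notin> ?z" using AE_N_null[OF Nnull] AE_N_null[OF rest_null] by eventually_elim simp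
    then have "?z \<in> null_sets P" by (subst AE_iff_null_sets[OF subsetD[OF sets_D_P zD]])
    then have "emeasure P ?z = 0" by (rule null_setsD1)
    then have "emeasure ?K ?z = 0" by (simp only: eK[OF zD])
    moreover have "?z \<in> sets ?K" unfolding sK by (rule zD)
    ultimately show ?thesis by (rule null_setsI)
   qed
   let ?E = "occ A U" and ?E1 = "occ ?A1 U"
   have E1: "?E1 \<in> sets D" by (intro D_sets fibred_meas(2) B(1) U)
   have eqE: "emeasure w A = emeasure w ?A1" if w: "w \<in> space P" "w \<notin> ?z" for w proof -
    have S: "A \<in> sets w" "?A1 \<in> sets w" "?N \<in> sets w" "rest \<in> sets w" using A s w(1) by (simp_all add: space_P)
    have 0: "emeasure w ?N = 0" "emeasure w rest = 0" using w by auto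
    have "emeasure w (A - ?A1) \<le> emeasure w (?N \<union> rest)" using A2 S by (intro emeasure_mono) auto
    also have "\<dots> \<le> emeasure w ?N + emeasure w rest" using S by (intro emeasure_subadditive)
    finally have "emeasure w (A - ?A1) = 0" using 0 by simp
    moreover have "emeasure w A = emeasure w ?A1 + emeasure w (A - ?A1)" using plus_emeasure[of ?A1 w "A - ?A1"] S A1 by (simp add: Un_absorb1)
    ultimately show ?thesis by simp
   qed
   have "w \<in> ?E \<longleftrightarrow> w \<in> (?E1 - ?z) \<union> (?E \<inter> ?z)" for w proof (cases "w \<in> ?z")
    case False
    have "w \<in> ?E \<longleftrightarrow> w \<in> ?E1" using eqE[OF _ False] by (cases "w \<in> space P") simp_all
    then show ?thesis using False by blast
   qed blast
   then have "?E = (?E1 - ?z) \<union> (?E \<inter> ?z)" by (rule set_eqI)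
   moreover have "?E1 - ?z \<in> sets ?K" unfolding sK by (rule sets.Diff[OF E1 zD])
   then have "(?E1 - ?z) \<union> (?E \<inter> ?z) \<in> sets (completion ?K)" by (rule sets_completionI[OF refl Int_lower2 zn])
   moreover have "(cnt A) -` U \<inter> space (completion ?K) = ?E" unfolding space_completion spK unfolding space_P by blast
   ultimately show "(cnt A) -` U \<inter> space (completion ?K) \<in> sets (completion ?K)" by (simp only:)
  qed simp
 qed simp
 then have "E \<in> sets (completion ?K)" using assms sets_P by blast
 then obtain F N N' where F: "E = F \<union> N" "N \<subseteq> N'" "N' \<in> null_sets ?K" "F \<in> sets ?K" by (rule sets_completionE)
 have N'D: "N' \<in> sets D" using F(3) unfolding null_sets_def sK by blast
 have N'P: "N' \<in> null_sets P" by (rule nullK[OF F(3)])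
 show ?thesis proof (rule bexI[of _ F], rule bexI[of _ "F \<union> N'"], intro conjI)
  show "F \<subseteq> E" "E \<subseteq> F \<union> N'" using F(1,2) by blast+
  show FD: "F \<in> sets D" using F(4) sK by simp
  then show "F \<union> N' \<in> sets D" using N'D by simp
  show "F \<union> N' - F \<in> null_sets P" by (rule null_sets_subset[OF N'P]) (use FD N'D sets_D_P in blast)+
 qed
qed

text \<open>A point is named by its translate, the piece \<open>R k\<close> that contains its
  coordinate, and its rank within that piece; the names are encoded as natural numbers.\<close>

definition index :: "nat \<Rightarrow> int \<times> nat \<times> nat" where "index m = (case prod_decode m of (a, s) \<Rightarrow> (int_decode a, prod_decode s))"

definition unindex :: "int \<Rightarrow> nat \<Rightarrow> nat \<Rightarrow> nat" where "unindex n k j = prod_encode (int_encode n, prod_encode (k, j))"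

lemma index_unindex [simp]: "index (unindex n k j) = (n, k, j)" by (simp add: index_def unindex_def)

lemma index_eq: "index m = (n, k, j) \<longleftrightarrow> m = unindex n k j"
proof
 assume "index m = (n, k, j)"
 moreover obtain a s where as: "prod_decode m = (a, s)" by (cases "prod_decode m")
 ultimately have n: "n = int_decode a" "prod_decode s = (k, j)" by (simp_all add: index_def)
 have "m = prod_encode (a, s)" using prod_decode_inverse[of m] as by simp
 moreover have "s = prod_encode (k, j)" using prod_decode_inverse[of s] n(2) by simp
 ultimately show "m = unindex n k j" using n(1) by (simp add: unindex_def)
qed simp

text \<open>The bits tell which rationals lie above the \<open>j\<close>-th point of the cell \<open>C n (R k)\<close>, ordered by \<open>psi\<close>.\<close>

definition bits :: "'a measure \<Rightarrow> int \<Rightarrow> nat \<Rightarrow> bool" where "bits w n i \<longleftrightarrow> (case prod_decode i of (k, s) \<Rightarrow> case prod_decode s of (j, l) \<Rightarrow>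
  of_nat (Suc j) \<le> emeasure w (C n (R k \<inter> {..rational l})))"

definition phi :: "'a measure \<Rightarrow> int \<Rightarrow> real" where "phi w n = code (bits w n)"

text \<open>If \<open>r\<close> codes the points of a configuration in one translate, this is the
  coordinate of the point of rank \<open>j\<close>, counted from \<open>0\<close>, in the
  \<open>k\<close>-th piece; \<open>\<infinity>\<close> if there are not that many points.\<close>

definition Q :: "real \<Rightarrow> nat \<Rightarrow> nat \<Rightarrow> ereal" where "Q r k j = quantile (\<lambda>l. digit r (prod_encode (k, prod_encode (j, l))))"

lemma digit_phi: "digit (phi w n) (prod_encode (k, prod_encode (j, l))) \<longleftrightarrow> of_nat (Suc j) \<le> emeasure w (C n (R k \<inter> {..rational l}))"
 by (simp add: phi_def digit_code bits_def)

text \<open>Stated for an arbitrary field because the code has to be measurable for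
  \<open>P\<close>, for the field \<open>D\<close> on which decoding works, and for the points in a
  single translate.\<close>

lemma phi_meas_gen:
 assumes "\<And>k l. (cnt (C n (R k \<inter> {..rational l}))) \<in> borel_measurable N"
 shows "(\<lambda>w. phi w n) \<in> borel_measurable N" unfolding phi_def
proof (rule measurable_code)
 fix i
 obtain k s where ks: "prod_decode i = (k, s)" by (cases "prod_decode i")
 obtain j l where jl: "prod_decode s = (j, l)" by (cases "prod_decode s")
 have "Measurable.pred N (\<lambda>w. of_nat (Suc j) \<le> emeasure w (C n (R k \<inter> {..rational l})))" using assms[of k l] by measurable
 moreover have "bits w n i = (of_nat (Suc j) \<le> emeasure w (C n (R k \<inter> {..rational l})))" for w unfolding bits_def ks prod.case jl ..
 ultimately show "Measurable.pred N (\<lambda>w. bits w n i)" by (simp only:)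
qed

lemma RU_borel: "U \<in> sets borel \<Longrightarrow> R k \<inter> U \<in> sets borel" using R_borel[of k] by (rule sets.Int)

lemma phi_meas_D: "(\<lambda>w. phi w n) \<in> borel_measurable D" by (rule phi_meas_gen[OF C_meas[OF RU_borel]]) simp

lemma phi_meas_P: "(\<lambda>w. phi w n) \<in> borel_measurable P" by (rule phi_meas_gen[OF N_meas[OF C_sets[OF RU_borel]]]) simp

lemma phi_meas_below: "(\<lambda>w. phi w n) \<in> borel_measurable (cylm M (below (pre n W)))"
proof (rule phi_meas_gen[OF emeasure_cylm])
 fix k l
 show "C n (R k \<inter> {..rational l}) \<in> below (pre n W)" using C_sets[OF RU_borel, of "{..rational l}" n k] C_sub by simp
qed

lemma phi_shift: assumes w: "w \<in> config M" shows "phi (t m w) n = phi w (n + m)"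
proof -
 have "emeasure (t m w) (C n (R k \<inter> {..rational l})) = emeasure w (C (n + m) (R k \<inter> {..rational l}))" for k l
  unfolding t_emeasure[OF w C_sets[OF RU_borel[OF atMost_borel]]] pre_C by (simp add: add.commute)
 then have "bits (t m w) n = bits w (n + m)" by (intro ext) (simp add: bits_def)
 then show ?thesis by (simp add: phi_def)
qed

definition B :: "real measure" where "B = distr P borel (\<lambda>w. phi w 0)"

lemma prob_B: "prob_space B" unfolding B_def by (rule prob_space_distr[OF phi_meas_P])

lemma sets_B: "sets B = sets borel" by (simp add: B_def)

lemma distr_phi: "distr P borel (\<lambda>w. phi w n) = B"
proof -
 have "B = distr (distr P P (t n)) borel (\<lambda>w. phi w 0)" unfolding B_def t_distr ..
 also have "\<dots> = distr P borel ((\<lambda>w. phi w 0) \<circ> t n)" by (rule distr_distr[OF phi_meas_P t_meas])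
 also have "\<dots> = distr P borel (\<lambda>w. phi w n)" by (rule distr_cong) (auto simp: phi_shift space_P)
 finally show ?thesis by simp
qed

text \<open>Each coordinate of the code depends on the points in one translate of \<open>W\<close>,
  and the translates are disjoint.\<close>

lemma phi_indep: "indep_vars (\<lambda>_. borel) (\<lambda>n w. phi w n) (UNIV :: int set)" unfolding indep_vars_def2
proof (intro conjI ballI phi_meas_P)
 have disj: "disjoint_family (\<lambda>n. pre n W)" using W_wander by (auto simp: disjoint_family_on_def)
 show "indep_sets (\<lambda>n. {(\<lambda>w. phi w n) -` A \<inter> space P |A. A \<in> sets borel}) UNIV" proof (rule indep_sets_mono_sets[OF indep_cyl[OF disj]])
  fix n :: int
  show "{(\<lambda>w. phi w n) -` A \<inter> space P |A. A \<in> sets borel} \<subseteq> cyl M (below (pre n W))" proof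
   fix E assume "E \<in> {(\<lambda>w. phi w n) -` A \<inter> space P |A. A \<in> sets borel}"
   then obtain A where A: "A \<in> sets borel" "E = (\<lambda>w. phi w n) -` A \<inter> space P" by blast
   show "E \<in> cyl M (below (pre n W))" using measurable_sets[OF phi_meas_below A(1)] unfolding A(2) space_cylm sets_cylm space_P .
  qed
 qed
qed

abbreviation Q' :: "(int \<Rightarrow> real) measure" where "Q' \<equiv> \<Pi>\<^sub>M i\<in>UNIV. B"

lemma sets_Q': "sets Q' = sets (\<Pi>\<^sub>M i\<in>(UNIV :: int set). (borel :: real measure))" by (rule sets_PiM_cong) (simp_all add: sets_B)

lemma space_Q': "space Q' = UNIV" by (simp add: space_PiM B_def)

lemma phi_meas: "phi \<in> measurable P Q'"
proof -
 have "(\<lambda>w. \<lambda>n\<in>UNIV. phi w n) \<in> measurable P (\<Pi>\<^sub>M i\<in>UNIV. borel)" by (rule measurable_restrict) (rule phi_meas_P)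
 then have "phi \<in> measurable P (\<Pi>\<^sub>M i\<in>UNIV. borel)" by (simp add: restrict_UNIV)
 then show ?thesis by (simp add: measurable_cong_sets[OF refl sets_Q'])
qed

lemma distr_phi_Q': "distr P Q' phi = Q'"
proof -
 have "distr P (\<Pi>\<^sub>M i\<in>UNIV. borel) (\<lambda>w. \<lambda>n\<in>UNIV. phi w n) = (\<Pi>\<^sub>M n\<in>(UNIV :: int set). distr P borel (\<lambda>w. phi w n))"
  by (rule indep_vars_iff_distr_eq_PiM'[THEN iffD1, OF _ _ phi_indep]) (simp_all add: phi_meas_P)
 then have "distr P (\<Pi>\<^sub>M i\<in>UNIV. borel) phi = Q'" by (simp add: restrict_UNIV distr_phi)
 moreover have "distr P (\<Pi>\<^sub>M i\<in>UNIV. borel) phi = distr P Q' phi" by (rule distr_cong) (simp_all add: sets_Q')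
 ultimately show ?thesis by simp
qed

section \<open>Decoding, and its agreement with the configuration almost surely\<close>

definition V :: "(int \<Rightarrow> real) \<Rightarrow> nat set" where "V y = {m. case index m of (n, k, j) \<Rightarrow> \<exists>x\<in>R k. Q (y n) k j = ereal x}"

definition pt :: "(int \<Rightarrow> real) \<Rightarrow> nat \<Rightarrow> 'a" where "pt y m = (case index m of (n, k, j) \<Rightarrow> Z (- n) (the_inv_into W psi (real_of_ereal (Q (y n) k j))))"

text \<open>The sum of unit masses at the decoded points; as the image of a counting measure it
  gives coinciding points their multiplicity. The names in \<open>V y\<close> are those whose
  quantile lies in its own piece, which an arbitrary sequence \<open>y\<close> may violate.\<close>

definition dec :: "(int \<Rightarrow> real) \<Rightarrow> 'a measure" where "dec y = distr (count_space (V y)) M (pt y)"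

lemma pt_in:
 assumes m: "m \<in> V y" "index m = (n, k, j)"
 shows "pt y m \<in> pre n W" "ereal (psi (Z n (pt y m))) = Q (y n) k j" "psi (Z n (pt y m)) \<in> R k"
proof -
 obtain x where x: "x \<in> R k" "Q (y n) k j = ereal x" using m by (auto simp: V_def)
 then have "x \<in> psi ` W" using psi_image by blast
 let ?w = "the_inv_into W psi x"
 have w: "?w \<in> W" "psi ?w = x" using psi_inj \<open>x \<in> psi ` W\<close> by (auto intro: the_inv_into_into f_the_inv_into_f)
 have ws: "?w \<in> space M" using w(1) sub_space[OF W_sets] by blast
 have p: "pt y m = Z (- n) ?w" using m(2) x(2) by (simp add: pt_def)
 have zp: "Z n (pt y m) = ?w" unfolding p by (rule Z_inv(2)[OF ws])
 show "pt y m \<in> pre n W" unfolding pre_iff zp using w(1) ws by (simp add: p Z_in)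
 show "ereal (psi (Z n (pt y m))) = Q (y n) k j" "psi (Z n (pt y m)) \<in> R k" using x w(2) by (simp_all add: zp)
qed

lemma pt_space: assumes "m \<in> V y" shows "pt y m \<in> space M"
proof -
 obtain n k j where "index m = (n, k, j)" by (cases "index m")
 then show ?thesis using pt_in(1)[OF assms] by (auto simp: pre_iff)
qed

lemma dec_conf: "dec y \<in> config M" by (simp add: dec_def)

lemma dec_emeasure: assumes A: "A \<in> sets M" shows "emeasure (dec y) A = emeasure (count_space UNIV) {m\<in>V y. pt y m \<in> A}"
proof -
 have "pt y \<in> measurable (count_space (V y)) M" using pt_space by auto
 then have "emeasure (dec y) A = emeasure (count_space (V y)) (pt y -` A \<inter> space (count_space (V y)))" unfolding dec_def using A by (rule emeasure_distr)
 also have "pt y -` A \<inter> space (count_space (V y)) = {m\<in>V y. pt y m \<in> A}" by auto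
 also have "emeasure (count_space (V y)) {m\<in>V y. pt y m \<in> A} = emeasure (count_space UNIV) {m\<in>V y. pt y m \<in> A}" by (simp add: emeasure_count_space)
 finally show ?thesis .
qed

lemma dec_C:
 assumes U: "U \<in> sets borel"
 shows "emeasure (dec y) (C n U) = emeasure (count_space UNIV) {m. case index m of (n', k, j) \<Rightarrow> n' = n \<and> Q (y n) k j \<in> ereal ` (R k \<inter> U)}"
proof -
 have key: "m \<in> V y \<and> pt y m \<in> C n U \<longleftrightarrow> n' = n \<and> Q (y n) k j \<in> ereal ` (R k \<inter> U)" if m: "index m = (n', k, j)" for m n' k j proof
  assume a: "m \<in> V y \<and> pt y m \<in> C n U"
  then have p: "pt y m \<in> pre n' W" "ereal (psi (Z n' (pt y m))) = Q (y n') k j" "psi (Z n' (pt y m)) \<in> R k" using pt_in[OF _ m] by auto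
  moreover have "n' = n" proof (rule ccontr)
   assume "n' \<noteq> n"
   from W_wander[OF this] show False using p(1) a C_sub by blast
  qed
  ultimately show "n' = n \<and> Q (y n) k j \<in> ereal ` (R k \<inter> U)" using a by (auto simp: C_iff intro!: image_eqI[of _ _ "psi (Z n (pt y m))"])
 next
  assume a: "n' = n \<and> Q (y n) k j \<in> ereal ` (R k \<inter> U)"
  then obtain x where x: "x \<in> R k" "x \<in> U" "Q (y n) k j = ereal x" by blast
  then have V: "m \<in> V y" using m a by (auto simp: V_def)
  have p: "pt y m \<in> pre n W" "ereal (psi (Z n (pt y m))) = Q (y n) k j" using pt_in(1,2)[OF V m] a by auto
  have "psi (Z n (pt y m)) = x" using p(2) x(3) by simp
  then show "m \<in> V y \<and> pt y m \<in> C n U" using V p(1) x(2) by (simp add: C_iff)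
 qed
 have "{m\<in>V y. pt y m \<in> C n U} = {m. case index m of (n', k, j) \<Rightarrow> n' = n \<and> Q (y n) k j \<in> ereal ` (R k \<inter> U)}" proof (rule set_eqI)
  fix m
  obtain n' k j where m: "index m = (n', k, j)" by (cases "index m")
  show "m \<in> {m\<in>V y. pt y m \<in> C n U} \<longleftrightarrow> m \<in> {m. case index m of (n', k, j) \<Rightarrow> n' = n \<and> Q (y n) k j \<in> ereal ` (R k \<inter> U)}"
   using key[OF m] by (simp add: m)
 qed
 then show ?thesis by (simp add: dec_emeasure[OF C_sets[OF U]])
qed

lemma dec_rest: "emeasure (dec y) rest = 0"
proof -
 have "pt y m \<notin> rest" if "m \<in> V y" for m proof -
  obtain n k j where "index m = (n, k, j)" by (cases "index m")
  then show ?thesis using pt_in(1)[OF that] by (auto simp: rest_def)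
 qed
 then have e: "{m\<in>V y. pt y m \<in> rest} = {}" by blast
 show ?thesis unfolding dec_emeasure[OF rest_sets] e by simp
qed

lemma Q_meas: "(\<lambda>r. Q r k j) \<in> borel_measurable borel" unfolding Q_def by (rule measurable_quantile) measurable

lemma ereal_image_borel: assumes "U \<in> sets borel" shows "ereal ` U \<in> sets borel"
proof -
 have "x \<in> ereal ` U \<longleftrightarrow> x \<in> (real_of_ereal -` U \<inter> space borel) - {\<infinity>, - \<infinity>}" for x by (cases x) auto
 then have "ereal ` U = (real_of_ereal -` U \<inter> space borel) - {\<infinity>, - \<infinity>}" by (rule set_eqI)
 moreover have "real_of_ereal \<in> borel_measurable borel" using borel_measurable_real_of_ereal[OF measurable_ident] by simp
 then have "real_of_ereal -` U \<inter> space borel \<in> sets borel" using assms by (rule measurable_sets)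
 ultimately show ?thesis by (simp only:) (intro sets.Diff; simp)
qed

lemma dec_C_meas: assumes U: "U \<in> sets borel" shows "(\<lambda>y. emeasure (dec y) (C n U)) \<in> borel_measurable Q'"
proof -
 let ?X = "\<lambda>y. {m. case index m of (n', k, j) \<Rightarrow> n' = n \<and> Q (y n) k j \<in> ereal ` (R k \<inter> U)}"
 have eq: "emeasure (dec y) (C n U) = (\<Sum>m. indicator (?X y) m)" for y
  unfolding dec_C[OF U] by (simp add: nn_integral_indicator[symmetric] nn_integral_count_space_nat del: nn_integral_indicator)
 have "(\<lambda>y. indicator (?X y) m :: ennreal) \<in> borel_measurable Q'" for m proof -
  obtain n' k j where m: "index m = (n', k, j)" by (cases "index m")
  have "(\<lambda>y. y n) \<in> borel_measurable Q'" unfolding measurable_cong_sets[OF sets_Q' refl] by (rule measurable_component_singleton) simp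
  then have "(\<lambda>y. Q (y n) k j) \<in> borel_measurable Q'" by (rule measurable_compose[OF _ Q_meas])
  from measurable_sets[OF this ereal_image_borel[OF RU_borel[OF U]]]
  have s: "{y \<in> space Q'. Q (y n) k j \<in> ereal ` (R k \<inter> U)} \<in> sets Q'" by (simp add: vimage_def Int_def conj_commute)
  have "(\<lambda>y. indicator (?X y) m :: ennreal) = (\<lambda>y. if n' = n then indicator {y \<in> space Q'. Q (y n) k j \<in> ereal ` (R k \<inter> U)} y else 0)"
   by (auto simp: m indicator_def space_Q' fun_eq_iff)
  then show ?thesis using s by simp
 qed
 then have "(\<lambda>y. \<Sum>m. indicator (?X y) m :: ennreal) \<in> borel_measurable Q'" by (rule borel_measurable_suminf_order)
 then show ?thesis unfolding eq .
qed

lemma dec_meas: "dec \<in> measurable Q' D"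
proof (rule measurable_sigma_sets)
 show "sets D = sigma_sets (config M) (cyl_gen M cells)" by (subst sets_D) (rule cyl_def)
 show "cyl_gen M cells \<subseteq> Pow (config M)" by (rule cyl_gen_Pow)
 show "dec \<in> space Q' \<rightarrow> config M" using dec_conf by blast
 fix E assume "E \<in> cyl_gen M cells"
 then obtain A U where A: "A \<in> cells" "U \<in> sets borel" "E = (cnt A) -` U \<inter> config M" unfolding cyl_gen_def by blast
 have "(\<lambda>y. emeasure (dec y) A) \<in> borel_measurable Q'" using A(1) dec_rest dec_C_meas by (auto simp: cells_def)
 from measurable_sets[OF this A(2)] show "dec -` E \<inter> space Q' \<in> sets Q'" unfolding A(3) using dec_conf by (simp add: vimage_def Int_def)
qed

text \<open>The configurations to which decoding applies. Countably many counts are constrained, so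
  the conditions hold together almost surely; all of them concern members of \<open>cells\<close>,
  so the set belongs to \<open>D\<close>.\<close>

definition M0 :: "'a measure set" where "M0 = {w\<in>space P. emeasure w rest = 0 \<and> (\<forall>n k. emeasure w (C n (R k)) \<in> \<nat>) \<and>
  (\<forall>n k l. emeasure w (C n (R k \<inter> {..rational l})) \<in> \<nat>)}"

lemma Nats_borel: "(\<nat> :: ennreal set) \<in> sets borel" unfolding Nats_def by (rule sets.countable) auto

lemma M0_D: "M0 \<in> sets D"
proof -
 have 1: "{w\<in>space D. emeasure w (C n (R k)) \<in> \<nat>} \<in> sets D" for n k
  using D_sets[OF C_meas[OF R_borel] Nats_borel, of n k] unfolding space_D space_P .
 have 2: "{w\<in>space D. emeasure w (C n (R k \<inter> {..rational l})) \<in> \<nat>} \<in> sets D" for n k l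
  using D_sets[OF C_meas[OF RU_borel[OF atMost_borel]] Nats_borel, of n k "rational l"] unfolding space_D space_P .
 have "rest \<in> cells" by (simp add: cells_def)
 then have "(occ rest ({0})) \<in> sets D" by (intro D_sets emeasure_cylm) simp_all
 then have 3: "{w\<in>space D. emeasure w rest = 0} \<in> sets D" unfolding space_D space_P by simp
 have "{w\<in>space D. emeasure w rest = 0 \<and> (\<forall>n k. emeasure w (C n (R k)) \<in> \<nat>) \<and>
  (\<forall>n k l. emeasure w (C n (R k \<inter> {..rational l})) \<in> \<nat>)} \<in> sets D" by (intro sets.sets_Collect_conj sets.sets_Collect_countable_All 1 2 3)
 then show ?thesis unfolding M0_def space_P space_D .
qed

lemma AE_M0: "AE w in P. w \<in> M0"
proof -
 have 1: "AE w in P. \<forall>n k. emeasure w (C n (R k)) \<in> \<nat>" using AE_N_nat[OF C_fmeasurable[of UNIV]] by (simp add: AE_all_countable)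
 have 2: "AE w in P. \<forall>n k l. emeasure w (C n (R k \<inter> {..rational l})) \<in> \<nat>"
  using AE_N_nat[OF C_fmeasurable[OF atMost_borel]] by (simp add: AE_all_countable)
 show ?thesis using 1 2 AE_N_null[OF rest_null] AE_space by eventually_elim (simp add: M0_def)
qed

text \<open>Restricted to a cell and carried to the line by the coordinate, the configuration is a
  finite Borel measure whose distribution function is integer-valued at the rationals; its quantiles
  are what \<open>Q\<close> reads from the code.\<close>

lemma quantile_count:
 assumes w: "w \<in> M0" and U: "U \<in> sets borel"
 shows "emeasure w (C n (R k \<inter> U)) = emeasure (count_space UNIV) {j. \<exists>x\<in>U. Q (phi w n) k j = ereal x}"
proof -
 have conf: "sets w = sets M" using w by (simp add: M0_def space_P)
 have sp: "space w = space M" by (rule sets_eq_imp_space_eq[OF conf])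
 have CR: "C n (R k) \<in> sets w" using C_sets[OF R_borel] conf by simp
 define K where "K = density w (indicator (C n (R k)))"
 define rho where "rho = distr K borel (\<lambda>x. psi (Z n x))"
 have "(\<lambda>x. psi (Z n x)) \<in> borel_measurable M" by (rule measurable_compose[OF Z_meas psi_meas])
 then have m: "(\<lambda>x. psi (Z n x)) \<in> borel_measurable K" unfolding K_def measurable_density_eq1 by (subst measurable_cong_sets[OF conf refl])
 have em: "emeasure rho U = emeasure w (C n (R k \<inter> U))" if U: "U \<in> sets borel" for U proof -
  have "emeasure rho U = emeasure K ((\<lambda>x. psi (Z n x)) -` U \<inter> space K)" unfolding rho_def by (rule emeasure_distr[OF m U])
  also have "\<dots> = emeasure w (C n (R k) \<inter> ((\<lambda>x. psi (Z n x)) -` U \<inter> space K))"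
   using measurable_sets[OF m U] unfolding K_def by (intro emeasure_restricted CR) simp
  also have "C n (R k) \<inter> ((\<lambda>x. psi (Z n x)) -` U \<inter> space K) = C n (R k \<inter> U)" by (auto simp: C_iff K_def sp pre_iff)
  finally show ?thesis .
 qed
 have fin: "emeasure rho UNIV \<noteq> \<infinity>" proof -
  have "emeasure w (C n (R k)) \<in> \<nat>" using w by (simp add: M0_def)
  then show ?thesis using em[of UNIV] by (auto simp: Nats_def)
 qed
 interpret finite_measure rho by (rule finite_measureI) (use fin in \<open>simp add: rho_def\<close>)
 have fb: "finite_borel_measure rho" by standard (simp add: rho_def)
 have cdf: "ennreal (cdf rho (rational l)) = emeasure w (C n (R k \<inter> {..rational l}))" for l
  unfolding cdf_def emeasure_eq_measure[symmetric] by (rule em) simp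
 have int: "cdf rho (rational l) \<in> \<nat>" for l proof -
  have "ennreal (cdf rho (rational l)) \<in> \<nat>" using w unfolding cdf by (simp add: M0_def)
  then obtain i :: nat where "ennreal (cdf rho (rational l)) = of_nat i" by (auto simp: Nats_def)
  then have "cdf rho (rational l) = real i" using measure_nonneg[of rho "{..rational l}"] by (simp add: ennreal_of_nat_eq_real_of_nat cdf_def)
  then show ?thesis by simp
 qed
 have b: "digit (phi w n) (prod_encode (k, prod_encode (j, l))) \<longleftrightarrow> real (Suc j) \<le> cdf rho (rational l)" for j l
  unfolding digit_phi cdf[symmetric] ennreal_of_nat_eq_real_of_nat by (rule ennreal_le_iff) (simp add: cdf_def)
 show ?thesis using integer_measure_quantiles[OF fb int b U, folded Q_def] em[OF U] by simp
qed

text \<open>Both measures are carried by the countable set \<open>X\<close> of decoded points, whose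
  singletons are cells, so it suffices to compare masses of singletons. Multiple points appear as
  repeated quantiles.\<close>

lemma dec_phi: assumes w: "w \<in> M0" shows "dec (phi w) = w"
proof -
 let ?y = "phi w"
 have conf: "sets w = sets M" using w by (simp add: M0_def space_P)
 have conf': "sets (dec ?y) = sets M" by (simp add: dec_def)
 define X where "X = pt ?y ` V ?y"
 have X: "countable X" unfolding X_def by (rule countable_image) simp
 have sing: "\<exists>n. x \<in> pre n W \<and> {x} = C n {psi (Z n x)}" if xX: "x \<in> X" for x proof -
  obtain m where m: "m \<in> V ?y" "x = pt ?y m" using xX by (auto simp: X_def)
  obtain n k j where "index m = (n, k, j)" by (cases "index m")
  then show ?thesis using pt_in(1)[OF m(1)] C_singleton[of x n] m(2) by auto
 qed
 have singM: "{x} \<in> sets M" if "x \<in> X" for x using sing[OF that] C_sets[of "{_}"] by (metis borel_singleton sets.empty_sets)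
 have XM: "X \<in> sets M" by (rule sets.countable[OF singM X])
 have eq1: "emeasure (dec ?y) {x} = emeasure w {x}" if x: "x \<in> X" for x proof -
  obtain n where n: "x \<in> pre n W" "{x} = C n {psi (Z n x)}" using sing[OF x] by blast
  let ?z = "psi (Z n x)"
  have "?z \<in> psi ` W" using n(1) by (auto simp: pre_iff)
  then obtain k where k: "?z \<in> R k" using psi_image by blast
  \<comment> \<open>The pieces are disjoint, so a coordinate value is coded in one piece only and
    its multiplicity is counted once.\<close>
  have k': "?z \<in> R k' \<longleftrightarrow> k' = k" for k' using R_disj k by (auto simp: disjoint_family_on_def)
  let ?J = "{j. \<exists>x\<in>{?z}. Q (?y n) k j = ereal x}"
  have "emeasure w {x} = emeasure w (C n (R k \<inter> {?z}))" using n(2) k by simp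
  also have "\<dots> = emeasure (count_space UNIV) ?J" by (rule quantile_count[OF w]) simp
  finally have 1: "emeasure w {x} = emeasure (count_space UNIV) ?J" .
  have "emeasure (dec ?y) {x} = emeasure (count_space UNIV) {m. case index m of (n', k', j) \<Rightarrow> n' = n \<and> Q (?y n) k' j \<in> ereal ` (R k' \<inter> {?z})}"
   using dec_C[of "{?z}" ?y n] n(2) by simp
  also have "{m. case index m of (n', k', j) \<Rightarrow> n' = n \<and> Q (?y n) k' j \<in> ereal ` (R k' \<inter> {?z})} = unindex n k ` ?J" proof (rule set_eqI)
   fix m
   obtain n' k' j where m: "index m = (n', k', j)" by (cases "index m")
   have "n' = n \<and> Q (?y n) k' j \<in> ereal ` (R k' \<inter> {?z}) \<longleftrightarrow> n' = n \<and> k' = k \<and> Q (?y n) k j = ereal ?z" using k' by auto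
   also have "\<dots> \<longleftrightarrow> m \<in> unindex n k ` ?J" proof
    assume "n' = n \<and> k' = k \<and> Q (?y n) k j = ereal ?z"
    then show "m \<in> unindex n k ` ?J" using m index_eq[of m n k j] by auto
   next
    assume "m \<in> unindex n k ` ?J"
    then show "n' = n \<and> k' = k \<and> Q (?y n) k j = ereal ?z" using m by auto
   qed
   finally show "m \<in> {m. case index m of (n', k', j) \<Rightarrow> n' = n \<and> Q (?y n) k' j \<in> ereal ` (R k' \<inter> {?z})} \<longleftrightarrow> m \<in> unindex n k ` ?J" by (simp add: m)
  qed
  also have "emeasure (count_space UNIV) (unindex n k ` ?J) = emeasure (count_space UNIV) ?J"
   by (rule count_space_inj_image) (auto simp: inj_on_def unindex_def prod_encode_eq)
  finally show ?thesis using 1 by simp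
 qed
 have null_dec: "emeasure (dec ?y) (space M - X) = 0" proof -
  have e: "{m\<in>V ?y. pt ?y m \<in> space M - X} = {}" by (auto simp: X_def)
  have s: "space M - X \<in> sets M" using XM by simp
  show ?thesis unfolding dec_emeasure[OF s] e by simp
 qed
 have nullw: "emeasure w (space M - X) = 0" proof -
  \<comment> \<open>The values that are not decoded coordinates for translate \<open>n\<close> and
    piece \<open>k\<close>; by \<open>quantile_count\<close> they carry no mass. Every point outside
    \<open>X\<close> has such a value or lies in \<open>rest\<close>.\<close>
  let ?G = "\<lambda>n k. - {x. \<exists>j. Q (?y n) k j = ereal x}"
  have G: "?G n k \<in> sets borel" for n k proof -
   have "{x. \<exists>j. Q (?y n) k j = ereal x} \<subseteq> range (\<lambda>j. real_of_ereal (Q (?y n) k j))" proof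
    fix x assume "x \<in> {x. \<exists>j. Q (?y n) k j = ereal x}"
    then obtain j where "Q (?y n) k j = ereal x" by blast
    then have "x = real_of_ereal (Q (?y n) k j)" by simp
    then show "x \<in> range (\<lambda>j. real_of_ereal (Q (?y n) k j))" by (rule range_eqI)
   qed
   then have "countable {x. \<exists>j. Q (?y n) k j = ereal x}" by (rule countable_subset) simp
   then have "{x. \<exists>j. Q (?y n) k j = ereal x} \<in> sets borel" by (rule sets.countable[OF borel_singleton[OF sets.empty_sets]])
   then show ?thesis by (rule borel_comp)
  qed
  have "C n (R k \<inter> ?G n k) \<in> null_sets w" for n k proof (rule null_setsI)
   have "{j. \<exists>x\<in>?G n k. Q (?y n) k j = ereal x} = {}" by auto
   then show "emeasure w (C n (R k \<inter> ?G n k)) = 0" using quantile_count[OF w G, of n k n k] by simp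
   show "C n (R k \<inter> ?G n k) \<in> sets w" unfolding conf by (rule C_sets[OF RU_borel[OF G]])
  qed
  moreover have "rest \<in> null_sets w" proof (rule null_setsI)
   show "emeasure w rest = 0" using w by (simp only: M0_def mem_Collect_eq)
   show "rest \<in> sets w" unfolding conf by (rule rest_sets)
  qed
  ultimately have "rest \<union> (\<Union>n. \<Union>k. C n (R k \<inter> ?G n k)) \<in> null_sets w" by (intro null_sets.Un null_sets_UN)
  moreover have "space M - X \<in> sets w" using XM conf by simp
  ultimately have "space M - X \<in> null_sets w" proof (rule null_sets_subset)
   show "space M - X \<subseteq> rest \<union> (\<Union>n. \<Union>k. C n (R k \<inter> ?G n k))" proof
    fix x assume x: "x \<in> space M - X"
    show "x \<in> rest \<union> (\<Union>n. \<Union>k. C n (R k \<inter> ?G n k))" proof (cases "x \<in> rest")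
     case False
     then obtain n where n: "x \<in> pre n W" using x by (auto simp: rest_def)
     then have "psi (Z n x) \<in> psi ` W" by (auto simp: pre_iff)
     then obtain k where k: "psi (Z n x) \<in> R k" using psi_image by blast
     have "Q (?y n) k j \<noteq> ereal (psi (Z n x))" for j proof
      assume q: "Q (?y n) k j = ereal (psi (Z n x))"
      let ?m = "unindex n k j"
      have V: "?m \<in> V ?y" using q k by (auto simp: V_def)
      have p: "pt ?y ?m \<in> pre n W" "ereal (psi (Z n (pt ?y ?m))) = Q (?y n) k j" using pt_in(1,2)[OF V index_unindex] by auto
      have "pt ?y ?m \<in> C n {psi (Z n x)}" using p q by (simp add: C_iff)
      then have "pt ?y ?m = x" using C_singleton[OF n] by simp
      then show False using x V by (auto simp: X_def)
     qed
     then have "x \<in> C n (R k \<inter> ?G n k)" using n k by (simp add: C_iff)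
     then show ?thesis by blast
    qed simp
   qed
  qed
  then show ?thesis by (rule null_setsD1)
 qed
 show ?thesis proof (rule measure_eqI)
  show "sets (dec ?y) = sets w" using conf conf' by simp
  fix A assume "A \<in> sets (dec ?y)"
  then have A: "A \<in> sets M" using conf' by simp
  have red: "emeasure kap A = (\<integral>\<^sup>+x. emeasure kap {x} \<partial>count_space (A \<inter> X))"
   if k: "sets kap = sets M" "emeasure kap (space M - X) = 0" for kap
  proof -
   have n: "space M - X \<in> null_sets kap" using k XM by (intro null_setsI) auto
   have AX: "A \<inter> X \<in> sets kap" "A - X \<in> sets kap" using A XM k(1) by auto
   have "A - X \<in> null_sets kap" by (rule null_sets_subset[OF n AX(2)]) (use sub_space[OF A] in blast)
   then have "emeasure kap (A \<inter> X \<union> (A - X)) = emeasure kap (A \<inter> X)" by (rule emeasure_Un_null_set[OF AX(1)])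
   moreover have "A \<inter> X \<union> (A - X) = A" by blast
   moreover have "emeasure kap (A \<inter> X) = (\<integral>\<^sup>+x. emeasure kap {x} \<partial>count_space (A \<inter> X))"
    by (rule emeasure_countable_singleton) (use singM k(1) X in auto)
   ultimately show ?thesis by simp
  qed
  show "emeasure (dec ?y) A = emeasure w A" unfolding red[OF conf' null_dec] red[OF conf nullw] by (intro nn_integral_cong eq1) simp
 qed
qed

lemma bernoulli_suspension: "bernoulli S T'"
proof -
 have M0P: "M0 \<in> sets P" using M0_D sets_D_P by blast
 \<comment> \<open>The sequences that are reproduced by decoding and coding again. The set is
   measurable because \<open>dec\<close> is measurable into \<open>D\<close> and \<open>phi\<close>
   from \<open>D\<close>, and it contains the code of every configuration in
   \<open>M0\<close>.\<close>
 let ?N0 = "{y \<in> space Q'. dec y \<in> M0 \<and> phi (dec y) = y}"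
 have M0': "{y \<in> space Q'. dec y \<in> M0} \<in> sets Q'" using measurable_sets[OF dec_meas M0_D] by (simp add: vimage_def Int_def conj_commute)
 have co: "{y \<in> space Q'. phi (dec y) n = y n} \<in> sets Q'" for n proof -
  have "(\<lambda>y. phi (dec y) n) \<in> borel_measurable Q'" by (rule measurable_compose[OF dec_meas phi_meas_D])
  moreover have "(\<lambda>y. y n) \<in> borel_measurable Q'" unfolding measurable_cong_sets[OF sets_Q' refl] by (rule measurable_component_singleton) simp
  ultimately show ?thesis by measurable
 qed
 have N0: "?N0 \<in> sets Q'" unfolding fun_eq_iff by (intro sets.sets_Collect_conj sets.sets_Collect_countable_All M0' co)
 have iso: "iso_mod0 (completion P) (completion Q') phi" proof (rule iso_mod0_completionI[of D P M0 phi Q' ?N0 dec])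
  show "space D = space P" by (simp only: space_D space_P)
  show "sets D \<subseteq> sets P" by (rule sets_D_P)
  show "\<exists>D1\<in>sets D. \<exists>D2\<in>sets D. D1 \<subseteq> E \<and> E \<subseteq> D2 \<and> D2 - D1 \<in> null_sets P" if "E \<in> sets P" for E by (rule D_approx[OF that])
  show "M0 \<in> sets D" by (rule M0_D)
  have "AE w in P. w \<notin> space P - M0" using AE_M0 by eventually_elim blast
  then show "space P - M0 \<in> null_sets P" by (subst AE_iff_null_sets[OF sets.compl_sets[OF M0P]])
  show "phi \<in> measurable P Q'" by (rule phi_meas)
  show "distr P Q' phi = Q'" by (rule distr_phi_Q')
  show "?N0 \<in> sets Q'" by (rule N0)
  show "phi w \<in> ?N0" if "w \<in> M0" for w using dec_phi[OF that] that by (simp add: space_Q')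
  show "dec y \<in> M0" if "y \<in> ?N0" for y using that by simp
  show "dec (phi w) = w" if "w \<in> M0" for w by (rule dec_phi[OF that])
  show "phi (dec y) = y" if "y \<in> ?N0" for y using that by simp
  show "{y\<in>?N0. dec y \<in> E} \<in> sets Q'" if E: "E \<in> sets D" for E proof -
   have "{y\<in>?N0. dec y \<in> E} = ?N0 \<inter> (dec -` E \<inter> space Q')" by blast
   then show ?thesis using N0 measurable_sets[OF dec_meas E] by (simp only: sets.Int)
  qed
 qed
 have "AE w in P. phi (T' w) = (\<lambda>i. phi w (i + 1))" using AE_space proof eventually_elim
  fix w assume "w \<in> space P"
  then have "w \<in> config M" unfolding space_P .
  from phi_shift[OF this, of 1] show "phi (T' w) = (\<lambda>i. phi w (i + 1))" by (intro ext) (simp add: Z_1)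
 qed
 then have "AE w in S. phi (T' w) = (\<lambda>i. phi w (i + 1))" by (rule AE_completion)
 then show ?thesis unfolding bernoulli_def using iso prob_B sets_B by blast
qed

end

lemma (in suspension) dissipative_imp_bernoulli:
 assumes leb: "lebesgue_space M" and dis: "dissipative M T"
 shows "bernoulli S T'"
proof -
 obtain W and psi :: "'a \<Rightarrow> real" and R :: "nat \<Rightarrow> real set"
  where *: "W \<in> sets M" "psi \<in> borel_measurable M" "inj_on psi W" "\<And>k. R k \<in> sets borel" "disjoint_family R" "psi ` W = (\<Union>k. R k)"
  "\<And>k. W \<inter> psi -` R k \<in> fmeasurable M" "\<And>m n. m \<noteq> n \<Longrightarrow> pre m W \<inter> pre n W = {}" "space M - (\<Union>n. pre n W) \<in> null_sets M"
  "\<And>A. A \<in> sets M \<Longrightarrow> A \<subseteq> W \<Longrightarrow> \<exists>B1\<in>sets borel. \<exists>B2\<in>sets borel. B1 \<subseteq> psi ` A \<and> psi ` A \<subseteq> B2 \<and> W \<inter> psi -` (B2 - B1) \<in> null_sets M"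
  by (rule fundamental_coordinate[OF leb dis]) (rule that)
 interpret coded_suspension M T P W psi R by unfold_locales (rule *; assumption?)+
 show ?thesis by (rule bernoulli_suspension)
qed

theorem theorem3p4:
 fixes M :: "'a measure" and T :: "'a \<Rightarrow> 'a" and S :: "'a measure measure" and T' :: "'a measure \<Rightarrow> 'a measure"
 assumes "lebesgue_space M" and "non_atomic M" and "emeasure M (space M) = \<infinity>" and "automorphism M T"
  and "poisson_suspension M S" and "T' = suspension_map M T"
 shows "(type_II_infinity_on_conservative_part M T \<longleftrightarrow> ergodic S T') \<and> (ergodic S T' \<longrightarrow> weakly_mixing S T') \<and>
     (\<forall>n. tends_up_to_infinity n \<longrightarrow> (rigid_along M T n \<longleftrightarrow> rigid_along S T' n)) \<and> (rigidity_free M T \<longleftrightarrow> mildly_mixing S T') \<and>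
     (zero_type M T \<longleftrightarrow> mixing S T') \<and> (mixing S T' \<longrightarrow> mixing_of_all_orders S T') \<and> (remotely_infinite M T \<longrightarrow> K_automorphism S T') \<and>
     (dissipative M T \<longrightarrow> bernoulli S T')"
proof -
 obtain P where P: "poisson_measure M P" "S = completion P" using \<open>poisson_suspension M S\<close> unfolding poisson_suspension_def by blast
 interpret suspension M T P by unfold_locales (fact \<open>automorphism M T\<close>, fact P(1))
 have sf: "sigma_finite_measure M" using \<open>lebesgue_space M\<close> unfolding lebesgue_space_def by blast
 show ?thesis unfolding P(2) \<open>T' = suspension_map M T\<close> type_II_infinity_iff[OF sf]
  using ergodic_imp_no_finite_invariant no_finite_invariant_imp_weakly_mixing weakly_mixing_imp_ergodic rigid_iff
   rigidity_free_imp_mildly_mixing mildly_mixing_imp_rigidity_free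
   zero_type_imp_mixing_all mixing_all_imp_mixing mixing_imp_zero_type
   remotely_infinite_imp_K[OF assms(1,2)] dissipative_imp_bernoulli[OF assms(1)] by blast
qed

end
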